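(* The sequence $\mathcal Y=\{Y_{nk}\}_{(n,k)\in J}$, constructed from the spectral data $\{\lambda_{nk},\alpha_{nk}\}_{(n,k)\in J}$ of the problem $L$ as described in the context, is complete in $L_2((0,\pi);\mathbb C^m)$.
   Context: Let $m\ge 1$; $\dagger$ denotes conjugate transpose and $I$ the unit $(m\times m)$-matrix. Let $\sigma\in L_2((0,\pi);\mathbb C^{m\times m})$ with $\sigma(x)=(\sigma(x))^\dagger$. Put $Y^{[1]}:=Y'-\sigma Y$ and $\ell Y:=-(Y^{[1]})'-\sigma Y^{[1]}-\sigma^2Y$. Let $T_j,H_j\in\mathbb C^{m\times m}$, $j=1,2$, satisfy $T_j=T_j^\dagger=T_j^2$, $T_j^\perp:=I-T_j$, $H_j=H_j^\dagger=T_jH_jT_j$. Denote $$V_1(Y):=T_1(Y^{[1]}(0)-H_1Y(0))-T_1^\perp Y(0),\quad V_2(Y):=T_2(Y^{[1]}(\pi)-H_2Y(\pi))-T_2^\perp Y(\pi),\quad V_1^\perp(Y):=T_1Y(0)+T_1^\perp Y^{[1]}(0).$$ $L$ is the boundary value problem $\ell Y=\lambda Y$ on $(0,\pi)$, $V_1(Y)=V_2(Y)=0$ (solutions have $Y,Y^{[1]}$ absolutely continuous on $[0,\pi]$). Spectral data: let $p^\perp:=\dim(\operatorname{Ker}T_1\cap\operatorname{Ker}T_2)$ and $J:=\{(n,k)\colon n\in\mathbb N,\ k=1,\dots,m\}\cup\{(0,k)\colon k=p^\perp+1,\dots,m\}$, ordered lexicographically, $\mathbb N=\{1,2,\dots\}$.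 The eigenvalues of $L$ are real and, counted with multiplicity (dimension of the space of eigenfunctions), are numbered as $\{\lambda_{nk}\}_{(n,k)\in J}$ in non-decreasing order; $\rho_{nk}:=\sqrt{\lambda_{nk}}$ with $\arg\rho_{nk}\in[-\pi/2,\pi/2)$. The Weyl solution $\Phi(x,\lambda)$ is the matrix solution of $\ell\Phi=\lambda\Phi$ with $V_1(\Phi)=I$, $V_2(\Phi)=0$; the Weyl matrix $M(\lambda):=V_1^\perp(\Phi)$ is meromorphic with simple poles at the eigenvalues of $L$; the weight matrices are $\alpha_{nk}:=\operatorname{Res}_{\lambda=\lambda_{nk}}M(\lambda)$, and $\operatorname{rank}(\alpha_{nk})$ equals the multiplicity of $\lambda_{nk}$. Construction of $\mathcal Y$: put $T_{nk}:=T_1+\rho_{nk}T_1^\perp$ if $\rho_{nk}\ne0$, $T_{nk}:=I$ if $\rho_{nk}=0$, and $B_{nk}:=\frac\pi2T_{nk}^{-1}\alpha_{nk}T_{nk}^{-1}$. For every maximal group of equal eigenvalues $\lambda_{n_1k_1}=\dots=\lambda_{n_rk_r}$, the subspace $\operatorname{Ran}B_{n_1k_1}\subset\mathbb C^m$ is $r$-dimensional; let $\{\mathcal E_{n_jk_j}\}_{j=1}^r$ be an orthonormal basis of it (the choice is arbitrary). This defines $\{\mathcal E_{nk}\}_{(n,k)\in J}$. Then $$Y_{nk}(x):=\begin{cases}(\cos(\rho_{nk}x)T_1+\sin(\rho_{nk}x)T_1^\perp)\mathcal E_{nk},&\rho_{nk}\ne0,\\(T_1+xT_1^\perp)\mathcal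 E_{nk},&\rho_{nk}=0.\end{cases}$$ *)

theory Defs
  imports "HOL-Complex_Analysis.Complex_Analysis" "HOL-Library.Function_Algebras"
begin

definition hconj :: "complex^'n^'m \<Rightarrow> complex^'m^'n" where
  "hconj A = transpose (map_matrix cnj A)"

definition hinner :: "complex^'m \<Rightarrow> complex^'m \<Rightarrow> complex" where
  "hinner u v = (\<Sum>i\<in>UNIV. u $ i * cnj (v $ i))"

definition orthonormal_basis :: "'i set \<Rightarrow> ('i \<Rightarrow> complex^'m) \<Rightarrow> (complex^'m) set \<Rightarrow> bool" where
  "orthonormal_basis G e V \<longleftrightarrow>
     (\<forall>i\<in>G. \<forall>j\<in>G. hinner (e i) (e j) = (if i = j then 1 else 0)) \<and> vec.span (e ` G) = V"

text \<open>The norm on \<open>complex^'m\<close> is the Hermitian norm; on matrices it is the Frobenius norm.\<close>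

definition L2_on :: "real set \<Rightarrow> (real \<Rightarrow> 'b::euclidean_space) \<Rightarrow> bool" where
  "L2_on S f \<longleftrightarrow> f \<in> borel_measurable (lebesgue_on S) \<and>
     integrable (lebesgue_on S) (\<lambda>x. (norm (f x))\<^sup>2)"

text \<open>A family in \<open>L\<^sub>2(S; \<complex>\<^sup>m)\<close> is complete if its complex linear span is dense.\<close>

definition complete_in_L2 :: "real set \<Rightarrow> 'i set \<Rightarrow> ('i \<Rightarrow> real \<Rightarrow> complex^'m) \<Rightarrow> bool" where
  "complete_in_L2 S I u \<longleftrightarrow> (\<forall>i\<in>I. L2_on S (u i)) \<and>
     (\<forall>f. L2_on S f \<longrightarrow> (\<forall>\<epsilon>>0. \<exists>F c. finite F \<and> F \<subseteq> I \<and>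
        sqrt (integral\<^sup>L (lebesgue_on S) (\<lambda>x. (norm (f x - (\<Sum>i\<in>F. c i *s u i x)))\<^sup>2)) < \<epsilon>))"

definition abs_cont_on :: "real \<Rightarrow> real \<Rightarrow> (real \<Rightarrow> 'b::real_normed_vector) \<Rightarrow> bool" where
  "abs_cont_on a b f \<longleftrightarrow>
     (\<forall>\<epsilon>>0. \<exists>\<delta>>0. \<forall>(n::nat) l r.
        (\<forall>i<n. a \<le> l i \<and> l i \<le> r i \<and> r i \<le> b) \<and>
        disjoint_family_on (\<lambda>i. {l i<..<r i}) {..<n} \<and> (\<Sum>i<n. r i - l i) < \<delta>
        \<longrightarrow> (\<Sum>i<n. norm (f (r i) - f (l i))) < \<epsilon>)"

text \<open>
  The quasi-derivative \<open>Y' - \<sigma> Y\<close> is only determined almost everywhere, whereas the boundary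
  conditions use its values at the end points. So a solution comes with the absolutely continuous
  representative \<open>Q\<close> of its quasi-derivative, which is unique on \<open>{0..pi}\<close>.
  In matrix expressions, \<open>mat c ** A\<close> is the complex scalar multiple \<open>c A\<close>.
\<close>

definition solution ::
  "(real \<Rightarrow> complex^'m^'m) \<Rightarrow> complex \<Rightarrow> (real \<Rightarrow> complex^'m) \<Rightarrow> (real \<Rightarrow> complex^'m) \<Rightarrow> bool" where
  "solution \<sigma> z Y Q \<longleftrightarrow> abs_cont_on 0 pi Y \<and> abs_cont_on 0 pi Q \<and>
     (AE x in lebesgue_on {0<..<pi}. \<exists>Y' Q'.
        (Y has_vector_derivative Y') (at x) \<and> (Q has_vector_derivative Q') (at x) \<and>
        Q x = Y' - \<sigma> x *v Y x \<and>
        - Q' - \<sigma> x *v Q x - (\<sigma> x ** \<sigma> x) *v Y x = z *s Y x)"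

definition matrix_solution ::
  "(real \<Rightarrow> complex^'m^'m) \<Rightarrow> complex \<Rightarrow> (real \<Rightarrow> complex^'m^'m) \<Rightarrow> (real \<Rightarrow> complex^'m^'m) \<Rightarrow> bool" where
  "matrix_solution \<sigma> z Y Q \<longleftrightarrow> abs_cont_on 0 pi Y \<and> abs_cont_on 0 pi Q \<and>
     (AE x in lebesgue_on {0<..<pi}. \<exists>Y' Q'.
        (Y has_vector_derivative Y') (at x) \<and> (Q has_vector_derivative Q') (at x) \<and>
        Q x = Y' - \<sigma> x ** Y x \<and>
        - Q' - \<sigma> x ** Q x - \<sigma> x ** \<sigma> x ** Y x = mat z ** Y x)"

text \<open>In the boundary forms, \<open>y\<close> and \<open>q\<close> are the values of the function and of its
  quasi-derivative at the end point in question.\<close>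

definition bdry :: "complex^'m^'m \<Rightarrow> complex^'m^'m \<Rightarrow> complex^'m \<Rightarrow> complex^'m \<Rightarrow> complex^'m" where
  "bdry T H y q = T *v (q - H *v y) - (mat 1 - T) *v y"

definition matrix_bdry ::
  "complex^'m^'m \<Rightarrow> complex^'m^'m \<Rightarrow> complex^'m^'m \<Rightarrow> complex^'m^'m \<Rightarrow> complex^'m^'m" where
  "matrix_bdry T H y q = T ** (q - H ** y) - (mat 1 - T) ** y"

definition matrix_bdry_perp :: "complex^'m^'m \<Rightarrow> complex^'m^'m \<Rightarrow> complex^'m^'m \<Rightarrow> complex^'m^'m" where
  "matrix_bdry_perp T y q = T ** y + (mat 1 - T) ** q"

text \<open>Functions on \<open>{0..pi}\<close> are represented by their extensions by zero, so that the dimension of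
  the eigenspace counts functions on \<open>{0..pi}\<close>.\<close>

definition eigenspace :: "(real \<Rightarrow> complex^'m^'m) \<Rightarrow> complex^'m^'m \<Rightarrow> complex^'m^'m \<Rightarrow>
    complex^'m^'m \<Rightarrow> complex^'m^'m \<Rightarrow> complex \<Rightarrow> (real \<Rightarrow> complex^'m) set" where
  "eigenspace \<sigma> T1 H1 T2 H2 z = {Y. (\<forall>x. x \<notin> {0..pi} \<longrightarrow> Y x = 0) \<and>
     (\<exists>Q. solution \<sigma> z Y Q \<and> bdry T1 H1 (Y 0) (Q 0) = 0 \<and> bdry T2 H2 (Y pi) (Q pi) = 0)}"

interpretation fun_vec: vector_space "\<lambda>(c::complex) (f :: real \<Rightarrow> complex^'m) x. c *s f x"
  by unfold_locales (auto simp: fun_eq_iff vec_eq_iff algebra_simps)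

definition multiplicity_of :: "(real \<Rightarrow> complex^'m^'m) \<Rightarrow> complex^'m^'m \<Rightarrow> complex^'m^'m \<Rightarrow>
    complex^'m^'m \<Rightarrow> complex^'m^'m \<Rightarrow> complex \<Rightarrow> nat" where
  "multiplicity_of \<sigma> T1 H1 T2 H2 z = fun_vec.dim (eigenspace \<sigma> T1 H1 T2 H2 z)"

definition index_set :: "complex^'m^'m \<Rightarrow> complex^'m^'m \<Rightarrow> (nat \<times> nat) set" where
  "index_set T1 T2 =
     {(n, k). 1 \<le> n \<and> 1 \<le> k \<and> k \<le> CARD('m)} \<union>
     {(n, k). n = 0 \<and> vec.dim {v. T1 *v v = 0 \<and> T2 *v v = 0} + 1 \<le> k \<and> k \<le> CARD('m)}"

definition eigenvalue_numbering :: "(real \<Rightarrow> complex^'m^'m) \<Rightarrow> complex^'m^'m \<Rightarrow> complex^'m^'m \<Rightarrow>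
    complex^'m^'m \<Rightarrow> complex^'m^'m \<Rightarrow> (nat \<times> nat \<Rightarrow> real) \<Rightarrow> bool" where
  "eigenvalue_numbering \<sigma> T1 H1 T2 H2 ev \<longleftrightarrow>
     (\<forall>i\<in>index_set T1 T2. \<forall>j\<in>index_set T1 T2.
        (i, j) \<in> less_than <*lex*> less_than \<longrightarrow> ev i \<le> ev j) \<and>
     (\<forall>z::complex. finite {j \<in> index_set T1 T2. complex_of_real (ev j) = z} \<and>
        card {j \<in> index_set T1 T2. complex_of_real (ev j) = z} = multiplicity_of \<sigma> T1 H1 T2 H2 z)"

text \<open>The Weyl matrix has an unspecified value where the Weyl solution is not unique or does not
  exist, that is, at the eigenvalues; residues do not depend on these values.\<close>

definition weyl_solution :: "(real \<Rightarrow> complex^'m^'m) \<Rightarrow> complex^'m^'m \<Rightarrow> complex^'m^'m \<Rightarrow>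
    complex^'m^'m \<Rightarrow> complex^'m^'m \<Rightarrow> complex \<Rightarrow>
    (real \<Rightarrow> complex^'m^'m) \<Rightarrow> (real \<Rightarrow> complex^'m^'m) \<Rightarrow> bool" where
  "weyl_solution \<sigma> T1 H1 T2 H2 z \<Phi> Q \<longleftrightarrow> matrix_solution \<sigma> z \<Phi> Q \<and>
     matrix_bdry T1 H1 (\<Phi> 0) (Q 0) = mat 1 \<and> matrix_bdry T2 H2 (\<Phi> pi) (Q pi) = 0"

definition weyl_matrix :: "(real \<Rightarrow> complex^'m^'m) \<Rightarrow> complex^'m^'m \<Rightarrow> complex^'m^'m \<Rightarrow>
    complex^'m^'m \<Rightarrow> complex^'m^'m \<Rightarrow> complex \<Rightarrow> complex^'m^'m" where
  "weyl_matrix \<sigma> T1 H1 T2 H2 z =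
     (THE M. \<exists>\<Phi> Q. weyl_solution \<sigma> T1 H1 T2 H2 z \<Phi> Q \<and> M = matrix_bdry_perp T1 (\<Phi> 0) (Q 0))"

definition weight_matrix :: "(real \<Rightarrow> complex^'m^'m) \<Rightarrow> complex^'m^'m \<Rightarrow> complex^'m^'m \<Rightarrow>
    complex^'m^'m \<Rightarrow> complex^'m^'m \<Rightarrow> real \<Rightarrow> complex^'m^'m" where
  "weight_matrix \<sigma> T1 H1 T2 H2 l =
     (\<chi> i j. residue (\<lambda>z. weyl_matrix \<sigma> T1 H1 T2 H2 z $ i $ j) (complex_of_real l))"

text \<open>The branch of the square root with argument in \<open>[-pi/2, pi/2)\<close>; on negative reals it differs
  from \<open>csqrt\<close>. The library sets \<open>Arg 0 = 0\<close>.\<close>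

definition rho :: "real \<Rightarrow> complex" where
  "rho l = (THE r. r\<^sup>2 = complex_of_real l \<and> - pi / 2 \<le> Arg r \<and> Arg r < pi / 2)"

lemma rho_eq: "rho l = (if 0 \<le> l then complex_of_real (sqrt l) else - \<i> * complex_of_real (sqrt (- l)))"
proof -
  define w where "w = (if 0 \<le> l then complex_of_real (sqrt l) else - \<i> * complex_of_real (sqrt (- l)))"
  have sq: "w\<^sup>2 = complex_of_real l"
    unfolding w_def by (simp add: power_mult_distrib flip: of_real_power)
  consider "l = 0" | "0 < l" | "l < 0" by linarith
  then have arg: "- pi / 2 \<le> Arg w \<and> Arg w < pi / 2 \<and> (l = 0 \<or> Arg (- w) \<ge> pi / 2)"
  proof cases
    case 1
    then show ?thesis by (simp add: w_def Arg_zero)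
  next
    case 2
    then have "Arg w = 0" "Arg (- w) = pi"
      by (simp_all add: w_def Arg_of_real flip: of_real_minus)
    then show ?thesis by simp
  next
    case 3
    then have "0 < sqrt (- l)" "w = complex_of_real (sqrt (- l)) * - \<i>"
      "- w = complex_of_real (sqrt (- l)) * \<i>"
      by (simp_all add: w_def)
    then have "Arg w = - pi / 2" "Arg (- w) = pi / 2"
      by (metis Arg_times_of_real Arg_minus_ii minus_divide_left, metis Arg_times_of_real Arg_ii)
    then show ?thesis by simp
  qed
  have "rho l = w"
    unfolding rho_def
  proof (rule the_equality)
    show "w\<^sup>2 = complex_of_real l \<and> - pi / 2 \<le> Arg w \<and> Arg w < pi / 2"
      using sq arg by blast
  next
    fix r assume r: "r\<^sup>2 = complex_of_real l \<and> - pi / 2 \<le> Arg r \<and> Arg r < pi / 2"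
    then have "r\<^sup>2 = w\<^sup>2" using sq by simp
    then have "r = w \<or> r = - w" by (simp only: power2_eq_iff)
    then show "r = w"
    proof
      assume eq: "r = - w"
      then have "l = 0" using r arg by fastforce
      then show "r = w" using eq by (simp add: w_def)
    qed
  qed
  then show ?thesis by (simp only: w_def)
qed

definition T_of :: "complex^'m^'m \<Rightarrow> complex \<Rightarrow> complex^'m^'m" where
  "T_of T1 r = (if r \<noteq> 0 then T1 + mat r ** (mat 1 - T1) else mat 1)"

definition B_of :: "(real \<Rightarrow> complex^'m^'m) \<Rightarrow> complex^'m^'m \<Rightarrow> complex^'m^'m \<Rightarrow>
    complex^'m^'m \<Rightarrow> complex^'m^'m \<Rightarrow> real \<Rightarrow> complex^'m^'m" where
  "B_of \<sigma> T1 H1 T2 H2 l = (pi / 2) *\<^sub>R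
     (matrix_inv (T_of T1 (rho l)) ** weight_matrix \<sigma> T1 H1 T2 H2 l ** matrix_inv (T_of T1 (rho l)))"

definition Y_of :: "complex^'m^'m \<Rightarrow> complex \<Rightarrow> complex^'m \<Rightarrow> real \<Rightarrow> complex^'m" where
  "Y_of T1 r e x =
     (if r \<noteq> 0 then (mat (cos (r * of_real x)) ** T1 + mat (sin (r * of_real x)) ** (mat 1 - T1)) *v e
      else (T1 + mat (of_real x) ** (mat 1 - T1)) *v e)"

end

theory Submission imports Defs begin

text \<open>The eigenfunctions of a self-adjoint problem are total: if \<open>f\<close> is orthogonal to all of them,
  then the quadratic form of the resolvent at \<open>f\<close> has no poles, hence is an entire function of
  \<open>z\<close> bounded by \<open>C / \<bar>Im z\<bar>\<close>, and so it vanishes.  This is applied twice: to the given problem and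
  to a problem with \<open>\<sigma> = 0\<close> and \<open>H1 = 0\<close>.

  For \<open>\<sigma> = 0\<close> the solutions satisfying the left boundary condition are
  \<open>cos (\<rho> x) T1 v + (sin (\<rho> x) / \<rho>) (I - T1) v\<close> with \<open>\<rho>\<^sup>2 = z\<close>; the function
  \<open>Y\<^sub>n\<^sub>k\<close> is the one with \<open>z = \<lambda>\<^sub>n\<^sub>k\<close> and \<open>v = T\<^sub>n\<^sub>k \<E>\<^sub>n\<^sub>k\<close>.
  A transformation operator independent of \<open>z\<close> and \<open>v\<close> takes it to the solution
  of the given equation with the same parameters.  Instead of constructing its kernel, one bounds its
  inverse on finite linear combinations of solutions by an energy estimate for the associated wave
  equation.  Completeness carries over: approximate \<open>f\<close> by free solutions, map these to solutions
  of the given equation, approximate the result by eigenfunctions, and map back.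

  Since the poles of the Weyl matrix are simple, a weight matrix has its range in the kernel of the
  characteristic matrix, and by the count of multiplicities the vectors
  \<open>T\<^sub>n\<^sub>k \<E>\<^sub>n\<^sub>k\<close> of one eigenvalue form a basis of this kernel.\<close>

text \<open>Formally the potential is the distribution \<open>\<sigma>'\<close>. The work is
  therefore done with the first-order system for \<open>Y\<close> and its quasi-derivative, whose
  coefficients involve only \<open>\<sigma>\<close> and its square and so are integrable.
  Self-adjointness enters through Green's identity, and twice. For the resolvent \<open>Y\<close> of
  \<open>f\<close> it gives Im z |Y|^2 = Im <Y, f>, whence the bound C / |Im z|. For the
  characteristic matrix it gives a lower bound of order |Im z|, so the inverse has simple poles
  whose residues map into the kernel; orthogonality to the eigenfunctions cancels exactly these
  residues. The comparison of the two equations is one-sided because the last step has a finite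
  combination that is small on the side of the given equation and has to be small on the free side.
  In the wave equation the dependence on \<open>s\<close> is explicit, trigonometric in
  \<open>s\<close>, while \<open>\<sigma>\<close> depends on the other variable. Taking that other
  variable as time makes \<open>\<sigma>\<close> a coefficient that is merely integrable in time,
  which is what Gronwall's inequality tolerates.\<close>

no_notation fps_nth (infixl "$" 75)

section \<open>Absolutely continuous functions\<close>

text \<open>Absolute continuity in Lebesgue's form, with a named derivative \<open>f\<close> that
  matters only up to null sets. It suits differential equations better than the epsilon-delta notion
  \<open>abs_cont_on\<close> of the statement; \<open>ac_deriv_abs_cont_on\<close>,
  \<open>ac_deriv_differentiable\<close> and \<open>ac_derivI\<close> translate between the
  two.\<close>

definition ac_deriv :: "real \<Rightarrow> real \<Rightarrow> (real \<Rightarrow> 'b::euclidean_space) \<Rightarrow> (real \<Rightarrow> 'b) \<Rightarrow> bool" where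
  "ac_deriv a b F f \<longleftrightarrow> f absolutely_integrable_on {a..b} \<and>
     (\<forall>x\<in>{a..b}. (f has_integral (F x - F a)) {a..x})"

lemma ac_deriv_integral:
  assumes "ac_deriv a b F f" "a \<le> l" "l \<le> r" "r \<le> b"
  shows "(f has_integral (F r - F l)) {l..r}"
proof -
  have r: "(f has_integral (F r - F a)) {a..r}" and l: "(f has_integral (F l - F a)) {a..l}"
    using assms by (auto simp: ac_deriv_def)
  have i: "f integrable_on {l..r}"
    by (rule integrable_subinterval_real[OF has_integral_integrable[OF r]]) (use assms in auto)
  have "(f has_integral (F l - F a + integral {l..r} f)) {a..r}"
    by (rule has_integral_combine[OF _ _ l]) (use assms i in \<open>auto simp: integrable_integral\<close>)
  then have "F l - F a + integral {l..r} f = F r - F a"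
    using r has_integral_unique by blast
  then have "integral {l..r} f = F r - F l" by (simp add: algebra_simps)
  then show ?thesis using i integrable_integral by fastforce
qed

lemma ac_deriv_abs_int: "ac_deriv a b F f \<Longrightarrow> f absolutely_integrable_on {a..b}"
  by (simp add: ac_deriv_def)

lemma ac_deriv_abs_int_sub:
  "ac_deriv a b F f \<Longrightarrow> a \<le> l \<Longrightarrow> r \<le> b \<Longrightarrow> f absolutely_integrable_on {l..r}"
  by (rule absolutely_integrable_on_subinterval[OF ac_deriv_abs_int]) auto

lemma ac_deriv_subinterval:
  assumes "ac_deriv a b F f" "a \<le> l" "r \<le> b"
  shows "ac_deriv l r F f"
  unfolding ac_deriv_def
  using ac_deriv_integral[OF assms(1,2)] ac_deriv_abs_int_sub[OF assms] assms by auto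

lemma ac_deriv_cong:
  assumes "ac_deriv a b F f" "\<And>x. x \<in> {a..b} \<Longrightarrow> F x = G x"
    "negligible N" "\<And>x. x \<in> {a..b} - N \<Longrightarrow> f x = g x"
  shows "ac_deriv a b G g"
proof -
  have "g absolutely_integrable_on {a..b}"
    by (rule absolutely_integrable_spike[OF ac_deriv_abs_int[OF assms(1)] assms(3)]) (use assms(4) in auto)
  moreover have "(g has_integral (G x - G a)) {a..x}" if "x \<in> {a..b}" for x
  proof -
    have "(f has_integral (G x - G a)) {a..x}"
      using assms(1,2) that by (auto simp: ac_deriv_def)
    then show ?thesis
      by (rule has_integral_spike[OF assms(3), rotated]) (use assms(4) that in auto)
  qed
  ultimately show ?thesis by (simp add: ac_deriv_def)
qed

lemma ac_deriv_continuous_on: "ac_deriv a b F f \<Longrightarrow> continuous_on {a..b} F"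
proof -
  assume A: "ac_deriv a b F f"
  have "continuous_on {a..b} (\<lambda>x. F a + integral {a..x} f)"
    using A by (intro continuous_intros indefinite_integral_continuous_1)
      (auto simp: ac_deriv_def set_lebesgue_integral_eq_integral(1))
  moreover have "F x = F a + integral {a..x} f" if "x \<in> {a..b}" for x
  proof -
    have "(f has_integral (F x - F a)) {a..x}" using A that by (auto simp: ac_deriv_def)
    then show ?thesis by (simp add: integral_unique)
  qed
  ultimately show ?thesis by (metis (no_types, lifting) continuous_on_cong)
qed

lemma ac_deriv_indefinite_integral:
  assumes "f absolutely_integrable_on {a..b}"
  shows "ac_deriv a b (\<lambda>x. c + integral {a..x} f) f"
proof -
  have "f integrable_on {a..x}" if "x \<in> {a..b}" for x
    by (rule integrable_subinterval_real[of _ a b])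
      (use assms that in \<open>auto simp: set_lebesgue_integral_eq_integral(1)\<close>)
  then show ?thesis using assms by (auto simp: ac_deriv_def)
qed

text \<open>Lebesgue's differentiation theorem. \<open>integrable_ccontinuous_explicit\<close>
  speaks of averages over intervals to the right of a point; applying it also to the reflection of
  \<open>g\<close> yields the derivative from the left.\<close>

lemma ac_deriv_differentiable:
  fixes F :: "real \<Rightarrow> 'b::euclidean_space"
  assumes A: "ac_deriv a b F f"
  obtains N where "negligible N" "\<And>x. x \<in> {a<..<b} - N \<Longrightarrow> (F has_vector_derivative f x) (at x)"
proof -
  \<comment> \<open>The extension by zero is integrable over every interval, including those that
    reach beyond \<open>{a..b}\<close>.\<close>
  define g where "g = (\<lambda>x. if x \<in> {a..b} then f x else 0)"
  have gU: "g absolutely_integrable_on UNIV"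
    unfolding g_def using ac_deriv_abs_int[OF A] absolutely_integrable_restrict_UNIV by blast
  have gint: "g integrable_on cbox u v" for u v
    using gU by (meson absolutely_integrable_on_def integrable_on_subcbox subset_UNIV)
  have "(\<lambda>x. g (- x)) integrable_on cbox u v" for u v
    using gint[of "-v" "-u"] integrable_reflect[where f=g and a="-v" and b="-u"] by simp
  then have gint': "(\<lambda>x. g (- x)) integrable_on cbox u v" for u v .
  obtain N1 where N1: "negligible N1"
      "\<And>x e. \<lbrakk>x \<notin> N1; 0 < e\<rbrakk> \<Longrightarrow> \<exists>d>0. \<forall>h. 0 < h \<and> h < d \<longrightarrow>
             norm (integral (cbox x (x + h *\<^sub>R One)) g /\<^sub>R h ^ DIM(real) - g x) < e"
    using integrable_ccontinuous_explicit[OF gint] by blast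
  obtain N2 where N2: "negligible N2"
      "\<And>x e. \<lbrakk>x \<notin> N2; 0 < e\<rbrakk> \<Longrightarrow> \<exists>d>0. \<forall>h. 0 < h \<and> h < d \<longrightarrow>
             norm (integral (cbox x (x + h *\<^sub>R One)) (\<lambda>x. g (- x)) /\<^sub>R h ^ DIM(real) - g (- x)) < e"
    using integrable_ccontinuous_explicit[OF gint'] by blast
  have "negligible (uminus ` N2)"
    by (rule negligible_differentiable_image_negligible) (auto simp: N2 differentiable_on_def intro!: derivative_intros)
  then have neg: "negligible (N1 \<union> uminus ` N2)" using N1 by auto
  have "(F has_vector_derivative f x) (at x)" if x: "x \<in> {a<..<b} - (N1 \<union> uminus ` N2)" for x
  proof -
    have xN: "x \<notin> N1" "- x \<notin> N2" and xab: "a < x" "x < b" using x by force+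
    show ?thesis
      unfolding has_vector_derivative_def has_derivative_at_alt
    proof (intro conjI allI impI bounded_linear_scaleR_left)
      fix e :: real assume "0 < e"
      obtain d1 where d1: "d1 > 0" "\<And>h. 0 < h \<Longrightarrow> h < d1 \<Longrightarrow> norm (integral {x..x + h} g /\<^sub>R h - g x) < e"
        using N1(2)[OF xN(1) \<open>0 < e\<close>] by (auto simp: )
      obtain d2 where d2: "d2 > 0" "\<And>h. 0 < h \<Longrightarrow> h < d2 \<Longrightarrow> norm (integral {-x..-x + h} (\<lambda>x. g (- x)) /\<^sub>R h - g x) < e"
        using N2(2)[OF xN(2) \<open>0 < e\<close>] by auto
      define d where "d = min (min d1 d2) (min (x - a) (b - x))"
      have "d > 0" using d1 d2 xab by (auto simp: d_def)
      moreover have "norm (F y - F x - (y - x) *\<^sub>R f x) \<le> e * norm (y - x)" if y: "norm (y - x) < d" for y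
      proof -
        have yab: "a < y" "y < b" using y by (auto simp: d_def)
        consider "y = x" | "y > x" | "y < x" by linarith
        then show ?thesis
        proof cases
          case 2
          define h where "h = y - x"
          have h: "0 < h" "h < d1" "y = x + h" using 2 y by (auto simp: h_def d_def)
          have "(f has_integral (F y - F x)) {x..y}"
            using ac_deriv_integral[OF A, of x y] xab yab 2 by auto
          then have "(g has_integral (F y - F x)) {x..y}"
            by (rule has_integral_eq[rotated]) (use xab yab in \<open>auto simp: g_def\<close>)
          then have I: "integral {x..x+h} g = F y - F x" using h by auto
          have "F y - F x - (y - x) *\<^sub>R f x = h *\<^sub>R (integral {x..x + h} g /\<^sub>R h - g x)"
            using h xab I by (auto simp: g_def algebra_simps)
          then have "norm (F y - F x - (y - x) *\<^sub>R f x) = h * norm (integral {x..x + h} g /\<^sub>R h - g x)"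
            using h by simp
          also have "\<dots> \<le> h * e" using d1(2)[OF h(1,2)] h by (intro mult_left_mono) auto
          finally show ?thesis using h by (simp add: mult.commute)
        next
          case 3
          define h where "h = x - y"
          have h: "0 < h" "h < d2" "y = x - h" using 3 y by (auto simp: h_def d_def)
          have "(f has_integral (F x - F y)) {y..x}"
            using ac_deriv_integral[OF A, of y x] xab yab 3 by auto
          then have "(g has_integral (F x - F y)) {y..x}"
            by (rule has_integral_eq[rotated]) (use xab yab in \<open>auto simp: g_def\<close>)
          then have "((\<lambda>x. g (- x)) has_integral (F x - F y)) {-x..-y}"
            by (simp add: has_integral_reflect_real)
          then have I: "integral {-x..-x+h} (\<lambda>x. g (- x)) = F x - F y" using h by auto
          have "F y - F x - (y - x) *\<^sub>R f x = - (h *\<^sub>R (integral {-x..-x + h} (\<lambda>x. g (- x)) /\<^sub>R h - g x))"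
            using h xab I by (auto simp: g_def algebra_simps)
          then have "norm (F y - F x - (y - x) *\<^sub>R f x) = h * norm (integral {-x..-x + h} (\<lambda>x. g (- x)) /\<^sub>R h - g x)"
            using h by simp
          also have "\<dots> \<le> h * e" using d2(2)[OF h(1,2)] h by (intro mult_left_mono) auto
          finally show ?thesis using h by (simp add: mult.commute)
        qed auto
      qed
      ultimately show "\<exists>d>0. \<forall>y. norm (y - x) < d \<longrightarrow> norm (F y - F x - (y - x) *\<^sub>R f x) \<le> e * norm (y - x)"
        by blast
    qed
  qed
  with neg show thesis by (rule that)
qed

text \<open>Since the open intervals are disjoint, the restrictions of \<open>g\<close> to them add
  up to a function that is at most \<open>g\<close> at every point.\<close>

lemma sum_integral_disjoint_le:
  fixes g :: "real \<Rightarrow> real"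
  assumes g: "g integrable_on {a..b}" "\<And>x. x \<in> {a..b} \<Longrightarrow> 0 \<le> g x"
    and lr: "\<And>i. i < n \<Longrightarrow> a \<le> l i \<and> l i \<le> r i \<and> r i \<le> b"
    and dis: "disjoint_family_on (\<lambda>i. {l i<..<r i}) {..<n::nat}"
  shows "(\<Sum>i<n. integral {l i..r i} g) \<le> integral {a..b} g"
proof -
  have I: "((\<lambda>x. if x \<in> {l i<..<r i} then g x else 0) has_integral (integral {l i..r i} g)) {a..b}" if "i < n" for i
  proof -
    have "g integrable_on {l i..r i}"
      by (rule integrable_subinterval_real[OF g(1)]) (use lr[OF that] in auto)
    then have "(g has_integral integral {l i..r i} g) {l i<..<r i}"
      using has_integral_open_interval[of g "integral {l i..r i} g" "l i" "r i"] by (simp add: integrable_integral)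
    moreover have "{l i<..<r i} \<subseteq> {a..b}" using lr[OF that] by auto
    ultimately show ?thesis by (simp only: has_integral_restrict)
  qed
  have S: "((\<lambda>x. \<Sum>i<n. if x \<in> {l i<..<r i} then g x else 0) has_integral (\<Sum>i<n. integral {l i..r i} g)) {a..b}"
    by (rule has_integral_sum) (use I in auto)
  show ?thesis
  proof (rule has_integral_le[OF S integrable_integral[OF g(1)]])
    fix x assume x: "x \<in> {a..b}"
    show "(\<Sum>i<n. if x \<in> {l i<..<r i} then g x else 0) \<le> g x"
    proof (cases "\<exists>k<n. x \<in> {l k<..<r k}")
      case True
      then obtain k where k: "k < n" "x \<in> {l k<..<r k}" by auto
      have "x \<notin> {l i<..<r i}" if "i < n" "i \<noteq> k" for i
        using disjoint_family_onD[OF dis, of i k] that k by blast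
      then have "(\<Sum>i<n. if x \<in> {l i<..<r i} then g x else 0) = (\<Sum>i<n. if i = k then g x else 0)"
        using k by (intro sum.cong) auto
      then show ?thesis using k by simp
    next
      case False
      then have "(\<Sum>i<n. if x \<in> {l i<..<r i} then g x else 0) = 0" by (intro sum.neutral) auto
      then show ?thesis using g(2)[OF x] by simp
    qed
  qed
qed

text \<open>The derivative is cut off at a height \<open>K\<close>: the part above \<open>K\<close>
  has small integral by dominated convergence, and the part below contributes at most
  \<open>K\<close> times the total length.\<close>

lemma ac_deriv_abs_cont_on:
  assumes A: "ac_deriv a b F f"
  shows "abs_cont_on a b F"
  unfolding abs_cont_on_def
proof (intro allI impI)
  fix e :: real assume e: "e > 0"
  define g where "g = (\<lambda>x. norm (f x))"
  have ga: "g absolutely_integrable_on {a..b}"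
    unfolding g_def by (rule absolutely_integrable_norm[OF ac_deriv_abs_int[OF A], unfolded o_def])
  have gi: "g integrable_on {a..b}" using ga by (simp add: set_lebesgue_integral_eq_integral(1))
  have mi: "(\<lambda>x. min (g x) (real k)) integrable_on {a..b}" for k
    using absolutely_integrable_min_1[OF ga, of "\<lambda>_. real k"]
    by (simp add: set_lebesgue_integral_eq_integral(1))
  have hi: "(\<lambda>x. g x - min (g x) (real k)) integrable_on {a..b}" for k
    by (intro integrable_diff gi mi)
  have "(\<lambda>k. integral {a..b} (\<lambda>x. g x - min (g x) (real k))) \<longlonglongrightarrow> integral {a..b} (\<lambda>x. 0)"
  proof (rule dominated_convergence(2)[of _ _ g])
    show "norm (g x - min (g x) (real k)) \<le> g x" for k x by (auto simp: g_def min_def)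
    show "(\<lambda>k. g x - min (g x) (real k)) \<longlonglongrightarrow> 0" for x
    proof (rule tendsto_eventually)
      obtain K where "g x \<le> real K" using real_arch_simple by blast
      then show "\<forall>\<^sub>F k in sequentially. g x - min (g x) (real k) = 0"
        unfolding eventually_sequentially by (intro exI[of _ K]) (auto simp: min_def)
    qed
  qed (use hi gi in auto)
  then have "\<forall>\<^sub>F k in sequentially. integral {a..b} (\<lambda>x. g x - min (g x) (real k)) < e/2"
    using order_tendstoD(2)[of _ 0 sequentially "e/2"] e by simp
  then obtain K where K: "integral {a..b} (\<lambda>x. g x - min (g x) (real K)) < e/2"
    by (auto simp: eventually_sequentially)
  \<comment> \<open>Chosen so that \<open>K * d \<le> e / 2\<close>; the added 1 covers
    \<open>K = 0\<close>.\<close>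
  define d where "d = e / (2 * (real K + 1))"
  have "d > 0" using e by (auto simp: d_def)
  moreover have "(\<Sum>i<n. norm (F (r i) - F (l i))) < e"
    if H: "(\<forall>i<n. a \<le> l i \<and> l i \<le> r i \<and> r i \<le> b) \<and>
        disjoint_family_on (\<lambda>i. {l i<..<r i}) {..<n} \<and> (\<Sum>i<n. r i - l i) < d" for n :: nat and l r
  proof -
    have one: "norm (F (r i) - F (l i)) \<le> real K * (r i - l i) + integral {l i..r i} (\<lambda>x. g x - min (g x) (real K))"
      if "i < n" for i
    proof -
      have s: "{l i..r i} \<subseteq> {a..b}" "l i \<le> r i" using H that by auto
      have fi: "(f has_integral (F (r i) - F (l i))) {l i..r i}"
        by (rule ac_deriv_integral[OF A]) (use H that in auto)
      have gI: "g integrable_on {l i..r i}" and mI: "(\<lambda>x. min (g x) (real K)) integrable_on {l i..r i}"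
        and hI: "(\<lambda>x. g x - min (g x) (real K)) integrable_on {l i..r i}"
        by (rule integrable_subinterval_real[OF gi s(1)], rule integrable_subinterval_real[OF mi s(1)],
            rule integrable_subinterval_real[OF hi s(1)])
      have "norm (F (r i) - F (l i)) \<le> integral {l i..r i} g"
        using integral_norm_bound_integral[OF has_integral_integrable[OF fi] gI] integral_unique[OF fi]
        by (simp add: g_def)
      also have "\<dots> = integral {l i..r i} (\<lambda>x. min (g x) (real K)) + integral {l i..r i} (\<lambda>x. g x - min (g x) (real K))"
        using integral_add[OF mI hI] by simp
      also have "integral {l i..r i} (\<lambda>x. min (g x) (real K)) \<le> integral {l i..r i} (\<lambda>x. real K)"
        by (rule integral_le[OF mI]) auto
      also have "\<dots> = real K * (r i - l i)" using s by simp
      finally show ?thesis by simp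
    qed
    have "(\<Sum>i<n. norm (F (r i) - F (l i))) \<le>
        (\<Sum>i<n. real K * (r i - l i) + integral {l i..r i} (\<lambda>x. g x - min (g x) (real K)))"
      by (rule sum_mono) (use one in auto)
    also have "\<dots> = real K * (\<Sum>i<n. r i - l i) + (\<Sum>i<n. integral {l i..r i} (\<lambda>x. g x - min (g x) (real K)))"
      by (simp add: sum.distrib sum_distrib_left)
    also have "(\<Sum>i<n. integral {l i..r i} (\<lambda>x. g x - min (g x) (real K))) \<le> integral {a..b} (\<lambda>x. g x - min (g x) (real K))"
      by (rule sum_integral_disjoint_le[OF hi]) (use H in auto)
    also have "real K * (\<Sum>i<n. r i - l i) \<le> real K * d" using H by (intro mult_left_mono) auto
    also have "real K * d \<le> e / 2"
      using e by (simp add: d_def field_simps)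
    finally show ?thesis using K by simp
  qed
  ultimately show "\<exists>\<delta>>0. \<forall>(n::nat) l r. (\<forall>i<n. a \<le> l i \<and> l i \<le> r i \<and> r i \<le> b) \<and>
      disjoint_family_on (\<lambda>i. {l i<..<r i}) {..<n} \<and> (\<Sum>i<n. r i - l i) < \<delta> \<longrightarrow> (\<Sum>i<n. norm (F (r i) - F (l i))) < e"
    by blast
qed

text \<open>The common source of the closure properties below: products, compositions and columns
  all have increments dominated in this way. With \<open>G = F\<close> it covers functions of a
  single \<open>F\<close>.\<close>

lemma abs_cont_on_lipschitz2:
  assumes F: "abs_cont_on a b F" and G: "abs_cont_on a b G" and "0 \<le> M"
    and H: "\<And>x y. x \<in> {a..b} \<Longrightarrow> y \<in> {a..b} \<Longrightarrow> norm (H x - H y) \<le> M * (norm (F x - F y) + norm (G x - G y))"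
  shows "abs_cont_on a b H"
  unfolding abs_cont_on_def
proof (intro allI impI)
  fix e :: real assume e: "e > 0"
  define e' where "e' = e / (2 * (M + 1))"
  have e': "e' > 0" using e \<open>0 \<le> M\<close> by (auto simp: e'_def)
  obtain d1 where d1: "d1 > 0" "\<And>(n::nat) l r. (\<forall>i<n. a \<le> l i \<and> l i \<le> r i \<and> r i \<le> b) \<and>
      disjoint_family_on (\<lambda>i. {l i<..<r i}) {..<n} \<and> (\<Sum>i<n. r i - l i) < d1 \<Longrightarrow> (\<Sum>i<n. norm (F (r i) - F (l i))) < e'"
    using F e' unfolding abs_cont_on_def by meson
  obtain d2 where d2: "d2 > 0" "\<And>(n::nat) l r. (\<forall>i<n. a \<le> l i \<and> l i \<le> r i \<and> r i \<le> b) \<and>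
      disjoint_family_on (\<lambda>i. {l i<..<r i}) {..<n} \<and> (\<Sum>i<n. r i - l i) < d2 \<Longrightarrow> (\<Sum>i<n. norm (G (r i) - G (l i))) < e'"
    using G e' unfolding abs_cont_on_def by meson
  have "(\<Sum>i<n. norm (H (r i) - H (l i))) < e"
    if C: "(\<forall>i<n. a \<le> l i \<and> l i \<le> r i \<and> r i \<le> b) \<and>
      disjoint_family_on (\<lambda>i. {l i<..<r i}) {..<n} \<and> (\<Sum>i<n. r i - l i) < min d1 d2" for n :: nat and l r
  proof -
    have "(\<Sum>i<n. norm (H (r i) - H (l i))) \<le> (\<Sum>i<n. M * (norm (F (r i) - F (l i)) + norm (G (r i) - G (l i))))"
      by (rule sum_mono, rule H) (use C in \<open>auto intro: order_trans\<close>)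
    also have "\<dots> = M * ((\<Sum>i<n. norm (F (r i) - F (l i))) + (\<Sum>i<n. norm (G (r i) - G (l i))))"
      unfolding sum_distrib_left[symmetric] sum.distrib by simp
    also have "\<dots> \<le> M * (e' + e')"
      using d1(2)[of n l r] d2(2)[of n l r] C \<open>0 \<le> M\<close> by (intro mult_left_mono add_mono) auto
    also have "\<dots> < e"
    proof -
      have "2 * (M + 1) \<noteq> 0" using \<open>0 \<le> M\<close> by simp
      then have "e' * (2 * (M + 1)) = e" by (simp add: e'_def)
      then show ?thesis using e' by (simp add: algebra_simps)
    qed
    finally show ?thesis .
  qed
  then show "\<exists>\<delta>>0. \<forall>(n::nat) l r. (\<forall>i<n. a \<le> l i \<and> l i \<le> r i \<and> r i \<le> b) \<and>
      disjoint_family_on (\<lambda>i. {l i<..<r i}) {..<n} \<and> (\<Sum>i<n. r i - l i) < \<delta> \<longrightarrow> (\<Sum>i<n. norm (H (r i) - H (l i))) < e"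
    using d1(1) d2(1) by (intro exI[of _ "min d1 d2"]) auto
qed

lemma abs_cont_on_continuous:
  assumes "abs_cont_on a b F"
  shows "continuous_on {a..b} F"
  unfolding continuous_on_iff
proof (intro ballI allI impI)
  fix x e :: real assume x: "x \<in> {a..b}" and "e > 0"
  obtain d where d: "d > 0" "\<And>(n::nat) l r. (\<forall>i<n. a \<le> l i \<and> l i \<le> r i \<and> r i \<le> b) \<and>
      disjoint_family_on (\<lambda>i. {l i<..<r i}) {..<n} \<and> (\<Sum>i<n. r i - l i) < d \<Longrightarrow> (\<Sum>i<n. norm (F (r i) - F (l i))) < e"
    using assms \<open>e > 0\<close> unfolding abs_cont_on_def by meson
  have "dist (F y) (F x) < e" if y: "y \<in> {a..b}" "dist y x < d" for y
  proof -
    have "(\<Sum>i<Suc 0. norm (F (max x y) - F (min x y))) < e"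
      by (rule d(2)) (use x y in \<open>auto simp: disjoint_family_on_def dist_real_def\<close>)
    then show ?thesis by (cases "x \<le> y") (auto simp: dist_norm max_def min_def norm_minus_commute)
  qed
  then show "\<exists>d>0. \<forall>y\<in>{a..b}. dist y x < d \<longrightarrow> dist (F y) (F x) < e" using d(1) by blast
qed

text \<open>The definition numbers the intervals by naturals, whereas the intervals of a tagged
  division are indexed by the division itself.\<close>

lemma abs_cont_on_finite_sum_less:
  assumes F: "abs_cont_on a b F" and "e > 0"
  obtains d where "d > 0" "\<And>(D :: 'i set) l r. finite D \<Longrightarrow>
      (\<And>i. i \<in> D \<Longrightarrow> a \<le> l i \<and> l i \<le> r i \<and> r i \<le> b) \<Longrightarrow>
      disjoint_family_on (\<lambda>i. {l i<..<r i}) D \<Longrightarrow> (\<Sum>i\<in>D. r i - l i) < d \<Longrightarrow>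
      (\<Sum>i\<in>D. norm (F (r i) - F (l i))) < e"
proof -
  obtain d where d: "d > 0" "\<And>(n::nat) l r. (\<forall>i<n. a \<le> l i \<and> l i \<le> r i \<and> r i \<le> b) \<and>
      disjoint_family_on (\<lambda>i. {l i<..<r i}) {..<n} \<and> (\<Sum>i<n. r i - l i) < d \<Longrightarrow> (\<Sum>i<n. norm (F (r i) - F (l i))) < e"
    using F \<open>e > 0\<close> unfolding abs_cont_on_def by meson
  show thesis
  proof (rule that[OF d(1)])
    fix D :: "'i set" and l r
    assume D: "finite D" "\<And>i. i \<in> D \<Longrightarrow> a \<le> l i \<and> l i \<le> r i \<and> r i \<le> b"
      "disjoint_family_on (\<lambda>i. {l i<..<r i}) D" "(\<Sum>i\<in>D. r i - l i) < d"
    obtain h where h: "bij_betw h {..<card D} D"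
      using ex_bij_betw_nat_finite[OF D(1)] by (auto simp: atLeast0LessThan)
    have hD: "h i \<in> D" if "i < card D" for i using h that by (auto simp: bij_betw_def)
    have "(\<Sum>i<card D. norm (F (r (h i)) - F (l (h i)))) < e"
    proof (rule d(2), intro conjI)
      show "\<forall>i<card D. a \<le> l (h i) \<and> l (h i) \<le> r (h i) \<and> r (h i) \<le> b" using D(2) hD by auto
      show "disjoint_family_on (\<lambda>i. {l (h i)<..<r (h i)}) {..<card D}"
        unfolding disjoint_family_on_def
      proof (intro ballI impI)
        fix m n assume mn: "m \<in> {..<card D}" "n \<in> {..<card D}" "m \<noteq> n"
        then have "h m \<noteq> h n" using h by (auto simp: bij_betw_def inj_on_def)
        then show "{l (h m)<..<r (h m)} \<inter> {l (h n)<..<r (h n)} = {}"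
          using D(3) mn hD by (auto simp: disjoint_family_on_def)
      qed
      show "(\<Sum>i<card D. r (h i) - l (h i)) < d"
        using D(4) sum.reindex_bij_betw[OF h, of "\<lambda>i. r i - l i"] by simp
    qed
    then show "(\<Sum>i\<in>D. norm (F (r i) - F (l i))) < e"
      using sum.reindex_bij_betw[OF h, of "\<lambda>i. norm (F (r i) - F (l i))"] by simp
  qed
qed

lemma negligible_open_superset:
  fixes N :: "real set"
  assumes "negligible N" "e > 0"
  obtains U where "open U" "N \<subseteq> U" "U \<in> lmeasurable" "measure lebesgue U < e"
proof -
  have N: "N \<in> sets lebesgue" "N \<in> lmeasurable" "measure lebesgue N = 0"
    using assms by (auto simp: negligible_imp_sets negligible_imp_measurable negligible_imp_measure0)
  obtain U where U: "open U" "N \<subseteq> U" "U - N \<in> lmeasurable" "emeasure lebesgue (U - N) < ennreal e"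
    by (rule sets_lebesgue_outer_open[OF N(1) \<open>e > 0\<close>])
  have "U = N \<union> (U - N)" using U by auto
  then have UL: "U \<in> lmeasurable" using N(2) U(3) by (metis fmeasurable.Un)
  have "measure lebesgue (U - N) < e"
    using U(3,4) \<open>e > 0\<close> by (simp add: emeasure_eq_measure2 ennreal_less_iff)
  moreover have "measure lebesgue U \<le> measure lebesgue N + measure lebesgue (U - N)"
    using measure_Un_le[of N lebesgue "U - N"] N(1) U(3) \<open>U = N \<union> (U - N)\<close> by (auto simp: fmeasurableD)
  ultimately show thesis using that U UL N(3) by auto
qed

text \<open>A gauge can be adapted to each tag separately. At a tag where \<open>F\<close> is
  differentiable it enforces the linear approximation of \<open>F\<close>; at an exceptional tag it
  keeps the interval inside an open set \<open>U\<close> of small measure, where absolute continuity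
  bounds the increments of \<open>F\<close>.\<close>

lemma ac_derivI:
  fixes F :: "real \<Rightarrow> 'b::euclidean_space"
  assumes F: "abs_cont_on a b F" and N: "negligible N"
    and D: "\<And>x. x \<in> {a<..<b} - N \<Longrightarrow> (F has_vector_derivative f x) (at x)"
    and f: "f absolutely_integrable_on {a..b}"
  shows "ac_deriv a b F f"
proof -
  have "(f has_integral (F c - F a)) {a..c}" if c: "c \<in> {a..b}" for c
  proof -
    \<comment> \<open>The end points become exceptional because derivatives are given in the open
      interval only. With \<open>g\<close> equal to 0 on \<open>N'\<close>, exceptional tags
      contribute nothing to a Riemann sum.\<close>
    define N' where "N' = insert a (insert b N)"
    define g where "g = (\<lambda>x. if x \<in> N' then 0 else f x)"
    have N': "negligible N'" using N by (auto simp: N'_def)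
    have "(g has_integral (F c - F a)) {a..c}"
      unfolding has_integral_real
    proof (intro allI impI)
      fix e :: real assume e: "e > 0"
      \<comment> \<open>Half of \<open>e\<close> pays for the tags outside \<open>N'\<close>, where
        the error is \<open>e1\<close> times the length, and half for the tags in \<open>N'\<close>.
        The added 1 avoids a division by 0 when \<open>c = a\<close>.\<close>
      define e1 where "e1 = e / (2 * (c - a + 1))"
      have e1: "e1 > 0" using e c by (auto simp: e1_def)
      obtain d where d: "d > 0" "\<And>(D :: (real \<times> real set) set) l r. finite D \<Longrightarrow>
          (\<And>i. i \<in> D \<Longrightarrow> a \<le> l i \<and> l i \<le> r i \<and> r i \<le> b) \<Longrightarrow>
          disjoint_family_on (\<lambda>i. {l i<..<r i}) D \<Longrightarrow> (\<Sum>i\<in>D. r i - l i) < d \<Longrightarrow>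
          (\<Sum>i\<in>D. norm (F (r i) - F (l i))) < e/2"
        using abs_cont_on_finite_sum_less[OF F half_gt_zero[OF e], where 'i = "real \<times> real set"] by blast
      obtain U where U: "open U" "N' \<subseteq> U" "U \<in> lmeasurable" "measure lebesgue U < d"
        by (rule negligible_open_superset[OF N' d(1)])
      have "\<exists>s>0. ball x s \<subseteq> U" if "x \<in> N'" for x
        using U that open_contains_ball by blast
      then obtain s where s: "\<And>x. x \<in> N' \<Longrightarrow> s x > 0 \<and> ball x (s x) \<subseteq> U" by metis
      have "\<exists>s>0. \<forall>y. norm (y - x) < s \<longrightarrow> norm (F y - F x - (y - x) *\<^sub>R f x) \<le> e1 * norm (y - x)"
        if "x \<in> {a<..<b} - N'" for x
        using D[of x] that e1 unfolding has_vector_derivative_def has_derivative_at_alt N'_def by auto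
      then obtain t where t: "\<And>x. x \<in> {a<..<b} - N' \<Longrightarrow> t x > 0 \<and>
           (\<forall>y. norm (y - x) < t x \<longrightarrow> norm (F y - F x - (y - x) *\<^sub>R f x) \<le> e1 * norm (y - x))"
        by metis
      \<comment> \<open>The radius 1 is a dummy: every tag lies in \<open>{a..c}\<close>, and one
        outside \<open>N'\<close> is then an inner point.\<close>
      define \<gamma> where "\<gamma> = (\<lambda>x. ball x (if x \<in> N' then s x else if x \<in> {a<..<b} then t x else 1))"
      have G: "gauge \<gamma>" unfolding gauge_def \<gamma>_def using s t by auto
      have B: "norm ((\<Sum>(x, k)\<in>P. measure lborel k *\<^sub>R g x) - (F c - F a)) < e"
        if P: "P tagged_division_of {a..c}" "\<gamma> fine P" for P
      proof -
        have fin: "finite P" using P by blast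
        define lo hi where "lo = (\<lambda>p :: real \<times> real set. Inf (snd p))" and "hi = (\<lambda>p :: real \<times> real set. Sup (snd p))"
        have pk: "snd p = {lo p..hi p} \<and> lo p \<le> fst p \<and> fst p \<le> hi p \<and> a \<le> lo p \<and> hi p \<le> c \<and> snd p \<subseteq> \<gamma> (fst p)"
          if "p \<in> P" for p
        proof -
          obtain x k where p: "p = (x, k)" by fastforce
          have "(x, k) \<in> P" using that p by simp
          then have "\<exists>u v. k = {u..v}" using tagged_division_ofD(4)[OF P(1), of x k] by auto
          then obtain u v where k: "k = {u..v}" by blast
          have xk: "x \<in> k" "k \<subseteq> {a..c}" using tagged_division_ofD(2,3)[OF P(1)] that p by auto
          have "k \<subseteq> \<gamma> x" using fineD[OF P(2)] that p by auto
          moreover have "u \<le> v" using xk k by auto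
          ultimately show ?thesis using p k xk by (auto simp: lo_def hi_def)
        qed
        define A B where "A = {p\<in>P. fst p \<in> N'}" and "B = {p\<in>P. fst p \<notin> N'}"
        have PAB: "P = A \<union> B" "A \<inter> B = {}" "finite A" "finite B" using fin by (auto simp: A_def B_def)
        have telescope: "(\<Sum>p\<in>P. F (hi p) - F (lo p)) = F c - F a"
          using additive_tagged_division_1[OF _ P(1), of F] c
          by (simp add: lo_def hi_def case_prod_unfold)
        have len: "(\<Sum>p\<in>P. hi p - lo p) = c - a"
          using additive_tagged_division_1[OF _ P(1), of "\<lambda>x. x"] c
          by (simp add: lo_def hi_def case_prod_unfold)
        have dis: "{lo p<..<hi p} \<inter> {lo q<..<hi q} = {}" if "p \<in> P" "q \<in> P" "p \<noteq> q" for p q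
        proof -
          have "interior (snd p) \<inter> interior (snd q) = {}"
            using tagged_division_ofD(5)[OF P(1), of "fst p" "snd p" "fst q" "snd q"] that
            by (metis prod.collapse)
          then show ?thesis using pk[OF that(1)] pk[OF that(2)] by (metis interior_atLeastAtMost_real)
        qed
        have "(\<Sum>p\<in>A. norm (F (hi p) - F (lo p))) < e/2"
        proof (rule d(2)[OF PAB(3)])
          show "a \<le> lo p \<and> lo p \<le> hi p \<and> hi p \<le> b" if "p \<in> A" for p
            using pk[of p] that c by (auto simp: A_def)
          show "disjoint_family_on (\<lambda>p. {lo p<..<hi p}) A"
            unfolding disjoint_family_on_def using dis by (auto simp: A_def)
          have "(\<Sum>p\<in>A. hi p - lo p) = (\<Sum>p\<in>A. measure lebesgue {lo p<..<hi p})"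
            using pk by (intro sum.cong) (fastforce simp: A_def)+
          also have "\<dots> = measure lebesgue (\<Union>p\<in>A. {lo p<..<hi p})"
          proof (rule measure_finite_Union[symmetric, OF PAB(3)])
            show "disjoint_family_on (\<lambda>p. {lo p<..<hi p}) A"
              using dis unfolding disjoint_family_on_def A_def by blast
            show "emeasure lebesgue {lo p<..<hi p} \<noteq> \<infinity>" if "p \<in> A" for p
              using pk[of p] that by (simp add: A_def)
          qed auto
          also have "\<dots> \<le> measure lebesgue U"
          proof (rule measure_mono_fmeasurable[OF _ _ U(3)])
            show "(\<Union>p\<in>A. {lo p<..<hi p}) \<subseteq> U"
            proof
              fix y assume "y \<in> (\<Union>p\<in>A. {lo p<..<hi p})"
              then obtain p where p: "p \<in> P" "fst p \<in> N'" "y \<in> {lo p<..<hi p}" by (auto simp: A_def)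
              then have "y \<in> \<gamma> (fst p)" using pk[OF p(1)] by force
              then show "y \<in> U" using s[OF p(2)] p(2) by (auto simp: \<gamma>_def)
            qed
          qed (use PAB in auto)
          finally show "(\<Sum>p\<in>A. hi p - lo p) < d" using U by simp
        qed
        moreover have "(\<Sum>p\<in>B. norm ((hi p - lo p) *\<^sub>R f (fst p) - (F (hi p) - F (lo p)))) \<le> e1 * (c - a)"
        proof -
          have "norm ((hi p - lo p) *\<^sub>R f (fst p) - (F (hi p) - F (lo p))) \<le> e1 * (hi p - lo p)" if "p \<in> B" for p
          proof -
            define x where "x = fst p"
            have p: "p \<in> P" "x \<notin> N'" using that by (auto simp: B_def x_def)
            note q = pk[OF p(1), folded x_def]
            have x: "x \<in> {a<..<b} - N'" using q p(2) c by (force simp: N'_def)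
            have "lo p \<in> \<gamma> x" "hi p \<in> \<gamma> x" using q by force+
            then have "norm (lo p - x) < t x" "norm (hi p - x) < t x"
              using x by (auto simp: \<gamma>_def dist_norm norm_minus_commute)
            then have 1: "norm (F (lo p) - F x - (lo p - x) *\<^sub>R f x) \<le> e1 * (x - lo p)"
              and 2: "norm (F (hi p) - F x - (hi p - x) *\<^sub>R f x) \<le> e1 * (hi p - x)"
              using t[OF x] q by (auto simp: abs_if split: if_splits)
            have "(hi p - lo p) *\<^sub>R f x - (F (hi p) - F (lo p)) =
               (F (lo p) - F x - (lo p - x) *\<^sub>R f x) - (F (hi p) - F x - (hi p - x) *\<^sub>R f x)"
              by (simp add: algebra_simps)
            then have "norm ((hi p - lo p) *\<^sub>R f x - (F (hi p) - F (lo p))) \<le> e1 * (x - lo p) + e1 * (hi p - x)"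
              using norm_triangle_ineq4 1 2 by (smt (verit, best))
            then show ?thesis by (simp add: x_def algebra_simps)
          qed
          then have "(\<Sum>p\<in>B. norm ((hi p - lo p) *\<^sub>R f (fst p) - (F (hi p) - F (lo p)))) \<le> (\<Sum>p\<in>B. e1 * (hi p - lo p))"
            by (rule sum_mono)
          also have "\<dots> \<le> (\<Sum>p\<in>P. e1 * (hi p - lo p))"
            by (rule sum_mono2[OF fin]) (use pk e1 in \<open>fastforce simp: B_def\<close>)+
          finally show ?thesis using len by (simp add: sum_distrib_left[symmetric])
        qed
        \<comment> \<open>The increments of \<open>F\<close> telescope to \<open>F c - F a\<close>,
          so the total error consists of the linearisation errors over \<open>B\<close> and the bare
          increments over \<open>A\<close>.\<close>
        moreover have EQ: "(\<Sum>(x, k)\<in>P. measure lborel k *\<^sub>R g x) - (F c - F a) =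
           (\<Sum>p\<in>B. (hi p - lo p) *\<^sub>R f (fst p) - (F (hi p) - F (lo p))) - (\<Sum>p\<in>A. F (hi p) - F (lo p))"
        proof -
          have ct: "measure lborel (snd p) = hi p - lo p" if "p \<in> P" for p
            using pk[OF that] by (metis content_real order_trans)
          have "(\<Sum>(x, k)\<in>P. measure lborel k *\<^sub>R g x) = (\<Sum>p\<in>P. measure lborel (snd p) *\<^sub>R g (fst p))"
            by (simp add: case_prod_unfold)
          also have "\<dots> = (\<Sum>p\<in>A. measure lborel (snd p) *\<^sub>R g (fst p)) + (\<Sum>p\<in>B. measure lborel (snd p) *\<^sub>R g (fst p))"
            using sum.union_disjoint[OF PAB(3,4,2), of "\<lambda>p. measure lborel (snd p) *\<^sub>R g (fst p)"] PAB(1) by simp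
          also have "(\<Sum>p\<in>A. measure lborel (snd p) *\<^sub>R g (fst p)) = 0"
            by (rule sum.neutral) (auto simp: A_def g_def)
          also have "(\<Sum>p\<in>B. measure lborel (snd p) *\<^sub>R g (fst p)) = (\<Sum>p\<in>B. (hi p - lo p) *\<^sub>R f (fst p))"
            by (rule sum.cong) (use ct in \<open>auto simp: B_def g_def\<close>)
          finally have 1: "(\<Sum>(x, k)\<in>P. measure lborel k *\<^sub>R g x) = (\<Sum>p\<in>B. (hi p - lo p) *\<^sub>R f (fst p))" by simp
          have "F c - F a = (\<Sum>p\<in>A. F (hi p) - F (lo p)) + (\<Sum>p\<in>B. F (hi p) - F (lo p))"
            using sum.union_disjoint[OF PAB(3,4,2), of "\<lambda>p. F (hi p) - F (lo p)"] PAB(1) telescope by simp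
          then show ?thesis unfolding 1 by (simp add: sum_subtractf)
        qed
        ultimately have "norm ((\<Sum>(x, k)\<in>P. measure lborel k *\<^sub>R g x) - (F c - F a)) < e1 * (c - a) + e/2"
          unfolding EQ using norm_triangle_ineq4[of "\<Sum>p\<in>B. (hi p - lo p) *\<^sub>R f (fst p) - (F (hi p) - F (lo p))" "\<Sum>p\<in>A. F (hi p) - F (lo p)"]
            norm_sum[of "\<lambda>p. (hi p - lo p) *\<^sub>R f (fst p) - (F (hi p) - F (lo p))" B]
            norm_sum[of "\<lambda>p. F (hi p) - F (lo p)" A] by linarith
        also have "e1 * (c - a) \<le> e1 * (c - a + 1)" using e1 by simp
        also have "e1 * (c - a + 1) = e/2" using c by (simp add: e1_def field_simps)
        finally show ?thesis by simp
      qed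
      show "\<exists>\<gamma>. gauge \<gamma> \<and> (\<forall>\<D>. \<D> tagged_division_of {a..c} \<and> \<gamma> fine \<D> \<longrightarrow>
          norm ((\<Sum>(x, k)\<in>\<D>. measure lborel k *\<^sub>R g x) - (F c - F a)) < e)"
        using G B by (intro exI[of _ \<gamma>] conjI allI impI) auto
    qed
    then show ?thesis
      by (rule has_integral_spike[OF N', rotated]) (auto simp: g_def)
  qed
  then show ?thesis using f by (simp add: ac_deriv_def)
qed

section \<open>Calculus of absolutely continuous functions and Gronwall's inequality\<close>

lemma ac_deriv_const: "ac_deriv a b (\<lambda>x. c) (\<lambda>x. 0)"
  by (simp add: ac_deriv_def)

lemma ac_deriv_C1:
  assumes "\<And>x. x \<in> {a..b} \<Longrightarrow> (F has_vector_derivative f x) (at x within {a..b})" "continuous_on {a..b} f"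
  shows "ac_deriv a b F f"
  unfolding ac_deriv_def
proof (intro conjI ballI)
  show "f absolutely_integrable_on {a..b}" by (rule absolutely_integrable_continuous_real[OF assms(2)])
  fix x assume "x \<in> {a..b}"
  then show "(f has_integral (F x - F a)) {a..x}"
    by (intro fundamental_theorem_of_calculus) (auto intro: has_vector_derivative_within_subset[OF assms(1)])
qed

lemma ac_deriv_linear:
  fixes F :: "real \<Rightarrow> 'b::euclidean_space" and h :: "'b \<Rightarrow> 'c::euclidean_space"
  assumes F: "ac_deriv a b F f" and h: "bounded_linear h"
  shows "ac_deriv a b (\<lambda>x. h (F x)) (\<lambda>x. h (f x))"
  unfolding ac_deriv_def
proof (intro conjI ballI)
  show "(\<lambda>x. h (f x)) absolutely_integrable_on {a..b}"
    using absolutely_integrable_linear[OF ac_deriv_abs_int[OF F] h] by (simp add: o_def)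
  fix x assume "x \<in> {a..b}"
  then show "((\<lambda>x. h (f x)) has_integral (h (F x) - h (F a))) {a..x}"
    using has_integral_linear[OF _ h, of f "F x - F a"] F
    by (auto simp: ac_deriv_def o_def linear_diff bounded_linear.linear[OF h])
qed

lemma ac_deriv_add:
  assumes "ac_deriv a b F f" "ac_deriv a b G g"
  shows "ac_deriv a b (\<lambda>x. F x + G x) (\<lambda>x. f x + g x)"
proof -
  have "((\<lambda>x. f x + g x) has_integral ((F x + G x) - (F a + G a))) {a..x}" if "x \<in> {a..b}" for x
  proof -
    have "((\<lambda>x. f x + g x) has_integral ((F x - F a) + (G x - G a))) {a..x}"
      using assms that by (intro has_integral_add) (auto simp: ac_deriv_def)
    then show ?thesis by (simp add: algebra_simps)
  qed
  then show ?thesis using assms by (auto simp: ac_deriv_def intro: set_integral_add(1))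
qed

lemma ac_deriv_minus: "ac_deriv a b F f \<Longrightarrow> ac_deriv a b (\<lambda>x. - F x) (\<lambda>x. - f x)"
  by (rule ac_deriv_linear[OF _ bounded_linear_minus[OF bounded_linear_ident]])

lemma ac_deriv_diff:
  assumes "ac_deriv a b F f" "ac_deriv a b G g"
  shows "ac_deriv a b (\<lambda>x. F x - G x) (\<lambda>x. f x - g x)"
  using ac_deriv_add[OF assms(1) ac_deriv_minus[OF assms(2)]] by simp

lemma ac_deriv_sum:
  assumes "\<And>i. i \<in> I \<Longrightarrow> ac_deriv a b (F i) (f i)"
  shows "ac_deriv a b (\<lambda>x. \<Sum>i\<in>I. F i x) (\<lambda>x. \<Sum>i\<in>I. f i x)"
  using assms by (induction I rule: infinite_finite_induct) (auto simp: ac_deriv_const intro: ac_deriv_add)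

lemma ac_deriv_Pair:
  assumes "ac_deriv a b F f" "ac_deriv a b G g"
  shows "ac_deriv a b (\<lambda>x. (F x, G x)) (\<lambda>x. (f x, g x))"
proof -
  have "bounded_linear (\<lambda>x. (x, 0))" "bounded_linear (\<lambda>x. (0, x))"
    by (auto intro: bounded_linear_Pair bounded_linear_ident bounded_linear_zero)
  from ac_deriv_add[OF ac_deriv_linear[OF assms(1) this(1)] ac_deriv_linear[OF assms(2) this(2)]]
  show ?thesis by simp
qed

lemma continuous_times_absolutely_integrable:
  fixes h :: "'b::euclidean_space \<Rightarrow> 'c::euclidean_space \<Rightarrow> 'd::euclidean_space"
  assumes h: "bounded_bilinear h" and F: "continuous_on {a..b} F" and g: "g absolutely_integrable_on {a..b::real}"
  shows "(\<lambda>x. h (F x) (g x)) absolutely_integrable_on {a..b}"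
proof (rule absolutely_integrable_bounded_measurable_product[OF h[folded bilinear_conv_bounded_bilinear]])
  show "F \<in> borel_measurable (lebesgue_on {a..b})"
    by (rule continuous_imp_measurable_on_sets_lebesgue[OF F]) auto
  show "bounded (F ` {a..b})" by (rule compact_imp_bounded[OF compact_continuous_image[OF F]]) auto
qed (use g in auto)

lemma abs_cont_on_bilinear:
  fixes h :: "'b::real_normed_vector \<Rightarrow> 'c::real_normed_vector \<Rightarrow> 'd::real_normed_vector"
  assumes h: "bounded_bilinear h" and F: "abs_cont_on a b F" and G: "abs_cont_on a b G"
  shows "abs_cont_on a b (\<lambda>x. h (F x) (G x))"
proof -
  interpret bounded_bilinear h by (rule h)
  obtain K where K: "K > 0" "\<And>u v. norm (h u v) \<le> norm u * norm v * K" using pos_bounded by blast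
  have "bounded (F ` {a..b})" "bounded (G ` {a..b})"
    by (intro compact_imp_bounded compact_continuous_image abs_cont_on_continuous F G; simp)+
  then obtain m1 m2 where m: "\<And>x. x \<in> {a..b} \<Longrightarrow> norm (F x) \<le> m1" "\<And>x. x \<in> {a..b} \<Longrightarrow> norm (G x) \<le> m2"
    unfolding bounded_iff by (metis imageI)
  define M where "M = max 0 (max m1 m2)"
  have M: "M \<ge> 0" "\<And>x. x \<in> {a..b} \<Longrightarrow> norm (F x) \<le> M" "\<And>x. x \<in> {a..b} \<Longrightarrow> norm (G x) \<le> M"
    using m by (fastforce simp: M_def)+
  show ?thesis
  proof (rule abs_cont_on_lipschitz2[OF F G, of "K * M"])
    show "0 \<le> K * M" using K M by simp
    fix x y assume xy: "x \<in> {a..b}" "y \<in> {a..b}"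
    have "h (F x) (G x) - h (F y) (G y) = h (F x - F y) (G x) + h (F y) (G x - G y)"
      by (simp add: diff_left diff_right)
    then have "norm (h (F x) (G x) - h (F y) (G y)) \<le> norm (h (F x - F y) (G x)) + norm (h (F y) (G x - G y))"
      by (metis norm_triangle_ineq)
    also have "\<dots> \<le> norm (F x - F y) * norm (G x) * K + norm (F y) * norm (G x - G y) * K"
      by (intro add_mono K)
    also have "\<dots> \<le> norm (F x - F y) * M * K + M * norm (G x - G y) * K"
      using xy M K by (intro add_mono mult_right_mono mult_left_mono mult_nonneg_nonneg) auto
    finally show "norm (h (F x) (G x) - h (F y) (G y)) \<le> K * M * (norm (F x - F y) + norm (G x - G y))"
      by (simp add: algebra_simps)
  qed
qed

text \<open>The product rule holds almost everywhere by \<open>ac_deriv_differentiable\<close>, the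
  product is absolutely continuous in the epsilon-delta sense, and \<open>ac_derivI\<close>
  recombines the two facts. Green's identity and the energy identity of the wave equation both rest
  on this integrated form.\<close>

lemma ac_deriv_bilinear:
  fixes h :: "'b::euclidean_space \<Rightarrow> 'c::euclidean_space \<Rightarrow> 'd::euclidean_space"
  assumes h: "bounded_bilinear h" and F: "ac_deriv a b F f" and G: "ac_deriv a b G g"
  shows "ac_deriv a b (\<lambda>x. h (F x) (G x)) (\<lambda>x. h (f x) (G x) + h (F x) (g x))"
proof -
  obtain N where N: "negligible N" "\<And>x. x \<in> {a<..<b} - N \<Longrightarrow> (F has_vector_derivative f x) (at x)"
    using ac_deriv_differentiable[OF F] by blast
  obtain N' where N': "negligible N'" "\<And>x. x \<in> {a<..<b} - N' \<Longrightarrow> (G has_vector_derivative g x) (at x)"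
    using ac_deriv_differentiable[OF G] by blast
  show ?thesis
  proof (rule ac_derivI[of _ _ _ "N \<union> N'"])
    show "abs_cont_on a b (\<lambda>x. h (F x) (G x))"
      by (intro abs_cont_on_bilinear[OF h] ac_deriv_abs_cont_on[OF F] ac_deriv_abs_cont_on[OF G])
    show "((\<lambda>x. h (F x) (G x)) has_vector_derivative h (f x) (G x) + h (F x) (g x)) (at x)"
      if "x \<in> {a<..<b} - (N \<union> N')" for x
      using bounded_bilinear.has_vector_derivative[OF h N(2) N'(2), of x] that by (simp add: add.commute)
    show "(\<lambda>x. h (f x) (G x) + h (F x) (g x)) absolutely_integrable_on {a..b}"
      using continuous_times_absolutely_integrable[OF h ac_deriv_continuous_on[OF F] ac_deriv_abs_int[OF G]]
        continuous_times_absolutely_integrable[OF bounded_bilinear.flip[OF h] ac_deriv_continuous_on[OF G] ac_deriv_abs_int[OF F]]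
      by (rule set_integral_add(1)[rotated])
  qed (use N N' in auto)
qed

text \<open>The range of \<open>F\<close> is bounded and \<open>h\<close> is Lipschitz on bounded
  intervals, so the composition stays absolutely continuous.\<close>

lemma ac_deriv_compose:
  fixes F :: "real \<Rightarrow> real" and h :: "real \<Rightarrow> real"
  assumes F: "ac_deriv a b F f" and h: "\<And>y. (h has_real_derivative h' y) (at y)" "continuous_on UNIV h'"
  shows "ac_deriv a b (\<lambda>x. h (F x)) (\<lambda>x. h' (F x) * f x)"
proof -
  have cF: "continuous_on {a..b} F" by (rule ac_deriv_continuous_on[OF F])
  have "bounded (F ` {a..b})" by (rule compact_imp_bounded[OF compact_continuous_image[OF cF]]) simp
  then obtain R where "\<forall>y\<in>F ` {a..b}. norm y \<le> R" unfolding bounded_iff by blast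
  then have R: "\<And>x. x \<in> {a..b} \<Longrightarrow> \<bar>F x\<bar> \<le> R" by auto
  have "bounded (h' ` {-R..R})"
    by (rule compact_imp_bounded[OF compact_continuous_image]) (auto intro: continuous_on_subset[OF h(2)])
  then obtain M0 where "\<forall>y\<in>h' ` {-R..R}. norm y \<le> M0" unfolding bounded_iff by blast
  then have M0: "\<And>y. y \<in> {-R..R} \<Longrightarrow> \<bar>h' y\<bar> \<le> M0" by auto
  define M where "M = max 0 M0"
  have lip: "\<bar>h y - h z\<bar> \<le> M * \<bar>y - z\<bar>" if "y \<in> {-R..R}" "z \<in> {-R..R}" for y z
    using field_differentiable_bound[of "{-R..R}" h h' M y z] that M0 h(1)
    by (fastforce simp: M_def intro: has_field_derivative_at_within)
  obtain N where N: "negligible N" "\<And>x. x \<in> {a<..<b} - N \<Longrightarrow> (F has_vector_derivative f x) (at x)"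
    using ac_deriv_differentiable[OF F] by blast
  show ?thesis
  proof (rule ac_derivI[OF _ N(1)])
    show "abs_cont_on a b (\<lambda>x. h (F x))"
    proof (rule abs_cont_on_lipschitz2[OF ac_deriv_abs_cont_on[OF F] ac_deriv_abs_cont_on[OF F], of M])
      fix x y assume "x \<in> {a..b}" "y \<in> {a..b}"
      then have "\<bar>h (F x) - h (F y)\<bar> \<le> M * \<bar>F x - F y\<bar>" using R by (intro lip) (auto simp: abs_le_iff minus_le_iff)
      moreover have "0 \<le> M * \<bar>F x - F y\<bar>" by (simp add: M_def)
      ultimately show "norm (h (F x) - h (F y)) \<le> M * (norm (F x - F y) + norm (F x - F y))"
        by (simp add: algebra_simps)
    qed (simp add: M_def)
    show "((\<lambda>x. h (F x)) has_vector_derivative h' (F x) * f x) (at x)" if "x \<in> {a<..<b} - N" for x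
      using DERIV_chain2[OF h(1), of F "f x" x UNIV] N(2)[OF that]
      by (simp add: has_real_derivative_iff_has_vector_derivative)
    show "(\<lambda>x. h' (F x) * f x) absolutely_integrable_on {a..b}"
      by (rule continuous_times_absolutely_integrable[OF bounded_bilinear_mult _ ac_deriv_abs_int[OF F]])
         (rule continuous_on_compose2[OF h(2) cF], auto)
  qed
qed

text \<open>This covers Gronwall's inequality (\<open>m = 0\<close>), and it also bounds the dissipation \<open>m\<close>.\<close>

lemma ac_deriv_gronwall:
  fixes e :: "real \<Rightarrow> real"
  assumes e: "ac_deriv a b e e'" and k: "k absolutely_integrable_on {a..b}" "\<And>x. x \<in> {a..b} \<Longrightarrow> 0 \<le> k x"
    and m: "m absolutely_integrable_on {a..b}" "\<And>x. x \<in> {a..b} \<Longrightarrow> 0 \<le> m x"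
    and N: "negligible N" "\<And>x. x \<in> {a..b} - N \<Longrightarrow> e' x \<le> k x * e x - m x" and "a \<le> b" "e b \<ge> 0"
  shows "e b + integral {a..b} m \<le> e a * exp (integral {a..b} k)"
proof -
  define \<kappa> where "\<kappa> = (\<lambda>x. integral {a..x} k)"
  have \<kappa>: "ac_deriv a b \<kappa> k" using ac_deriv_indefinite_integral[OF k(1), of 0] by (simp add: \<kappa>_def)
  \<comment> \<open>The integrating factor. Off \<open>N\<close> the derivative of
    \<open>e x * exp (- \<kappa> x)\<close> is at most \<open>- exp (- \<kappa> x) * m x\<close>; as
    \<open>m\<close> is nonnegative and \<open>\<kappa>\<close> is largest at \<open>b\<close>, this
    is at most \<open>- exp (- \<kappa> b) * m x\<close>.\<close>
  have E: "ac_deriv a b (\<lambda>x. exp (- \<kappa> x)) (\<lambda>x. exp (- \<kappa> x) * - k x)"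
    by (rule ac_deriv_compose[OF ac_deriv_minus[OF \<kappa>], where h = exp and h' = exp])
       (auto intro: derivative_eq_intros continuous_intros)
  note P = ac_deriv_bilinear[OF bounded_bilinear_mult e E]
  have \<kappa>b: "\<kappa> x \<le> \<kappa> b" if "x \<in> {a..b}" for x
    unfolding \<kappa>_def using that k set_lebesgue_integral_eq_integral(1)[OF k(1)]
    by (intro integral_subset_le) (auto intro: integrable_subinterval_real)
  have ka: "\<kappa> a = 0" by (simp add: \<kappa>_def)
  have 1: "((\<lambda>x. e' x * exp (- \<kappa> x) + e x * (exp (- \<kappa> x) * - k x)) has_integral
       (e b * exp (- \<kappa> b) - e a * exp (- \<kappa> a))) {a..b}"
    using P \<open>a \<le> b\<close> by (auto simp: ac_deriv_def)
  have mi: "m integrable_on {a..b}" using m(1) by (rule set_lebesgue_integral_eq_integral(1))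
  have 2: "((\<lambda>x. - exp (- \<kappa> b) * m x) has_integral (- exp (- \<kappa> b) * integral {a..b} m)) {a..b}"
    by (rule has_integral_mult_right[OF integrable_integral[OF mi]])
  have "e b * exp (- \<kappa> b) - e a * exp (- \<kappa> a) \<le> - exp (- \<kappa> b) * integral {a..b} m"
  proof (rule has_integral_le)
    show "((\<lambda>x. if x \<in> N then - exp (- \<kappa> b) * m x else e' x * exp (- \<kappa> x) + e x * (exp (- \<kappa> x) * - k x)) has_integral
       (e b * exp (- \<kappa> b) - e a * exp (- \<kappa> a))) {a..b}"
      by (rule has_integral_spike[OF N(1) _ 1]) auto
    show "((\<lambda>x. - exp (- \<kappa> b) * m x) has_integral (- exp (- \<kappa> b) * integral {a..b} m)) {a..b}" by (rule 2)
    fix x assume x: "x \<in> {a..b}"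
    have "e' x * exp (- \<kappa> x) + e x * (exp (- \<kappa> x) * - k x) \<le> - exp (- \<kappa> b) * m x" if "x \<notin> N"
    proof -
      have "e' x * exp (- \<kappa> x) + e x * (exp (- \<kappa> x) * - k x) = exp (- \<kappa> x) * (e' x - k x * e x)"
        by (simp add: algebra_simps)
      also have "\<dots> \<le> exp (- \<kappa> x) * (- m x)"
        using N(2)[of x] x that by (intro mult_left_mono) auto
      also have "\<dots> \<le> exp (- \<kappa> b) * (- m x)"
        using m(2)[OF x] \<kappa>b[OF x] by (intro mult_right_mono_neg) auto
      finally show ?thesis by simp
    qed
    then show "(if x \<in> N then - exp (- \<kappa> b) * m x else e' x * exp (- \<kappa> x) + e x * (exp (- \<kappa> x) * - k x)) \<le> - exp (- \<kappa> b) * m x"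
      by auto
  qed
  then have "exp (- \<kappa> b) * (e b + integral {a..b} m) \<le> e a" by (simp add: ka algebra_simps)
  then have "exp (\<kappa> b) * (exp (- \<kappa> b) * (e b + integral {a..b} m)) \<le> exp (\<kappa> b) * e a"
    by (intro mult_left_mono) auto
  then show ?thesis by (simp add: \<kappa>_def mult.assoc[symmetric] exp_add[symmetric] mult.commute)
qed

text \<open>The norm of \<open>W\<close> need not be differentiable where \<open>W\<close> vanishes,
  so Gronwall's inequality is applied to the majorant \<open>e\<close>, the right-hand side of the
  integrated inequality.\<close>

lemma ac_deriv_norm_le:
  fixes W :: "real \<Rightarrow> 'e::euclidean_space"
  assumes W: "ac_deriv a b W w" and k: "k absolutely_integrable_on {a..b}" "\<And>x. x \<in> {a..b} \<Longrightarrow> 0 \<le> k x"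
    and m: "m absolutely_integrable_on {a..b}" "\<And>x. x \<in> {a..b} \<Longrightarrow> 0 \<le> m x"
    and N: "negligible N" "\<And>x. x \<in> {a..b} - N \<Longrightarrow> norm (w x) \<le> k x * norm (W x) + m x"
    and x: "x \<in> {a..b}"
  shows "norm (W x) \<le> (norm (W a) + integral {a..b} m) * exp (integral {a..b} k)"
proof -
  have cW: "continuous_on {a..b} (\<lambda>x. norm (W x))"
    using ac_deriv_continuous_on[OF W] by (rule continuous_on_norm)
  have kW: "(\<lambda>x. k x * norm (W x)) absolutely_integrable_on {a..b}"
    using continuous_times_absolutely_integrable[OF bounded_bilinear_mult cW k(1)] by (simp add: mult.commute)
  define e where "e = (\<lambda>x. (norm (W a) + integral {a..b} m) + integral {a..x} (\<lambda>x. k x * norm (W x)))"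
  have e: "ac_deriv a b e (\<lambda>x. k x * norm (W x))"
    unfolding e_def by (rule ac_deriv_indefinite_integral[OF kW])
  have mi: "m integrable_on {a..b}" using m(1) by (rule set_lebesgue_integral_eq_integral(1))
  have le: "norm (W y) \<le> e y" if y: "y \<in> {a..b}" for y
  proof -
    have sub: "{a..y} \<subseteq> {a..b}" using y by auto
    have wi: "(w has_integral (W y - W a)) {a..y}" using W y by (auto simp: ac_deriv_def)
    have my: "m integrable_on {a..y}" by (rule integrable_subinterval_real[OF mi sub])
    have ky: "(\<lambda>x. k x * norm (W x)) integrable_on {a..y}"
      by (rule integrable_subinterval_real[OF set_lebesgue_integral_eq_integral(1)[OF kW] sub])
    have "((\<lambda>x. if x \<in> N then 0 else w x) has_integral (W y - W a)) {a..y}"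
      by (rule has_integral_spike[OF N(1) _ wi]) auto
    then have "norm (W y - W a) \<le> integral {a..y} (\<lambda>x. k x * norm (W x) + m x)"
    proof -
      assume H: "((\<lambda>x. if x \<in> N then 0 else w x) has_integral (W y - W a)) {a..y}"
      have "norm (integral {a..y} (\<lambda>x. if x \<in> N then 0 else w x)) \<le> integral {a..y} (\<lambda>x. k x * norm (W x) + m x)"
        by (rule integral_norm_bound_integral)
           (use H N(2) sub k(2) m(2) in \<open>auto intro!: integrable_add ky my add_nonneg_nonneg simp: subset_iff\<close>)
      then show ?thesis using integral_unique[OF H] by simp
    qed
    also have "\<dots> = integral {a..y} (\<lambda>x. k x * norm (W x)) + integral {a..y} m"
      by (rule integral_add[OF ky my])
    also have "integral {a..y} m \<le> integral {a..b} m"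
      by (rule integral_subset_le[OF sub my mi]) (use m in auto)
    finally show ?thesis using norm_triangle_sub[of "W y" "W a"] by (simp add: e_def)
  qed
  have "e x + integral {a..x} (\<lambda>x. 0) \<le> e a * exp (integral {a..x} k)"
  proof (rule ac_deriv_gronwall[where N = "{}"])
    have sub: "{a..x} \<subseteq> {a..b}" using x by auto
    show "ac_deriv a x e (\<lambda>x. k x * norm (W x))" by (rule ac_deriv_subinterval[OF e]) (use x in auto)
    show "k absolutely_integrable_on {a..x}" by (rule absolutely_integrable_on_subinterval[OF k(1) sub])
    show "0 \<le> e x" by (rule order_trans[OF norm_ge_zero le[OF x]])
    show "k y * norm (W y) \<le> k y * e y - 0" if "y \<in> {a..x} - {}" for y
      using le[of y] k(2)[of y] that x by (auto intro: mult_left_mono)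
  qed (use x k in auto)
  also have "e a * exp (integral {a..x} k) \<le> e a * exp (integral {a..b} k)"
  proof (intro mult_left_mono)
    have sub: "{a..x} \<subseteq> {a..b}" using x by auto
    have "integral {a..x} k \<le> integral {a..b} k"
      using set_lebesgue_integral_eq_integral(1)[OF k(1)] k(2) sub
      by (intro integral_subset_le) (auto intro: integrable_subinterval_real)
    then show "exp (integral {a..x} k) \<le> exp (integral {a..b} k)" by simp
    show "0 \<le> e a" by (rule order_trans[OF norm_ge_zero le]) (use x in auto)
  qed
  finally show ?thesis using le[OF x] by (simp add: e_def)
qed

section \<open>Linear systems with integrable coefficients\<close>

text \<open>The system \<open>w' = A x w\<close> with an integrable bound \<open>k\<close> of the
  operator norm. The last clause takes the place of measurability of \<open>A\<close> as an
  operator-valued function.\<close>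

definition linear_field :: "real \<Rightarrow> real \<Rightarrow> (real \<Rightarrow> 'e::euclidean_space \<Rightarrow> 'e) \<Rightarrow> (real \<Rightarrow> real) \<Rightarrow> bool" where
  "linear_field a b A k \<longleftrightarrow> k absolutely_integrable_on {a..b} \<and>
     (\<forall>x\<in>{a..b}. linear (A x) \<and> 0 \<le> k x \<and> (\<forall>w. norm (A x w) \<le> k x * norm w)) \<and>
     (\<forall>w. continuous_on {a..b} w \<longrightarrow> (\<lambda>x. A x (w x)) absolutely_integrable_on {a..b})"

text \<open>Picard iteration. As \<open>k\<close> may be unbounded, the usual powers of
  \<open>x - a\<close> over factorials are replaced by powers of its primitive
  \<open>\<alpha>\<close>, which still gives a summable majorant.\<close>

lemma linear_ode_exists:
  fixes A :: "real \<Rightarrow> 'e::euclidean_space \<Rightarrow> 'e"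
  assumes A: "linear_field a b A k" and h: "h absolutely_integrable_on {a..b}" and ab: "a \<le> b"
  obtains W where "ac_deriv a b W (\<lambda>x. A x (W x) + h x)" "W a = w0"
proof -
  have k: "k absolutely_integrable_on {a..b}" "\<And>x. x \<in> {a..b} \<Longrightarrow> 0 \<le> k x"
    and lin: "\<And>x. x \<in> {a..b} \<Longrightarrow> linear (A x)"
    and bd: "\<And>x w. x \<in> {a..b} \<Longrightarrow> norm (A x w) \<le> k x * norm w"
    and AI: "\<And>w. continuous_on {a..b} w \<Longrightarrow> (\<lambda>x. A x (w x)) absolutely_integrable_on {a..b}"
    using A by (auto simp: linear_field_def)
  have ki: "k integrable_on {a..b}" by (rule set_lebesgue_integral_eq_integral(1)[OF k(1)])
  define \<alpha> where "\<alpha> = (\<lambda>x. integral {a..x} k)"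
  have \<alpha>: "ac_deriv a b \<alpha> k" using ac_deriv_indefinite_integral[OF k(1), of 0] by (simp add: \<alpha>_def)
  have \<alpha>0: "0 \<le> \<alpha> x" "\<alpha> x \<le> \<alpha> b" if "x \<in> {a..b}" for x
    unfolding \<alpha>_def using that k(2) ki
    by (auto intro!: integral_nonneg integral_subset_le intro: integrable_subinterval_real)
  \<comment> \<open>The \<open>V n\<close> are the successive increments rather than the iterates;
    the solution is their sum \<open>W\<close>.\<close>
  define V where "V = rec_nat (\<lambda>x. w0 + integral {a..x} h) (\<lambda>n v x. integral {a..x} (\<lambda>t. A t (v t)))"
  have V0: "V 0 = (\<lambda>x. w0 + integral {a..x} h)" and VS: "\<And>n. V (Suc n) = (\<lambda>x. 0 + integral {a..x} (\<lambda>t. A t (V n t)))"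
    by (auto simp: V_def)
  have d0: "ac_deriv a b (V 0) h" unfolding V0 by (rule ac_deriv_indefinite_integral[OF h])
  have cV: "continuous_on {a..b} (V n)" for n
  proof (induction n)
    case 0 show ?case by (rule ac_deriv_continuous_on[OF d0])
  next
    case (Suc n) show ?case
      unfolding VS by (rule ac_deriv_continuous_on[OF ac_deriv_indefinite_integral[OF AI[OF Suc]]])
  qed
  have dS: "ac_deriv a b (V (Suc n)) (\<lambda>x. A x (V n x))" for n
    unfolding VS by (rule ac_deriv_indefinite_integral[OF AI[OF cV]])
  have "bounded (V 0 ` {a..b})" by (intro compact_imp_bounded compact_continuous_image cV) simp
  then obtain C where "\<forall>y\<in>V 0 ` {a..b}. norm y \<le> C" unfolding bounded_iff by blast
  then have C: "\<And>x. x \<in> {a..b} \<Longrightarrow> norm (V 0 x) \<le> C" by auto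
  have C0: "0 \<le> C" using order_trans[OF norm_ge_zero C[of a]] ab by simp
  have Vb: "norm (V n x) \<le> C * (\<alpha> x ^ n / fact n)" if "x \<in> {a..b}" for n x
    using that
  proof (induction n arbitrary: x)
    case 0 then show ?case using C by simp
  next
    case (Suc n)
    have p: "ac_deriv a b (\<lambda>x. \<alpha> x ^ Suc n / fact (Suc n)) (\<lambda>x. \<alpha> x ^ n / fact n * k x)"
      by (rule ac_deriv_compose[OF \<alpha>, where h = "\<lambda>y. y ^ Suc n / fact (Suc n)" and h' = "\<lambda>y. y ^ n / fact n"])
         (auto intro!: continuous_intros DERIV_cong[OF DERIV_cdivide[OF DERIV_pow[of "Suc n"]]] simp del: of_nat_Suc power_Suc)
    have q: "((\<lambda>x. C * (\<alpha> x ^ n / fact n * k x)) has_integral C * (\<alpha> x ^ Suc n / fact (Suc n))) {a..x}"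
      using ac_deriv_integral[OF p, of a x] Suc.prems by (intro has_integral_mult_right) (auto simp: \<alpha>_def)
    have i: "((\<lambda>t. A t (V n t)) has_integral V (Suc n) x) {a..x}"
      using ac_deriv_integral[OF dS[of n], of a x] Suc.prems by (simp add: VS)
    have "norm (integral {a..x} (\<lambda>t. A t (V n t))) \<le> integral {a..x} (\<lambda>x. C * (\<alpha> x ^ n / fact n * k x))"
    proof (rule integral_norm_bound_integral)
      fix t assume t: "t \<in> {a..x}"
      then have t': "t \<in> {a..b}" using Suc.prems by auto
      have "norm (A t (V n t)) \<le> k t * norm (V n t)" by (rule bd[OF t'])
      also have "\<dots> \<le> k t * (C * (\<alpha> t ^ n / fact n))" by (intro mult_left_mono Suc.IH t' k)
      finally show "norm (A t (V n t)) \<le> C * (\<alpha> t ^ n / fact n * k t)" by (simp add: algebra_simps)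
    qed (use i q in auto)
    then show ?case using integral_unique[OF q] integral_unique[OF i] by simp
  qed
  define M where "M = (\<lambda>n. C * (\<alpha> b ^ n / fact n))"
  have VM: "norm (V n x) \<le> M n" if "x \<in> {a..b}" for n x
  proof -
    have "norm (V n x) \<le> C * (\<alpha> x ^ n / fact n)" by (rule Vb[OF that])
    also have "\<dots> \<le> M n" unfolding M_def
      by (intro mult_left_mono divide_right_mono power_mono \<alpha>0 that C0) auto
    finally show ?thesis .
  qed
  have "summable M" unfolding M_def
    using summable_mult[OF summable_exp[of "\<alpha> b"], of C] by (simp add: field_simps)
  define W where "W = (\<lambda>x. \<Sum>n. V n x)"
  have lim: "uniform_limit {a..b} (\<lambda>n x. \<Sum>i<n. V i x) W sequentially"
    unfolding W_def by (rule Weierstrass_m_test[OF VM \<open>summable M\<close>])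
  have cW: "continuous_on {a..b} W"
    by (rule uniform_limit_theorem[OF _ lim]) (auto intro!: always_eventually continuous_intros cV)
  have dW: "W x = V 0 x + integral {a..x} (\<lambda>t. A t (W t))" if x: "x \<in> {a..b}" for x
  proof -
    have AW: "(\<lambda>t. A t (W t)) integrable_on {a..x}"
      by (rule integrable_subinterval_real[OF set_lebesgue_integral_eq_integral(1)[OF AI[OF cW]]]) (use x in auto)
    have kx: "k integrable_on {a..x}" by (rule integrable_subinterval_real[OF ki]) (use x in auto)
    \<comment> \<open>Uniform convergence of the partial sums, weighted with the integrable
      \<open>k\<close>, allows the limit under the integral.\<close>
    have P: "(\<lambda>n. \<Sum>i<n. V (Suc i) x) \<longlonglongrightarrow> integral {a..x} (\<lambda>t. A t (W t))"
      unfolding tendsto_iff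
    proof (intro allI impI)
      fix e :: real assume "e > 0"
      define e' where "e' = e / (2 * (\<alpha> x + 1))"
      have e': "e' > 0" using \<open>e > 0\<close> \<alpha>0(1)[OF x] by (auto simp: e'_def)
      have "\<forall>\<^sub>F n in sequentially. \<forall>t\<in>{a..b}. dist (\<Sum>i<n. V i t) (W t) < e'"
        using lim e' by (auto simp: uniform_limit_iff)
      then show "\<forall>\<^sub>F n in sequentially. dist (\<Sum>i<n. V (Suc i) x) (integral {a..x} (\<lambda>t. A t (W t))) < e"
      proof eventually_elim
        case (elim n)
        have i: "((\<lambda>t. \<Sum>i<n. A t (V i t)) has_integral (\<Sum>i<n. V (Suc i) x)) {a..x}"
          by (intro has_integral_sum) (use ac_deriv_integral[OF dS, of a x] x in \<open>auto simp: VS\<close>)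
        have i2: "((\<lambda>t. (\<Sum>i<n. A t (V i t)) - A t (W t)) has_integral
             ((\<Sum>i<n. V (Suc i) x) - integral {a..x} (\<lambda>t. A t (W t)))) {a..x}"
          by (rule has_integral_diff[OF i integrable_integral[OF AW]])
        have "norm (integral {a..x} (\<lambda>t. (\<Sum>i<n. A t (V i t)) - A t (W t))) \<le> integral {a..x} (\<lambda>t. e' * k t)"
        proof (rule integral_norm_bound_integral)
          fix t assume "t \<in> {a..x}"
          then have t: "t \<in> {a..b}" using x by auto
          have "(\<Sum>i<n. A t (V i t)) - A t (W t) = A t ((\<Sum>i<n. V i t) - W t)"
            by (simp add: linear_diff[OF lin[OF t]] linear_sum[OF lin[OF t]])
          then have "norm ((\<Sum>i<n. A t (V i t)) - A t (W t)) \<le> k t * norm ((\<Sum>i<n. V i t) - W t)"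
            using bd[OF t] by simp
          also have "\<dots> \<le> k t * e'" using elim t k(2)[OF t] by (intro mult_left_mono) (auto simp: dist_norm less_imp_le)
          finally show "norm ((\<Sum>i<n. A t (V i t)) - A t (W t)) \<le> e' * k t" by (simp add: mult.commute)
        qed (use i2 kx in \<open>auto intro: integrable_on_mult_right\<close>)
        also have "\<dots> = e' * \<alpha> x" by (simp add: \<alpha>_def)
        also have "\<dots> < e"
        proof -
          have "2 * (\<alpha> x + 1) \<noteq> 0" using \<alpha>0(1)[OF x] by simp
          then have "e' * (2 * (\<alpha> x + 1)) = e" by (simp add: e'_def)
          moreover have "e' * \<alpha> x \<ge> 0" using e' \<alpha>0(1)[OF x] by simp
          ultimately show ?thesis using e' by (simp add: algebra_simps)
        qed
        finally show ?case using integral_unique[OF i2] by (simp add: dist_norm)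
      qed
    qed
    have "(\<lambda>n. \<Sum>i<Suc n. V i x) \<longlonglongrightarrow> V 0 x + integral {a..x} (\<lambda>t. A t (W t))"
      unfolding sum.lessThan_Suc_shift by (intro tendsto_add tendsto_const P)
    moreover have "(\<lambda>n. \<Sum>i<n. V i x) \<longlonglongrightarrow> W x"
      using tendsto_uniform_limitI[OF lim x] .
    ultimately show ?thesis using LIMSEQ_Suc LIMSEQ_unique by blast
  qed
  have "ac_deriv a b (\<lambda>x. 0 + integral {a..x} (\<lambda>t. A t (W t))) (\<lambda>x. A x (W x))"
    by (rule ac_deriv_indefinite_integral[OF AI[OF cW]])
  from ac_deriv_add[OF this d0] have "ac_deriv a b W (\<lambda>x. A x (W x) + h x)"
    by (rule ac_deriv_cong[where N = "{}"]) (use dW in \<open>auto simp: add.commute\<close>)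
  moreover have "W a = w0" using dW[of a] ab by (simp add: V0)
  ultimately show thesis by (rule that)
qed

lemma linear_ode_norm_le:
  fixes A :: "real \<Rightarrow> 'e::euclidean_space \<Rightarrow> 'e"
  assumes A: "linear_field a b A k" and h: "h absolutely_integrable_on {a..b}"
    and W: "ac_deriv a b W (\<lambda>x. A x (W x) + h x)" and x: "x \<in> {a..b}"
  shows "norm (W x) \<le> (norm (W a) + integral {a..b} (\<lambda>x. norm (h x))) * exp (integral {a..b} k)"
proof (rule ac_deriv_norm_le[OF W _ _ _ _ _ _ x, where N = "{}"])
  show "(\<lambda>x. norm (h x)) absolutely_integrable_on {a..b}"
    by (rule absolutely_integrable_norm[OF h, unfolded o_def])
  fix x assume "x \<in> {a..b} - {}"
  then have "norm (A x (W x)) \<le> k x * norm (W x)" using A by (auto simp: linear_field_def)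
  then show "norm (A x (W x) + h x) \<le> k x * norm (W x) + norm (h x)"
    using norm_triangle_ineq[of "A x (W x)" "h x"] by linarith
qed (use A in \<open>auto simp: linear_field_def\<close>)

lemma linear_ode_unique:
  fixes A :: "real \<Rightarrow> 'e::euclidean_space \<Rightarrow> 'e"
  assumes A: "linear_field a b A k"
    and W: "ac_deriv a b W (\<lambda>x. A x (W x) + h x)" and U: "ac_deriv a b U (\<lambda>x. A x (U x) + h x)"
    and a: "W a = U a" and x: "x \<in> {a..b}"
  shows "W x = U x"
proof -
  have "ac_deriv a b (\<lambda>x. W x - U x) (\<lambda>x. A x (W x - U x) + 0)"
    by (rule ac_deriv_cong[OF ac_deriv_diff[OF W U], where N = "{}"])
       (use A in \<open>auto simp: linear_field_def linear_diff\<close>)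
  from linear_ode_norm_le[OF A _ this x] show ?thesis using a by simp
qed

section \<open>Hermitian inner products\<close>

lemma norm_scalar_vec: "norm (c *s (v::complex^'n)) = cmod c * norm v"
  by (simp add: norm_vec_def norm_mult L2_set_right_distrib)

lemma norm_matrix_vector_le: "norm (A *v (v::complex^'n)) \<le> norm (A::complex^'n^'m) * norm v"
proof -
  have "cmod ((A *v v) $ i) \<le> norm (A $ i) * norm v" for i
  proof -
    have "cmod ((A *v v) $ i) \<le> (\<Sum>j\<in>UNIV. cmod (A $ i $ j) * cmod (v $ j))"
      unfolding matrix_vector_mult_def by (simp add: norm_mult[symmetric] norm_sum)
    also have "\<dots> \<le> L2_set (\<lambda>j. cmod (A $ i $ j)) UNIV * L2_set (\<lambda>j. cmod (v $ j)) UNIV"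
      using L2_set_mult_ineq[of "\<lambda>j. cmod (A $ i $ j)" "\<lambda>j. cmod (v $ j)" UNIV] by simp
    finally show ?thesis by (simp add: norm_vec_def)
  qed
  then have "norm (A *v v) \<le> L2_set (\<lambda>i. norm (A $ i) * norm v) UNIV"
    unfolding norm_vec_def[of "A *v v"] by (intro L2_set_mono) auto
  also have "\<dots> = norm A * norm v" by (simp add: norm_vec_def[of A] L2_set_left_distrib)
  finally show ?thesis .
qed

text \<open>The squared Frobenius norm is the sum of the squared norms of the columns, and
  \<open>A\<close> acts on the columns of \<open>B\<close> one by one.\<close>

lemma norm_matrix_matrix_le: "norm ((A::complex^'n^'m) ** (B::complex^'k^'n)) \<le> norm A * norm B"
proof -
  have col: "norm (column j (A ** B)) \<le> norm A * norm (column j B)" for j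
  proof -
    have "column j (A ** B) = A *v column j B"
      by (simp add: column_def matrix_matrix_mult_def matrix_vector_mult_def)
    then show ?thesis using norm_matrix_vector_le by metis
  qed
  have nc: "(norm C)\<^sup>2 = (\<Sum>j\<in>UNIV. (norm (column j C))\<^sup>2)" for C :: "complex^'a^'b"
  proof -
    have "(norm C)\<^sup>2 = (\<Sum>i\<in>UNIV. \<Sum>j\<in>UNIV. (cmod (C $ i $ j))\<^sup>2)"
      by (simp add: norm_vec_def L2_set_def sum_nonneg)
    also have "\<dots> = (\<Sum>j\<in>UNIV. \<Sum>i\<in>UNIV. (cmod (C $ i $ j))\<^sup>2)" by (rule sum.swap)
    finally show ?thesis by (simp add: norm_vec_def L2_set_def sum_nonneg column_def)
  qed
  have "(norm (A ** B))\<^sup>2 = (\<Sum>j\<in>UNIV. (norm (column j (A ** B)))\<^sup>2)" by (rule nc)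
  also have "\<dots> \<le> (\<Sum>j\<in>UNIV. (norm A * norm (column j B))\<^sup>2)"
    by (intro sum_mono power_mono col) auto
  also have "\<dots> = (norm A * norm B)\<^sup>2"
    by (simp add: nc[of B] power_mult_distrib sum_distrib_left)
  finally show ?thesis by (rule power2_le_imp_le) simp
qed

lemma bounded_bilinear_matrix_vector: "bounded_bilinear (\<lambda>(A::complex^'n^'m) (v::complex^'n). A *v v)"
proof
  show "\<exists>K. \<forall>(A::complex^'n^'m) v. norm (A *v v) \<le> norm A * norm v * K"
    using norm_matrix_vector_le by (intro exI[of _ 1]) auto
qed (auto simp: vec_eq_iff matrix_vector_mult_def algebra_simps sum.distrib sum_distrib_left scaleR_sum_right)

lemma bounded_bilinear_matrix_matrix: "bounded_bilinear (\<lambda>(A::complex^'n^'m) (B::complex^'k^'n). A ** B)"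
proof
  show "\<exists>K. \<forall>(A::complex^'n^'m) (B::complex^'k^'n). norm (A ** B) \<le> norm A * norm B * K"
    using norm_matrix_matrix_le by (intro exI[of _ 1]) auto
qed (auto simp: vec_eq_iff matrix_matrix_mult_def algebra_simps sum.distrib sum_distrib_left scaleR_sum_right)

lemma bounded_bilinear_scalar_vec: "bounded_bilinear (\<lambda>(c::complex) (v::complex^'n). c *s v)"
proof
  show "\<exists>K. \<forall>c (v::complex^'n). norm (c *s v) \<le> norm c * norm v * K"
    by (intro exI[of _ 1]) (simp add: norm_scalar_vec)
qed (auto simp: vec_eq_iff algebra_simps)

lemma norm_hinner_le: "cmod (hinner u v) \<le> norm u * norm v"
proof -
  have "cmod (hinner u v) \<le> (\<Sum>i\<in>UNIV. cmod (u $ i) * cmod (v $ i))"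
    unfolding hinner_def by (rule order_trans[OF norm_sum]) (simp add: norm_mult)
  also have "\<dots> \<le> norm u * norm v"
    using L2_set_mult_ineq[of "\<lambda>j. cmod (u $ j)" "\<lambda>j. cmod (v $ j)" UNIV] by (simp add: norm_vec_def)
  finally show ?thesis .
qed

lemma bounded_bilinear_hinner: "bounded_bilinear (hinner :: complex^'n \<Rightarrow> _)"
proof
  show "\<exists>K. \<forall>u v :: complex^'n. norm (hinner u v) \<le> norm u * norm v * K"
    using norm_hinner_le by (intro exI[of _ 1]) auto
qed (auto simp: hinner_def algebra_simps sum.distrib sum_distrib_left scaleR_sum_right)

lemma hinner_add_left: "hinner (u + v) w = hinner u w + hinner v w"
  and hinner_add_right: "hinner u (v + w) = hinner u v + hinner u w"
  and hinner_diff_left: "hinner (u - v) w = hinner u w - hinner v w"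
  and hinner_diff_right: "hinner u (v - w) = hinner u v - hinner u w"
  and hinner_minus_left: "hinner (- u) w = - hinner u w"
  and hinner_minus_right: "hinner u (- w) = - hinner u w"
  and hinner_zero_left: "hinner 0 w = 0"
  and hinner_zero_right: "hinner u 0 = 0"
  and hinner_scale_left: "hinner (c *s u) w = c * hinner u w"
  and hinner_scale_right: "hinner u (c *s w) = cnj c * hinner u w"
  by (auto simp: hinner_def algebra_simps sum.distrib sum_subtractf sum_negf sum_distrib_left)

lemmas hinner_simps = hinner_add_left hinner_add_right hinner_diff_left hinner_diff_right
  hinner_minus_left hinner_minus_right hinner_zero_left hinner_zero_right hinner_scale_left hinner_scale_right

lemma hinner_commute: "hinner u v = cnj (hinner v u)"
  by (simp add: hinner_def mult.commute)

lemma hinner_self: "hinner u u = of_real ((norm u)\<^sup>2)"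
  by (simp add: hinner_def norm_vec_def L2_set_def sum_nonneg complex_norm_square[symmetric])

lemma hinner_matrix_left: "hinner (A *v u) v = hinner u (hconj A *v v)"
proof -
  have "hinner (A *v u) v = (\<Sum>i\<in>UNIV. \<Sum>j\<in>UNIV. A $ i $ j * u $ j * cnj (v $ i))"
    by (simp add: hinner_def matrix_vector_mult_def sum_distrib_right)
  also have "\<dots> = (\<Sum>j\<in>UNIV. \<Sum>i\<in>UNIV. A $ i $ j * u $ j * cnj (v $ i))" by (rule sum.swap)
  also have "\<dots> = hinner u (hconj A *v v)"
    by (simp add: hinner_def matrix_vector_mult_def hconj_def transpose_def map_matrix_def sum_distrib_left algebra_simps)
  finally show ?thesis .
qed

lemma inner_eq_Re_hinner: "u \<bullet> v = Re (hinner u v)"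
  by (simp add: inner_vec_def hinner_def inner_complex_def)

lemma matrix_vector_scale: "A *v (c *s v) = c *s (A *v (v::complex^'n))"
  by (simp add: vec_eq_iff matrix_vector_mult_def sum_distrib_left algebra_simps)

lemma vec_sum_axis: "(v::complex^'n) = (\<Sum>j\<in>UNIV. v $ j *s axis j 1)"
  by (simp add: vec_eq_iff axis_def if_distrib cong: if_cong)

section \<open>Square-integrable functions\<close>

lemma integrable_Ioo_iff:
  fixes f :: "real \<Rightarrow> 'b::euclidean_space"
  shows "integrable (lebesgue_on {a<..<b}) f \<longleftrightarrow> f absolutely_integrable_on {a..b}"
proof -
  have "integrable (lebesgue_on {a<..<b}) f \<longleftrightarrow> f absolutely_integrable_on {a<..<b}"
    by (simp add: integrable_restrict_space set_integrable_def)
  then show ?thesis by (simp only: absolutely_integrable_on_Icc_iff_Ioo)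
qed

lemma integral_Ioo_eq:
  fixes f :: "real \<Rightarrow> 'b::euclidean_space"
  assumes "f absolutely_integrable_on {a..b}"
  shows "integral\<^sup>L (lebesgue_on {a<..<b}) f = integral {a..b} f"
  using assms integrable_Ioo_iff[of a b f]
  by (simp add: lebesgue_integral_eq_integral integral_open_interval_real)

lemma L2_on_measurable:
  fixes f :: "real \<Rightarrow> 'b::euclidean_space"
  assumes "f \<in> borel_measurable (lebesgue_on {a<..<b})"
  shows "f \<in> borel_measurable (lebesgue_on {a..b})"
proof -
  have S: "{a<..<b} \<in> sets lebesgue" "{a..b} \<in> sets lebesgue" by auto
  have "(\<lambda>x. if x \<in> {a<..<b} then f x else 0) \<in> borel_measurable lebesgue"
    using borel_measurable_if[OF S(1), of f] assms by blast
  moreover have "AE x in lebesgue. (if x \<in> {a<..<b} then f x else 0) = (if x \<in> {a..b} then f x else 0)"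
    by (rule AE_I'[of "{a, b}"]) (auto simp: negligible_iff_null_sets[symmetric])
  ultimately have "(\<lambda>x. if x \<in> {a..b} then f x else 0) \<in> borel_measurable lebesgue"
    by (rule borel_measurable_AE)
  then show ?thesis using borel_measurable_if[OF S(2), of f] by blast
qed

lemma L2_on_iff:
  fixes f :: "real \<Rightarrow> 'b::euclidean_space"
  shows "L2_on {a<..<b} f \<longleftrightarrow> f \<in> borel_measurable (lebesgue_on {a..b}) \<and>
     (\<lambda>x. (norm (f x))\<^sup>2) absolutely_integrable_on {a..b}"
proof -
  have "f \<in> borel_measurable (lebesgue_on {a<..<b})" if "f \<in> borel_measurable (lebesgue_on {a..b})"
    by (rule measurable_restrict_mono[OF that]) auto
  then show ?thesis
    unfolding L2_on_def integrable_Ioo_iff using L2_on_measurable[of f a b] by blast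
qed

text \<open>The crude bound of a product by the sum of the squares is enough for integrability. In
  particular \<open>\<sigma> x ** \<sigma> x\<close> becomes an admissible coefficient.\<close>

lemma L2_on_bilinear_integrable:
  fixes f :: "real \<Rightarrow> 'b::euclidean_space" and h :: "'b \<Rightarrow> 'c::euclidean_space \<Rightarrow> 'd::euclidean_space"
  assumes h: "bounded_bilinear h" and f: "L2_on {a<..<b} f" and g: "L2_on {a<..<b} g"
  shows "(\<lambda>x. h (f x) (g x)) absolutely_integrable_on {a..b}"
proof -
  interpret bounded_bilinear h by (rule h)
  obtain K where K: "K > 0" "\<And>u v. norm (h u v) \<le> norm u * norm v * K" using pos_bounded by blast
  show ?thesis
  proof (rule measurable_bounded_by_integrable_imp_absolutely_integrable)
    show "(\<lambda>x. h (f x) (g x)) \<in> borel_measurable (lebesgue_on {a..b})"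
      by (rule borel_measurable_bilinear) (use h f g in \<open>auto simp: L2_on_iff bilinear_conv_bounded_bilinear\<close>)
    show "(\<lambda>x. K * ((norm (f x))\<^sup>2 + (norm (g x))\<^sup>2)) integrable_on {a..b}"
      using f g by (intro integrable_on_mult_right integrable_add)
        (auto simp: L2_on_iff set_lebesgue_integral_eq_integral(1))
    fix x
    have "norm (f x) * norm (g x) \<le> (norm (f x))\<^sup>2 + (norm (g x))\<^sup>2"
    proof -
      have "0 \<le> norm (f x) * norm (g x)" by simp
      then show ?thesis using sum_squares_bound[of "norm (f x)" "norm (g x)"] by linarith
    qed
    then have "norm (f x) * norm (g x) * K \<le> ((norm (f x))\<^sup>2 + (norm (g x))\<^sup>2) * K"
      using K(1) by (intro mult_right_mono) auto
    then show "norm (h (f x) (g x)) \<le> K * ((norm (f x))\<^sup>2 + (norm (g x))\<^sup>2)"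
      using K(2)[of "f x" "g x"] by (simp add: mult.commute)
  qed simp
qed

lemma continuous_imp_L2_on:
  fixes f :: "real \<Rightarrow> 'b::euclidean_space"
  assumes "continuous_on {a..b} f"
  shows "L2_on {a<..<b} f"
  unfolding L2_on_iff
  using assms by (auto intro!: continuous_imp_measurable_on_sets_lebesgue absolutely_integrable_continuous_real continuous_intros)

lemma L2_on_imp_absolutely_integrable:
  fixes f :: "real \<Rightarrow> 'b::euclidean_space"
  assumes "L2_on {a<..<b} f"
  shows "f absolutely_integrable_on {a..b}"
proof -
  have "L2_on {a<..<b} (\<lambda>x. 1::real)" by (rule continuous_imp_L2_on) (rule continuous_on_const)
  from L2_on_bilinear_integrable[OF bounded_bilinear_scaleR this assms] show ?thesis by simp
qed

lemma L2_on_add: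
  fixes f :: "real \<Rightarrow> 'b::euclidean_space"
  assumes f: "L2_on {a<..<b} f" and g: "L2_on {a<..<b} g"
  shows "L2_on {a<..<b} (\<lambda>x. f x + g x)"
  unfolding L2_on_iff
proof
  have m: "f \<in> borel_measurable (lebesgue_on {a..b})" "g \<in> borel_measurable (lebesgue_on {a..b})"
    using f g by (auto simp: L2_on_iff)
  show "(\<lambda>x. f x + g x) \<in> borel_measurable (lebesgue_on {a..b})" using m by simp
  have "(\<lambda>x. (f x) \<bullet> (f x) + 2 * (f x \<bullet> g x) + (g x \<bullet> g x)) absolutely_integrable_on {a..b}"
    using L2_on_bilinear_integrable[OF bounded_bilinear_inner f f] L2_on_bilinear_integrable[OF bounded_bilinear_inner f g]
      L2_on_bilinear_integrable[OF bounded_bilinear_inner g g]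
    by (intro set_integral_add(1) set_integrable_mult_right) auto
  then show "(\<lambda>x. (norm (f x + g x))\<^sup>2) absolutely_integrable_on {a..b}"
    by (rule absolutely_integrable_spike_eq[THEN iffD1, OF negligible_empty, rotated])
      (simp add: power2_norm_eq_inner inner_add_left inner_add_right inner_commute)
qed

lemma L2_on_linear:
  fixes f :: "real \<Rightarrow> 'b::euclidean_space" and h :: "'b \<Rightarrow> 'c::euclidean_space"
  assumes f: "L2_on {a<..<b} f" and h: "bounded_linear h"
  shows "L2_on {a<..<b} (\<lambda>x. h (f x))"
proof -
  obtain K where K: "\<And>u. norm (h u) \<le> norm u * K" using bounded_linear.bounded[OF h] by blast
  have m: "(\<lambda>x. h (f x)) \<in> borel_measurable (lebesgue_on {a..b})"
    using f h by (auto simp: L2_on_iff intro: borel_measurable_continuous_on linear_continuous_on)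
  have "(\<lambda>x. (norm (h (f x)))\<^sup>2) absolutely_integrable_on {a..b}"
  proof (rule measurable_bounded_by_integrable_imp_absolutely_integrable)
    show "(\<lambda>x. (norm (h (f x)))\<^sup>2) \<in> borel_measurable (lebesgue_on {a..b})" using m by simp
    show "(\<lambda>x. K\<^sup>2 * (norm (f x))\<^sup>2) integrable_on {a..b}"
      using f by (intro integrable_on_mult_right) (auto simp: L2_on_iff set_lebesgue_integral_eq_integral(1))
    show "norm ((norm (h (f x)))\<^sup>2) \<le> K\<^sup>2 * (norm (f x))\<^sup>2" for x
      using power_mono[OF K[of "f x"], of 2] by (simp add: power_mult_distrib mult.commute)
  qed simp
  then show ?thesis using m by (simp add: L2_on_iff)
qed

lemma L2_on_diff:
  fixes f :: "real \<Rightarrow> 'b::euclidean_space"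
  assumes f: "L2_on {a<..<b} f" and g: "L2_on {a<..<b} g"
  shows "L2_on {a<..<b} (\<lambda>x. f x - g x)"
  using L2_on_add[OF f L2_on_linear[OF g bounded_linear_minus[OF bounded_linear_ident]]] by simp

lemma L2_on_sum:
  fixes f :: "'i \<Rightarrow> real \<Rightarrow> 'b::euclidean_space"
  assumes "\<And>i. i \<in> I \<Longrightarrow> L2_on {a<..<b} (f i)"
  shows "L2_on {a<..<b} (\<lambda>x. \<Sum>i\<in>I. f i x)"
  using assms by (induction I rule: infinite_finite_induct)
    (auto intro: L2_on_add continuous_imp_L2_on continuous_on_const)

section \<open>Boundary conditions and quasi-derivatives\<close>

locale boundary_data =
  fixes T H :: "complex^'m^'m"
  assumes T_herm: "hconj T = T" and T_idem: "T ** T = T"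
    and H_herm: "hconj H = H" and H_eq: "T ** H ** T = H"
begin

definition bdry_perp :: "complex^'m \<Rightarrow> complex^'m \<Rightarrow> complex^'m" where
  "bdry_perp y q = T *v y + (q - T *v q)"

lemma T_T: "T *v (T *v v) = T *v v"
  by (simp add: matrix_vector_mul_assoc T_idem)

lemma T_H: "T *v (H *v v) = H *v v"
  by (metis H_eq T_idem matrix_mul_assoc matrix_vector_mul_assoc)

lemma H_T: "H *v (T *v v) = H *v v"
  by (metis H_eq T_idem matrix_mul_assoc matrix_vector_mul_assoc)

lemma hinner_T: "hinner u (T *v v) = hinner (T *v u) v"
  by (simp add: hinner_matrix_left T_herm)

lemma hinner_H: "hinner u (H *v v) = hinner (H *v u) v"
  by (simp add: hinner_matrix_left H_herm)

lemma bdry_eq: "bdry T H y q = T *v q - H *v y - (y - T *v y)"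
  by (simp add: bdry_def matrix_vector_mult_diff_distrib matrix_vector_mult_diff_rdistrib T_H)

lemmas T_simps = T_T T_H H_T matrix_vector_mult_diff_distrib matrix_vector_right_distrib

text \<open>Passing from the boundary values to the pair of \<open>bdry\<close> and
  \<open>bdry_perp\<close> preserves the Lagrange bracket, because \<open>T\<close> is an orthogonal
  projection and \<open>H\<close> is Hermitian. So a vanishing boundary form kills the boundary
  terms in Green's identity; this is the self-adjointness of the condition.\<close>

lemma bdry_green:
  "hinner q y' - hinner y q' = hinner (bdry T H y q) (bdry_perp y' q') - hinner (bdry_perp y q) (bdry T H y' q')"
  by (simp add: bdry_eq bdry_perp_def hinner_simps hinner_T hinner_H T_simps)

text \<open>The two boundary forms are coordinates on the space of pairs of boundary values, and
  this is the inverse coordinate change. With \<open>u = 0\<close> it parametrises the pairs that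
  satisfy the boundary condition.\<close>

lemma bdry_param:
  assumes "bdry T H y q = u" "bdry_perp y q = v"
  shows "y = T *v v - (u - T *v u)" "q = T *v u + H *v v + (v - T *v v)"
  using assms(1)[symmetric] assms(2)[symmetric]
  by (simp_all add: bdry_eq bdry_perp_def T_simps)

lemma bdry_of_param:
  "bdry T H (T *v v - (u - T *v u)) (T *v u + H *v v + (v - T *v v)) = u"
  "bdry_perp (T *v v - (u - T *v u)) (T *v u + H *v v + (v - T *v v)) = v"
  by (simp_all add: bdry_eq bdry_perp_def T_simps)

end

lemma bdry_add: "bdry T H (y + y') (q + q') = bdry T H y q + bdry T H y' q'"
  by (simp add: bdry_def matrix_vector_mult_diff_distrib matrix_vector_right_distrib)

lemma bdry_scale: "bdry T H (c *s y) (c *s q) = c *s bdry T H y q"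
  by (simp add: bdry_def matrix_vector_mult_diff_distrib matrix_vector_scale vector_sub_rdistrib vector_ssub_ldistrib)

text \<open>A quadratic remainder is what the comparison of solutions for two values of the spectral
  parameter delivers; see \<open>sl_expansion\<close>.\<close>

lemma quadratic_imp_has_field_derivative:
  fixes g :: "complex \<Rightarrow> complex"
  assumes "\<And>z. cmod (z - z0) \<le> 1 \<Longrightarrow> cmod (g z - g z0 - (z - z0) * d) \<le> K * (cmod (z - z0))\<^sup>2"
  shows "(g has_field_derivative d) (at z0)"
  unfolding has_field_derivative_def has_derivative_at_alt
proof (intro conjI allI impI bounded_linear_mult_right)
  fix e :: real assume e: "e > 0"
  define d' where "d' = min 1 (e / (\<bar>K\<bar> + 1))"
  have "d' > 0" using e by (simp add: d'_def)
  moreover have "norm (g z - g z0 - d * (z - z0)) \<le> e * norm (z - z0)" if z: "norm (z - z0) < d'" for z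
  proof -
    have "cmod (z - z0) * (\<bar>K\<bar> + 1) \<le> e" using z by (simp add: d'_def field_simps)
    then have "K * cmod (z - z0) \<le> e"
      by (smt (verit, best) mult_right_mono norm_ge_zero mult.commute)
    then have "K * cmod (z - z0) * cmod (z - z0) \<le> e * cmod (z - z0)" by (intro mult_right_mono) auto
    then show ?thesis using assms[of z] z by (simp add: d'_def power2_eq_square mult.commute mult.left_commute)
  qed
  ultimately show "\<exists>d'>0. \<forall>y. norm (y - z0) < d' \<longrightarrow> norm (g y - g z0 - d * (y - z0)) \<le> e * norm (y - z0)"
    by blast
qed

section \<open>The first-order system and its dependence on the spectral parameter\<close>

locale hermitian_potential =
  fixes \<sigma> :: "real \<Rightarrow> complex^'m^'m"
  assumes \<sigma>: "L2_on {0<..<pi} \<sigma>"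
    and \<sigma>_herm: "AE x in lebesgue_on {0<..<pi}. \<sigma> x = hconj (\<sigma> x)"
begin

lemma \<sigma>_int: "\<sigma> absolutely_integrable_on {0..pi}"
  by (rule L2_on_imp_absolutely_integrable[OF \<sigma>])

lemma \<sigma>\<sigma>_int: "(\<lambda>x. \<sigma> x ** \<sigma> x) absolutely_integrable_on {0..pi}"
  by (rule L2_on_bilinear_integrable[OF bounded_bilinear_matrix_matrix \<sigma> \<sigma>])

lemma negligible_non_hermitian:
  obtains N where "negligible N" "\<And>x. x \<in> {0..pi} - N \<Longrightarrow> hconj (\<sigma> x) = \<sigma> x"
proof -
  have "AE x in lebesgue. x \<in> {0<..<pi} \<longrightarrow> \<sigma> x = hconj (\<sigma> x)"
    using \<sigma>_herm by (simp add: AE_restrict_space_iff)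
  then obtain N where N: "negligible N" "{x. \<not> (x \<in> {0<..<pi} \<longrightarrow> \<sigma> x = hconj (\<sigma> x))} \<subseteq> N"
    by (auto simp: eventually_ae_filter_negligible)
  show thesis
  proof (rule that[of "insert 0 (insert pi N)"])
    show "hconj (\<sigma> x) = \<sigma> x" if "x \<in> {0..pi} - insert 0 (insert pi N)" for x
    proof -
      have "x \<in> {0<..<pi}" "x \<notin> N" using that by auto
      then have "\<sigma> x = hconj (\<sigma> x)" using N(2) by blast
      then show ?thesis by simp
    qed
  qed (use N in auto)
qed

text \<open>The inhomogeneous equation \<open>ell Y = z Y + f\<close> as a system for
  \<open>Y\<close> and its quasi-derivative \<open>Q\<close>. The sign of \<open>f\<close> is such
  that \<open>Y\<close> is the resolvent at \<open>z\<close> applied to \<open>f\<close> once both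
  boundary conditions hold.\<close>

definition sl_sol :: "complex \<Rightarrow> (real \<Rightarrow> complex^'m) \<Rightarrow> (real \<Rightarrow> complex^'m) \<Rightarrow> (real \<Rightarrow> complex^'m) \<Rightarrow> bool" where
  "sl_sol z f Y Q \<longleftrightarrow> ac_deriv 0 pi Y (\<lambda>x. \<sigma> x *v Y x + Q x) \<and>
     ac_deriv 0 pi Q (\<lambda>x. - (\<sigma> x *v Q x) - (\<sigma> x ** \<sigma> x) *v Y x - z *s Y x - f x)"

definition sl_field :: "complex \<Rightarrow> real \<Rightarrow> (complex^'m) \<times> (complex^'m) \<Rightarrow> (complex^'m) \<times> (complex^'m)" where
  "sl_field z x w = (\<sigma> x *v fst w + snd w, - (\<sigma> x *v snd w) - (\<sigma> x ** \<sigma> x) *v fst w - z *s fst w)"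

text \<open>Bounds the operator norm of \<open>sl_field z x\<close> for all \<open>z\<close> with
  \<open>cmod z \<le> R\<close> at once, so that \<open>growth R\<close> serves a whole disc. It is
  integrable because \<open>\<sigma>\<close> is square integrable.\<close>

definition sl_bound :: "real \<Rightarrow> real \<Rightarrow> real" where
  "sl_bound R x = 1 + 2 * norm (\<sigma> x) + (norm (\<sigma> x))\<^sup>2 + R"

lemma sl_bound_int: "sl_bound R absolutely_integrable_on {0..pi}"
  unfolding sl_bound_def
  using absolutely_integrable_norm[OF \<sigma>_int, unfolded o_def] \<sigma>
  by (intro set_integral_add(1) set_integrable_mult_right) (auto simp: L2_on_iff)

lemma linear_field_sl_field:
  assumes "cmod z \<le> R"
  shows "linear_field 0 pi (sl_field z) (sl_bound R)"
  unfolding linear_field_def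
proof (intro conjI ballI allI impI)
  show "sl_bound R absolutely_integrable_on {0..pi}" by (rule sl_bound_int)
  fix x :: real
  show "linear (sl_field z x)"
    by (rule linearI) (auto simp: sl_field_def matrix_vector_right_distrib vector_add_ldistrib vec_eq_iff
        matrix_vector_mult_def sum_distrib_left scaleR_sum_right algebra_simps sum.distrib)
  show "0 \<le> sl_bound R x"
    using assms norm_ge_zero[of z] by (simp add: sl_bound_def) (smt (verit) norm_ge_zero zero_le_power2)
  fix w :: "(complex^'m) \<times> (complex^'m)"
  obtain Y Q where w: "w = (Y, Q)" by fastforce
  have YQ: "norm Y \<le> norm w" "norm Q \<le> norm w"
    using norm_fst_le[of Y Q] norm_snd_le[of Q Y] by (simp_all add: w)
  have 1: "norm (\<sigma> x *v Y) \<le> norm (\<sigma> x) * norm w"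
    by (rule order_trans[OF norm_matrix_vector_le]) (intro mult_left_mono YQ norm_ge_zero)
  have 2: "norm (\<sigma> x *v Q) \<le> norm (\<sigma> x) * norm w"
    by (rule order_trans[OF norm_matrix_vector_le]) (intro mult_left_mono YQ norm_ge_zero)
  have "norm ((\<sigma> x ** \<sigma> x) *v Y) \<le> norm (\<sigma> x ** \<sigma> x) * norm Y" by (rule norm_matrix_vector_le)
  also have "\<dots> \<le> (norm (\<sigma> x) * norm (\<sigma> x)) * norm w"
    by (intro mult_mono norm_matrix_matrix_le YQ) auto
  finally have 3: "norm ((\<sigma> x ** \<sigma> x) *v Y) \<le> (norm (\<sigma> x))\<^sup>2 * norm w" by (simp add: power2_eq_square)
  have 4: "norm (z *s Y) \<le> R * norm w"
    unfolding norm_scalar_vec using assms YQ by (intro mult_mono) (auto intro: order_trans[OF norm_ge_zero])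
  have "norm (sl_field z x w) \<le> norm (\<sigma> x *v Y + Q) + norm (- (\<sigma> x *v Q) - (\<sigma> x ** \<sigma> x) *v Y - z *s Y)"
    by (simp add: sl_field_def w norm_Pair_le)
  also have "\<dots> \<le> (norm (\<sigma> x *v Y) + norm Q) + (norm (\<sigma> x *v Q) + norm ((\<sigma> x ** \<sigma> x) *v Y) + norm (z *s Y))"
    by (intro add_mono norm_triangle_ineq order_trans[OF norm_triangle_ineq4]) (auto intro: order_trans[OF norm_triangle_ineq4])
  also have "\<dots> \<le> (norm (\<sigma> x) * norm w + norm w) + (norm (\<sigma> x) * norm w + (norm (\<sigma> x))\<^sup>2 * norm w + R * norm w)"
    by (intro add_mono 1 2 3 4 YQ)
  finally show "norm (sl_field z x w) \<le> sl_bound R x * norm w"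
    by (simp add: sl_bound_def algebra_simps)
next
  fix w :: "real \<Rightarrow> (complex^'m) \<times> (complex^'m)" assume w: "continuous_on {0..pi} w"
  have Y: "continuous_on {0..pi} (\<lambda>x. fst (w x))" and Q: "continuous_on {0..pi} (\<lambda>x. snd (w x))"
    using w by (auto intro: continuous_intros)
  have m: "(\<lambda>x. S x *v u x) absolutely_integrable_on {0..pi}"
    if "S absolutely_integrable_on {0..pi}" "continuous_on {0..pi} u" for S :: "real \<Rightarrow> complex^'m^'m" and u
    using continuous_times_absolutely_integrable[OF bounded_bilinear.flip[OF bounded_bilinear_matrix_vector] that(2,1)] .
  have c: "(\<lambda>x. z *s fst (w x)) absolutely_integrable_on {0..pi}"
    by (rule absolutely_integrable_continuous_real)
       (rule bounded_linear.continuous_on[OF bounded_bilinear.bounded_linear_right[OF bounded_bilinear_scalar_vec] Y])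
  have 1: "(\<lambda>x. \<sigma> x *v fst (w x) + snd (w x)) absolutely_integrable_on {0..pi}"
    by (intro set_integral_add(1) m \<sigma>_int Y absolutely_integrable_continuous_real Q)
  have 2: "(\<lambda>x. (- (\<sigma> x *v snd (w x)) - (\<sigma> x ** \<sigma> x) *v fst (w x) - z *s fst (w x))) absolutely_integrable_on {0..pi}"
    by (intro set_integral_diff(1) absolutely_integrable_linear[OF m[OF \<sigma>_int Q] bounded_linear_minus[OF bounded_linear_ident], unfolded o_def] m \<sigma>\<sigma>_int Y c)
  have bl: "bounded_linear (\<lambda>x::complex^'m. (x, 0::complex^'m))" "bounded_linear (\<lambda>x::complex^'m. (0::complex^'m, x))"
    by (auto intro: bounded_linear_Pair bounded_linear_ident bounded_linear_zero)
  show "(\<lambda>x. sl_field z x (w x)) absolutely_integrable_on {0..pi}"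
    using set_integral_add(1)[OF absolutely_integrable_linear[OF 1 bl(1)] absolutely_integrable_linear[OF 2 bl(2)]]
    by (simp add: sl_field_def o_def)
qed

lemma sl_sol_iff_pair:
  "sl_sol z f Y Q \<longleftrightarrow> ac_deriv 0 pi (\<lambda>x. (Y x, Q x)) (\<lambda>x. sl_field z x (Y x, Q x) + (0, - f x))"
proof
  assume "sl_sol z f Y Q"
  then have "ac_deriv 0 pi (\<lambda>x. (Y x, Q x)) (\<lambda>x. (\<sigma> x *v Y x + Q x, - (\<sigma> x *v Q x) - (\<sigma> x ** \<sigma> x) *v Y x - z *s Y x - f x))"
    unfolding sl_sol_def by (intro ac_deriv_Pair) auto
  then show "ac_deriv 0 pi (\<lambda>x. (Y x, Q x)) (\<lambda>x. sl_field z x (Y x, Q x) + (0, - f x))"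
    by (simp add: sl_field_def)
next
  assume A: "ac_deriv 0 pi (\<lambda>x. (Y x, Q x)) (\<lambda>x. sl_field z x (Y x, Q x) + (0, - f x))"
  from ac_deriv_linear[OF A bounded_linear_fst] ac_deriv_linear[OF A bounded_linear_snd]
  show "sl_sol z f Y Q" by (simp add: sl_sol_def sl_field_def)
qed

lemma sl_sol_continuous:
  assumes "sl_sol z f Y Q"
  shows "continuous_on {0..pi} Y" "continuous_on {0..pi} Q"
  using assms by (auto simp: sl_sol_def intro: ac_deriv_continuous_on)

lemma Pair_int:
  fixes f :: "real \<Rightarrow> complex^'m"
  assumes "f absolutely_integrable_on {0..pi}"
  shows "(\<lambda>x. (0::complex^'m, - f x)) absolutely_integrable_on {0..pi}"
proof -
  have "bounded_linear (\<lambda>x::complex^'m. (0::complex^'m, - x))"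
    by (rule bounded_linear_Pair[OF bounded_linear_zero bounded_linear_minus[OF bounded_linear_ident]])
  from absolutely_integrable_linear[OF assms this] show ?thesis by (simp add: o_def)
qed

definition growth :: "real \<Rightarrow> real" where "growth R = exp (integral {0..pi} (sl_bound R))"

lemma growth_pos: "growth R > 0" by (simp add: growth_def)

lemma sl_sol_norm_le:
  assumes S: "sl_sol z f Y Q" and f: "f absolutely_integrable_on {0..pi}" and z: "cmod z \<le> R" and x: "x \<in> {0..pi}"
  shows "norm (Y x, Q x) \<le> (norm (Y 0, Q 0) + integral {0..pi} (\<lambda>x. norm (f x))) * growth R"
  using linear_ode_norm_le[OF linear_field_sl_field[OF z] Pair_int[OF f] S[unfolded sl_sol_iff_pair] x]
  by (simp add: growth_def)

lemma sl_sol_unique: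
  assumes "sl_sol z f Y Q" "sl_sol z f Y' Q'" "Y 0 = Y' 0" "Q 0 = Q' 0" "x \<in> {0..pi}"
  shows "Y x = Y' x" "Q x = Q' x"
  using linear_ode_unique[OF linear_field_sl_field[OF order_refl] assms(1)[unfolded sl_sol_iff_pair] assms(2)[unfolded sl_sol_iff_pair]] assms(3-)
  by auto

lemma sl_sol_lincomb:
  assumes "sl_sol z f Y Q" "sl_sol z g Y' Q'"
  shows "sl_sol z (\<lambda>x. c *s f x + g x) (\<lambda>x. c *s Y x + Y' x) (\<lambda>x. c *s Q x + Q' x)"
proof -
  have bl: "bounded_linear (\<lambda>v::complex^'m. c *s v)"
    by (rule bounded_bilinear.bounded_linear_right[OF bounded_bilinear_scalar_vec])
  have Y: "ac_deriv 0 pi Y (\<lambda>x. \<sigma> x *v Y x + Q x)" "ac_deriv 0 pi Y' (\<lambda>x. \<sigma> x *v Y' x + Q' x)"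
    and Q: "ac_deriv 0 pi Q (\<lambda>x. - (\<sigma> x *v Q x) - (\<sigma> x ** \<sigma> x) *v Y x - z *s Y x - f x)"
      "ac_deriv 0 pi Q' (\<lambda>x. - (\<sigma> x *v Q' x) - (\<sigma> x ** \<sigma> x) *v Y' x - z *s Y' x - g x)"
    using assms by (auto simp: sl_sol_def)
  show ?thesis
    unfolding sl_sol_def
  proof
    show "ac_deriv 0 pi (\<lambda>x. c *s Y x + Y' x) (\<lambda>x. \<sigma> x *v (c *s Y x + Y' x) + (c *s Q x + Q' x))"
      by (rule ac_deriv_cong[OF ac_deriv_add[OF ac_deriv_linear[OF Y(1) bl] Y(2)], where N = "{}"])
        (auto simp: matrix_vector_scale matrix_vector_right_distrib vector_add_ldistrib)
    show "ac_deriv 0 pi (\<lambda>x. c *s Q x + Q' x) (\<lambda>x. - (\<sigma> x *v (c *s Q x + Q' x)) -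
        (\<sigma> x ** \<sigma> x) *v (c *s Y x + Y' x) - z *s (c *s Y x + Y' x) - (c *s f x + g x))"
      by (rule ac_deriv_cong[OF ac_deriv_add[OF ac_deriv_linear[OF Q(1) bl] Q(2)], where N = "{}"])
        (auto simp: matrix_vector_scale matrix_vector_right_distrib vec_eq_iff algebra_simps)
  qed
qed

text \<open>A change of the spectral parameter is traded for an inhomogeneity. Solutions for two
  parameters can then be subtracted as solutions for one of them.\<close>

lemma sl_sol_shift:
  assumes "sl_sol z f Y Q"
  shows "sl_sol z0 (\<lambda>x. f x + (z - z0) *s Y x) Y Q"
proof -
  have eq: "- (\<sigma> x *v Q x) - (\<sigma> x ** \<sigma> x) *v Y x - z *s Y x - f x =
     - (\<sigma> x *v Q x) - (\<sigma> x ** \<sigma> x) *v Y x - z0 *s Y x - (f x + (z - z0) *s Y x)" for x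
    by (simp add: vec_eq_iff algebra_simps)
  show ?thesis using assms unfolding sl_sol_def eq .
qed

text \<open>The initial data determine the values on \<open>{0..pi}\<close> only; outside, the
  chosen function is arbitrary, so later statements about its values restrict \<open>x\<close> to
  this interval.\<close>

definition sl :: "(real \<Rightarrow> complex^'m) \<Rightarrow> complex^'m \<Rightarrow> complex^'m \<Rightarrow> complex \<Rightarrow> real \<Rightarrow> (complex^'m) \<times> (complex^'m)" where
  "sl f y0 q0 z = (SOME W. W 0 = (y0, q0) \<and> sl_sol z f (\<lambda>x. fst (W x)) (\<lambda>x. snd (W x)))"

lemma sl:
  assumes "f absolutely_integrable_on {0..pi}"
  shows "sl f y0 q0 z 0 = (y0, q0)" "sl_sol z f (\<lambda>x. fst (sl f y0 q0 z x)) (\<lambda>x. snd (sl f y0 q0 z x))"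
proof -
  obtain W where "ac_deriv 0 pi W (\<lambda>x. sl_field z x (W x) + (0, - f x))" "W 0 = (y0, q0)"
    by (rule linear_ode_exists[OF linear_field_sl_field[OF order_refl] Pair_int[OF assms] pi_ge_zero])
  then have "W 0 = (y0, q0) \<and> sl_sol z f (\<lambda>x. fst (W x)) (\<lambda>x. snd (W x))"
    by (simp add: sl_sol_iff_pair)
  then have "sl f y0 q0 z 0 = (y0, q0) \<and> sl_sol z f (\<lambda>x. fst (sl f y0 q0 z x)) (\<lambda>x. snd (sl f y0 q0 z x))"
    unfolding sl_def by (rule someI[of "\<lambda>W. W 0 = (y0, q0) \<and> sl_sol z f (\<lambda>x. fst (W x)) (\<lambda>x. snd (W x))"])
  then show "sl f y0 q0 z 0 = (y0, q0)" "sl_sol z f (\<lambda>x. fst (sl f y0 q0 z x)) (\<lambda>x. snd (sl f y0 q0 z x))" by auto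
qed

lemma sl_unique:
  assumes "sl_sol z f Y Q" "f absolutely_integrable_on {0..pi}" "x \<in> {0..pi}"
  shows "sl f (Y 0) (Q 0) z x = (Y x, Q x)"
  using sl_sol_unique[OF sl(2)[OF assms(2)] assms(1), of "Y 0" "Q 0"] sl(1)[OF assms(2)] assms(3)
  by (simp add: prod_eq_iff)

lemma scale_int:
  assumes "(f :: real \<Rightarrow> complex^'m) absolutely_integrable_on {a..b}"
  shows "(\<lambda>x. c *s f x) absolutely_integrable_on {a..b}"
  using absolutely_integrable_linear[OF assms bounded_bilinear.bounded_linear_right[OF bounded_bilinear_scalar_vec]]
  by (simp add: o_def)

lemma norm_fst_snd_le: "norm (fst w) \<le> norm w" "norm (snd w) \<le> norm w"
  by (metis norm_fst_le prod.collapse, metis norm_snd_le prod.collapse)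

lemma norm_integral_scale:
  fixes Y :: "real \<Rightarrow> complex^'m"
  assumes "continuous_on {0..pi} Y" "\<And>x. x \<in> {0..pi} \<Longrightarrow> norm (Y x) \<le> M"
  shows "integral {0..pi} (\<lambda>x. norm (c *s Y x)) \<le> cmod c * M * pi"
proof -
  have "integral {0..pi} (\<lambda>x. norm (c *s Y x)) \<le> integral {0..pi} (\<lambda>x. cmod c * M)"
  proof (rule integral_le)
    show "(\<lambda>x. norm (c *s Y x)) integrable_on {0..pi}"
      unfolding norm_scalar_vec by (intro integrable_continuous_real continuous_intros assms)
  qed (auto simp: norm_scalar_vec intro!: mult_left_mono[OF assms(2)])
  then show ?thesis by (simp add: mult_ac)
qed

lemma sl_bounded:
  assumes f: "f absolutely_integrable_on {0..pi}" and z: "cmod z \<le> R" and x: "x \<in> {0..pi}"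
  shows "norm (sl f y0 q0 z x) \<le> (norm (y0, q0) + integral {0..pi} (\<lambda>x. norm (f x))) * growth R"
  using sl_sol_norm_le[OF sl(2)[OF f] f z x, of y0 q0] sl(1)[OF f, of y0 q0 z] by simp

text \<open>By \<open>sl_sol_shift\<close> the difference solves the equation at \<open>z'\<close>
  with zero initial data and inhomogeneity \<open>z - z'\<close> times the solution for
  \<open>z\<close>. One factor \<open>growth R\<close> bounds that solution, the other the response
  to it.\<close>

lemma sl_lipschitz:
  assumes f: "f absolutely_integrable_on {0..pi}" and A: "cmod z \<le> R" "cmod z' \<le> R" "x \<in> {0..pi}"
  shows "norm (sl f y0 q0 z x - sl f y0 q0 z' x) \<le>
    (norm (y0, q0) + integral {0..pi} (\<lambda>x. norm (f x))) * growth R * pi * growth R * cmod (z - z')"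
proof -
  define M where "M = (norm (y0, q0) + integral {0..pi} (\<lambda>x. norm (f x))) * growth R"
  define U where "U = sl f y0 q0"
  have U: "sl_sol z' (\<lambda>x. f x + (z - z') *s fst (U z x)) (\<lambda>x. fst (U z x)) (\<lambda>x. snd (U z x))"
    unfolding U_def by (rule sl_sol_shift[OF sl(2)[OF f]])
  have U': "sl_sol z' f (\<lambda>x. fst (U z' x)) (\<lambda>x. snd (U z' x))" unfolding U_def by (rule sl(2)[OF f])
  have "sl_sol z' (\<lambda>x. (-1) *s f x + (f x + (z - z') *s fst (U z x))) (\<lambda>x. (-1) *s fst (U z' x) + fst (U z x))
     (\<lambda>x. (-1) *s snd (U z' x) + snd (U z x))"
    by (rule sl_sol_lincomb[OF U' U])
  moreover have "(-1) *s f x + (f x + (z - z') *s fst (U z x)) = (z - z') *s fst (U z x)" for x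
    by (simp add: vec_eq_iff)
  moreover have "(-1) *s u + v = v - u" for u v :: "complex^'m" by (simp add: vec_eq_iff)
  ultimately have D: "sl_sol z' (\<lambda>x. (z - z') *s fst (U z x)) (\<lambda>x. fst (U z x) - fst (U z' x)) (\<lambda>x. snd (U z x) - snd (U z' x))"
    by simp
  have cY: "continuous_on {0..pi} (\<lambda>x. fst (U z x))" using sl_sol_continuous(1)[OF U] .
  have bY: "norm (fst (U z t)) \<le> M" if "t \<in> {0..pi}" for t
    using sl_bounded[OF f A(1) that, of y0 q0] norm_fst_snd_le(1)[of "U z t"] by (simp add: M_def U_def)
  have "norm (fst (U z x) - fst (U z' x), snd (U z x) - snd (U z' x)) \<le>
     (norm (fst (U z 0) - fst (U z' 0), snd (U z 0) - snd (U z' 0)) + integral {0..pi} (\<lambda>x. norm ((z - z') *s fst (U z x)))) * growth R"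
    by (rule sl_sol_norm_le[OF D scale_int[OF absolutely_integrable_continuous_real[OF cY]] A(2,3)])
  also have "\<dots> = integral {0..pi} (\<lambda>x. norm ((z - z') *s fst (U z x))) * growth R"
    by (simp add: U_def sl(1)[OF f])
  also have "\<dots> \<le> (cmod (z - z') * M * pi) * growth R"
    using growth_pos[of R] by (intro mult_right_mono norm_integral_scale cY bY) auto
  finally show ?thesis
    by (simp add: U_def M_def minus_prod_def algebra_simps)
qed

text \<open>The derivative \<open>D\<close> in \<open>z\<close> is the solution with zero initial
  data whose inhomogeneity is the solution at \<open>z0\<close>. The remainder then has the
  inhomogeneity \<open>z - z0\<close> times a difference of two solutions, which
  \<open>sl_lipschitz\<close> makes quadratically small, uniformly in \<open>x\<close>.\<close>

lemma sl_expansion: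
  assumes f: "f absolutely_integrable_on {0..pi}"
  shows "\<exists>D K. continuous_on {0..pi} D \<and> 0 \<le> K \<and>
    (\<forall>z x. cmod (z - z0) \<le> 1 \<longrightarrow> x \<in> {0..pi} \<longrightarrow>
      norm (sl f y0 q0 z x - sl f y0 q0 z0 x - ((z - z0) *s fst (D x), (z - z0) *s snd (D x))) \<le> K * (cmod (z - z0))\<^sup>2)"
proof -
  define R where "R = cmod z0 + 1"
  define U where "U = sl f y0 q0"
  define K where "K = (norm (y0, q0) + integral {0..pi} (\<lambda>x. norm (f x))) * growth R * pi * growth R"
  have K: "0 \<le> K" "\<And>z z' x. cmod z \<le> R \<Longrightarrow> cmod z' \<le> R \<Longrightarrow> x \<in> {0..pi} \<Longrightarrow>
      norm (U z x - U z' x) \<le> K * cmod (z - z')"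
    unfolding K_def U_def using growth_pos[of R] f sl_lipschitz[OF f]
    by (auto intro!: mult_nonneg_nonneg add_nonneg_nonneg integral_nonneg simp: absolutely_integrable_on_def less_imp_le)
  have U: "sl_sol z f (\<lambda>x. fst (U z x)) (\<lambda>x. snd (U z x))" for z unfolding U_def by (rule sl(2)[OF f])
  define h where "h = (\<lambda>x. fst (U z0 x))"
  have ch: "continuous_on {0..pi} h" unfolding h_def by (rule sl_sol_continuous(1)[OF U])
  have hi: "h absolutely_integrable_on {0..pi}" by (rule absolutely_integrable_continuous_real[OF ch])
  define D where "D = sl h 0 0 z0"
  have D: "sl_sol z0 h (\<lambda>x. fst (D x)) (\<lambda>x. snd (D x))" unfolding D_def by (rule sl(2)[OF hi])
  have D0: "D 0 = (0, 0)" unfolding D_def by (rule sl(1)[OF hi])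
  have "continuous_on {0..pi} (\<lambda>x. (fst (D x), snd (D x)))"
    by (intro continuous_on_Pair sl_sol_continuous[OF D])
  then have cD: "continuous_on {0..pi} D" by simp
  show ?thesis
  proof (intro exI[of _ D] exI[of _ "K * pi * growth R"] conjI allI impI cD)
    show "0 \<le> K * pi * growth R" using K(1) growth_pos[of R] by simp
    fix z x assume z: "cmod (z - z0) \<le> 1" and x: "x \<in> {0..pi}"
    have zR: "cmod z \<le> R" "cmod z0 \<le> R"
      using norm_triangle_sub[of z z0] z by (auto simp: R_def)
    define c where "c = z - z0"
    have S1: "sl_sol z0 (\<lambda>x. f x + c *s fst (U z x)) (\<lambda>x. fst (U z x)) (\<lambda>x. snd (U z x))"
      unfolding c_def by (rule sl_sol_shift[OF U])
    note S2 = sl_sol_lincomb[OF U[of z0] S1, of "-1"]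
    note S3 = sl_sol_lincomb[OF D S2, of "- c"]
    have e1: "f x + c *s fst (U z x) - f x - c *s h x = c *s (fst (U z x) - fst (U z0 x))" for x
      by (simp add: vec_eq_iff h_def algebra_simps)
    have e2: "(- c) *s u + ((-1) *s v + w) = w - v - c *s u" for u v w :: "complex^'m"
      by (simp add: vec_eq_iff)
    have S: "sl_sol z0 (\<lambda>x. c *s (fst (U z x) - fst (U z0 x))) (\<lambda>x. fst (U z x) - fst (U z0 x) - c *s fst (D x))
        (\<lambda>x. snd (U z x) - snd (U z0 x) - c *s snd (D x))"
      using S3 unfolding e2 e1 .
    have cY: "continuous_on {0..pi} (\<lambda>x. fst (U z x) - fst (U z0 x))"
      by (intro continuous_on_diff sl_sol_continuous(1)[OF U])
    have bY: "norm (fst (U z t) - fst (U z0 t)) \<le> K * cmod c" if "t \<in> {0..pi}" for t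
      using K(2)[OF zR that] norm_fst_snd_le(1)[of "U z t - U z0 t"] by (simp add: c_def)
    have "norm (fst (U z x) - fst (U z0 x) - c *s fst (D x), snd (U z x) - snd (U z0 x) - c *s snd (D x)) \<le>
       (norm (fst (U z 0) - fst (U z0 0) - c *s fst (D 0), snd (U z 0) - snd (U z0 0) - c *s snd (D 0)) +
        integral {0..pi} (\<lambda>x. norm (c *s (fst (U z x) - fst (U z0 x))))) * growth R"
      by (rule sl_sol_norm_le[OF S scale_int[OF absolutely_integrable_continuous_real[OF cY]] zR(2) x])
    also have "\<dots> = integral {0..pi} (\<lambda>x. norm (c *s (fst (U z x) - fst (U z0 x)))) * growth R"
      by (simp add: U_def sl(1)[OF f] D0 vec_eq_iff)
    also have "\<dots> \<le> (cmod c * (K * cmod c) * pi) * growth R"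
      using growth_pos[of R] by (intro mult_right_mono norm_integral_scale cY bY) auto
    finally show "norm (sl f y0 q0 z x - sl f y0 q0 z0 x - ((z - z0) *s fst (D x), (z - z0) *s snd (D x))) \<le>
       K * pi * growth R * (cmod (z - z0))\<^sup>2"
      by (simp add: U_def c_def minus_prod_def algebra_simps power2_eq_square)
  qed
qed

text \<open>Here \<open>bounded_linear\<close> means real linearity; the second assumption on
  \<open>h\<close> adds the complex homogeneity without which the composition would not be
  holomorphic.\<close>

lemma sl_holomorphic:
  assumes f: "f absolutely_integrable_on {0..pi}" and x: "x \<in> {0..pi}"
    and h: "bounded_linear h" "\<And>c u v. h (c *s u, c *s v) = c * h (u, v)"
  shows "(\<lambda>z. h (sl f y0 q0 z x)) holomorphic_on UNIV"
proof -
  have "(\<lambda>z. h (sl f y0 q0 z x)) field_differentiable at z0" for z0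
  proof -
    obtain D K where DK: "0 \<le> K" "\<And>z x. cmod (z - z0) \<le> 1 \<Longrightarrow> x \<in> {0..pi} \<Longrightarrow>
      norm (sl f y0 q0 z x - sl f y0 q0 z0 x - ((z - z0) *s fst (D x), (z - z0) *s snd (D x))) \<le> K * (cmod (z - z0))\<^sup>2"
      using sl_expansion[OF f, of z0 y0 q0] by blast
    obtain B where B: "B > 0" "\<And>w. norm (h w) \<le> norm w * B" using bounded_linear.pos_bounded[OF h(1)] by blast
    have "((\<lambda>z. h (sl f y0 q0 z x)) has_field_derivative h (D x)) (at z0)"
    proof (rule quadratic_imp_has_field_derivative)
      fix z assume z: "cmod (z - z0) \<le> 1"
      have "h (sl f y0 q0 z x) - h (sl f y0 q0 z0 x) - (z - z0) * h (D x) =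
         h (sl f y0 q0 z x - sl f y0 q0 z0 x - ((z - z0) *s fst (D x), (z - z0) *s snd (D x)))"
        using h(2)[of "z - z0" "fst (D x)" "snd (D x)"]
        by (simp add: linear_diff[OF bounded_linear.linear[OF h(1)]])
      then have "cmod (h (sl f y0 q0 z x) - h (sl f y0 q0 z0 x) - (z - z0) * h (D x)) \<le>
         norm (sl f y0 q0 z x - sl f y0 q0 z0 x - ((z - z0) *s fst (D x), (z - z0) *s snd (D x))) * B"
        using B(2) by metis
      also have "\<dots> \<le> (K * (cmod (z - z0))\<^sup>2) * B" using DK(2)[OF z x] B(1) by (intro mult_right_mono) auto
      finally show "cmod (h (sl f y0 q0 z x) - h (sl f y0 q0 z0 x) - (z - z0) * h (D x)) \<le> (K * B) * (cmod (z - z0))\<^sup>2"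
        by (simp add: algebra_simps)
    qed
    then show ?thesis by (auto simp: field_differentiable_def)
  qed
  then show ?thesis by (simp add: holomorphic_on_def field_differentiable_at_within)
qed

lemma hinner_int:
  fixes u g :: "real \<Rightarrow> complex^'m"
  assumes "continuous_on {0..pi} u" "g absolutely_integrable_on {0..pi}"
  shows "(\<lambda>x. hinner (u x) (g x)) absolutely_integrable_on {0..pi}"
  by (rule continuous_times_absolutely_integrable[OF bounded_bilinear_hinner assms])

text \<open>The expansion in \<open>sl_expansion\<close> is uniform in \<open>x\<close> and so
  survives the integration against \<open>g\<close>.\<close>

lemma sl_integral_holomorphic:
  assumes f: "f absolutely_integrable_on {0..pi}" and g: "g absolutely_integrable_on {0..pi}"
  shows "(\<lambda>z. integral {0..pi} (\<lambda>x. hinner (fst (sl f y0 q0 z x)) (g x))) holomorphic_on UNIV"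
proof -
  let ?F = "\<lambda>z. integral {0..pi} (\<lambda>x. hinner (fst (sl f y0 q0 z x)) (g x))"
  have "?F field_differentiable at z0" for z0
  proof -
    obtain D K where DK: "continuous_on {0..pi} D" "0 \<le> K" "\<And>z x. cmod (z - z0) \<le> 1 \<Longrightarrow> x \<in> {0..pi} \<Longrightarrow>
      norm (sl f y0 q0 z x - sl f y0 q0 z0 x - ((z - z0) *s fst (D x), (z - z0) *s snd (D x))) \<le> K * (cmod (z - z0))\<^sup>2"
      using sl_expansion[OF f, of z0 y0 q0] by blast
    let ?d = "integral {0..pi} (\<lambda>x. hinner (fst (D x)) (g x))"
    have iU: "(\<lambda>x. hinner (fst (sl f y0 q0 z x)) (g x)) integrable_on {0..pi}" for z
      using hinner_int[OF sl_sol_continuous(1)[OF sl(2)[OF f]] g] by (rule set_lebesgue_integral_eq_integral(1))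
    have iD: "(\<lambda>x. hinner (fst (D x)) (g x)) integrable_on {0..pi}"
      using hinner_int[OF continuous_on_fst[OF DK(1)] g] by (rule set_lebesgue_integral_eq_integral(1))
    have ng: "(\<lambda>x. norm (g x)) integrable_on {0..pi}" using g by (simp add: absolutely_integrable_on_def)
    have "(?F has_field_derivative ?d) (at z0)"
    proof (rule quadratic_imp_has_field_derivative)
      fix z assume z: "cmod (z - z0) \<le> 1"
      let ?r = "\<lambda>x. hinner (fst (sl f y0 q0 z x) - fst (sl f y0 q0 z0 x) - (z - z0) *s fst (D x)) (g x)"
      have I: "(?r has_integral (?F z - ?F z0 - (z - z0) * ?d)) {0..pi}"
        unfolding hinner_simps
        by (intro has_integral_diff has_integral_mult_right integrable_integral iU iD)
      have "cmod (integral {0..pi} ?r) \<le> integral {0..pi} (\<lambda>x. K * (cmod (z - z0))\<^sup>2 * norm (g x))"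
      proof (rule integral_norm_bound_integral)
        fix x assume x: "x \<in> {0..pi}"
        have "norm (fst (sl f y0 q0 z x) - fst (sl f y0 q0 z0 x) - (z - z0) *s fst (D x)) \<le> K * (cmod (z - z0))\<^sup>2"
          using DK(3)[OF z x] norm_fst_snd_le(1)[of "sl f y0 q0 z x - sl f y0 q0 z0 x - ((z - z0) *s fst (D x), (z - z0) *s snd (D x))"] by simp
        then show "cmod (?r x) \<le> K * (cmod (z - z0))\<^sup>2 * norm (g x)"
          by (intro order_trans[OF norm_hinner_le] mult_right_mono) auto
      qed (use I ng in \<open>auto intro: integrable_on_mult_right\<close>)
      also have "\<dots> = K * integral {0..pi} (\<lambda>x. norm (g x)) * (cmod (z - z0))\<^sup>2" by simp
      finally show "cmod (?F z - ?F z0 - (z - z0) * ?d) \<le> K * integral {0..pi} (\<lambda>x. norm (g x)) * (cmod (z - z0))\<^sup>2"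
        using integral_unique[OF I] by simp
    qed
    then show ?thesis by (auto simp: field_differentiable_def)
  qed
  then show ?thesis by (simp add: holomorphic_on_def field_differentiable_at_within)
qed

end

section \<open>The characteristic matrix\<close>

lemma det_holomorphic_on:
  assumes "\<And>i j. (\<lambda>z. A z $ i $ j) holomorphic_on S"
  shows "(\<lambda>z. det (A z :: complex^'n^'n)) holomorphic_on S"
  unfolding det_def by (intro holomorphic_intros assms)

text \<open>The assumed bound says nothing on the real axis, so Liouville's theorem does not apply
  directly. Multiplication by \<open>w\<^sup>2 - R\<^sup>2\<close> turns it into the bound
  \<open>2 * R * C\<close> on the whole circle of radius \<open>R\<close>; the maximum principle
  carries this to \<open>z\<close>, where the factor is of order \<open>R\<^sup>2\<close>, and a
  large \<open>R\<close> gives the contradiction.\<close>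

lemma entire_inverse_Im_bound:
  assumes G: "G holomorphic_on UNIV" and bd: "\<And>z. Im z \<noteq> 0 \<Longrightarrow> cmod (G z) \<le> C / \<bar>Im z\<bar>"
  shows "G z = 0"
proof (rule ccontr)
  assume nz: "G z \<noteq> 0"
  have C: "C \<ge> 0"
    using order_trans[OF norm_ge_zero bd[of \<i>]] by simp
  define q where "q = C / cmod (G z)"
  \<comment> \<open>Solved backwards: \<open>(R - cmod z) * cmod (G z)\<close> has to exceed
    \<open>2 * C\<close>, and \<open>2 * q\<close> contributes exactly \<open>2 * C\<close> to this
    product.\<close>
  define R where "R = cmod z + (1 + 2 * (cmod z + q))"
  have q: "0 \<le> q" unfolding q_def by (rule divide_nonneg_nonneg[OF C norm_ge_zero])
  have "R > cmod z"
  proof -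
    have "0 < 1 + 2 * (cmod z + q)" by (rule add_pos_nonneg) (use q in auto)
    then show ?thesis unfolding R_def by simp
  qed
  then have R0: "R > cmod z" "R > 0" using norm_ge_zero[of z] by linarith+
  \<comment> \<open>On the circle of radius \<open>R\<close> the factor \<open>w\<^sup>2 - R\<^sup>2\<close> has modulus \<open>2 R \<bar>Im w\<bar>\<close>.\<close>
  have "cmod ((z\<^sup>2 - of_real (R\<^sup>2)) * G z) \<le> 2 * R * C"
  proof (rule maximum_modulus_frontier[where S = "cball 0 R" and f = "\<lambda>w. (w\<^sup>2 - of_real (R\<^sup>2)) * G w"])
    show "(\<lambda>w. (w\<^sup>2 - of_real (R\<^sup>2)) * G w) holomorphic_on interior (cball 0 R)"
      by (intro holomorphic_intros holomorphic_on_subset[OF G]) auto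
    show "continuous_on (closure (cball 0 R)) (\<lambda>w. (w\<^sup>2 - of_real (R\<^sup>2)) * G w)"
      by (intro continuous_intros continuous_on_subset[OF holomorphic_on_imp_continuous_on[OF G]]) auto
    fix w :: complex assume "w \<in> frontier (cball 0 R)"
    then have w: "cmod w = R" using R0 by (simp add: frontier_cball)
    have "w\<^sup>2 - of_real (R\<^sup>2) = w * (w - cnj w)"
      using w complex_norm_square[of w] by (simp add: power2_eq_square algebra_simps)
    also have "w - cnj w = 2 * Im w * \<i>" by (rule complex_diff_cnj)
    finally have e: "cmod (w\<^sup>2 - of_real (R\<^sup>2)) = 2 * R * \<bar>Im w\<bar>"
      using w by (simp add: norm_mult)
    show "cmod ((w\<^sup>2 - of_real (R\<^sup>2)) * G w) \<le> 2 * R * C"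
    proof (cases "Im w = 0")
      case True
      then show ?thesis using e C R0 by (simp add: norm_mult)
    next
      case False
      then have "\<bar>Im w\<bar> * cmod (G w) \<le> C" using bd[OF False] by (simp add: field_simps)
      then have "2 * R * (\<bar>Im w\<bar> * cmod (G w)) \<le> 2 * R * C" using R0 by (intro mult_left_mono) auto
      then show ?thesis using e by (simp add: norm_mult)
    qed
  qed (use R0 in auto)
  moreover have "cmod (z\<^sup>2 - of_real (R\<^sup>2)) \<ge> R * (R - cmod z)"
  proof -
    have "R\<^sup>2 = cmod (of_real (R\<^sup>2))" by (simp add: norm_power)
    also have "\<dots> \<le> cmod (z\<^sup>2 - of_real (R\<^sup>2)) + cmod (z\<^sup>2)"
      using norm_triangle_ineq2[of "of_real (R\<^sup>2)" "z\<^sup>2"] norm_minus_commute[of "z\<^sup>2" "of_real (R\<^sup>2)"] by linarith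
    finally have "R\<^sup>2 - (cmod z)\<^sup>2 \<le> cmod (z\<^sup>2 - of_real (R\<^sup>2))" by (simp add: norm_power)
    moreover have "R * (R - cmod z) \<le> R\<^sup>2 - (cmod z)\<^sup>2"
      using R0 mult_right_mono[of "cmod z" R "cmod z"] by (simp add: power2_eq_square algebra_simps)
    ultimately show ?thesis by linarith
  qed
  ultimately have "R * (R - cmod z) * cmod (G z) \<le> 2 * R * C"
    by (smt (verit) norm_mult mult_right_mono norm_ge_zero)
  then have "R * ((R - cmod z) * cmod (G z)) \<le> R * (2 * C)" by (simp add: algebra_simps)
  then have "(R - cmod z) * cmod (G z) \<le> 2 * C" using R0 by simp
  moreover have "(R - cmod z) * cmod (G z) = (1 + 2 * cmod z) * cmod (G z) + 2 * C"
    using nz by (simp add: R_def q_def field_simps)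
  moreover have "(1 + 2 * cmod z) * cmod (G z) > 0" using nz by (intro mult_pos_pos add_pos_nonneg) auto
  ultimately show False by linarith
qed

text \<open>Riemann's theorem on removable singularities, applied at every point. Defining
  \<open>G\<close> as the limit of \<open>g\<close> makes the local extensions agree without any
  gluing.\<close>

lemma entire_extension:
  assumes g: "\<And>z0. \<exists>r>0. g holomorphic_on ball z0 r - {z0}"
    and lim: "\<And>z0. ((\<lambda>z. (z - z0) * g z) \<longlongrightarrow> 0) (at z0)"
  obtains G where "G holomorphic_on UNIV" "\<And>z. isCont g z \<Longrightarrow> G z = g z"
proof
  define G where "G = (\<lambda>z. Lim (at z) g)"
  show "G z = g z" if "isCont g z" for z
    using that unfolding G_def isCont_def by (intro tendsto_Lim) auto
  have "G field_differentiable at z0" for z0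
  proof -
    obtain r where r: "r > 0" "g holomorphic_on ball z0 r - {z0}" using g by blast
    obtain h where h: "h holomorphic_on ball z0 r" "\<And>z. z \<in> ball z0 r - {z0} \<Longrightarrow> h z = g z"
      using holomorphic_on_extend_lim[OF r(2)] lim[of z0] r(1) by auto
    have "G z = h z" if z: "z \<in> ball z0 r" for z
    proof -
      have "isCont h z"
        using h(1) z by (meson continuous_on_eq_continuous_at holomorphic_on_imp_continuous_on open_ball)
      then have "(h \<longlongrightarrow> h z) (at z)" by (simp add: isCont_def)
      moreover have "\<forall>\<^sub>F w in at z. h w = g w"
      proof -
        have "\<forall>\<^sub>F w in at z. w \<in> ball z0 r" using z by (intro eventually_at_in_open') auto
        moreover have "\<forall>\<^sub>F w in at z. w \<noteq> z0"
        proof (cases "z = z0")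
          case True then show ?thesis by (simp add: eventually_neq_at_within)
        next
          case False
          then have "\<forall>\<^sub>F w in at z. w \<in> - {z0}" by (intro eventually_at_in_open') auto
          then show ?thesis by simp
        qed
        ultimately show ?thesis by eventually_elim (use h(2) in auto)
      qed
      ultimately have "(g \<longlongrightarrow> h z) (at z)" by (rule Lim_transform_eventually)
      then show ?thesis unfolding G_def by (intro tendsto_Lim) auto
    qed
    then have "G holomorphic_on ball z0 r" using h(1) holomorphic_cong by metis
    then show ?thesis using r(1) by (meson centre_in_ball holomorphic_on_imp_differentiable_at open_ball)
  qed
  then show "G holomorphic_on UNIV" by (simp add: holomorphic_on_def field_differentiable_at_within)
qed

lemma continuous_ae_zero:
  fixes f :: "real \<Rightarrow> 'b::euclidean_space"
  assumes f: "continuous_on {a..b} f" and N: "negligible N" "\<And>x. x \<in> {a..b} - N \<Longrightarrow> f x = 0" and ab: "a < b"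
    and x: "x \<in> {a..b}"
  shows "f x = 0"
proof -
  have "integral {a..b} (\<lambda>x. norm (f x)) = integral {a..b} (\<lambda>x. 0)"
    by (rule integral_spike[OF N(1)]) (use N(2) in auto)
  then have "\<forall>x\<in>{a..b}. norm (f x) = 0"
    using integral_eq_0_iff[OF continuous_on_norm[OF f] ab] by simp
  then show ?thesis using x by simp
qed

lemma ac_deriv_zero:
  fixes F :: "real \<Rightarrow> 'b::euclidean_space"
  assumes "ac_deriv a b F f" "\<And>x. x \<in> {a..b} \<Longrightarrow> F x = 0"
  obtains N where "negligible N" "\<And>x. x \<in> {a..b} - N \<Longrightarrow> f x = 0"
proof -
  obtain N where N: "negligible N" "\<And>x. x \<in> {a<..<b} - N \<Longrightarrow> (F has_vector_derivative f x) (at x)"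
    using ac_deriv_differentiable[OF assms(1)] by blast
  show thesis
  proof (rule that[of "insert a (insert b N)"])
    show "negligible (insert a (insert b N))" using N by simp
    fix x assume x: "x \<in> {a..b} - insert a (insert b N)"
    then have "(F has_vector_derivative f x) (at x)" by (intro N(2)) auto
    moreover have "(F has_vector_derivative 0) (at x)"
      by (rule has_vector_derivative_transform_within_open[of "\<lambda>_. 0" 0 x "{a<..<b}"])
         (use x assms(2) in \<open>auto intro!: derivative_eq_intros\<close>)
    ultimately show "f x = 0" by (rule vector_derivative_unique_at)
  qed
qed

context hermitian_potential
begin

text \<open>If a solution vanishes then so do the right-hand sides of its system almost everywhere:
  the first gives \<open>Q\<close>, the second gives \<open>f\<close>. The resolvent is thus
  injective, which ends the proof of \<open>eigenfunctions_total\<close>.\<close>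

lemma sl_sol_zero:
  assumes S: "sl_sol z f Y Q" and Y: "\<And>x. x \<in> {0..pi} \<Longrightarrow> Y x = 0"
  shows "\<And>x. x \<in> {0..pi} \<Longrightarrow> Q x = 0" "\<exists>N. negligible N \<and> (\<forall>x\<in>{0..pi}-N. f x = 0)"
proof -
  obtain N where N: "negligible N" "\<And>x. x \<in> {0..pi} - N \<Longrightarrow> \<sigma> x *v Y x + Q x = 0"
    using ac_deriv_zero[of 0 pi Y "\<lambda>x. \<sigma> x *v Y x + Q x"] S Y unfolding sl_sol_def by blast
  show Q: "Q x = 0" if "x \<in> {0..pi}" for x
    by (rule continuous_ae_zero[OF sl_sol_continuous(2)[OF S] N(1) _ pi_gt_zero that]) (use N(2) Y in fastforce)
  obtain N' where N': "negligible N'"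
     "\<And>x. x \<in> {0..pi} - N' \<Longrightarrow> - (\<sigma> x *v Q x) - (\<sigma> x ** \<sigma> x) *v Y x - z *s Y x - f x = 0"
    using ac_deriv_zero[of 0 pi Q "\<lambda>x. - (\<sigma> x *v Q x) - (\<sigma> x ** \<sigma> x) *v Y x - z *s Y x - f x"] S Q
    unfolding sl_sol_def by blast
  have "f x = 0" if "x \<in> {0..pi} - N'" for x
    using N'(2)[OF that] Y[of x] Q[of x] that by simp
  then show "\<exists>N. negligible N \<and> (\<forall>x\<in>{0..pi}-N. f x = 0)" using N' by blast
qed

text \<open>Green's identity. In the derivative of the bracket formed with quasi-derivatives, the
  terms with \<open>\<sigma>\<close> and its square cancel because \<open>\<sigma>\<close> is
  Hermitian almost everywhere, so no derivative of \<open>\<sigma>\<close> appears.\<close>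

lemma lagrange_identity:
  assumes S: "sl_sol z f Y Q" and S': "sl_sol w g Y' Q'"
  shows "((\<lambda>x. - (z - cnj w) * hinner (Y x) (Y' x) - hinner (f x) (Y' x) + hinner (Y x) (g x)) has_integral
     ((hinner (Q pi) (Y' pi) - hinner (Y pi) (Q' pi)) - (hinner (Q 0) (Y' 0) - hinner (Y 0) (Q' 0)))) {0..pi}"
proof -
  have Y: "ac_deriv 0 pi Y (\<lambda>x. \<sigma> x *v Y x + Q x)" "ac_deriv 0 pi Y' (\<lambda>x. \<sigma> x *v Y' x + Q' x)"
    and Q: "ac_deriv 0 pi Q (\<lambda>x. - (\<sigma> x *v Q x) - (\<sigma> x ** \<sigma> x) *v Y x - z *s Y x - f x)"
      "ac_deriv 0 pi Q' (\<lambda>x. - (\<sigma> x *v Q' x) - (\<sigma> x ** \<sigma> x) *v Y' x - w *s Y' x - g x)"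
    using S S' by (auto simp: sl_sol_def)
  obtain N where N: "negligible N" "\<And>x. x \<in> {0..pi} - N \<Longrightarrow> hconj (\<sigma> x) = \<sigma> x"
    by (rule negligible_non_hermitian) blast
  note A = ac_deriv_diff[OF ac_deriv_bilinear[OF bounded_bilinear_hinner Q(1) Y(2)] ac_deriv_bilinear[OF bounded_bilinear_hinner Y(1) Q(2)]]
  have "ac_deriv 0 pi (\<lambda>x. hinner (Q x) (Y' x) - hinner (Y x) (Q' x))
     (\<lambda>x. - (z - cnj w) * hinner (Y x) (Y' x) - hinner (f x) (Y' x) + hinner (Y x) (g x))"
  proof (rule ac_deriv_cong[OF A _ N(1)])
    fix x assume x: "x \<in> {0..pi} - N"
    have h: "hinner u (\<sigma> x *v v) = hinner (\<sigma> x *v u) v" for u v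
      by (simp add: hinner_matrix_left N(2)[OF x])
    show "hinner (- (\<sigma> x *v Q x) - \<sigma> x ** \<sigma> x *v Y x - z *s Y x - f x) (Y' x) +
         hinner (Q x) (\<sigma> x *v Y' x + Q' x) -
         (hinner (\<sigma> x *v Y x + Q x) (Q' x) +
          hinner (Y x) (- (\<sigma> x *v Q' x) - \<sigma> x ** \<sigma> x *v Y' x - w *s Y' x - g x)) =
         - (z - cnj w) * hinner (Y x) (Y' x) - hinner (f x) (Y' x) + hinner (Y x) (g x)"
      by (simp add: hinner_simps matrix_vector_mul_assoc[symmetric] h algebra_simps)
  qed simp
  then show ?thesis by (auto simp: ac_deriv_def)
qed

end

section \<open>Solutions satisfying the left condition, and the characteristic matrix\<close>

locale sturm_liouville = hermitian_potential \<sigma> + left: boundary_data T1 H1 + right: boundary_data T2 H2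
  for \<sigma> :: "real \<Rightarrow> complex^'m^'m" and T1 H1 T2 H2 :: "complex^'m^'m"
begin

text \<open>The initial values are those of \<open>bdry_param\<close> with \<open>u = 0\<close>: the
  left boundary form vanishes and the complementary form equals \<open>v\<close>. Every solution
  with the left condition arises in this way, see \<open>phi_unique\<close>.\<close>

definition phi :: "complex \<Rightarrow> complex^'m \<Rightarrow> real \<Rightarrow> (complex^'m) \<times> (complex^'m)" where
  "phi z v = sl (\<lambda>_. 0) (T1 *v v) (H1 *v v + (v - T1 *v v)) z"

lemma zero_int: "(\<lambda>_. 0 :: complex^'m) absolutely_integrable_on {0..pi}" by simp

lemma phi_sol: "sl_sol z (\<lambda>_. 0) (\<lambda>x. fst (phi z v x)) (\<lambda>x. snd (phi z v x))"
  unfolding phi_def by (rule sl(2)[OF zero_int])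

lemma phi_0: "phi z v 0 = (T1 *v v, H1 *v v + (v - T1 *v v))"
  unfolding phi_def by (rule sl(1)[OF zero_int])

lemma phi_bdry: "bdry T1 H1 (fst (phi z v 0)) (snd (phi z v 0)) = 0"
  "left.bdry_perp (fst (phi z v 0)) (snd (phi z v 0)) = v"
  using left.bdry_of_param[of v 0] by (simp_all add: phi_0)

lemma phi_unique:
  assumes "sl_sol z (\<lambda>_. 0) Y Q" "bdry T1 H1 (Y 0) (Q 0) = 0" "x \<in> {0..pi}"
  shows "phi z (left.bdry_perp (Y 0) (Q 0)) x = (Y x, Q x)"
  using sl_unique[OF assms(1) zero_int assms(3)] left.bdry_param[OF assms(2) refl] by (simp add: phi_def)

lemma phi_lincomb:
  assumes "x \<in> {0..pi}"
  shows "phi z (c *s v + v') x = (c *s fst (phi z v x) + fst (phi z v' x), c *s snd (phi z v x) + snd (phi z v' x))"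
proof -
  have S: "sl_sol z (\<lambda>_. 0) (\<lambda>x. c *s fst (phi z v x) + fst (phi z v' x)) (\<lambda>x. c *s snd (phi z v x) + snd (phi z v' x))"
    using sl_sol_lincomb[OF phi_sol[of z v] phi_sol[of z v'], of c] by simp
  have e1: "c *s (T1 *v v) + T1 *v v' = T1 *v (c *s v + v')"
    by (simp add: matrix_vector_right_distrib matrix_vector_scale)
  have e2: "c *s (H1 *v v + (v - T1 *v v)) + (H1 *v v' + (v' - T1 *v v')) = H1 *v (c *s v + v') + (c *s v + v' - T1 *v (c *s v + v'))"
    by (simp add: matrix_vector_right_distrib matrix_vector_scale vec_eq_iff algebra_simps)
  show ?thesis
    using sl_unique[OF S zero_int assms] unfolding phi_0 fst_conv snd_conv e1 e2
    by (subst phi_def)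
qed

lemma phi_zero: "x \<in> {0..pi} \<Longrightarrow> phi z 0 x = 0"
  using phi_lincomb[of x z "-1" 0 0] by (simp add: prod_eq_iff vec_eq_iff)

lemma phi_scale: "x \<in> {0..pi} \<Longrightarrow> phi z (c *s v) x = (c *s fst (phi z v x), c *s snd (phi z v x))"
  using phi_lincomb[of x z c v 0] phi_zero[of x z] by simp

lemma phi_add: "x \<in> {0..pi} \<Longrightarrow> phi z (v + v') x = phi z v x + phi z v' x"
  using phi_lincomb[of x z 1 v v'] by (simp add: prod_eq_iff)

lemma phi_diff: "x \<in> {0..pi} \<Longrightarrow> phi z (v - v') x = phi z v x - phi z v' x"
  using phi_lincomb[of x z "-1" v' v] by (simp add: prod_eq_iff vec_eq_iff)

lemma phi_sum: "x \<in> {0..pi} \<Longrightarrow> phi z (\<Sum>i\<in>I. v i) x = (\<Sum>i\<in>I. phi z (v i) x)"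
  by (induction I rule: infinite_finite_induct) (auto simp: phi_zero phi_add)

lemma fst_phi_axis: "x \<in> {0..pi} \<Longrightarrow> fst (phi z v x) = (\<Sum>j\<in>UNIV. v $ j *s fst (phi z (axis j 1) x))"
  by (subst vec_sum_axis[of v]) (simp add: phi_sum phi_scale fst_sum)

lemma phi_continuous: "continuous_on {0..pi} (\<lambda>x. fst (phi z v x))"
  by (rule sl_sol_continuous(1)[OF phi_sol])

text \<open>The characteristic matrix: its kernel consists of the \<open>v\<close> for which
  \<open>phi z v\<close> also satisfies the right condition, that is, of the parameters of the
  eigenfunctions.\<close>

definition Delta :: "complex \<Rightarrow> complex^'m^'m" where
  "Delta z = matrix (\<lambda>v. bdry T2 H2 (fst (phi z v pi)) (snd (phi z v pi)))"

lemma Delta_works: "Delta z *v v = bdry T2 H2 (fst (phi z v pi)) (snd (phi z v pi))"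
  unfolding Delta_def
proof (rule matrix_works)
  show "Vector_Spaces.linear (*s) (*s) (\<lambda>v. bdry T2 H2 (fst (phi z v pi)) (snd (phi z v pi)))"
    by unfold_locales
      (auto simp: phi_add phi_scale bdry_add bdry_scale algebra_simps vector_add_ldistrib)
qed

lemma Delta_holomorphic: "(\<lambda>z. Delta z $ i $ j) holomorphic_on UNIV"
proof -
  have e: "Delta z $ i $ j = bdry T2 H2 (fst (phi z (axis j 1) pi)) (snd (phi z (axis j 1) pi)) $ i" for z
    by (simp add: Delta_def matrix_def)
  show ?thesis unfolding e phi_def
  proof (rule sl_holomorphic[OF zero_int, where h = "\<lambda>w. bdry T2 H2 (fst w) (snd w) $ i"])
    show "bounded_linear (\<lambda>w. bdry T2 H2 (fst w) (snd w) $ i)"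
      unfolding bdry_def
      by (intro bounded_linear_intros bounded_linear_compose[OF bounded_linear_vec_nth]
          bounded_linear_compose[OF matrix_vector_mul_bounded_linear])
  qed (auto simp: bdry_scale)
qed

lemma phi_norm_le:
  "\<exists>B>0. (\<forall>z v. \<forall>x\<in>{0..pi}. cmod z \<le> R \<longrightarrow> norm (phi z v x) \<le> B * norm v) \<and>
    (\<forall>z z' v. \<forall>x\<in>{0..pi}. cmod z \<le> R \<longrightarrow> cmod z' \<le> R \<longrightarrow> norm (phi z v x - phi z' v x) \<le> B * norm v * cmod (z - z'))"
proof -
  define C where "C = 2 * norm T1 + norm H1 + 1"
  have C: "C \<ge> 1" by (simp add: C_def)
  have init: "norm (T1 *v v, H1 *v v + (v - T1 *v v)) \<le> C * norm v" for v
  proof -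
    have "norm (T1 *v v, H1 *v v + (v - T1 *v v)) \<le> norm (T1 *v v) + (norm (H1 *v v) + (norm v + norm (T1 *v v)))"
      by (intro order_trans[OF norm_Pair_le] add_mono order_refl order_trans[OF norm_triangle_ineq] norm_triangle_ineq4)
    also have "\<dots> \<le> norm T1 * norm v + (norm H1 * norm v + (norm v + norm T1 * norm v))"
      by (intro add_mono norm_matrix_vector_le order_refl)
    finally show ?thesis by (simp add: C_def algebra_simps)
  qed
  have g: "growth R > 0" by (rule growth_pos)
  have b1: "norm (phi z v x) \<le> C * growth R * norm v" if "cmod z \<le> R" "x \<in> {0..pi}" for z v x
  proof -
    have "norm (phi z v x) \<le> norm (T1 *v v, H1 *v v + (v - T1 *v v)) * growth R"
      using sl_bounded[OF zero_int that, of "T1 *v v" "H1 *v v + (v - T1 *v v)"] by (simp add: phi_def)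
    also have "\<dots> \<le> (C * norm v) * growth R" using g init by (intro mult_right_mono) auto
    finally show ?thesis by (simp add: algebra_simps)
  qed
  have b2: "norm (phi z v x - phi z' v x) \<le> C * growth R * pi * growth R * norm v * cmod (z - z')"
    if A: "cmod z \<le> R" "cmod z' \<le> R" "x \<in> {0..pi}" for z z' v x
  proof -
    have "norm (phi z v x - phi z' v x) \<le> norm (T1 *v v, H1 *v v + (v - T1 *v v)) * growth R * pi * growth R * cmod (z - z')"
      using sl_lipschitz[OF zero_int A, of "T1 *v v" "H1 *v v + (v - T1 *v v)"] by (simp add: phi_def)
    also have "\<dots> \<le> (C * norm v) * growth R * pi * growth R * cmod (z - z')"
      using g init by (intro mult_right_mono) auto
    finally show ?thesis by (simp add: algebra_simps)
  qed
  show ?thesis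
  proof (intro exI[of _ "C * growth R + C * growth R * pi * growth R"] conjI allI ballI impI)
    have p: "C * growth R > 0" "C * growth R * pi * growth R > 0" using C g by auto
    show "C * growth R + C * growth R * pi * growth R > 0" using p by linarith
    show "norm (phi z v x) \<le> (C * growth R + C * growth R * pi * growth R) * norm v"
      if "x \<in> {0..pi}" "cmod z \<le> R" for z v x
      using b1[OF that(2,1), of v] p mult_right_mono[of "C * growth R" "C * growth R + C * growth R * pi * growth R" "norm v"] by force
    show "norm (phi z v x - phi z' v x) \<le> (C * growth R + C * growth R * pi * growth R) * norm v * cmod (z - z')"
      if "x \<in> {0..pi}" "cmod z \<le> R" "cmod z' \<le> R" for z z' v x
      using b2[OF that(2,3,1), of v] p
        mult_right_mono[of "C * growth R * pi * growth R" "C * growth R + C * growth R * pi * growth R" "norm v * cmod (z - z')"]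
      by (simp add: mult.assoc)
  qed
qed

lemma phi_L2_pos:
  assumes "v \<noteq> 0"
  shows "integral {0..pi} (\<lambda>x. (norm (fst (phi z v x)))\<^sup>2) > 0"
proof (rule ccontr)
  assume "\<not> ?thesis"
  moreover have "integral {0..pi} (\<lambda>x. (norm (fst (phi z v x)))\<^sup>2) \<ge> 0"
    by (intro integral_nonneg integrable_continuous_real continuous_intros phi_continuous) auto
  ultimately have "integral {0..pi} (\<lambda>x. (norm (fst (phi z v x)))\<^sup>2) = 0" by linarith
  then have "\<forall>x\<in>{0..pi}. (norm (fst (phi z v x)))\<^sup>2 = 0"
    by (subst (asm) integral_eq_0_iff) (auto intro!: continuous_intros phi_continuous)
  then have Y: "fst (phi z v x) = 0" if "x \<in> {0..pi}" for x using that by simp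
  have "snd (phi z v 0) = 0" by (rule sl_sol_zero(1)[OF phi_sol Y]) auto
  then have "left.bdry_perp (fst (phi z v 0)) (snd (phi z v 0)) = 0"
    using Y[of 0] by (simp add: left.bdry_perp_def)
  then show False using phi_bdry(2) assms by simp
qed

text \<open>A compactness argument: the squared norm of \<open>phi z v\<close> is positive and
  continuous, indeed Lipschitz, on the product of the disc with the unit sphere, so it has a
  positive minimum there. Homogeneity in \<open>v\<close> does the rest.\<close>

lemma phi_L2_lower:
  "\<exists>c>0. \<forall>z v. cmod z \<le> R \<longrightarrow> c * (norm v)\<^sup>2 \<le> integral {0..pi} (\<lambda>x. (norm (fst (phi z v x)))\<^sup>2)"
proof -
  obtain B where B: "B > 0" "\<And>z v x. cmod z \<le> R \<Longrightarrow> x \<in> {0..pi} \<Longrightarrow> norm (phi z v x) \<le> B * norm v"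
    "\<And>z z' v x. cmod z \<le> R \<Longrightarrow> cmod z' \<le> R \<Longrightarrow> x \<in> {0..pi} \<Longrightarrow> norm (phi z v x - phi z' v x) \<le> B * norm v * cmod (z - z')"
    using phi_norm_le[of R] by blast
  define K :: "(complex \<times> (complex^'m)) set" where "K = cball 0 R \<times> sphere 0 1"
  define F where "F = (\<lambda>p :: complex \<times> (complex^'m). integral {0..pi} (\<lambda>x. (norm (fst (phi (fst p) (snd p) x)))\<^sup>2))"
  have int: "(\<lambda>x. (norm (fst (phi z v x)))\<^sup>2) integrable_on {0..pi}" for z v
    by (intro integrable_continuous_real continuous_intros phi_continuous)
  have "(pi * (4 * B * B))-lipschitz_on K F"
  proof (rule lipschitz_onI)
    fix p q assume pq: "p \<in> K" "q \<in> K"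
    obtain z v z' v' where e: "p = (z, v)" "q = (z', v')" by (cases p, cases q) auto
    have A: "cmod z \<le> R" "cmod z' \<le> R" "norm v = 1" "norm v' = 1" using pq by (auto simp: K_def e)
    have d: "cmod (z - z') \<le> dist p q" "norm (v - v') \<le> dist p q"
      using dist_fst_le[of p q] dist_snd_le[of p q] by (auto simp: e dist_norm)
    have pt: "\<bar>(norm (fst (phi z v x)))\<^sup>2 - (norm (fst (phi z' v' x)))\<^sup>2\<bar> \<le> 4 * B * B * dist p q" if x: "x \<in> {0..pi}" for x
    proof -
      have n: "norm (fst (phi z v x)) \<le> B" "norm (fst (phi z' v' x)) \<le> B"
        using order_trans[OF norm_fst_snd_le(1) B(2)[OF A(1) x, of v]] order_trans[OF norm_fst_snd_le(1) B(2)[OF A(2) x, of v']] A by auto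
      have "phi z v x - phi z' v' x = phi z (v - v') x + (phi z v' x - phi z' v' x)"
        by (simp add: phi_diff[OF x])
      then have "norm (phi z v x - phi z' v' x) \<le> norm (phi z (v - v') x) + norm (phi z v' x - phi z' v' x)"
        by (metis norm_triangle_ineq)
      also have "\<dots> \<le> B * norm (v - v') + B * norm v' * cmod (z - z')" by (intro add_mono B A x)
      also have "\<dots> \<le> B * dist p q + B * dist p q" using A B(1) d by (intro add_mono) auto
      finally have "norm (fst (phi z v x) - fst (phi z' v' x)) \<le> 2 * B * dist p q"
        using norm_fst_snd_le(1)[of "phi z v x - phi z' v' x"] by simp
      then have 1: "\<bar>norm (fst (phi z v x)) - norm (fst (phi z' v' x))\<bar> \<le> 2 * B * dist p q"
        using norm_triangle_ineq3[of "fst (phi z v x)" "fst (phi z' v' x)"] by linarith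
      have "\<bar>(norm (fst (phi z v x)))\<^sup>2 - (norm (fst (phi z' v' x)))\<^sup>2\<bar> =
          \<bar>norm (fst (phi z v x)) - norm (fst (phi z' v' x))\<bar> * (norm (fst (phi z v x)) + norm (fst (phi z' v' x)))"
        by (simp add: power2_eq_square square_diff_square_factored abs_mult mult.commute)
      also have "\<dots> \<le> (2 * B * dist p q) * (B + B)"
        using B(1) by (intro mult_mono 1 add_mono n) auto
      finally show ?thesis by (simp add: algebra_simps)
    qed
    have "norm (integral {0..pi} (\<lambda>x. (norm (fst (phi z v x)))\<^sup>2 - (norm (fst (phi z' v' x)))\<^sup>2)) \<le> integral {0..pi} (\<lambda>x. 4 * B * B * dist p q)"
      by (rule integral_norm_bound_integral) (use pt in \<open>auto intro: integrable_diff int\<close>)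
    then show "dist (F p) (F q) \<le> pi * (4 * B * B) * dist p q"
      by (simp add: F_def e dist_norm integral_diff[OF int int] mult_ac)
  qed (use B in auto)
  then have cF: "continuous_on K F" by (rule lipschitz_on_continuous_on)
  have cK: "compact K" unfolding K_def by (intro compact_Times) auto
  have Fpos: "F p > 0" if "p \<in> K" for p
    unfolding F_def by (rule phi_L2_pos) (use that in \<open>auto simp: K_def\<close>)
  have "\<exists>c>0. \<forall>p\<in>K. c \<le> F p"
  proof (cases "K = {}")
    case True then show ?thesis by (intro exI[of _ 1]) auto
  next
    case False
    then obtain p where "p \<in> K" "\<And>q. q \<in> K \<Longrightarrow> F p \<le> F q"
      using continuous_attains_inf[OF cK _ cF] by blast
    then show ?thesis using Fpos by blast
  qed
  then obtain c where c: "c > 0" "\<And>p. p \<in> K \<Longrightarrow> c \<le> F p" by blast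
  show ?thesis
  proof (intro exI[of _ c] conjI allI impI c(1))
    fix z v assume z: "cmod z \<le> R"
    show "c * (norm v)\<^sup>2 \<le> integral {0..pi} (\<lambda>x. (norm (fst (phi z v x)))\<^sup>2)"
    proof (cases "v = 0")
      case True
      then show ?thesis by (auto intro!: integral_nonneg int)
    next
      case False
      define u where "u = complex_of_real (1 / norm v) *s v"
      have u: "norm u = 1" using False by (simp add: u_def norm_scalar_vec norm_divide)
      have v: "v = complex_of_real (norm v) *s u" using False by (simp add: u_def vec_eq_iff)
      have "c \<le> F (z, u)" by (rule c(2)) (use z u in \<open>auto simp: K_def\<close>)
      then have "c * (norm v)\<^sup>2 \<le> (norm v)\<^sup>2 * integral {0..pi} (\<lambda>x. (norm (fst (phi z u x)))\<^sup>2)"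
        using mult_left_mono[of c "F (z, u)" "(norm v)\<^sup>2"] by (simp add: F_def mult.commute)
      also have "\<dots> = integral {0..pi} (\<lambda>x. (norm v)\<^sup>2 * (norm (fst (phi z u x)))\<^sup>2)" by simp
      also have "\<dots> = integral {0..pi} (\<lambda>x. (norm (fst (phi z v x)))\<^sup>2)"
      proof (rule integral_cong)
        fix x assume "x \<in> {0..pi}"
        then have "fst (phi z v x) = complex_of_real (norm v) *s fst (phi z u x)"
          using phi_scale[of x z "complex_of_real (norm v)" u] v by simp
        then show "(norm v)\<^sup>2 * (norm (fst (phi z u x)))\<^sup>2 = (norm (fst (phi z v x)))\<^sup>2"
          by (simp add: norm_scalar_vec power_mult_distrib)
      qed
      finally show ?thesis .
    qed
  qed
qed

text \<open>The pairing of a solution with itself. The left condition removes the terms at 0, and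
  \<open>bdry_green\<close> expresses those at \<open>pi\<close> through the right boundary
  form.\<close>

lemma green_self:
  assumes S: "sl_sol z f Y Q" and b: "bdry T1 H1 (Y 0) (Q 0) = 0"
  shows "((\<lambda>x. - (z - cnj z) * of_real ((norm (Y x))\<^sup>2) - hinner (f x) (Y x) + hinner (Y x) (f x)) has_integral
     (hinner (bdry T2 H2 (Y pi) (Q pi)) (right.bdry_perp (Y pi) (Q pi)) -
      hinner (right.bdry_perp (Y pi) (Q pi)) (bdry T2 H2 (Y pi) (Q pi)))) {0..pi}"
  using lagrange_identity[OF S S] left.bdry_green[of "Q 0" "Y 0" "Y 0" "Q 0"] b right.bdry_green[of "Q pi" "Y pi" "Y pi" "Q pi"]
  by (simp add: hinner_simps hinner_self)

text \<open>The linear rate in \<open>\<bar>Im z\<bar>\<close> forces the poles of the inverse of \<open>Delta\<close> to be simple.\<close>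

lemma Delta_lower:
  "\<exists>c>0. \<forall>z v. cmod z \<le> R \<longrightarrow> c * \<bar>Im z\<bar> * norm v \<le> norm (Delta z *v v)"
proof -
  obtain c where c: "c > 0" "\<And>z v. cmod z \<le> R \<Longrightarrow> c * (norm v)\<^sup>2 \<le> integral {0..pi} (\<lambda>x. (norm (fst (phi z v x)))\<^sup>2)"
    using phi_L2_lower[of R] by blast
  obtain B where B: "B > 0" "\<And>z v x. cmod z \<le> R \<Longrightarrow> x \<in> {0..pi} \<Longrightarrow> norm (phi z v x) \<le> B * norm v"
    using phi_norm_le[of R] by blast
  define D where "D = 2 * norm T2 + 1"
  have D: "D \<ge> 1" by (simp add: D_def)
  show ?thesis
  proof (intro exI[of _ "c / (D * B)"] conjI allI impI)
    show "c / (D * B) > 0" using c B D by auto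
    fix z v assume z: "cmod z \<le> R"
    define Y Q where "Y = fst (phi z v pi)" and "Q = snd (phi z v pi)"
    \<comment> \<open>Green's identity for \<open>phi z v\<close> with itself reads \<open>- (z -
      cnj z) * A = hinner (Delta z *v v) P - hinner P (Delta z *v v)\<close>. Since \<open>A\<close>
      is at least \<open>c * (norm v)\<^sup>2\<close> and \<open>P\<close> is at most of order
      \<open>norm v\<close>, the vector \<open>Delta z *v v\<close> cannot be small.\<close>
    define P where "P = right.bdry_perp Y Q"
    define A where "A = integral {0..pi} (\<lambda>x. (norm (fst (phi z v x)))\<^sup>2)"
    have "norm P \<le> norm T2 * norm Y + (norm Q + norm T2 * norm Q)"
      unfolding P_def right.bdry_perp_def
      by (intro order_trans[OF norm_triangle_ineq] add_mono norm_matrix_vector_le order_trans[OF norm_triangle_ineq4] order_refl)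
    also have "\<dots> \<le> norm T2 * (B * norm v) + (B * norm v + norm T2 * (B * norm v))"
      using B(2)[OF z, of pi v] norm_fst_snd_le[of "phi z v pi"]
      by (intro add_mono mult_left_mono) (auto simp: Y_def Q_def)
    finally have P: "norm P \<le> D * B * norm v" by (simp add: D_def algebra_simps)
    have "((\<lambda>x. - (z - cnj z) * of_real ((norm (fst (phi z v x)))\<^sup>2)) has_integral (hinner (Delta z *v v) P - hinner P (Delta z *v v))) {0..pi}"
      using green_self[OF phi_sol phi_bdry(1), of z v] by (simp add: hinner_simps Delta_works P_def Y_def Q_def)
    moreover have "((\<lambda>x. - (z - cnj z) * of_real ((norm (fst (phi z v x)))\<^sup>2)) has_integral (- (z - cnj z) * of_real A)) {0..pi}"
      unfolding A_def
      by (intro has_integral_mult_right has_integral_of_real integrable_integral integrable_continuous_real continuous_intros phi_continuous)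
    ultimately have "- (z - cnj z) * of_real A = hinner (Delta z *v v) P - hinner P (Delta z *v v)"
      using has_integral_unique by blast
    then have "cmod ((z - cnj z) * of_real A) = cmod (hinner (Delta z *v v) P - hinner P (Delta z *v v))"
      by (metis norm_minus_cancel mult_minus_left)
    also have "\<dots> \<le> cmod (hinner (Delta z *v v) P) + cmod (hinner P (Delta z *v v))" by (rule norm_triangle_ineq4)
    also have "\<dots> \<le> norm (Delta z *v v) * norm P + norm P * norm (Delta z *v v)" by (intro add_mono norm_hinner_le)
    also have "cmod ((z - cnj z) * of_real A) = 2 * \<bar>Im z\<bar> * \<bar>A\<bar>"
      by (simp add: complex_diff_cnj norm_mult)
    finally have "\<bar>Im z\<bar> * \<bar>A\<bar> \<le> norm (Delta z *v v) * norm P" by (simp add: mult.commute)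
    moreover have "\<bar>Im z\<bar> * A \<le> \<bar>Im z\<bar> * \<bar>A\<bar>" by (intro mult_left_mono) auto
    ultimately have 1: "\<bar>Im z\<bar> * A \<le> norm (Delta z *v v) * norm P" by linarith
    have "\<bar>Im z\<bar> * (c * (norm v)\<^sup>2) \<le> \<bar>Im z\<bar> * A" unfolding A_def by (intro mult_left_mono c z) auto
    also have "\<dots> \<le> norm (Delta z *v v) * (D * B * norm v)" using 1 P by (meson mult_left_mono norm_ge_zero order_trans)
    finally have "(c * \<bar>Im z\<bar> * norm v) * norm v \<le> (D * B * norm (Delta z *v v)) * norm v"
      by (simp add: power2_eq_square algebra_simps)
    then have "c * \<bar>Im z\<bar> * norm v \<le> D * B * norm (Delta z *v v)"
      using B(1) D by (cases "v = 0") auto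
    then show "c / (D * B) * \<bar>Im z\<bar> * norm v \<le> norm (Delta z *v v)"
      using B(1) D by (simp add: field_simps)
  qed
qed

lemma det_nonzero_iff: "det (A :: complex^'m^'m) \<noteq> 0 \<longleftrightarrow> (\<forall>v. A *v v = 0 \<longrightarrow> v = 0)"
  by (simp add: invertible_det_nz[symmetric] invertible_left_inverse matrix_left_invertible_ker)

lemma det_Delta_nonreal:
  assumes "Im z \<noteq> 0"
  shows "det (Delta z) \<noteq> 0"
  unfolding det_nonzero_iff
proof (intro allI impI)
  fix v assume v: "Delta z *v v = 0"
  obtain c where "c > 0" "c * \<bar>Im z\<bar> * norm v \<le> norm (Delta z *v v)"
    using Delta_lower[of "cmod z"] by (metis order_refl)
  then show "v = 0" using v assms by (simp add: mult_le_0_iff)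
qed

lemma det_Delta_holomorphic: "(\<lambda>z. det (Delta z)) holomorphic_on UNIV"
  by (intro det_holomorphic_on Delta_holomorphic)

text \<open>The determinant is entire and nonzero at \<open>\<i>\<close>, so its zeros are
  isolated.\<close>

lemma eventually_det_Delta: "\<forall>\<^sub>F z in at z0. det (Delta z) \<noteq> 0"
  using non_zero_neighbour_alt[OF det_Delta_holomorphic open_UNIV connected_UNIV UNIV_I UNIV_I det_Delta_nonreal[of \<i>], of z0]
  by (auto elim: eventually_mono)

text \<open>The inverse of \<open>Delta z\<close> applied to \<open>b\<close>, written by Cramer's
  rule so that it is visibly a quotient of entire functions. Where the determinant is 0 the value is
  the zero vector, by the convention for division.\<close>

definition cramer_sol :: "complex \<Rightarrow> complex^'m \<Rightarrow> complex^'m" where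
  "cramer_sol z b = (\<chi> k. det (\<chi> i j. if j = k then b $ i else Delta z $ i $ j) / det (Delta z))"

lemma cramer_sol: "det (Delta z) \<noteq> 0 \<Longrightarrow> Delta z *v cramer_sol z b = b"
  using cramer[of "Delta z"] by (simp add: cramer_sol_def)

lemma cramer_sol_holomorphic:
  assumes "\<And>i. (\<lambda>z. b z $ i) holomorphic_on UNIV"
  shows "(\<lambda>z. cramer_sol z (b z) $ k) holomorphic_on {z. det (Delta z) \<noteq> 0}"
proof -
  have "(\<lambda>z. det (\<chi> i j. if j = k then b z $ i else Delta z $ i $ j)) holomorphic_on {z. det (Delta z) \<noteq> 0}"
  proof (rule det_holomorphic_on)
    show "(\<lambda>z. (\<chi> i j. if j = k then b z $ i else Delta z $ i $ j) $ i $ j) holomorphic_on {z. det (Delta z) \<noteq> 0}" for i j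
      by (cases "j = k") (auto intro: holomorphic_on_subset[OF assms] holomorphic_on_subset[OF Delta_holomorphic])
  qed
  then show ?thesis unfolding cramer_sol_def
    by (auto intro!: holomorphic_on_divide holomorphic_on_subset[OF det_Delta_holomorphic])
qed

text \<open>Approaching the real point vertically, \<open>Delta_lower\<close> bounds the solution by
  a multiple of 1 / |Im z|, so its product with \<open>z - p\<close> stays bounded along a sequence.
  A meromorphic function that is bounded along one sequence tending to \<open>p\<close> has no pole
  at \<open>p\<close>.\<close>

lemma cramer_sol_simple_pole:
  assumes b: "\<And>i. (\<lambda>z. b z $ i) holomorphic_on UNIV"
  obtains \<omega> where "\<And>k. ((\<lambda>z. (z - of_real l) * cramer_sol z (b z) $ k) \<longlongrightarrow> \<omega> $ k) (at (of_real l))"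
    "Delta (of_real l) *v \<omega> = 0"
proof -
  define p where "p = complex_of_real l"
  define h where "h = (\<lambda>k z. (z - p) * cramer_sol z (b z) $ k)"
  \<comment> \<open>On the vertical line through \<open>p\<close> the distance to \<open>p\<close>
    equals the imaginary part, which matches the rate in \<open>Delta_lower\<close>.
    \<open>Suc n\<close> keeps the points off \<open>p\<close>.\<close>
  define zz where "zz = (\<lambda>n. p + \<i> * of_real (1 / real (Suc n)))"
  have bcont: "isCont (\<lambda>z. b z $ i) z" for i z
    using holomorphic_on_imp_continuous_on[OF b[of i]] by (simp add: continuous_on_eq_continuous_at)
  have zz: "zz \<longlonglongrightarrow> p"
  proof -
    have "(\<lambda>n. p + \<i> * of_real (1 / real (Suc n))) \<longlonglongrightarrow> p + \<i> * of_real 0"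
      by (intro tendsto_intros LIMSEQ_Suc lim_1_over_n)
    then show ?thesis by (simp add: zz_def)
  qed
  have zzp: "zz n \<noteq> p" for n by (simp add: zz_def del: of_nat_Suc)
  have zzat: "filterlim zz (at p) sequentially"
    using zz zzp by (simp add: filterlim_at)
  have detzz: "det (Delta (zz n)) \<noteq> 0" for n
    by (rule det_Delta_nonreal) (simp add: zz_def p_def)
  obtain c where c: "c > 0" "\<And>z v. cmod z \<le> cmod p + 1 \<Longrightarrow> c * \<bar>Im z\<bar> * norm v \<le> norm (Delta z *v v)"
    using Delta_lower[of "cmod p + 1"] by blast
  have bz: "(\<lambda>n. b (zz n)) \<longlonglongrightarrow> b p"
    by (rule vec_tendstoI) (rule isCont_tendsto_compose[OF bcont zz])
  have "bounded (range (\<lambda>n. b (zz n)))" using bz by (rule convergent_imp_bounded)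
  then obtain M where "\<forall>y\<in>range (\<lambda>n. b (zz n)). norm y \<le> M" unfolding bounded_iff by blast
  then have M: "norm (b (zz n)) \<le> M" for n by auto
  have hb: "cmod (h k (zz n)) \<le> M / c" for k n
  proof -
    have "cmod (zz n - p) = cmod (\<i> * of_real (1 / real (Suc n)))" by (simp add: zz_def)
    also have "\<dots> = 1 / real (Suc n)" unfolding norm_mult norm_of_real by simp
    finally have i2: "cmod (zz n - p) = 1 / real (Suc n)" .
    have "1 / real (Suc n) \<le> 1" by simp
    then have "cmod (zz n) \<le> cmod p + 1"
      using norm_triangle_sub[of "zz n" p] i2 by linarith
    moreover have "Im (zz n) = 1 / real (Suc n)" by (simp add: zz_def p_def)
    ultimately have i: "Im (zz n) = 1 / real (Suc n)" "cmod (zz n - p) = 1 / real (Suc n)" "cmod (zz n) \<le> cmod p + 1"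
      using i2 by blast+
    have "c * (1 / real (Suc n)) * norm (cramer_sol (zz n) (b (zz n))) \<le> norm (b (zz n))"
      using c(2)[OF i(3), of "cramer_sol (zz n) (b (zz n))"] cramer_sol[OF detzz] i by simp
    then have "c * (1 / real (Suc n) * norm (cramer_sol (zz n) (b (zz n)))) \<le> M" using M[of n] by (simp add: mult.assoc)
    then have "1 / real (Suc n) * norm (cramer_sol (zz n) (b (zz n))) \<le> M / c" using c(1) by (simp add: field_simps)
    moreover have "cmod (h k (zz n)) \<le> 1 / real (Suc n) * norm (cramer_sol (zz n) (b (zz n)))"
      unfolding h_def norm_mult i(2) by (intro mult_left_mono component_le_norm_cart Finite_Cartesian_Product.norm_nth_le) auto
    ultimately show ?thesis by linarith
  qed
  have "\<exists>x. (h k \<longlongrightarrow> x) (at p)" for k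
  proof -
    have num: "(\<lambda>z. det (\<chi> i j. if j = k then b z $ i else Delta z $ i $ j)) holomorphic_on UNIV"
    proof (rule det_holomorphic_on)
      show "(\<lambda>z. (\<chi> i j. if j = k then b z $ i else Delta z $ i $ j) $ i $ j) holomorphic_on UNIV" for i j
        by (cases "j = k") (auto intro: b Delta_holomorphic)
    qed
    have "h k meromorphic_on {p}"
    proof -
      have "(\<lambda>z. det (\<chi> i j. if j = k then b z $ i else Delta z $ i $ j)) meromorphic_on {p}"
        "(\<lambda>z. det (Delta z)) meromorphic_on {p}"
        using num det_Delta_holomorphic
        by (auto intro!: analytic_on_imp_meromorphic_on intro: analytic_on_subset[of _ UNIV] simp: analytic_on_open)
      then have "(\<lambda>z. (z - p) * (det (\<chi> i j. if j = k then b z $ i else Delta z $ i $ j) / det (Delta z))) meromorphic_on {p}"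
        by (intro meromorphic_intros)
      then show ?thesis by (simp add: h_def[abs_def] cramer_sol_def)
    qed
    then have "not_essential (h k) p" by (rule meromorphic_on_not_essential)
    \<comment> \<open>At a pole the modulus would tend to infinity along \<open>zz\<close>, against
      \<open>hb\<close>.\<close>
    moreover have "\<not> is_pole (h k) p"
    proof
      assume "is_pole (h k) p"
      then have "filterlim (h k) at_infinity (at p)" by (simp add: is_pole_def)
      then have "filterlim (\<lambda>n. h k (zz n)) at_infinity sequentially"
        using zzat by (rule filterlim_compose)
      then have "\<forall>\<^sub>F n in sequentially. M / c + 1 \<le> cmod (h k (zz n))"
        using filterlim_at_infinity_imp_norm_at_top by (auto simp: filterlim_at_top)
      then show False using hb[of k] by (auto simp: eventually_sequentially) (smt (verit) order_refl)
    qed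
    ultimately show ?thesis by (auto simp: not_essential_def)
  qed
  then obtain \<omega>f where \<omega>f: "\<And>k. (h k \<longlongrightarrow> \<omega>f k) (at p)" by metis
  define \<omega> where "\<omega> = (\<chi> k. \<omega>f k)"
  have \<omega>: "(h k \<longlongrightarrow> \<omega> $ k) (at p)" for k using \<omega>f by (simp add: \<omega>_def)
  \<comment> \<open>The limit of the equation \<open>Delta z *v h = (z - p) *s b z\<close> along
    \<open>zz\<close>; its right-hand side tends to 0, which puts \<open>\<omega>\<close> into the
    kernel.\<close>
  have A: "(\<lambda>n. (Delta (zz n) *v (\<chi> k. h k (zz n))) $ i) \<longlonglongrightarrow> (Delta p *v \<omega>) $ i" for i
    unfolding matrix_vector_mult_def
    using holomorphic_on_imp_continuous_on[OF Delta_holomorphic]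
    by (auto intro!: tendsto_intros filterlim_compose[OF \<omega> zzat] isCont_tendsto_compose[OF _ zz] simp: continuous_on_eq_continuous_at)
  have B: "(Delta (zz n) *v (\<chi> k. h k (zz n))) $ i = (zz n - p) * b (zz n) $ i" for n i
  proof -
    have "(\<chi> k. h k (zz n)) = (zz n - p) *s cramer_sol (zz n) (b (zz n))" by (simp add: vec_eq_iff h_def algebra_simps)
    then show ?thesis by (simp only: matrix_vector_scale cramer_sol[OF detzz] vector_smult_component)
  qed
  have C: "(\<lambda>n. (zz n - p) * b (zz n) $ i) \<longlonglongrightarrow> (p - p) * b p $ i" for i
    by (intro tendsto_intros zz isCont_tendsto_compose[OF bcont])
  have "(Delta p *v \<omega>) $ i = 0" for i
    using LIMSEQ_unique[OF A[of i, unfolded B] C[of i]] by simp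
  then have "Delta p *v \<omega> = 0" by (simp add: vec_eq_iff)
  with \<omega> show thesis using that unfolding h_def p_def by blast
qed

text \<open>With \<open>Y z\<close> the resolvent applied to \<open>f\<close>, the function
  \<open>g z\<close>, the pairing of \<open>Y z\<close> with \<open>f\<close>, has its possible
  poles at eigenvalues only. They are simple, and the residue is the pairing of an eigenfunction
  with \<open>f\<close>, hence 0. So \<open>g\<close> extends to an entire function, to which
  \<open>entire_inverse_Im_bound\<close> applies.\<close>

lemma eigenfunctions_total:
  assumes f: "L2_on {0<..<pi} f"
    and orth: "\<And>(l::real) v. Delta (of_real l) *v v = 0 \<Longrightarrow>
      integral {0..pi} (\<lambda>x. hinner (fst (phi (of_real l) v x)) (f x)) = 0"
  shows "\<exists>N. negligible N \<and> (\<forall>x\<in>{0..pi} - N. f x = 0)"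
proof -
  have fi: "f absolutely_integrable_on {0..pi}" by (rule L2_on_imp_absolutely_integrable[OF f])
  \<comment> \<open>A particular solution with zero initial data. Adding \<open>phi z (w z)\<close>
    keeps the left condition, and \<open>w\<close> is chosen to restore the right one wherever the
    determinant is nonzero.\<close>
  define up where "up = sl f 0 0"
  have up: "sl_sol z f (\<lambda>x. fst (up z x)) (\<lambda>x. snd (up z x))" "up z 0 = (0, 0)" for z
    unfolding up_def by (rule sl(2)[OF fi], rule sl(1)[OF fi])
  define b where "b = (\<lambda>z. - bdry T2 H2 (fst (up z pi)) (snd (up z pi)))"
  have bh: "(\<lambda>z. b z $ i) holomorphic_on UNIV" for i
    unfolding b_def up_def
  proof (rule sl_holomorphic[OF fi, where h = "\<lambda>w. (- bdry T2 H2 (fst w) (snd w)) $ i"])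
    show "bounded_linear (\<lambda>w. (- bdry T2 H2 (fst w) (snd w)) $ i)"
      unfolding bdry_def
      by (intro bounded_linear_intros bounded_linear_minus bounded_linear_compose[OF bounded_linear_vec_nth]
          bounded_linear_compose[OF matrix_vector_mul_bounded_linear])
  qed (auto simp: bdry_scale)
  define w where "w = (\<lambda>z. cramer_sol z (b z))"
  define Y where "Y = (\<lambda>z x. fst (phi z (w z) x) + fst (up z x))"
  define Q where "Q = (\<lambda>z x. snd (phi z (w z) x) + snd (up z x))"
  have YQ: "sl_sol z f (Y z) (Q z)" for z
    using sl_sol_lincomb[OF phi_sol[of z "w z"] up(1)[of z], of 1] by (simp add: Y_def[abs_def] Q_def[abs_def])
  have b0: "bdry T1 H1 (Y z 0) (Q z 0) = 0" for z
    using phi_bdry(1)[of z "w z"] by (simp add: Y_def Q_def up(2))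
  have bpi: "bdry T2 H2 (Y z pi) (Q z pi) = 0" if "det (Delta z) \<noteq> 0" for z
    using cramer_sol[OF that, of "b z"] by (simp add: Y_def Q_def bdry_add Delta_works w_def b_def)
  \<comment> \<open>By \<open>geq\<close> this depends on \<open>z\<close> through the entire
    functions \<open>P\<close> and \<open>E j\<close> and the vector \<open>w z\<close>, so only
    \<open>w\<close> can produce poles.\<close>
  define g where "g = (\<lambda>z. integral {0..pi} (\<lambda>x. hinner (Y z x) (f x)))"
  define E where "E = (\<lambda>j z. integral {0..pi} (\<lambda>x. hinner (fst (phi z (axis j 1) x)) (f x)))"
  define P where "P = (\<lambda>z. integral {0..pi} (\<lambda>x. hinner (fst (up z x)) (f x)))"
  have Eh: "E j holomorphic_on UNIV" for j
    unfolding E_def[abs_def] phi_def by (rule sl_integral_holomorphic[OF zero_int fi])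
  have Ph: "P holomorphic_on UNIV"
    unfolding P_def up_def by (rule sl_integral_holomorphic[OF fi fi])
  have intphi: "(\<lambda>x. hinner (fst (phi z v x)) (f x)) integrable_on {0..pi}" for z v
    using hinner_int[OF phi_continuous fi] by (rule set_lebesgue_integral_eq_integral(1))
  have Ev: "integral {0..pi} (\<lambda>x. hinner (fst (phi z v x)) (f x)) = (\<Sum>j\<in>UNIV. v $ j * E j z)" for z v
  proof -
    have "integral {0..pi} (\<lambda>x. hinner (fst (phi z v x)) (f x)) =
       integral {0..pi} (\<lambda>x. \<Sum>j\<in>UNIV. v $ j * hinner (fst (phi z (axis j 1) x)) (f x))"
    proof (rule integral_cong)
      fix x assume "x \<in> {0..pi}"
      then show "hinner (fst (phi z v x)) (f x) = (\<Sum>j\<in>UNIV. v $ j * hinner (fst (phi z (axis j 1) x)) (f x))"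
        by (subst fst_phi_axis)
          (simp_all add: bounded_bilinear.sum_left[OF bounded_bilinear_hinner] hinner_simps)
    qed
    also have "\<dots> = (\<Sum>j\<in>UNIV. v $ j * E j z)"
      unfolding E_def by (subst integral_sum) (auto intro!: integrable_on_mult_right intphi)
    finally show ?thesis .
  qed
  have geq: "g z = P z + (\<Sum>j\<in>UNIV. w z $ j * E j z)" for z
  proof -
    have "(\<lambda>x. hinner (fst (up z x)) (f x)) integrable_on {0..pi}"
      using hinner_int[OF sl_sol_continuous(1)[OF up(1)] fi] by (rule set_lebesgue_integral_eq_integral(1))
    then show ?thesis
      unfolding g_def Y_def hinner_simps
      by (subst integral_add[OF intphi]) (simp_all add: Ev P_def)
  qed
  have gh: "g holomorphic_on {z. det (Delta z) \<noteq> 0}"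
    unfolding geq w_def
    by (intro holomorphic_intros cramer_sol_holomorphic bh holomorphic_on_subset[OF Ph] holomorphic_on_subset[OF Eh]) auto
  have opn: "open {z. det (Delta z) \<noteq> 0}"
    using holomorphic_on_imp_continuous_on[OF det_Delta_holomorphic]
    by (intro open_Collect_neq) (auto intro: continuous_on_const)
  have gcont: "isCont g z" if "det (Delta z) \<noteq> 0" for z
    using holomorphic_on_imp_continuous_on[OF gh] opn that by (simp add: continuous_on_eq_continuous_at)
  have isC: "isCont h z" if "h holomorphic_on UNIV" for h :: "complex \<Rightarrow> complex" and z
    using holomorphic_on_imp_continuous_on[OF that] by (simp add: continuous_on_eq_continuous_at)
  obtain G where G: "G holomorphic_on UNIV" "\<And>z. isCont g z \<Longrightarrow> G z = g z"
  proof (rule entire_extension[of g])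
    fix z0
    show "\<exists>r>0. g holomorphic_on ball z0 r - {z0}"
    proof -
      have "\<forall>\<^sub>F z in at z0. det (Delta z) \<noteq> 0" by (rule eventually_det_Delta)
      then obtain r where "r > 0" "\<forall>z. z \<noteq> z0 \<and> dist z z0 < r \<longrightarrow> det (Delta z) \<noteq> 0"
        unfolding eventually_at by auto
      then show ?thesis
        by (intro exI[of _ r] conjI holomorphic_on_subset[OF gh]) (auto simp: dist_commute)
    qed
    show "((\<lambda>z. (z - z0) * g z) \<longlongrightarrow> 0) (at z0)"
    proof (cases "Im z0 = 0")
      case False
      then have "isCont g z0" by (intro gcont det_Delta_nonreal)
      then have "((\<lambda>z. (z - z0) * g z) \<longlongrightarrow> (z0 - z0) * g z0) (at z0)"
        unfolding isCont_def by (intro tendsto_intros) auto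
      then show ?thesis by simp
    next
      case True
      then have z0: "z0 = of_real (Re z0)" by (simp add: complex_eq_iff)
      obtain \<omega> where \<omega>: "\<And>k. ((\<lambda>z. (z - z0) * w z $ k) \<longlongrightarrow> \<omega> $ k) (at z0)" "Delta z0 *v \<omega> = 0"
        using cramer_sol_simple_pole[OF bh, of "Re z0"] z0 unfolding w_def by metis
      have "((\<lambda>z. (z - z0) * P z + (\<Sum>j\<in>UNIV. (z - z0) * w z $ j * E j z)) \<longlongrightarrow>
          (z0 - z0) * P z0 + (\<Sum>j\<in>UNIV. \<omega> $ j * E j z0)) (at z0)"
        using isC[OF Ph, of z0] isC[OF Eh, of z0] \<omega>(1) unfolding isCont_def by (intro tendsto_intros) auto
      \<comment> \<open>By \<open>Ev\<close> this sum is the pairing of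
        \<open>phi z0 \<omega>\<close> with \<open>f\<close>, and \<open>\<omega>\<close> lies in
        the kernel of \<open>Delta z0\<close>.\<close>
      moreover have "(\<Sum>j\<in>UNIV. \<omega> $ j * E j z0) = 0"
        using orth[of "Re z0" \<omega>] \<omega>(2) z0 Ev[of z0 \<omega>] by simp
      ultimately show ?thesis by (simp add: geq distrib_left sum_distrib_left mult.assoc)
    qed
  qed blast
  define F where "F = integral {0..pi} (\<lambda>x. (norm (f x))\<^sup>2)"
  have fF: "(\<lambda>x. (norm (f x))\<^sup>2) integrable_on {0..pi}"
    using f by (auto simp: L2_on_iff set_lebesgue_integral_eq_integral(1))
  have Yc: "continuous_on {0..pi} (Y z)" for z by (rule sl_sol_continuous(1)[OF YQ])
  have Yi: "(\<lambda>x. (norm (Y z x))\<^sup>2) integrable_on {0..pi}" for z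
    by (intro integrable_continuous_real continuous_intros Yc)
  have gi: "(\<lambda>x. hinner (Y z x) (f x)) integrable_on {0..pi}" for z
    using hinner_int[OF Yc fi] by (rule set_lebesgue_integral_eq_integral(1))
  \<comment> \<open>Green's identity for \<open>Y z\<close> with itself has no boundary terms left,
    so \<open>z - cnj z\<close> times the squared norm equals
    \<open>g z - cnj (g z)\<close>.\<close>
  have energy: "Im z * integral {0..pi} (\<lambda>x. (norm (Y z x))\<^sup>2) = Im (g z)" if z: "det (Delta z) \<noteq> 0" for z
  proof -
    define A where "A = integral {0..pi} (\<lambda>x. (norm (Y z x))\<^sup>2)"
    have 1: "((\<lambda>x. - (z - cnj z) * of_real ((norm (Y z x))\<^sup>2) - hinner (f x) (Y z x) + hinner (Y z x) (f x)) has_integral 0) {0..pi}"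
      using green_self[OF YQ[of z] b0[of z]] by (simp add: bpi[OF z] hinner_simps)
    have g1: "((\<lambda>x. hinner (Y z x) (f x)) has_integral g z) {0..pi}"
      unfolding g_def by (rule integrable_integral[OF gi])
    have g2: "((\<lambda>x. hinner (f x) (Y z x)) has_integral cnj (g z)) {0..pi}"
      using has_integral_linear[OF g1 bounded_linear_cnj] by (simp add: o_def hinner_commute[symmetric])
    have "((\<lambda>x. - (z - cnj z) * of_real ((norm (Y z x))\<^sup>2) - hinner (f x) (Y z x) + hinner (Y z x) (f x)) has_integral
       (- (z - cnj z) * of_real A - cnj (g z) + g z)) {0..pi}"
      unfolding A_def
      by (intro has_integral_add has_integral_diff has_integral_mult_right has_integral_of_real integrable_integral Yi g1 g2)
    with 1 have "- (z - cnj z) * of_real A - cnj (g z) + g z = 0" using has_integral_unique by blast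
    then have "Im (- (z - cnj z) * of_real A - cnj (g z) + g z) = 0" by simp
    then show ?thesis by (simp add: A_def[symmetric])
  qed
  have gbound: "cmod (g z) \<le> F / \<bar>Im z\<bar>" if z: "Im z \<noteq> 0" for z
  proof -
    define A where "A = integral {0..pi} (\<lambda>x. (norm (Y z x))\<^sup>2)"
    define t where "t = \<bar>Im z\<bar>"
    have t: "t > 0" using z by (simp add: t_def)
    have "\<bar>Im z * A\<bar> \<le> cmod (g z)"
      using energy[OF det_Delta_nonreal[OF z]] abs_Im_le_cmod[of "g z"] by (simp add: A_def)
    moreover have "A \<ge> 0" unfolding A_def by (intro integral_nonneg Yi) auto
    ultimately have tA: "t * A \<le> cmod (g z)" by (simp add: t_def abs_mult)
    \<comment> \<open>The weights are such that, by \<open>tA\<close>, the first term integrates to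
      at most half of \<open>cmod (g z)\<close> and can be absorbed.\<close>
    have pt: "norm (hinner (Y z x) (f x)) \<le> (t / 2) * (norm (Y z x))\<^sup>2 + (1 / (2 * t)) * (norm (f x))\<^sup>2" for x
    proof -
      have "0 \<le> (t * norm (Y z x) - norm (f x))\<^sup>2" by simp
      then have "2 * t * (norm (Y z x) * norm (f x)) \<le> t\<^sup>2 * (norm (Y z x))\<^sup>2 + (norm (f x))\<^sup>2"
        by (simp add: power2_diff power_mult_distrib algebra_simps)
      then have "norm (Y z x) * norm (f x) \<le> (t\<^sup>2 * (norm (Y z x))\<^sup>2 + (norm (f x))\<^sup>2) / (2 * t)"
        using t by (simp add: pos_le_divide_eq mult.commute)
      also have "\<dots> = (t / 2) * (norm (Y z x))\<^sup>2 + (1 / (2 * t)) * (norm (f x))\<^sup>2"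
        using t by (simp add: add_divide_distrib power2_eq_square)
      finally show ?thesis using norm_hinner_le order_trans by blast
    qed
    have "cmod (g z) \<le> integral {0..pi} (\<lambda>x. (t / 2) * (norm (Y z x))\<^sup>2 + (1 / (2 * t)) * (norm (f x))\<^sup>2)"
      unfolding g_def
      by (rule integral_norm_bound_integral[OF gi integrable_add[OF integrable_on_mult_right[OF Yi] integrable_on_mult_right[OF fF]] pt])
    also have "\<dots> = integral {0..pi} (\<lambda>x. (t / 2) * (norm (Y z x))\<^sup>2) + integral {0..pi} (\<lambda>x. (1 / (2 * t)) * (norm (f x))\<^sup>2)"
      by (intro integral_add integrable_on_mult_right Yi fF)
    also have "\<dots> = (t / 2) * A + (1 / (2 * t)) * F" by (simp only: integral_mult_right A_def F_def)
    finally have "cmod (g z) \<le> (t * A) / 2 + F / (2 * t)" by simp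
    then have "cmod (g z) \<le> cmod (g z) / 2 + F / (2 * t)" using tA by linarith
    then show ?thesis by (simp add: t_def)
  qed
  have G0: "G z = 0" for z
  proof (rule entire_inverse_Im_bound[OF G(1)])
    show "cmod (G z) \<le> F / \<bar>Im z\<bar>" if "Im z \<noteq> 0" for z
      using G(2)[OF gcont[OF det_Delta_nonreal[OF that]]] gbound[OF that] by simp
  qed
  \<comment> \<open>A single nonreal point suffices: \<open>g \<i> = 0\<close> forces
    \<open>Y \<i>\<close> to vanish by \<open>energy\<close>, and then its inhomogeneity
    \<open>f\<close> vanishes as well.\<close>
  have di: "det (Delta \<i>) \<noteq> 0" by (rule det_Delta_nonreal) simp
  then have "g \<i> = 0" using G(2)[OF gcont] G0 by simp
  then have "integral {0..pi} (\<lambda>x. (norm (Y \<i> x))\<^sup>2) = 0" using energy[OF di] by simp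
  then have "Y \<i> x = 0" if "x \<in> {0..pi}" for x
    using integral_eq_0_iff[of 0 pi "\<lambda>x. (norm (Y \<i> x))\<^sup>2"] continuous_on_power[OF continuous_on_norm[OF Yc]] that by auto
  then show ?thesis by (rule sl_sol_zero(2)[OF YQ])
qed

end

section \<open>Total and complete families\<close>

definition L2sq :: "real \<Rightarrow> real \<Rightarrow> (real \<Rightarrow> 'b::euclidean_space) \<Rightarrow> real" where
  "L2sq a b f = integral {a..b} (\<lambda>x. (norm (f x))\<^sup>2)"

lemma L2sq_has_integral: "L2_on {a<..<b} f \<Longrightarrow> ((\<lambda>x. (norm (f x))\<^sup>2) has_integral L2sq a b f) {a..b}"
  unfolding L2sq_def L2_on_iff by (auto intro: integrable_integral set_lebesgue_integral_eq_integral(1))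

lemma L2sq_nonneg: "0 \<le> L2sq a b f"
  unfolding L2sq_def by (cases "(\<lambda>x. (norm (f x))\<^sup>2) integrable_on {a..b}")
    (auto intro: integral_nonneg simp: not_integrable_integral)

lemma L2sq_lebesgue: "L2_on {a<..<b} f \<Longrightarrow> integral\<^sup>L (lebesgue_on {a<..<b}) (\<lambda>x. (norm (f x))\<^sup>2) = L2sq a b f"
  unfolding L2sq_def by (rule integral_Ioo_eq) (simp add: L2_on_iff)

text \<open>Removes the factor \<open>1 + s\<close> that estimates with \<open>L2sq_add_le\<close>
  leave behind.\<close>

lemma le_mult_one_plus_imp_le:
  fixes x y :: real
  assumes "\<And>s. s > 0 \<Longrightarrow> x \<le> (1 + s) * y" "0 \<le> y"
  shows "x \<le> y"
proof (rule field_le_epsilon)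
  fix e :: real assume "e > 0"
  have "x \<le> (1 + e / (y + 1)) * y" using \<open>e > 0\<close> assms(2) by (intro assms(1)) auto
  also have "\<dots> = y + e * (y / (y + 1))" by (simp add: algebra_simps)
  also have "\<dots> \<le> y + e * 1" using \<open>e > 0\<close> assms(2) by (intro add_left_mono mult_left_mono) (auto simp: field_simps)
  finally show "x \<le> y + e" by simp
qed

text \<open>A triangle inequality for squares. A small \<open>s\<close> keeps the constant of
  \<open>u\<close> near 1 when \<open>v\<close> is negligible; \<open>s = 1\<close> gives the usual
  factor 2.\<close>

lemma norm_add_sq_le:
  fixes u v :: "'b::real_inner"
  assumes "s > 0"
  shows "(norm (u + v))\<^sup>2 \<le> (1 + s) * (norm u)\<^sup>2 + (1 + 1 / s) * (norm v)\<^sup>2"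
proof -
  have "0 \<le> (s * norm u - norm v)\<^sup>2" by simp
  then have "2 * s * (norm u * norm v) \<le> s\<^sup>2 * (norm u)\<^sup>2 + (norm v)\<^sup>2"
    by (simp add: power2_diff power_mult_distrib algebra_simps)
  then have "2 * (norm u * norm v) \<le> (s\<^sup>2 * (norm u)\<^sup>2 + (norm v)\<^sup>2) / s"
    using assms by (simp add: pos_le_divide_eq mult_ac)
  also have "\<dots> = s * (norm u)\<^sup>2 + (norm v)\<^sup>2 / s"
    using assms by (simp add: add_divide_distrib power2_eq_square)
  finally have 1: "2 * (norm u * norm v) \<le> s * (norm u)\<^sup>2 + (norm v)\<^sup>2 / s" .
  have "(norm (u + v))\<^sup>2 \<le> (norm u + norm v)\<^sup>2" by (intro power_mono norm_triangle_ineq) auto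
  also have "\<dots> = (norm u)\<^sup>2 + 2 * (norm u * norm v) + (norm v)\<^sup>2" by (simp add: power2_sum)
  finally show ?thesis using 1 by (simp add: algebra_simps)
qed

lemma L2sq_add_le:
  fixes f g :: "real \<Rightarrow> 'b::euclidean_space"
  assumes f: "L2_on {a<..<b} f" and g: "L2_on {a<..<b} g" and s: "s > 0"
  shows "L2sq a b (\<lambda>x. f x + g x) \<le> (1 + s) * L2sq a b f + (1 + 1 / s) * L2sq a b g"
proof (rule has_integral_le)
  show "((\<lambda>x. (1 + s) * (norm (f x))\<^sup>2 + (1 + 1 / s) * (norm (g x))\<^sup>2) has_integral ((1 + s) * L2sq a b f + (1 + 1 / s) * L2sq a b g)) {a..b}"
    by (intro has_integral_add has_integral_mult_right L2sq_has_integral f g)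
  show "((\<lambda>x. (norm (f x + g x))\<^sup>2) has_integral L2sq a b (\<lambda>x. f x + g x)) {a..b}"
    by (intro L2sq_has_integral L2_on_add f g)
qed (rule norm_add_sq_le[OF s])

lemma L2sq_parallelogram:
  fixes f g :: "real \<Rightarrow> 'b::euclidean_space"
  assumes f: "L2_on {a<..<b} f" and g: "L2_on {a<..<b} g"
  shows "L2sq a b (\<lambda>x. f x - g x) = 2 * L2sq a b f + 2 * L2sq a b g - 4 * L2sq a b (\<lambda>x. (1/2) *\<^sub>R (f x + g x))"
proof -
  have h: "L2_on {a<..<b} (\<lambda>x. (1/2) *\<^sub>R (f x + g x))"
    by (rule L2_on_linear[OF L2_on_add[OF f g] bounded_linear_scaleR_right])
  have "((\<lambda>x. 2 * (norm (f x))\<^sup>2 + 2 * (norm (g x))\<^sup>2 - 4 * (norm ((1/2) *\<^sub>R (f x + g x)))\<^sup>2) has_integral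
      (2 * L2sq a b f + 2 * L2sq a b g - 4 * L2sq a b (\<lambda>x. (1/2) *\<^sub>R (f x + g x)))) {a..b}"
    by (intro has_integral_add has_integral_diff has_integral_mult_right L2sq_has_integral f g h)
  moreover have "2 * (norm u)\<^sup>2 + 2 * (norm v)\<^sup>2 - 4 * (norm ((1/2) *\<^sub>R (u + v)))\<^sup>2 = (norm (u - v))\<^sup>2" for u v :: 'b
    by (simp add: power_divide power2_norm_eq_inner inner_simps inner_commute) (simp add: field_simps)
  ultimately show ?thesis
    using has_integral_unique[OF L2sq_has_integral[OF L2_on_diff[OF f g]]] by simp
qed

text \<open>Riesz-Fischer for a geometrically convergent sequence. The differences of successive
  members have summable integrals, so the sequence converges almost everywhere; Fatou's lemma
  carries the bound over to the limit.\<close>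

lemma L2_on_complete:
  fixes h :: "nat \<Rightarrow> real \<Rightarrow> 'b::euclidean_space"
  assumes ab: "a \<le> b" and h: "\<And>n. L2_on {a<..<b} (h n)"
    and C: "\<And>n m. n \<le> m \<Longrightarrow> L2sq a b (\<lambda>x. h n x - h m x) \<le> C * (1/16) ^ n"
  obtains g where "L2_on {a<..<b} g" "\<And>n. L2sq a b (\<lambda>x. h n x - g x) \<le> C * (1/16) ^ n"
proof -
  define M where "M = lebesgue_on {a<..<b}"
  have hM: "h n \<in> borel_measurable M" for n using h[of n] by (simp add: L2_on_def M_def)
  have C0: "C \<ge> 0" using order_trans[OF L2sq_nonneg C[of 0 0]] by simp
  define D where "D = (\<lambda>n x. norm (h n x - h (Suc n) x))"
  define K where "K = (\<bar>b - a\<bar> + C) / 2"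
  have dL: "L2_on {a<..<b} (\<lambda>x. h n x - h m x)" for n m by (rule L2_on_diff[OF h h])
  have Dint: "integrable M (D n)" and Dle: "integral\<^sup>L M (D n) \<le> K * (1/4) ^ n" for n
  proof -
    have i: "D n absolutely_integrable_on {a..b}"
      unfolding D_def by (rule absolutely_integrable_norm[OF L2_on_imp_absolutely_integrable[OF dL], unfolded o_def])
    then show "integrable M (D n)" by (simp add: M_def integrable_Ioo_iff)
    \<comment> \<open>The square root of the rate 1/16. It balances the two terms of the pointwise
      bound of \<open>D n\<close>, whose integrals both become multiples of
      \<open>s\<close>.\<close>
    define s :: real where "s = (1/4) ^ n"
    have s: "s > 0" "s * s = (1/16) ^ n" by (auto simp: s_def power_mult_distrib[symmetric])
    have "integral {a..b} (D n) \<le> s / 2 * \<bar>b - a\<bar> + 1 / (2 * s) * L2sq a b (\<lambda>x. h n x - h (Suc n) x)"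
    proof (rule has_integral_le)
      show "(D n has_integral integral {a..b} (D n)) {a..b}"
        by (rule integrable_integral[OF set_lebesgue_integral_eq_integral(1)[OF i]])
      show "((\<lambda>x. s / 2 + 1 / (2 * s) * (norm (h n x - h (Suc n) x))\<^sup>2) has_integral
         (s / 2 * \<bar>b - a\<bar> + 1 / (2 * s) * L2sq a b (\<lambda>x. h n x - h (Suc n) x))) {a..b}"
        using has_integral_const_real[of "s/2" a b] ab
        by (intro has_integral_add has_integral_mult_right L2sq_has_integral dL) (simp add: mult.commute)
      fix x
      define d where "d = norm (h n x - h (Suc n) x)"
      have "0 \<le> (s - d)\<^sup>2" by simp
      then have "2 * s * d \<le> s\<^sup>2 + d\<^sup>2" by (simp add: power2_diff)
      then have "d \<le> (s\<^sup>2 + d\<^sup>2) / (2 * s)" using s(1) by (simp add: pos_le_divide_eq mult_ac)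
      also have "\<dots> = s / 2 + 1 / (2 * s) * d\<^sup>2" using s(1) by (simp add: add_divide_distrib power2_eq_square)
      finally show "D n x \<le> s / 2 + 1 / (2 * s) * (norm (h n x - h (Suc n) x))\<^sup>2" by (simp add: D_def d_def)
    qed
    also have "\<dots> \<le> s / 2 * \<bar>b - a\<bar> + 1 / (2 * s) * (C * (s * s))"
      using s(1) C[of n "Suc n"] unfolding s(2) by (intro add_left_mono mult_left_mono) auto
    also have "\<dots> = K * s" using s(1) by (simp add: K_def algebra_simps add_divide_distrib)
    finally show "integral\<^sup>L M (D n) \<le> K * (1/4) ^ n"
      using i by (simp add: M_def integral_Ioo_eq s_def)
  qed
  have "(\<integral>\<^sup>+ x. (\<Sum>n. ennreal (D n x)) \<partial>M) = (\<Sum>n. \<integral>\<^sup>+ x. ennreal (D n x) \<partial>M)"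
    using Dint by (intro nn_integral_suminf) (auto dest: borel_measurable_integrable)
  also have "\<dots> = (\<Sum>n. ennreal (integral\<^sup>L M (D n)))"
    by (intro suminf_cong nn_integral_eq_integral Dint) (auto simp: D_def)
  also have "\<dots> \<le> (\<Sum>n. ennreal (K * (1/4) ^ n))"
    by (intro suminf_le ennreal_leI Dle) auto
  also have "\<dots> = ennreal (\<Sum>n. K * (1/4) ^ n)"
    by (intro suminf_ennreal2) (use C0 in \<open>auto simp: K_def intro!: summable_mult summable_geometric\<close>)
  finally have fin: "(\<integral>\<^sup>+ x. (\<Sum>n. ennreal (D n x)) \<partial>M) \<noteq> \<infinity>"
    by (metis ennreal_less_top infinity_ennreal_def leD top.not_eq_extremum)
  have "AE x in M. (\<Sum>n. ennreal (D n x)) \<noteq> \<infinity>"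
    by (rule nn_integral_PInf_AE[OF _ fin]) (use Dint in \<open>auto dest: borel_measurable_integrable\<close>)
  then have conv: "AE x in M. convergent (\<lambda>n. h n x)"
  proof eventually_elim
    case (elim x)
    have "summable (\<lambda>n. D n x)"
      by (rule summable_suminf_not_top) (use elim in \<open>auto simp: D_def\<close>)
    then have "summable (\<lambda>n. h n x - h (Suc n) x)" unfolding D_def by (rule summable_norm_cancel)
    then have "convergent (\<lambda>n. \<Sum>i<n. h i x - h (Suc i) x)" by (simp add: summable_iff_convergent)
    moreover have "(\<Sum>i<n. h i x - h (Suc i) x) = h 0 x - h n x" for n by (induction n) auto
    ultimately have c: "convergent (\<lambda>n. h 0 x - h n x)" by simp
    have "(\<lambda>n. h 0 x - (h 0 x - h n x)) = (\<lambda>n. h n x)" by simp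
    then show ?case using convergent_diff[OF convergent_const[of "h 0 x"] c] by simp
  qed
  define g where "g = (\<lambda>x. lim (\<lambda>n. h n x))"
  have gM: "g \<in> borel_measurable M" unfolding g_def by (intro borel_measurable_lim_metric hM)
  have lim: "AE x in M. (\<lambda>n. h n x) \<longlonglongrightarrow> g x"
    using conv by eventually_elim (simp add: g_def convergent_LIMSEQ_iff)
  have N: "(\<integral>\<^sup>+ x. ennreal ((norm (h n x - g x))\<^sup>2) \<partial>M) \<le> ennreal (C * (1/16) ^ n)" for n
  proof -
    have "(\<integral>\<^sup>+ x. ennreal ((norm (h n x - g x))\<^sup>2) \<partial>M) = (\<integral>\<^sup>+ x. liminf (\<lambda>m. ennreal ((norm (h n x - h m x))\<^sup>2)) \<partial>M)"
    proof (rule nn_integral_cong_AE)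
      show "AE x in M. ennreal ((norm (h n x - g x))\<^sup>2) = liminf (\<lambda>m. ennreal ((norm (h n x - h m x))\<^sup>2))"
        using lim
      proof eventually_elim
        case (elim x)
        then have "(\<lambda>m. ennreal ((norm (h n x - h m x))\<^sup>2)) \<longlonglongrightarrow> ennreal ((norm (h n x - g x))\<^sup>2)"
          by (intro tendsto_intros)
        then show ?case by (intro lim_imp_Liminf[symmetric]) auto
      qed
    qed
    also have "\<dots> \<le> liminf (\<lambda>m. \<integral>\<^sup>+ x. ennreal ((norm (h n x - h m x))\<^sup>2) \<partial>M)"
      by (rule nn_integral_liminf) (use hM in measurable)
    also have "\<dots> \<le> ennreal (C * (1/16) ^ n)"
    proof (rule Liminf_le)
      show "\<forall>\<^sub>F m in sequentially. (\<integral>\<^sup>+ x. ennreal ((norm (h n x - h m x))\<^sup>2) \<partial>M) \<le> ennreal (C * (1/16) ^ n)"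
        unfolding eventually_sequentially
      proof (intro exI[of _ n] allI impI)
        fix m assume m: "n \<le> m"
        have "(\<integral>\<^sup>+ x. ennreal ((norm (h n x - h m x))\<^sup>2) \<partial>M) = ennreal (integral\<^sup>L M (\<lambda>x. (norm (h n x - h m x))\<^sup>2))"
          by (rule nn_integral_eq_integral) (use dL[of n m] in \<open>auto simp: L2_on_def M_def\<close>)
        then show "(\<integral>\<^sup>+ x. ennreal ((norm (h n x - h m x))\<^sup>2) \<partial>M) \<le> ennreal (C * (1/16) ^ n)"
          using C[OF m] by (simp add: M_def L2sq_lebesgue[OF dL] ennreal_leI)
      qed
    qed simp
    finally show ?thesis .
  qed
  have L: "L2_on {a<..<b} (\<lambda>x. h n x - g x)" for n
    unfolding L2_on_def M_def[symmetric]
  proof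
    show "(\<lambda>x. h n x - g x) \<in> borel_measurable M" using hM gM by simp
    show "integrable M (\<lambda>x. (norm (h n x - g x))\<^sup>2)"
    proof (rule integrableI_bounded)
      show "(\<lambda>x. (norm (h n x - g x))\<^sup>2) \<in> borel_measurable M" using hM gM by simp
      show "(\<integral>\<^sup>+ x. ennreal (norm ((norm (h n x - g x))\<^sup>2)) \<partial>M) < \<infinity>"
        using N[of n] by (simp add: order_le_less_trans)
    qed
  qed
  have "L2_on {a<..<b} (\<lambda>x. h 0 x - (h 0 x - g x))" by (rule L2_on_diff[OF h L])
  then have "L2_on {a<..<b} g" by simp
  moreover have "L2sq a b (\<lambda>x. h n x - g x) \<le> C * (1/16) ^ n" for n
  proof -
    have "ennreal (L2sq a b (\<lambda>x. h n x - g x)) = (\<integral>\<^sup>+ x. ennreal ((norm (h n x - g x))\<^sup>2) \<partial>M)"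
      using nn_integral_eq_integral[of M "\<lambda>x. (norm (h n x - g x))\<^sup>2"] L[of n] L2sq_lebesgue[OF L[of n]]
      by (simp add: L2_on_def M_def)
    then have "ennreal (L2sq a b (\<lambda>x. h n x - g x)) \<le> ennreal (C * (1/16) ^ n)" using N[of n] by simp
    moreover have "0 \<le> C * (1/16) ^ n" using C0 by simp
    ultimately show ?thesis by (simp only: ennreal_le_iff)
  qed
  ultimately show thesis by (rule that)
qed

lemma L2sq_diff_scale:
  fixes g u :: "real \<Rightarrow> complex^'m"
  assumes g: "L2_on {a<..<b} g" and u: "L2_on {a<..<b} u"
  shows "L2sq a b (\<lambda>x. g x - c *s u x) =
    L2sq a b g - 2 * Re (c * integral {a..b} (\<lambda>x. hinner (u x) (g x))) + (cmod c)\<^sup>2 * L2sq a b u"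
proof -
  have cu: "L2_on {a<..<b} (\<lambda>x. c *s u x)"
    by (rule L2_on_linear[OF u bounded_bilinear.bounded_linear_right[OF bounded_bilinear_scalar_vec]])
  have i: "(\<lambda>x. hinner (u x) (g x)) integrable_on {a..b}"
    using L2_on_bilinear_integrable[OF bounded_bilinear_hinner u g] by (rule set_lebesgue_integral_eq_integral(1))
  have "((\<lambda>x. Re (c * hinner (u x) (g x))) has_integral Re (c * integral {a..b} (\<lambda>x. hinner (u x) (g x)))) {a..b}"
    by (intro has_integral_Re has_integral_mult_right integrable_integral i)
  then have "((\<lambda>x. (norm (g x))\<^sup>2 - 2 * Re (c * hinner (u x) (g x)) + (cmod c)\<^sup>2 * (norm (u x))\<^sup>2) has_integral
     (L2sq a b g - 2 * Re (c * integral {a..b} (\<lambda>x. hinner (u x) (g x))) + (cmod c)\<^sup>2 * L2sq a b u)) {a..b}"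
    by (intro has_integral_add has_integral_diff has_integral_mult_right L2sq_has_integral g u)
  moreover have "(norm v)\<^sup>2 - 2 * Re (c * hinner w v) + (cmod c)\<^sup>2 * (norm w)\<^sup>2 = (norm (v - c *s w))\<^sup>2" for v w :: "complex^'m"
  proof -
    have "(norm (v - c *s w))\<^sup>2 = Re (hinner (v - c *s w) (v - c *s w))" by (simp add: hinner_self)
    also have "\<dots> = Re (hinner v v) - Re (c * hinner w v) - Re (cnj (c * hinner w v)) + Re (c * cnj c * hinner w w)"
      using hinner_commute[of v w] by (simp add: hinner_simps algebra_simps)
    also have "c * cnj c = of_real ((cmod c)\<^sup>2)" by (rule complex_norm_square[symmetric])
    finally show ?thesis by (simp add: hinner_self)
  qed
  ultimately show ?thesis
    using has_integral_unique[OF L2sq_has_integral[OF L2_on_diff[OF g cu]]] by simp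
qed

text \<open>The projection theorem for the span \<open>V\<close>: a minimising sequence of residuals
  converges to a residual \<open>g\<close> of least norm, which is orthogonal to the family.
  Totality makes \<open>g\<close> vanish, so the distance \<open>d\<close> is 0.\<close>

lemma complete_in_L2_if_total:
  fixes u :: "'i \<Rightarrow> real \<Rightarrow> complex^'m"
  assumes ab: "a \<le> b" and u: "\<And>i. i \<in> I \<Longrightarrow> L2_on {a<..<b} (u i)"
    and total: "\<And>g. L2_on {a<..<b} g \<Longrightarrow> (\<And>i. i \<in> I \<Longrightarrow> integral {a..b} (\<lambda>x. hinner (u i x) (g x)) = 0) \<Longrightarrow>
       \<exists>N. negligible N \<and> (\<forall>x\<in>{a..b} - N. g x = 0)"
  shows "complete_in_L2 {a<..<b} I u"
proof -
  define V where "V = {v. \<exists>F c. finite F \<and> F \<subseteq> I \<and> v = (\<lambda>x. \<Sum>i\<in>F. c i *s u i x)}"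
  have scaleL2: "L2_on {a<..<b} (\<lambda>x. c *s v x)" if "L2_on {a<..<b} v" for c and v :: "real \<Rightarrow> complex^'m"
    by (rule L2_on_linear[OF that bounded_bilinear.bounded_linear_right[OF bounded_bilinear_scalar_vec]])
  have VL2: "L2_on {a<..<b} v" if "v \<in> V" for v
    using that u by (auto simp: V_def intro!: L2_on_sum scaleL2)
  have V0: "(\<lambda>x. 0) \<in> V" unfolding V_def by (auto intro!: exI[of _ "{}"])
  have Vadd: "(\<lambda>x. c *s v x + d *s w x) \<in> V" if vw: "v \<in> V" "w \<in> V" for v w c d
  proof -
    obtain F p where F: "finite F" "F \<subseteq> I" "v = (\<lambda>x. \<Sum>i\<in>F. p i *s u i x)" using vw(1) by (auto simp: V_def)
    obtain G q where G: "finite G" "G \<subseteq> I" "w = (\<lambda>x. \<Sum>i\<in>G. q i *s u i x)" using vw(2) by (auto simp: V_def)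
    define r where "r = (\<lambda>i. c * (if i \<in> F then p i else 0) + d * (if i \<in> G then q i else 0))"
    have "c *s v x + d *s w x = (\<Sum>i\<in>F \<union> G. r i *s u i x)" for x
    proof -
      have "v x = (\<Sum>i\<in>F \<union> G. (if i \<in> F then p i else 0) *s u i x)"
        unfolding F(3) by (rule sum.mono_neutral_cong_left) (use F G in auto)
      moreover have "w x = (\<Sum>i\<in>F \<union> G. (if i \<in> G then q i else 0) *s u i x)"
        unfolding G(3) by (rule sum.mono_neutral_cong_left) (use F G in auto)
      ultimately show ?thesis
        by (simp only: r_def vec.scale_sum_right vec.scale_scale sum.distrib[symmetric] vec.scale_left_distrib)
    qed
    then show ?thesis using F G unfolding V_def by (auto intro!: exI[of _ "F \<union> G"] exI[of _ r])
  qed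
  have Vu: "u i \<in> V" if "i \<in> I" for i
    unfolding V_def using that by (auto intro!: exI[of _ "{i}"] exI[of _ "\<lambda>_. 1"])
  have dens: "\<exists>v\<in>V. L2sq a b (\<lambda>x. f x - v x) < e" if f: "L2_on {a<..<b} f" and e: "e > 0" for f e
  proof -
    define N where "N = (\<lambda>v. L2sq a b (\<lambda>x. f x - v x))"
    define d where "d = Inf (N ` V)"
    have bdd: "bdd_below (N ` V)" by (rule bdd_belowI[of _ 0]) (auto simp: N_def L2sq_nonneg)
    have dle: "d \<le> N v" if "v \<in> V" for v unfolding d_def using that bdd by (auto intro: cInf_lower)
    have "\<exists>v\<in>V. N v < d + (1/16) ^ n" for n
    proof -
      have "Inf (N ` V) < d + (1/16) ^ n" by (simp add: d_def)
      then show ?thesis using V0 bdd by (subst (asm) cInf_less_iff) auto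
    qed
    then obtain v where v: "\<And>n. v n \<in> V" "\<And>n. N (v n) < d + (1/16) ^ n" by metis
    define h where "h = (\<lambda>n x. f x - v n x)"
    have hL: "L2_on {a<..<b} (h n)" for n unfolding h_def by (intro L2_on_diff f VL2 v)
    have Nh: "L2sq a b (h n) = N (v n)" for n by (simp add: h_def N_def)
    \<comment> \<open>The midpoint of two elements of \<open>V\<close> lies in \<open>V\<close>, so
      its residual has squared norm at least \<open>d\<close>; the parallelogram law turns this into
      a Cauchy estimate with the rate of \<open>L2_on_complete\<close>.\<close>
    have cauchy: "L2sq a b (\<lambda>x. h n x - h m x) \<le> 4 * (1/16) ^ n" if nm: "n \<le> m" for n m
    proof -
      have "(1/2) *\<^sub>R (h n x + h m x) = f x - ((1/2) *s v n x + (1/2) *s v m x)" for x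
        by (simp add: h_def vec_eq_iff) (simp add: scaleR_conv_of_real field_simps)
      then have "d \<le> L2sq a b (\<lambda>x. (1/2) *\<^sub>R (h n x + h m x))"
        using dle[OF Vadd[OF v(1)[of n] v(1)[of m], of "1/2" "1/2"]] by (simp add: N_def)
      moreover have "N (v m) < d + (1/16) ^ n"
      proof -
        have "(1/16::real) ^ m \<le> (1/16) ^ n" by (rule power_decreasing[OF nm]) auto
        then show ?thesis using v(2)[of m] by linarith
      qed
      ultimately show ?thesis
        using v(2)[of n] L2sq_parallelogram[OF hL[of n] hL[of m]] Nh by simp
    qed
    obtain g where g: "L2_on {a<..<b} g" "\<And>n. L2sq a b (\<lambda>x. h n x - g x) \<le> 4 * (1/16) ^ n"
      using L2_on_complete[of a b h 4, OF ab hL cauchy] by blast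
    have z: "(\<lambda>n. (1/16::real) ^ n) \<longlonglongrightarrow> 0" by (rule LIMSEQ_power_zero) simp
    \<comment> \<open>The function \<open>g - c w\<close> is the limit of the residuals of
      \<open>v n + c w\<close>, each of which has squared norm at least \<open>d\<close>.\<close>
    have lower: "d \<le> L2sq a b (\<lambda>x. g x - c *s w x)" if w: "w \<in> V" for w c
    proof -
      have gw: "L2_on {a<..<b} (\<lambda>x. g x - c *s w x)" by (intro L2_on_diff g scaleL2 VL2 w)
      have "d \<le> (1 + s) * L2sq a b (\<lambda>x. g x - c *s w x)" if s: "s > 0" for s
      proof (rule LIMSEQ_le_const)
        show "(\<lambda>n. (1 + s) * L2sq a b (\<lambda>x. g x - c *s w x) + (1 + 1 / s) * (4 * (1/16) ^ n)) \<longlonglongrightarrow> (1 + s) * L2sq a b (\<lambda>x. g x - c *s w x)"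
          by (rule tendsto_eq_intros z refl | simp)+
        have "d \<le> (1 + s) * L2sq a b (\<lambda>x. g x - c *s w x) + (1 + 1 / s) * (4 * (1/16) ^ n)" for n
        proof -
          have "d \<le> N (\<lambda>x. 1 *s v n x + c *s w x)" by (rule dle[OF Vadd[OF v(1) w]])
          also have "\<dots> = L2sq a b (\<lambda>x. (g x - c *s w x) + (h n x - g x))"
            unfolding N_def h_def by (rule arg_cong[where f = "L2sq a b"]) (simp add: fun_eq_iff)
          also have "\<dots> \<le> (1 + s) * L2sq a b (\<lambda>x. g x - c *s w x) + (1 + 1 / s) * L2sq a b (\<lambda>x. h n x - g x)"
            by (rule L2sq_add_le[OF gw L2_on_diff[OF hL g(1)] s])
          also have "\<dots> \<le> (1 + s) * L2sq a b (\<lambda>x. g x - c *s w x) + (1 + 1 / s) * (4 * (1/16) ^ n)"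
            using s by (intro add_left_mono mult_left_mono g) auto
          finally show ?thesis .
        qed
        then show "\<exists>N. \<forall>n\<ge>N. d \<le> (1 + s) * L2sq a b (\<lambda>x. g x - c *s w x) + (1 + 1 / s) * (4 * (1/16) ^ n)" by blast
      qed
      then show ?thesis
        by (rule le_mult_one_plus_imp_le) (auto simp: L2sq_nonneg)
    qed
    have upper: "L2sq a b g \<le> d"
    proof -
      have "L2sq a b g \<le> (1 + s) * d" if s: "s > 0" for s
      proof (rule LIMSEQ_le_const)
        show "(\<lambda>n. (1 + s) * (d + (1/16) ^ n) + (1 + 1 / s) * (4 * (1/16) ^ n)) \<longlonglongrightarrow> (1 + s) * d"
          by (rule tendsto_eq_intros z refl | simp)+
        have "L2sq a b g \<le> (1 + s) * (d + (1/16) ^ n) + (1 + 1 / s) * (4 * (1/16) ^ n)" for n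
        proof -
          have m: "L2_on {a<..<b} (\<lambda>x. - (h n x - g x))"
            by (rule L2_on_linear[OF L2_on_diff[OF hL g(1)] bounded_linear_minus[OF bounded_linear_ident]])
          have "L2sq a b g = L2sq a b (\<lambda>x. h n x + - (h n x - g x))" by simp
          also have "\<dots> \<le> (1 + s) * L2sq a b (h n) + (1 + 1 / s) * L2sq a b (\<lambda>x. - (h n x - g x))"
            by (rule L2sq_add_le[OF hL m s])
          also have "L2sq a b (\<lambda>x. - (h n x - g x)) = L2sq a b (\<lambda>x. h n x - g x)" by (simp add: L2sq_def norm_minus_commute)
          also have "(1 + s) * L2sq a b (h n) + (1 + 1 / s) * L2sq a b (\<lambda>x. h n x - g x) \<le>
             (1 + s) * (d + (1/16) ^ n) + (1 + 1 / s) * (4 * (1/16) ^ n)"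
            using s v(2)[of n] by (intro add_mono mult_left_mono g) (auto simp: Nh)
          finally show ?thesis .
        qed
        then show "\<exists>N. \<forall>n\<ge>N. L2sq a b g \<le> (1 + s) * (d + (1/16) ^ n) + (1 + 1 / s) * (4 * (1/16) ^ n)" by blast
      qed
      moreover have "0 \<le> d" unfolding d_def using V0 by (intro cInf_greatest) (auto simp: N_def L2sq_nonneg)
      ultimately show ?thesis by (rule le_mult_one_plus_imp_le)
    qed
    have "integral {a..b} (\<lambda>x. hinner (u i x) (g x)) = 0" if i: "i \<in> I" for i
    proof (rule ccontr)
      define \<beta> where "\<beta> = integral {a..b} (\<lambda>x. hinner (u i x) (g x))"
      assume "\<not> ?thesis"
      then have \<beta>: "(cmod \<beta>)\<^sup>2 > 0" by (simp add: \<beta>_def)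
      define U where "U = L2sq a b (u i)"
      have U: "U \<ge> 0" by (simp add: U_def L2sq_nonneg)
      \<comment> \<open>Subtracting \<open>t * cnj \<beta>\<close> times \<open>u i\<close> changes
        the squared norm by \<open>t * (t * U - 2)\<close> times the square of
        \<open>cmod \<beta>\<close>, which is negative once \<open>t * U < 2\<close>.\<close>
      define t where "t = 1 / (U + 1)"
      have t: "t > 0" "t * U < 2" using U by (auto simp: t_def field_simps)
      have "d \<le> L2sq a b (\<lambda>x. g x - (of_real t * cnj \<beta>) *s u i x)" by (rule lower[OF Vu[OF i]])
      also have "\<dots> = L2sq a b g - 2 * Re (of_real t * cnj \<beta> * \<beta>) + (cmod (of_real t * cnj \<beta>))\<^sup>2 * U"
        unfolding L2sq_diff_scale[OF g(1) u[OF i]] \<beta>_def U_def by simp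
      also have "of_real t * cnj \<beta> * \<beta> = of_real (t * (cmod \<beta>)\<^sup>2)"
        by (simp only: of_real_mult complex_norm_square) (simp add: mult_ac)
      also have "(cmod (of_real t * cnj \<beta>))\<^sup>2 * U = t * (t * U) * (cmod \<beta>)\<^sup>2"
        by (simp add: norm_mult power_mult_distrib power2_eq_square)
      finally have "2 * (t * (cmod \<beta>)\<^sup>2) \<le> t * (t * U) * (cmod \<beta>)\<^sup>2" using upper by simp
      then have "(t * (cmod \<beta>)\<^sup>2) * 2 \<le> (t * (cmod \<beta>)\<^sup>2) * (t * U)" by (simp add: mult_ac)
      then have "2 \<le> t * U" using t(1) \<beta> by (simp add: mult_le_cancel_left_pos)
      then show False using t by simp
    qed
    from total[OF g(1) this] obtain Z where Z: "negligible Z" "\<And>x. x \<in> {a..b} - Z \<Longrightarrow> g x = 0" by blast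
    have "L2sq a b g = integral {a..b} (\<lambda>x. 0)"
      unfolding L2sq_def by (rule integral_spike[OF Z(1)]) (use Z(2) in auto)
    then have "d \<le> 0" using lower[OF V0, of 0] by simp
    moreover obtain n where "(1/16::real) ^ n < e" using real_arch_pow_inv[OF e, of "1/16"] by auto
    ultimately have "N (v n) < e" using v(2)[of n] by linarith
    then show ?thesis using v(1) by (auto simp: N_def)
  qed
  show ?thesis
    unfolding complete_in_L2_def
  proof (intro conjI ballI allI impI)
    fix f :: "real \<Rightarrow> complex^'m" and e :: real assume f: "L2_on {a<..<b} f" and e: "e > 0"
    obtain v where v: "v \<in> V" "L2sq a b (\<lambda>x. f x - v x) < e\<^sup>2" using dens[OF f, of "e\<^sup>2"] e by auto
    then obtain F c where F: "finite F" "F \<subseteq> I" "v = (\<lambda>x. \<Sum>i\<in>F. c i *s u i x)" by (auto simp: V_def)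
    have "sqrt (L2sq a b (\<lambda>x. f x - v x)) < e" using v(2) e by (intro real_less_lsqrt L2sq_nonneg) auto
    moreover have "integral\<^sup>L (lebesgue_on {a<..<b}) (\<lambda>x. (norm (f x - v x))\<^sup>2) = L2sq a b (\<lambda>x. f x - v x)"
      by (rule L2sq_lebesgue[OF L2_on_diff[OF f VL2[OF v(1)]]])
    ultimately show "\<exists>F c. finite F \<and> F \<subseteq> I \<and> sqrt (integral\<^sup>L (lebesgue_on {a<..<b}) (\<lambda>x. (norm (f x - (\<Sum>i\<in>F. c i *s u i x)))\<^sup>2)) < e"
      using F(1,2) unfolding F(3) by (intro exI[of _ F] exI[of _ c] conjI) auto
  qed (use u in auto)
qed

section \<open>Energy estimates for the wave equation\<close>

text \<open>Cauchy-Schwarz, read off from the integral of the square of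
  \<open>s * norm (u x) - I\<close>.\<close>

lemma norm_integral_sq_le:
  fixes u :: "real \<Rightarrow> 'b::euclidean_space"
  assumes u: "continuous_on {0..s} u" and s: "0 \<le> s"
  shows "(norm (integral {0..s} u))\<^sup>2 \<le> s * integral {0..s} (\<lambda>x. (norm (u x))\<^sup>2)"
proof (cases "s = 0")
  case False
  then have s0: "s > 0" using s by simp
  define I where "I = integral {0..s} (\<lambda>x. norm (u x))"
  define S where "S = integral {0..s} (\<lambda>x. (norm (u x))\<^sup>2)"
  have i1: "((\<lambda>x. norm (u x)) has_integral I) {0..s}"
    unfolding I_def by (intro integrable_integral integrable_continuous_real continuous_intros u)
  have i2: "((\<lambda>x. (norm (u x))\<^sup>2) has_integral S) {0..s}"
    unfolding S_def by (intro integrable_integral integrable_continuous_real continuous_intros u)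
  have "((\<lambda>x. I\<^sup>2) has_integral (s * I\<^sup>2)) {0..s}"
    using has_integral_const_real[of "I\<^sup>2" 0 s] s by simp
  then have "((\<lambda>x. s\<^sup>2 * (norm (u x))\<^sup>2 - 2 * s * I * norm (u x) + I\<^sup>2) has_integral (s\<^sup>2 * S - 2 * s * I * I + s * I\<^sup>2)) {0..s}"
    by (intro has_integral_add has_integral_diff has_integral_mult_right i1 i2)
  moreover have "s\<^sup>2 * (norm (u x))\<^sup>2 - 2 * s * I * norm (u x) + I\<^sup>2 = (s * norm (u x) - I)\<^sup>2" for x
    by (simp add: power2_eq_square algebra_simps)
  ultimately have "((\<lambda>x. (s * norm (u x) - I)\<^sup>2) has_integral (s\<^sup>2 * S - 2 * s * I * I + s * I\<^sup>2)) {0..s}"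
    by simp
  from has_integral_nonneg[OF this] have "0 \<le> s\<^sup>2 * S - 2 * s * I * I + s * I\<^sup>2" by simp
  then have "s * I\<^sup>2 \<le> s * (s * S)" by (simp add: power2_eq_square algebra_simps)
  then have "I\<^sup>2 \<le> s * S" using s0 by simp
  moreover have "norm (integral {0..s} u) \<le> I"
    unfolding I_def by (intro integral_norm_bound_integral integrable_continuous_real continuous_intros u) auto
  then have "(norm (integral {0..s} u))\<^sup>2 \<le> I\<^sup>2" by (intro power_mono) auto
  ultimately show ?thesis by (simp add: S_def)
qed simp

lemma hinner_sum_sum:
  fixes B D :: "'j \<Rightarrow> complex^'m"
  shows "hinner (\<Sum>j\<in>J. a j *s B j) (\<Sum>k\<in>J. d k *s D k) = (\<Sum>j\<in>J. \<Sum>k\<in>J. hinner (B j) (D k) * (a j * cnj (d k)))"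
  unfolding bounded_bilinear.sum_left[OF bounded_bilinear_hinner]
  by (intro sum.cong refl)
    (simp add: bounded_bilinear.sum_right[OF bounded_bilinear_hinner] hinner_simps sum_distrib_left mult_ac)

lemma continuous_on_scalar_vec:
  fixes c :: "real \<Rightarrow> complex" and v :: "real \<Rightarrow> complex^'m"
  shows "continuous_on S c \<Longrightarrow> continuous_on S v \<Longrightarrow> continuous_on S (\<lambda>x. c x *s v x)"
  by (rule bounded_bilinear.continuous_on[OF bounded_bilinear_scalar_vec])

text \<open>Since \<open>A' j\<close> is merely integrable, differentiation under the integral is
  avoided: as the variables separate, the energy is a finite sum of products of absolutely
  continuous functions of \<open>t\<close>. The moving end point \<open>x - t\<close> produces the
  last term.\<close>

lemma ac_deriv_energy:
  fixes A A' :: "'j \<Rightarrow> real \<Rightarrow> complex^'m" and \<alpha> :: "'j \<Rightarrow> real \<Rightarrow> complex"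
  assumes x: "0 \<le> x" and A: "\<And>j. j \<in> J \<Longrightarrow> ac_deriv 0 x (A j) (A' j)"
    and \<alpha>: "\<And>j. j \<in> J \<Longrightarrow> continuous_on {0..x} (\<alpha> j)"
  defines "u \<equiv> \<lambda>t s. \<Sum>j\<in>J. \<alpha> j s *s A j t" and "u' \<equiv> \<lambda>t s. \<Sum>j\<in>J. \<alpha> j s *s A' j t"
  shows "ac_deriv 0 x (\<lambda>t. integral {0..x - t} (\<lambda>s. (norm (u t s))\<^sup>2))
     (\<lambda>t. integral {0..x - t} (\<lambda>s. 2 * (u t s \<bullet> u' t s)) - (norm (u t (x - t)))\<^sup>2)"
proof -
  define C where "C = (\<lambda>j k r. integral {0..r} (\<lambda>s. \<alpha> j s * cnj (\<alpha> k s)))"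
  have c2: "continuous_on {0..x} (\<lambda>s. \<alpha> j s * cnj (\<alpha> k s))" if "j \<in> J" "k \<in> J" for j k
    by (intro continuous_intros \<alpha> that)
  have dC: "ac_deriv 0 x (\<lambda>t. C j k (x - t)) (\<lambda>t. - (\<alpha> j (x - t) * cnj (\<alpha> k (x - t))))" if jk: "j \<in> J" "k \<in> J" for j k
  proof (rule ac_deriv_C1)
    have im: "(\<lambda>t. x - t) ` {0..x} = {0..x}" by simp
    fix t assume t: "t \<in> {0..x}"
    have "(C j k has_vector_derivative \<alpha> j (x - t) * cnj (\<alpha> k (x - t))) (at (x - t) within (\<lambda>t. x - t) ` {0..x})"
      unfolding C_def im by (rule integral_has_vector_derivative[OF c2[OF jk]]) (use t in auto)
    moreover have "((\<lambda>t. x - t) has_vector_derivative -1) (at t within {0..x})"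
      by (auto intro!: derivative_eq_intros)
    ultimately show "((\<lambda>t. C j k (x - t)) has_vector_derivative - (\<alpha> j (x - t) * cnj (\<alpha> k (x - t)))) (at t within {0..x})"
      using vector_diff_chain_within[of "\<lambda>t. x - t" "-1" t "{0..x}" "C j k"] by (simp add: o_def)
  next
    show "continuous_on {0..x} (\<lambda>t. - (\<alpha> j (x - t) * cnj (\<alpha> k (x - t))))"
      by (intro continuous_intros continuous_on_compose2[OF \<alpha>[OF jk(1)]] continuous_on_compose2[OF \<alpha>[OF jk(2)]]) auto
  qed
  have HI: "((\<lambda>s. hinner (\<Sum>j\<in>J. \<alpha> j s *s B j) (\<Sum>k\<in>J. \<alpha> k s *s D k)) has_integral (\<Sum>j\<in>J. \<Sum>k\<in>J. hinner (B j) (D k) * C j k r)) {0..r}"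
    if r: "r \<in> {0..x}" for B D :: "'j \<Rightarrow> complex^'m" and r
  \<comment> \<open>For infinite \<open>J\<close> all sums are 0 by convention.\<close>
  proof (cases "finite J")
    case True
    have "(\<lambda>s. \<alpha> j s * cnj (\<alpha> k s)) integrable_on {0..r}" if "j \<in> J" "k \<in> J" for j k
      by (rule integrable_continuous_real[OF continuous_on_subset[OF c2[OF that]]]) (use r in auto)
    then show ?thesis
      unfolding hinner_sum_sum C_def
      by (intro has_integral_sum True has_integral_mult_right integrable_integral) auto
  qed (simp add: hinner_simps)
  have acE: "ac_deriv 0 x (\<lambda>t. Re (\<Sum>j\<in>J. \<Sum>k\<in>J. hinner (A j t) (A k t) * C j k (x - t)))
    (\<lambda>t. Re (\<Sum>j\<in>J. \<Sum>k\<in>J. (hinner (A' j t) (A k t) + hinner (A j t) (A' k t)) * C j k (x - t) +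
        hinner (A j t) (A k t) * - (\<alpha> j (x - t) * cnj (\<alpha> k (x - t)))))"
    by (intro ac_deriv_linear[OF _ bounded_linear_Re] ac_deriv_sum ac_deriv_bilinear[OF bounded_bilinear_mult]
        ac_deriv_bilinear[OF bounded_bilinear_hinner] A dC)
  show ?thesis
  proof (rule ac_deriv_cong[OF acE _ negligible_empty])
    fix t assume t: "t \<in> {0..x}"
    then have r: "x - t \<in> {0..x}" by auto
    have "((\<lambda>s. hinner (u t s) (u t s)) has_integral (\<Sum>j\<in>J. \<Sum>k\<in>J. hinner (A j t) (A k t) * C j k (x - t))) {0..x - t}"
      unfolding u_def by (rule HI[OF r])
    from has_integral_Re[OF this]
    show "Re (\<Sum>j\<in>J. \<Sum>k\<in>J. hinner (A j t) (A k t) * C j k (x - t)) = integral {0..x - t} (\<lambda>s. (norm (u t s))\<^sup>2)"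
      by (simp add: hinner_self integral_unique)
  next
    fix t assume "t \<in> {0..x} - {}"
    then have t: "t \<in> {0..x}" by simp
    then have r: "x - t \<in> {0..x}" by auto
    have "((\<lambda>s. hinner (u' t s) (u t s) + hinner (u t s) (u' t s)) has_integral
       ((\<Sum>j\<in>J. \<Sum>k\<in>J. hinner (A' j t) (A k t) * C j k (x - t)) + (\<Sum>j\<in>J. \<Sum>k\<in>J. hinner (A j t) (A' k t) * C j k (x - t)))) {0..x - t}"
      unfolding u_def u'_def by (intro has_integral_add HI[OF r])
    from has_integral_Re[OF this]
    have 1: "((\<lambda>s. Re (hinner (u' t s) (u t s) + hinner (u t s) (u' t s))) has_integral
       Re (\<Sum>j\<in>J. \<Sum>k\<in>J. (hinner (A' j t) (A k t) + hinner (A j t) (A' k t)) * C j k (x - t))) {0..x - t}"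
      by (simp add: distrib_right sum.distrib)
    have e: "Re (hinner v w + hinner w v) = 2 * (w \<bullet> v)" for v w :: "complex^'m"
      by (simp add: inner_eq_Re_hinner hinner_commute[of v w])
    have 2: "(norm (u t (x - t)))\<^sup>2 = Re (\<Sum>j\<in>J. \<Sum>k\<in>J. hinner (A j t) (A k t) * (\<alpha> j (x - t) * cnj (\<alpha> k (x - t))))"
      unfolding hinner_sum_sum[symmetric] by (simp add: u_def hinner_self)
    have "Re (\<Sum>j\<in>J. \<Sum>k\<in>J. (hinner (A' j t) (A k t) + hinner (A j t) (A' k t)) * C j k (x - t) +
        hinner (A j t) (A k t) * - (\<alpha> j (x - t) * cnj (\<alpha> k (x - t)))) =
      Re (\<Sum>j\<in>J. \<Sum>k\<in>J. (hinner (A' j t) (A k t) + hinner (A j t) (A' k t)) * C j k (x - t)) - (norm (u t (x - t)))\<^sup>2"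
    proof -
      have "(\<Sum>j\<in>J. \<Sum>k\<in>J. X j k + W j k * - B j k) = (\<Sum>j\<in>J. \<Sum>k\<in>J. X j k) - (\<Sum>j\<in>J. \<Sum>k\<in>J. W j k * B j k)"
        for X W B :: "'j \<Rightarrow> 'j \<Rightarrow> complex"
        by (simp add: sum_subtractf)
      then show ?thesis unfolding 2 by (simp only: minus_complex.simps)
    qed
    also have "\<dots> = integral {0..x - t} (\<lambda>s. 2 * (u t s \<bullet> u' t s)) - (norm (u t (x - t)))\<^sup>2"
      using integral_unique[OF 1] unfolding e by simp
    finally show "Re (\<Sum>j\<in>J. \<Sum>k\<in>J. (hinner (A' j t) (A k t) + hinner (A j t) (A' k t)) * C j k (x - t) +
        hinner (A j t) (A k t) * - (\<alpha> j (x - t) * cnj (\<alpha> k (x - t)))) =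
       integral {0..x - t} (\<lambda>s. 2 * (u t s \<bullet> u' t s)) - (norm (u t (x - t)))\<^sup>2" .
  qed
qed

text \<open>\<open>cosz z\<close> and \<open>sinz z\<close> form the fundamental system of
  \<open>- c'' = z c\<close>: the cosine of the root of \<open>z\<close> times \<open>s\<close>, and
  the corresponding sine divided by that root. Both are even in the root, so the branch
  \<open>csqrt\<close> is immaterial; at \<open>z = 0\<close> the second takes its limit
  \<open>s\<close>.\<close>

definition cosz :: "complex \<Rightarrow> real \<Rightarrow> complex" where
  "cosz z s = cos (csqrt z * of_real s)"

definition sinz :: "complex \<Rightarrow> real \<Rightarrow> complex" where
  "sinz z s = (if z = 0 then of_real s else sin (csqrt z * of_real s) / csqrt z)"

lemma cosz_0 [simp]: "cosz z 0 = 1" and sinz_0 [simp]: "sinz z 0 = 0"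
  by (simp_all add: cosz_def sinz_def)

lemma cosz_deriv: "(cosz z has_vector_derivative - z * sinz z s) (at s within S)"
proof -
  have 1: "((\<lambda>s. csqrt z * of_real s) has_vector_derivative csqrt z) (at s within S)"
    by (auto intro!: derivative_eq_intros simp: has_vector_derivative_def scaleR_conv_of_real mult.commute)
  have 2: "(cos has_field_derivative - sin (csqrt z * of_real s)) (at (csqrt z * of_real s))"
    by (rule DERIV_cos)
  have "((cos \<circ> (\<lambda>s. csqrt z * of_real s)) has_vector_derivative csqrt z * - sin (csqrt z * of_real s)) (at s within S)"
    by (rule field_vector_diff_chain_within[OF 1 has_field_derivative_at_within[OF 2]])
  moreover have "csqrt z * - sin (csqrt z * of_real s) = - z * sinz z s"
  proof (cases "z = 0")
    case False
    then have "z = csqrt z * csqrt z" "csqrt z \<noteq> 0" using power2_csqrt[of z] by (auto simp: power2_eq_square)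
    then show ?thesis using False by (simp add: sinz_def field_simps)
  qed (simp add: sinz_def)
  ultimately show ?thesis by (simp add: cosz_def[abs_def] o_def)
qed

lemma sinz_deriv: "(sinz z has_vector_derivative cosz z s) (at s within S)"
proof (cases "z = 0")
  case True
  have "((\<lambda>s. of_real s :: complex) has_vector_derivative 1) (at s within S)"
    by (auto intro!: derivative_eq_intros simp: has_vector_derivative_def scaleR_conv_of_real)
  then show ?thesis using True by (simp add: sinz_def[abs_def] cosz_def)
next
  case False
  have 1: "((\<lambda>s. csqrt z * of_real s) has_vector_derivative csqrt z) (at s within S)"
    by (auto intro!: derivative_eq_intros simp: has_vector_derivative_def scaleR_conv_of_real mult.commute)
  have 2: "((\<lambda>w. sin w / csqrt z) has_field_derivative cos (csqrt z * of_real s) / csqrt z) (at (csqrt z * of_real s))"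
    by (rule DERIV_cdivide[OF DERIV_sin])
  have "(((\<lambda>w. sin w / csqrt z) \<circ> (\<lambda>s. csqrt z * of_real s)) has_vector_derivative csqrt z * (cos (csqrt z * of_real s) / csqrt z)) (at s within S)"
    by (rule field_vector_diff_chain_within[OF 1 has_field_derivative_at_within[OF 2]])
  then show ?thesis using False by (simp add: sinz_def[abs_def] cosz_def o_def)
qed

lemma cosz_continuous: "continuous_on S (cosz z)" and sinz_continuous: "continuous_on S (sinz z)"
  by (auto simp: cosz_def[abs_def] intro!: continuous_intros)
    (cases "z = 0"; auto simp: sinz_def[abs_def] intro!: continuous_intros)

lemma inner_matrix_le:
  fixes y w :: "complex^'m"
  shows "\<bar>y \<bullet> (A *v w)\<bar> \<le> norm A * (norm y * norm w)"
proof -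
  have "\<bar>y \<bullet> (A *v w)\<bar> \<le> norm y * norm (A *v w)" by (rule Cauchy_Schwarz_ineq2)
  also have "\<dots> \<le> norm y * (norm A * norm w)" by (intro mult_left_mono norm_matrix_vector_le) auto
  finally show ?thesis by (simp add: mult_ac)
qed

lemma mult_le_sum_squares_half: "2 * (p * q) \<le> p\<^sup>2 + q\<^sup>2" for p q :: real
  using sum_squares_bound[of p q] by (simp add: mult.assoc)

context hermitian_potential
begin

lemma \<sigma>_norm_int: "(\<lambda>x. norm (\<sigma> x)) absolutely_integrable_on {0..pi}"
  by (rule absolutely_integrable_norm[OF \<sigma>_int, unfolded o_def])

lemma \<sigma>_sq_int: "(\<lambda>x. (norm (\<sigma> x))\<^sup>2) absolutely_integrable_on {0..pi}"
  using \<sigma> by (simp add: L2_on_iff)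

text \<open>Collects the coefficients from the bound \<open>remb\<close> in
  \<open>wave_energy\<close>: \<open>2 * norm (\<sigma> x)\<close> from the terms linear in
  \<open>\<sigma>\<close>, and for the quadratic term a factor 1 from \<open>q\<close> and
  \<open>pi\<^sup>2\<close> from the primitive \<open>Iy\<close>.\<close>

definition energy_rate :: "real \<Rightarrow> real" where
  "energy_rate x = 2 * norm (\<sigma> x) + (1 + pi\<^sup>2) * (norm (\<sigma> x))\<^sup>2"

lemma energy_rate_int: "energy_rate absolutely_integrable_on {0..pi}"
  unfolding energy_rate_def by (intro set_integral_add(1) set_integrable_mult_right \<sigma>_norm_int \<sigma>_sq_int)

definition energy_const :: real where "energy_const = exp (integral {0..pi} energy_rate)"

lemma energy_rate_nonneg: "0 \<le> energy_rate x"
  by (simp add: energy_rate_def)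

text \<open>The fields \<open>y\<close> and \<open>q\<close> solve the wave equation for the operator, with initial data \<open>(Y, 0)\<close>
  on \<open>s = 0\<close>.  Evolving the energy in the direction of \<open>t\<close> only uses the integrability of
  \<open>\<sigma>\<close> and \<open>\<sigma>\<^sup>2\<close>, and it also controls the flux \<open>y - q\<close> through the characteristic \<open>s = x - t\<close>.\<close>

lemma wave_energy:
  fixes Y Q :: "'j \<Rightarrow> real \<Rightarrow> complex^'m" and z :: "'j \<Rightarrow> complex"
  assumes S: "\<And>j. j \<in> J \<Longrightarrow> sl_sol (z j) (\<lambda>_. 0) (Y j) (Q j)" and x: "0 \<le> x" "x \<le> pi"
  defines "y \<equiv> \<lambda>t s. \<Sum>j\<in>J. cosz (z j) s *s Y j t" and "q \<equiv> \<lambda>t s. \<Sum>j\<in>J. sinz (z j) s *s Q j t"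
  defines "e \<equiv> \<lambda>t. integral {0..x - t} (\<lambda>s. (norm (y t s))\<^sup>2 + (norm (q t s))\<^sup>2)"
  assumes t: "t \<in> {0..x}"
  shows "e t + integral {0..t} (\<lambda>r. (norm (y r (x - r) - q r (x - r)))\<^sup>2) \<le> e 0 * energy_const"
proof -
  define Y' where "Y' = (\<lambda>j t. \<sigma> t *v Y j t + Q j t)"
  define Q' where "Q' = (\<lambda>j t. - (\<sigma> t *v Q j t) - (\<sigma> t ** \<sigma> t) *v Y j t - z j *s Y j t - 0)"
  have dY: "ac_deriv 0 x (Y j) (Y' j)" and dQ: "ac_deriv 0 x (Q j) (Q' j)" if "j \<in> J" for j
    using S[OF that] ac_deriv_subinterval[of 0 pi _ _ 0 x] x unfolding sl_sol_def Y'_def Q'_def by auto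
  define y' where "y' = (\<lambda>t s. \<Sum>j\<in>J. cosz (z j) s *s Y' j t)"
  define q' where "q' = (\<lambda>t s. \<Sum>j\<in>J. sinz (z j) s *s Q' j t)"
  define ys where "ys = (\<lambda>t s. \<Sum>j\<in>J. (- z j * sinz (z j) s) *s Y j t)"
  define qs where "qs = (\<lambda>t s. \<Sum>j\<in>J. cosz (z j) s *s Q j t)"
  \<comment> \<open>The term with the square of \<open>\<sigma>\<close> acts on \<open>Y\<close> but
    carries the weight \<open>sinz\<close> of \<open>q\<close>; the resulting field is the primitive
    of \<open>y\<close> in \<open>s\<close>.\<close>
  define Iy where "Iy = (\<lambda>t s. \<Sum>j\<in>J. sinz (z j) s *s Y j t)"
  have cont: "continuous_on S' (y t)" "continuous_on S' (q t)" "continuous_on S' (Iy t)" "continuous_on S' (ys t)" "continuous_on S' (qs t)"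
    for t S'
    unfolding y_def q_def Iy_def ys_def qs_def
    by (intro continuous_on_sum continuous_on_scalar_vec cosz_continuous sinz_continuous continuous_on_mult continuous_on_const)+
  have ints: "(\<lambda>s. (norm (y t s))\<^sup>2) integrable_on {0..r}" "(\<lambda>s. (norm (q t s))\<^sup>2) integrable_on {0..r}" for t r
    by (intro integrable_continuous_real continuous_on_power continuous_on_norm cont)+
  have dys: "(y t has_vector_derivative ys t s) (at s within S')" for t s S'
    unfolding y_def ys_def
    by (intro has_vector_derivative_sum bounded_linear.has_vector_derivative[OF bounded_bilinear.bounded_linear_left[OF bounded_bilinear_scalar_vec]] cosz_deriv)
  have dqs: "(q t has_vector_derivative qs t s) (at s within S')" for t s S'
    unfolding q_def qs_def
    by (intro has_vector_derivative_sum bounded_linear.has_vector_derivative[OF bounded_bilinear.bounded_linear_left[OF bounded_bilinear_scalar_vec]] sinz_deriv)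
  have dIy: "(Iy t has_vector_derivative y t s) (at s within S')" for t s S'
    unfolding Iy_def y_def
    by (intro has_vector_derivative_sum bounded_linear.has_vector_derivative[OF bounded_bilinear.bounded_linear_left[OF bounded_bilinear_scalar_vec]] sinz_deriv)
  \<comment> \<open>Together with \<open>qt\<close> this is the symmetric hyperbolic system: the
    \<open>t\<close>-derivative of \<open>y\<close> is \<open>\<sigma> y\<close> plus the
    \<open>s\<close>-derivative of \<open>q\<close>, that of \<open>q\<close> is the
    \<open>s\<close>-derivative of \<open>y\<close> plus terms without derivatives.\<close>
  have yt: "y' t s = \<sigma> t *v y t s + qs t s" for t s
    by (simp add: y'_def Y'_def y_def qs_def vec.scale_right_distrib sum.distrib
        linear_sum[OF matrix_vector_mul_linear] matrix_vector_scale
        bounded_linear.linear linear_sum[OF bounded_linear.linear[OF matrix_vector_mul_bounded_linear]])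
  have qt: "q' t s = - (\<sigma> t *v q t s) - (\<sigma> t ** \<sigma> t) *v Iy t s + ys t s" for t s
    by (simp add: q'_def Q'_def q_def Iy_def ys_def vec.scale_right_diff_distrib vec.scale_minus_right vec.scale_scale sum_subtractf sum_negf
        matrix_vector_scale linear_sum[OF bounded_linear.linear[OF matrix_vector_mul_bounded_linear]] mult_ac)
  have e_eq: "e t = integral {0..x - t} (\<lambda>s. (norm (y t s))\<^sup>2) + integral {0..x - t} (\<lambda>s. (norm (q t s))\<^sup>2)" for t
    unfolding e_def by (rule integral_add[OF ints])
  define e' where "e' = (\<lambda>t. (integral {0..x - t} (\<lambda>s. 2 * (y t s \<bullet> y' t s)) - (norm (y t (x - t)))\<^sup>2) +
       (integral {0..x - t} (\<lambda>s. 2 * (q t s \<bullet> q' t s)) - (norm (q t (x - t)))\<^sup>2))"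
  have de: "ac_deriv 0 x e e'"
    unfolding e_eq[abs_def] e'_def y_def q_def y'_def q'_def
    by (intro ac_deriv_add ac_deriv_energy x dY dQ cosz_continuous sinz_continuous)
  define m where "m = (\<lambda>t. (norm (y t (x - t) - q t (x - t)))\<^sup>2)"
  have cm: "continuous_on {0..x} m"
  proof -
    have Yc: "continuous_on {0..x} (Y j)" and Qc: "continuous_on {0..x} (Q j)" if "j \<in> J" for j
      using dY[OF that] dQ[OF that] by (auto intro: ac_deriv_continuous_on)
    have k: "continuous_on {0..x} (\<lambda>t. cosz w (x - t))" "continuous_on {0..x} (\<lambda>t. sinz w (x - t))" for w
      by (intro continuous_on_compose2[OF cosz_continuous[of UNIV]] continuous_on_compose2[OF sinz_continuous[of UNIV]] continuous_intros; simp)+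
    show ?thesis
      unfolding m_def y_def q_def
      by (intro continuous_on_power continuous_on_norm continuous_on_diff continuous_on_sum continuous_on_scalar_vec k Yc Qc)
  qed
  have bound: "e' t \<le> energy_rate t * e t - m t" if t: "t \<in> {0..x}" for t
  proof -
    define r where "r = x - t"
    have r: "0 \<le> r" "r \<le> pi" using t x by (auto simp: r_def)
    define P where "P = integral {0..r} (\<lambda>s. (norm (y t s))\<^sup>2)"
    define R where "R = integral {0..r} (\<lambda>s. (norm (q t s))\<^sup>2)"
    have P0: "P \<ge> 0" unfolding P_def by (intro integral_nonneg ints) auto
    have Pi: "((\<lambda>s. (norm (y t s))\<^sup>2) has_integral P) {0..r}" and Ri: "((\<lambda>s. (norm (q t s))\<^sup>2) has_integral R) {0..r}"
      unfolding P_def R_def by (auto intro: integrable_integral ints)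
    \<comment> \<open>The primitive vanishes at \<open>s = 0\<close>, so Cauchy-Schwarz bounds it by
      the energy. This is what makes the quadratic term a perturbation.\<close>
    have Iyb: "(norm (Iy t s))\<^sup>2 \<le> pi * P" if s: "s \<in> {0..r}" for s
    proof -
      have "(y t has_integral (Iy t s - Iy t 0)) {0..s}"
        by (rule fundamental_theorem_of_calculus) (use s dIy in auto)
      then have "Iy t s = integral {0..s} (y t)" by (simp add: Iy_def integral_unique)
      then have "(norm (Iy t s))\<^sup>2 \<le> s * integral {0..s} (\<lambda>s. (norm (y t s))\<^sup>2)"
        using norm_integral_sq_le[OF cont(1), of s t] s by simp
      also have "\<dots> \<le> pi * P"
        unfolding P_def using s r by (intro mult_mono integral_subset_le ints integral_nonneg) auto
      finally show ?thesis .
    qed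
    \<comment> \<open>The principal terms form the \<open>s\<close>-derivative of
      \<open>y \<bullet> q\<close>, and \<open>q\<close> vanishes at \<open>s = 0\<close>; only the
      value at the end point remains.\<close>
    have flux: "((\<lambda>s. y t s \<bullet> qs t s + ys t s \<bullet> q t s) has_integral (y t r \<bullet> q t r)) {0..r}"
    proof -
      have "((\<lambda>s. y t s \<bullet> qs t s + ys t s \<bullet> q t s) has_integral (y t r \<bullet> q t r - y t 0 \<bullet> q t 0)) {0..r}"
        by (rule fundamental_theorem_of_calculus[OF r(1)])
          (rule bounded_bilinear.has_vector_derivative[OF bounded_bilinear_inner dys dqs])
      moreover have "q t 0 = 0" by (simp add: q_def)
      ultimately show ?thesis by simp
    qed
    define a where "a = norm (\<sigma> t)"
    define rem where "rem = (\<lambda>s. y t s \<bullet> (\<sigma> t *v y t s) - q t s \<bullet> (\<sigma> t *v q t s) - q t s \<bullet> ((\<sigma> t ** \<sigma> t) *v Iy t s))"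
    have crem: "rem integrable_on {0..r}"
      unfolding rem_def
      by (intro integrable_continuous_real continuous_on_diff continuous_on_inner cont
          bounded_linear.continuous_on[OF matrix_vector_mul_bounded_linear])
    have remb: "2 * rem s \<le> 2 * a * (norm (y t s))\<^sup>2 + (2 * a + a\<^sup>2) * (norm (q t s))\<^sup>2 + a\<^sup>2 * (pi * P)" if s: "s \<in> {0..r}" for s
    proof -
      have 1: "y t s \<bullet> (\<sigma> t *v y t s) \<le> a * (norm (y t s))\<^sup>2"
        using inner_matrix_le[of "y t s" "\<sigma> t" "y t s"] by (simp add: a_def power2_eq_square)
      have 2: "- (q t s \<bullet> (\<sigma> t *v q t s)) \<le> a * (norm (q t s))\<^sup>2"
        using inner_matrix_le[of "q t s" "\<sigma> t" "q t s"] by (simp add: a_def power2_eq_square)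
      have "\<bar>q t s \<bullet> ((\<sigma> t ** \<sigma> t) *v Iy t s)\<bar> \<le> norm (\<sigma> t ** \<sigma> t) * (norm (q t s) * norm (Iy t s))"
        by (rule inner_matrix_le)
      also have "\<dots> \<le> a\<^sup>2 * (norm (q t s) * norm (Iy t s))"
        using norm_matrix_matrix_le[of "\<sigma> t" "\<sigma> t"] by (intro mult_right_mono) (auto simp: a_def power2_eq_square)
      finally have "- (2 * (q t s \<bullet> ((\<sigma> t ** \<sigma> t) *v Iy t s))) \<le> a\<^sup>2 * (2 * (norm (q t s) * norm (Iy t s)))"
        by (simp add: algebra_simps)
      also have "\<dots> \<le> a\<^sup>2 * ((norm (q t s))\<^sup>2 + (norm (Iy t s))\<^sup>2)"
        by (intro mult_left_mono mult_le_sum_squares_half) auto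
      also have "\<dots> \<le> a\<^sup>2 * ((norm (q t s))\<^sup>2 + pi * P)" by (intro mult_left_mono add_left_mono Iyb s) auto
      finally have 3: "- (2 * (q t s \<bullet> ((\<sigma> t ** \<sigma> t) *v Iy t s))) \<le> a\<^sup>2 * ((norm (q t s))\<^sup>2 + pi * P)" .
      have "2 * rem s = 2 * (y t s \<bullet> (\<sigma> t *v y t s)) + 2 * (- (q t s \<bullet> (\<sigma> t *v q t s))) + - (2 * (q t s \<bullet> ((\<sigma> t ** \<sigma> t) *v Iy t s)))"
        by (simp add: rem_def)
      also have "\<dots> \<le> 2 * (a * (norm (y t s))\<^sup>2) + 2 * (a * (norm (q t s))\<^sup>2) + a\<^sup>2 * ((norm (q t s))\<^sup>2 + pi * P)"
        using 1 2 3 by (intro add_mono mult_left_mono) auto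
      finally show ?thesis by (simp add: algebra_simps)
    qed
    have "integral {0..r} (\<lambda>s. 2 * rem s) \<le> 2 * a * P + (2 * a + a\<^sup>2) * R + a\<^sup>2 * (pi * P) * r"
    proof (rule has_integral_le[OF integrable_integral])
      show "(\<lambda>s. 2 * rem s) integrable_on {0..r}" by (rule integrable_on_mult_right[OF crem])
      show "((\<lambda>s. 2 * a * (norm (y t s))\<^sup>2 + (2 * a + a\<^sup>2) * (norm (q t s))\<^sup>2 + a\<^sup>2 * (pi * P)) has_integral
         (2 * a * P + (2 * a + a\<^sup>2) * R + a\<^sup>2 * (pi * P) * r)) {0..r}"
        using has_integral_const_real[of "a\<^sup>2 * (pi * P)" 0 r] r
        by (intro has_integral_add has_integral_mult_right Pi Ri) (simp add: mult.commute)
    qed (rule remb)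
    also have "\<dots> \<le> 2 * a * P + (2 * a + a\<^sup>2) * R + a\<^sup>2 * (pi * P) * pi"
      using r P0 by (intro add_left_mono mult_left_mono) auto
    also have "\<dots> \<le> (2 * a + (1 + pi\<^sup>2) * a\<^sup>2) * (P + R)"
    proof -
      have "0 \<le> R" unfolding R_def by (intro integral_nonneg ints) auto
      then have "0 \<le> a\<^sup>2 * P" "0 \<le> pi\<^sup>2 * a\<^sup>2 * R" using P0 by auto
      then show ?thesis by (simp add: algebra_simps power2_eq_square)
    qed
    also have "\<dots> = energy_rate t * e t" by (simp add: e_eq energy_rate_def a_def P_def R_def r_def)
    finally have rem_le: "integral {0..r} (\<lambda>s. 2 * rem s) \<le> energy_rate t * e t" .
    have "((\<lambda>s. 2 * (y t s \<bullet> qs t s + ys t s \<bullet> q t s) + 2 * rem s) has_integral (2 * (y t r \<bullet> q t r) + integral {0..r} (\<lambda>s. 2 * rem s))) {0..r}"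
      by (intro has_integral_add has_integral_mult_right flux integrable_integral integrable_on_mult_right crem)
    moreover have "2 * (y t s \<bullet> qs t s + ys t s \<bullet> q t s) + 2 * rem s = 2 * (y t s \<bullet> y' t s) + 2 * (q t s \<bullet> q' t s)" for s
      by (simp add: yt qt rem_def inner_simps inner_commute algebra_simps)
    ultimately have "integral {0..r} (\<lambda>s. 2 * (y t s \<bullet> y' t s) + 2 * (q t s \<bullet> q' t s)) = 2 * (y t r \<bullet> q t r) + integral {0..r} (\<lambda>s. 2 * rem s)"
      by (simp add: integral_unique)
    moreover have "integral {0..r} (\<lambda>s. 2 * (y t s \<bullet> y' t s) + 2 * (q t s \<bullet> q' t s)) =
       integral {0..r} (\<lambda>s. 2 * (y t s \<bullet> y' t s)) + integral {0..r} (\<lambda>s. 2 * (q t s \<bullet> q' t s))"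
      unfolding yt qt
      by (intro integral_add integrable_continuous_real continuous_on_mult continuous_on_const continuous_on_inner continuous_on_add
          continuous_on_diff continuous_on_minus cont bounded_linear.continuous_on[OF matrix_vector_mul_bounded_linear])
    \<comment> \<open>Twice the flux and the two terms of the moving end point complete the square
      \<open>- m t\<close>.\<close>
    ultimately have "e' t = 2 * (y t r \<bullet> q t r) + integral {0..r} (\<lambda>s. 2 * rem s) - (norm (y t r))\<^sup>2 - (norm (q t r))\<^sup>2"
      by (simp add: e'_def r_def)
    also have "\<dots> = integral {0..r} (\<lambda>s. 2 * rem s) - m t"
      by (simp add: m_def r_def power2_norm_eq_inner inner_simps inner_commute)
    finally show ?thesis using rem_le by linarith
  qed
  have sub: "{0..t} \<subseteq> {0..x}" "{0..t} \<subseteq> {0..pi}" using t x by auto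
  have e0: "0 \<le> e t" for t unfolding e_eq by (intro add_nonneg_nonneg integral_nonneg ints) auto
  have "e t + integral {0..t} m \<le> e 0 * exp (integral {0..t} energy_rate)"
  proof (rule ac_deriv_gronwall[where N = "{}"])
    show "ac_deriv 0 t e e'" by (rule ac_deriv_subinterval[OF de]) (use t in auto)
    show "energy_rate absolutely_integrable_on {0..t}" by (rule absolutely_integrable_on_subinterval[OF energy_rate_int sub(2)])
    show "m absolutely_integrable_on {0..t}"
      by (rule absolutely_integrable_continuous_real[OF continuous_on_subset[OF cm sub(1)]])
  qed (use t bound energy_rate_nonneg e0 in \<open>auto simp: m_def\<close>)
  also have "\<dots> \<le> e 0 * energy_const"
  proof -
    have k: "energy_rate integrable_on {0..pi}" by (rule set_lebesgue_integral_eq_integral(1)[OF energy_rate_int])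
    have "integral {0..t} energy_rate \<le> integral {0..pi} energy_rate"
      by (rule integral_subset_le[OF sub(2) integrable_subinterval_real[OF k sub(2)] k]) (simp add: energy_rate_nonneg)
    then show ?thesis unfolding energy_const_def using e0[of 0] by (intro mult_left_mono) auto
  qed
  finally show ?thesis by (simp add: m_def)
qed

lemma energy_const_pos: "energy_const > 0"
  by (simp add: energy_const_def)

definition sigma_sq :: real where "sigma_sq = integral {0..pi} (\<lambda>x. (norm (\<sigma> x))\<^sup>2)"

text \<open>The three summands come from the estimate of \<open>b\<close> in
  \<open>wave_trace\<close>: the first two from splitting the product of
  \<open>norm (\<sigma> t)\<close> with the trace of \<open>y - q\<close>, the third from the bound
  of \<open>Iy\<close>.\<close>

definition trace_const :: real where
  "trace_const = sigma_sq / 2 + energy_const / 2 + sigma_sq * sqrt (pi * energy_const)"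

text \<open>Follows \<open>y + q\<close> along the characteristic from \<open>(0, x)\<close> to
  \<open>(x, 0)\<close>, where \<open>q\<close> vanishes and \<open>y\<close> equals the sum of the
  \<open>Y j x\<close>. Along it the principal terms cancel and the derivative is
  \<open>\<sigma> (y - q)\<close> minus the quadratic term in \<open>Iy\<close>. The trace of
  \<open>y - q\<close> on the characteristic is square integrable by the dissipation term of
  \<open>wave_energy\<close>, which matches a square integrable \<open>\<sigma>\<close>.\<close>

lemma wave_trace:
  fixes Y Q :: "'j \<Rightarrow> real \<Rightarrow> complex^'m" and z :: "'j \<Rightarrow> complex"
  assumes S: "\<And>j. j \<in> J \<Longrightarrow> sl_sol (z j) (\<lambda>_. 0) (Y j) (Q j)" and x: "0 \<le> x" "x \<le> pi"
  defines "y \<equiv> \<lambda>t s. \<Sum>j\<in>J. cosz (z j) s *s Y j t" and "q \<equiv> \<lambda>t s. \<Sum>j\<in>J. sinz (z j) s *s Q j t"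
  assumes w: "w > 0" "integral {0..x} (\<lambda>s. (norm (y 0 s))\<^sup>2 + (norm (q 0 s))\<^sup>2) \<le> w\<^sup>2"
  shows "norm ((\<Sum>j\<in>J. Y j x) - (y 0 x + q 0 x)) \<le> trace_const * w"
proof -
  define e where "e = (\<lambda>t. integral {0..x - t} (\<lambda>s. (norm (y t s))\<^sup>2 + (norm (q t s))\<^sup>2))"
  define m where "m = (\<lambda>t. (norm (y t (x - t) - q t (x - t)))\<^sup>2)"
  have W: "e t + integral {0..t} m \<le> e 0 * energy_const" if "t \<in> {0..x}" for t
    unfolding e_def m_def y_def q_def by (rule wave_energy[OF S x that])
  have e0: "e 0 \<le> w\<^sup>2" using w(2) by (simp add: e_def)
  have dY: "ac_deriv 0 x (Y j) (\<lambda>t. \<sigma> t *v Y j t + Q j t)"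
    and dQ: "ac_deriv 0 x (Q j) (\<lambda>t. - (\<sigma> t *v Q j t) - (\<sigma> t ** \<sigma> t) *v Y j t - z j *s Y j t - 0)" if "j \<in> J" for j
    using S[OF that] ac_deriv_subinterval[of 0 pi _ _ 0 x] x unfolding sl_sol_def by auto
  have dcos: "ac_deriv 0 x (\<lambda>t. cosz u (x - t)) (\<lambda>t. u * sinz u (x - t))"
    and dsin: "ac_deriv 0 x (\<lambda>t. sinz u (x - t)) (\<lambda>t. - cosz u (x - t))" for u
  proof -
    have d: "((\<lambda>t. x - t) has_vector_derivative -1) (at t within {0..x})" for t
      by (auto intro!: derivative_eq_intros)
    have k: "continuous_on {0..x} (\<lambda>t. cosz w (x - t))" "continuous_on {0..x} (\<lambda>t. sinz w (x - t))" for w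
      by (intro continuous_on_compose2[OF cosz_continuous[of UNIV]] continuous_on_compose2[OF sinz_continuous[of UNIV]] continuous_intros; simp)+
    show "ac_deriv 0 x (\<lambda>t. cosz u (x - t)) (\<lambda>t. u * sinz u (x - t))"
    proof (rule ac_deriv_C1)
      show "((\<lambda>t. cosz u (x - t)) has_vector_derivative u * sinz u (x - t)) (at t within {0..x})" for t
        using vector_diff_chain_within[OF d[of t] cosz_deriv[of u "x - t"]] by (simp add: o_def)
    qed (intro continuous_on_mult continuous_on_const k)
    show "ac_deriv 0 x (\<lambda>t. sinz u (x - t)) (\<lambda>t. - cosz u (x - t))"
    proof (rule ac_deriv_C1)
      show "((\<lambda>t. sinz u (x - t)) has_vector_derivative - cosz u (x - t)) (at t within {0..x})" for t
        using vector_diff_chain_within[OF d[of t] sinz_deriv[of u "x - t"]] by (simp add: o_def)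
    qed (intro continuous_on_minus k)
  qed
  define Iy where "Iy = (\<lambda>t s. \<Sum>j\<in>J. sinz (z j) s *s Y j t)"
  have cont: "continuous_on S' (y t)" "continuous_on S' (q t)" for t S'
    unfolding y_def q_def
    by (intro continuous_on_sum continuous_on_scalar_vec cosz_continuous sinz_continuous continuous_on_const)+
  have dIy: "(Iy t has_vector_derivative y t s) (at s within S')" for t s S'
    unfolding Iy_def y_def
    by (intro has_vector_derivative_sum bounded_linear.has_vector_derivative[OF bounded_bilinear.bounded_linear_left[OF bounded_bilinear_scalar_vec]] sinz_deriv)
  have ints: "(\<lambda>s. (norm (y t s))\<^sup>2) integrable_on {0..r}" "(\<lambda>s. (norm (q t s))\<^sup>2) integrable_on {0..r}" for t r
    by (intro integrable_continuous_real continuous_on_power continuous_on_norm cont)+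
  have m_int: "m integrable_on {0..x}"
  proof -
    have Yc: "continuous_on {0..x} (Y j)" and Qc: "continuous_on {0..x} (Q j)" if "j \<in> J" for j
      using dY[OF that] dQ[OF that] by (auto intro: ac_deriv_continuous_on)
    have k: "continuous_on {0..x} (\<lambda>t. cosz w (x - t))" "continuous_on {0..x} (\<lambda>t. sinz w (x - t))" for w
      using ac_deriv_continuous_on[OF dcos] ac_deriv_continuous_on[OF dsin] by auto
    show ?thesis
      unfolding m_def y_def q_def
      by (intro integrable_continuous_real continuous_on_power continuous_on_norm continuous_on_diff continuous_on_sum continuous_on_scalar_vec k Yc Qc)
  qed
  have et: "0 \<le> e t" for t
    unfolding e_def by (intro integral_nonneg integrable_add ints) auto
  have mt: "0 \<le> integral {0..t} m" if "t \<in> {0..x}" for t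
    using that by (intro integral_nonneg integrable_subinterval_real[OF m_int]) (auto simp: m_def)
  have Kw: "e 0 * energy_const \<le> energy_const * w\<^sup>2" using e0 energy_const_pos by (simp add: mult.commute)
  have Iyb: "norm (Iy t (x - t)) \<le> sqrt (pi * energy_const) * w" if t: "t \<in> {0..x}" for t
  proof -
    have "(y t has_integral (Iy t (x - t) - Iy t 0)) {0..x - t}"
      by (rule fundamental_theorem_of_calculus) (use t dIy in auto)
    then have "Iy t (x - t) = integral {0..x - t} (y t)" by (simp add: Iy_def integral_unique)
    then have "(norm (Iy t (x - t)))\<^sup>2 \<le> (x - t) * integral {0..x - t} (\<lambda>s. (norm (y t s))\<^sup>2)"
      using norm_integral_sq_le[OF cont(1), of "x - t" t] t by simp
    also have "\<dots> \<le> pi * e t"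
      unfolding e_def using t x by (intro mult_mono integral_le integrable_add ints integral_nonneg) auto
    also have "\<dots> \<le> pi * (energy_const * w\<^sup>2)"
      using W[OF t] mt[OF t] Kw by (intro mult_left_mono) auto
    finally have "(norm (Iy t (x - t)))\<^sup>2 \<le> (sqrt (pi * energy_const) * w)\<^sup>2"
      using energy_const_pos by (simp add: power_mult_distrib mult_ac)
    then show ?thesis by (rule power2_le_imp_le) (use energy_const_pos w in auto)
  qed
  \<comment> \<open>\<open>B t\<close> is \<open>y + q\<close> at the point
    \<open>(t, x - t)\<close> of the characteristic, and \<open>b\<close> is its derivative.\<close>
  define B where "B = (\<lambda>t. \<Sum>j\<in>J. cosz (z j) (x - t) *s Y j t + sinz (z j) (x - t) *s Q j t)"
  define b where "b = (\<lambda>t. \<sigma> t *v (y t (x - t) - q t (x - t)) - (\<sigma> t ** \<sigma> t) *v Iy t (x - t))"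
  have msum: "M *v (\<Sum>j\<in>J. f j) = (\<Sum>j\<in>J. M *v f j)" for M :: "complex^'m^'m" and f :: "'j \<Rightarrow> complex^'m"
    by (rule linear_sum[OF bounded_linear.linear[OF matrix_vector_mul_bounded_linear]])
  have "ac_deriv 0 x B b"
  proof (rule ac_deriv_cong[OF _ refl negligible_empty])
    show "ac_deriv 0 x B (\<lambda>t. \<Sum>j\<in>J.
        ((z j * sinz (z j) (x - t)) *s Y j t + cosz (z j) (x - t) *s (\<sigma> t *v Y j t + Q j t)) +
        (- cosz (z j) (x - t) *s Q j t + sinz (z j) (x - t) *s (- (\<sigma> t *v Q j t) - (\<sigma> t ** \<sigma> t) *v Y j t - z j *s Y j t - 0)))"
      unfolding B_def
      by (intro ac_deriv_sum ac_deriv_add ac_deriv_bilinear[OF bounded_bilinear_scalar_vec] dcos dsin dY dQ)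
    fix t
    have eqj: "((z j * sinz (z j) (x - t)) *s Y j t + cosz (z j) (x - t) *s (\<sigma> t *v Y j t + Q j t)) +
        (- cosz (z j) (x - t) *s Q j t + sinz (z j) (x - t) *s (- (\<sigma> t *v Q j t) - (\<sigma> t ** \<sigma> t) *v Y j t - z j *s Y j t - 0)) =
        cosz (z j) (x - t) *s (\<sigma> t *v Y j t) - sinz (z j) (x - t) *s (\<sigma> t *v Q j t) - sinz (z j) (x - t) *s ((\<sigma> t ** \<sigma> t) *v Y j t)" for j
      by (simp add: vec_eq_iff algebra_simps)
    show "(\<Sum>j\<in>J.
        ((z j * sinz (z j) (x - t)) *s Y j t + cosz (z j) (x - t) *s (\<sigma> t *v Y j t + Q j t)) +
        (- cosz (z j) (x - t) *s Q j t + sinz (z j) (x - t) *s (- (\<sigma> t *v Q j t) - (\<sigma> t ** \<sigma> t) *v Y j t - z j *s Y j t - 0))) = b t"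
      unfolding eqj by (simp add: b_def y_def q_def Iy_def matrix_vector_mult_diff_distrib msum matrix_vector_scale sum_subtractf)
  qed
  then have bI: "(b has_integral (B x - B 0)) {0..x}" using x by (auto simp: ac_deriv_def)
  define S where "S = integral {0..x} (\<lambda>t. (norm (\<sigma> t))\<^sup>2)"
  define c where "c = sqrt (pi * energy_const)"
  have c0: "c \<ge> 0" using energy_const_pos by (simp add: c_def)
  have s_int: "(\<lambda>t. (norm (\<sigma> t))\<^sup>2) integrable_on {0..pi}" by (rule set_lebesgue_integral_eq_integral(1)[OF \<sigma>_sq_int])
  have sI: "((\<lambda>t. (norm (\<sigma> t))\<^sup>2) has_integral S) {0..x}"
    unfolding S_def by (rule integrable_integral[OF integrable_subinterval_real[OF s_int]]) (use x in auto)
  have SS: "S \<le> sigma_sq"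
    unfolding S_def sigma_sq_def
    by (rule integral_subset_le[OF _ has_integral_integrable[OF sI] s_int]) (use x in auto)
  have UI: "((\<lambda>t. (w / 2 + c * w) * (norm (\<sigma> t))\<^sup>2 + 1 / (2 * w) * m t) has_integral
      ((w / 2 + c * w) * S + 1 / (2 * w) * integral {0..x} m)) {0..x}"
    by (intro has_integral_add has_integral_mult_right sI integrable_integral m_int)
  \<comment> \<open>The product is split with weight \<open>w\<close>, the size of the data, so that
    the integrated bound is linear in \<open>w\<close>.\<close>
  have pt: "norm (b t) \<le> (w / 2 + c * w) * (norm (\<sigma> t))\<^sup>2 + 1 / (2 * w) * m t" if t: "t \<in> {0..x}" for t
  proof -
    define p where "p = norm (\<sigma> t)"
    define n where "n = norm (y t (x - t) - q t (x - t))"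
    have "0 \<le> (w * p - n)\<^sup>2" by simp
    then have "2 * w * (p * n) \<le> w\<^sup>2 * p\<^sup>2 + n\<^sup>2" by (simp add: power2_diff power_mult_distrib algebra_simps)
    then have "p * n \<le> (w\<^sup>2 * p\<^sup>2 + n\<^sup>2) / (2 * w)" using w(1) by (simp add: pos_le_divide_eq mult_ac)
    also have "\<dots> = w / 2 * p\<^sup>2 + 1 / (2 * w) * n\<^sup>2" using w(1) by (simp add: add_divide_distrib power2_eq_square)
    finally have 1: "p * n \<le> w / 2 * p\<^sup>2 + 1 / (2 * w) * n\<^sup>2" .
    have "norm ((\<sigma> t ** \<sigma> t) *v Iy t (x - t)) \<le> norm (\<sigma> t ** \<sigma> t) * norm (Iy t (x - t))" by (rule norm_matrix_vector_le)
    also have "\<dots> \<le> (p * p) * (c * w)"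
      unfolding p_def c_def using norm_matrix_matrix_le Iyb[OF t] by (intro mult_mono) auto
    finally have 2: "norm ((\<sigma> t ** \<sigma> t) *v Iy t (x - t)) \<le> c * w * p\<^sup>2" by (simp add: power2_eq_square mult_ac)
    have "norm (b t) \<le> norm (\<sigma> t *v (y t (x - t) - q t (x - t))) + norm ((\<sigma> t ** \<sigma> t) *v Iy t (x - t))"
      unfolding b_def by (rule norm_triangle_ineq4)
    also have "\<dots> \<le> p * n + c * w * p\<^sup>2"
      unfolding p_def n_def by (intro add_mono norm_matrix_vector_le 2[unfolded p_def])
    also have "\<dots> \<le> (w / 2 * p\<^sup>2 + 1 / (2 * w) * n\<^sup>2) + c * w * p\<^sup>2" using 1 by simp
    finally show ?thesis by (simp add: p_def n_def m_def algebra_simps)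
  qed
  have "norm (integral {0..x} b) \<le> integral {0..x} (\<lambda>t. (w / 2 + c * w) * (norm (\<sigma> t))\<^sup>2 + 1 / (2 * w) * m t)"
    by (rule integral_norm_bound_integral[OF has_integral_integrable[OF bI] has_integral_integrable[OF UI] pt])
  then have "norm (B x - B 0) \<le> (w / 2 + c * w) * S + 1 / (2 * w) * integral {0..x} m"
    using integral_unique[OF UI] integral_unique[OF bI] by simp
  also have "\<dots> \<le> (w / 2 + c * w) * sigma_sq + 1 / (2 * w) * (energy_const * w\<^sup>2)"
    using W[of x] et[of x] Kw x w(1) c0 SS by (intro add_mono mult_left_mono) auto
  also have "\<dots> = trace_const * w"
    using w(1) by (simp add: trace_const_def c_def field_simps power2_eq_square)
  finally have "norm (B x - B 0) \<le> trace_const * w" .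
  moreover have "B x = (\<Sum>j\<in>J. Y j x)" by (simp add: B_def)
  moreover have "B 0 = y 0 x + q 0 x" by (simp add: B_def y_def q_def sum.distrib)
  ultimately show ?thesis by simp
qed

end

section \<open>Comparison of the free and the perturbed solutions\<close>

context sturm_liouville
begin

definition free :: "complex \<Rightarrow> complex^'m \<Rightarrow> real \<Rightarrow> complex^'m" where
  "free z v s = cosz z s *s (T1 *v v) + sinz z s *s (v - T1 *v v)"

text \<open>In \<open>free_L2_le_phi\<close> the first three terms bound the initial energy of the
  wave, the fourth bounds \<open>Hc\<close>, and the 1 ensures positivity.\<close>

definition free_const :: real where
  "free_const = (norm T1)\<^sup>2 + 2 * (1 + norm T1)\<^sup>2 + 2 * (norm H1)\<^sup>2 * pi * pi + pi * (norm H1)\<^sup>2 + 1"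

text \<open>The Gronwall constant that closes \<open>free_L2_le_phi\<close>; the factor 2 is the
  weight of the perturbed solution in the estimate \<open>main\<close> there.\<close>

definition compare_const :: real where
  "compare_const = 2 * exp (integral {0..pi} (\<lambda>_. 2 * (trace_const + 1)\<^sup>2 * free_const))"

lemma free_const_pos: "free_const > 0"
  unfolding free_const_def by (intro add_nonneg_pos add_nonneg_nonneg mult_nonneg_nonneg) auto

text \<open>The map taking \<open>phi\<close> to \<open>free\<close> (the inverse of a transformation operator) is bounded.\<close>

lemma free_L2_le_phi:
  fixes z :: "'j \<Rightarrow> complex" and v :: "'j \<Rightarrow> complex^'m"
  shows "L2sq 0 pi (\<lambda>x. \<Sum>j\<in>J. free (z j) (v j) x) \<le> compare_const * L2sq 0 pi (\<lambda>x. \<Sum>j\<in>J. fst (phi (z j) (v j) x))"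
proof -
  define c where "c = (\<lambda>s. \<Sum>j\<in>J. free (z j) (v j) s)"
  define Y where "Y = (\<lambda>x. \<Sum>j\<in>J. fst (phi (z j) (v j) x))"
  define G where "G = (\<lambda>x. integral {0..x} (\<lambda>s. (norm (c s))\<^sup>2))"
  \<comment> \<open>The part of the initial field \<open>q0\<close> that stems from
    \<open>H1\<close>. It is the primitive of \<open>H1 *v c\<close>, hence controlled by the
    integral of the square of \<open>c\<close>.\<close>
  define Hc where "Hc = (\<lambda>s. \<Sum>j\<in>J. sinz (z j) s *s (H1 *v v j))"
  define y0 where "y0 = (\<lambda>s. \<Sum>j\<in>J. cosz (z j) s *s fst (phi (z j) (v j) 0))"
  define q0 where "q0 = (\<lambda>s. \<Sum>j\<in>J. sinz (z j) s *s snd (phi (z j) (v j) 0))"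
  have msum: "M *v (\<Sum>j\<in>J. f j) = (\<Sum>j\<in>J. M *v f j)" for M :: "complex^'m^'m" and f :: "'j \<Rightarrow> complex^'m"
    by (rule linear_sum[OF bounded_linear.linear[OF matrix_vector_mul_bounded_linear]])
  have cc: "continuous_on A c" for A
    unfolding c_def free_def
    by (intro continuous_on_sum continuous_on_add continuous_on_scalar_vec cosz_continuous sinz_continuous continuous_on_const)
  have cY: "continuous_on {0..pi} Y" unfolding Y_def by (intro continuous_on_sum phi_continuous)
  have c_int: "(\<lambda>s. (norm (c s))\<^sup>2) integrable_on {0..r}" for r
    by (intro integrable_continuous_real continuous_on_power continuous_on_norm cc)
  \<comment> \<open>The initial fields are functions of \<open>c\<close> alone, and
    \<open>y0 + q0 = c + Hc\<close>. So \<open>wave_trace\<close>, which compares \<open>Y x\<close>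
    with \<open>y0 x + q0 x\<close>, recovers \<open>c x\<close> from \<open>Y x\<close>.\<close>
  have y0: "y0 s = T1 *v c s" for s
    by (simp add: y0_def c_def free_def phi_0 msum matrix_vector_right_distrib matrix_vector_mult_diff_distrib matrix_vector_scale left.T_T)
  have q0: "q0 s = (c s - T1 *v c s) + Hc s" for s
    unfolding y0[symmetric]
    by (simp add: q0_def y0_def c_def free_def phi_0 Hc_def sum_subtractf[symmetric] sum.distrib[symmetric] vec.scale_right_distrib)
       (intro sum.cong refl; simp add: vec_eq_iff algebra_simps)
  have dHc: "(Hc has_vector_derivative H1 *v c s) (at s within A)" for s A
  proof -
    have "(Hc has_vector_derivative (\<Sum>j\<in>J. cosz (z j) s *s (H1 *v v j))) (at s within A)"
      unfolding Hc_def
      by (intro has_vector_derivative_sum bounded_linear.has_vector_derivative[OF bounded_bilinear.bounded_linear_left[OF bounded_bilinear_scalar_vec]] sinz_deriv)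
    moreover have "(\<Sum>j\<in>J. cosz (z j) s *s (H1 *v v j)) = H1 *v c s"
      by (simp add: c_def free_def msum matrix_vector_right_distrib matrix_vector_mult_diff_distrib matrix_vector_scale left.H_T)
    ultimately show ?thesis by simp
  qed
  have Hcb: "(norm (Hc s))\<^sup>2 \<le> pi * (norm H1)\<^sup>2 * G x" if s: "s \<in> {0..x}" "x \<le> pi" for s x
  proof -
    have cH: "continuous_on {0..s} (\<lambda>s. H1 *v c s)"
      by (rule bounded_linear.continuous_on[OF matrix_vector_mul_bounded_linear cc])
    have "((\<lambda>s. H1 *v c s) has_integral (Hc s - Hc 0)) {0..s}"
      by (rule fundamental_theorem_of_calculus) (use s dHc in auto)
    then have "Hc s = integral {0..s} (\<lambda>s. H1 *v c s)" by (simp add: Hc_def integral_unique)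
    then have "(norm (Hc s))\<^sup>2 \<le> s * integral {0..s} (\<lambda>s. (norm (H1 *v c s))\<^sup>2)"
      using norm_integral_sq_le[OF cH] s by simp
    also have "integral {0..s} (\<lambda>s. (norm (H1 *v c s))\<^sup>2) \<le> integral {0..s} (\<lambda>s. (norm H1)\<^sup>2 * (norm (c s))\<^sup>2)"
      by (intro integral_le integrable_continuous_real continuous_on_power continuous_on_norm cH integrable_on_mult_right c_int)
        (simp add: power_mult_distrib[symmetric] power_mono norm_matrix_vector_le)
    also have "\<dots> = (norm H1)\<^sup>2 * integral {0..s} (\<lambda>s. (norm (c s))\<^sup>2)" by simp
    also have "integral {0..s} (\<lambda>s. (norm (c s))\<^sup>2) \<le> G x"
      unfolding G_def using s by (intro integral_subset_le c_int) auto
    finally have "(norm (Hc s))\<^sup>2 \<le> s * ((norm H1)\<^sup>2 * G x)" using s by (simp add: mult_left_mono)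
    also have "\<dots> \<le> pi * ((norm H1)\<^sup>2 * G x)"
      using s unfolding G_def by (intro mult_right_mono mult_nonneg_nonneg integral_nonneg c_int) auto
    finally show ?thesis by (simp add: mult.assoc)
  qed
  have G0: "0 \<le> G x" for x unfolding G_def by (intro integral_nonneg c_int) auto
  \<comment> \<open>A Volterra-type estimate at each point: the square of \<open>c\<close> is
    bounded by that of \<open>Y\<close> plus a multiple of its own integral \<open>G x\<close>.
    Gronwall's inequality for \<open>G\<close> then removes the latter.\<close>
  have main: "(norm (c x))\<^sup>2 \<le> (2 * (trace_const + 1)\<^sup>2 * free_const) * norm (G x) + 2 * (norm (Y x))\<^sup>2" if x: "x \<in> {0..pi} - {0}" for x
  proof (cases "G x = 0")
    case True
    then have "\<forall>s\<in>{0..x}. (norm (c s))\<^sup>2 = 0"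
      unfolding G_def using x integral_eq_0_iff[of 0 x "\<lambda>s. (norm (c s))\<^sup>2"] continuous_on_power[OF continuous_on_norm[OF cc]] by auto
    then have "c x = 0" using x by auto
    moreover have "0 \<le> 2 * (trace_const + 1)\<^sup>2 * free_const" using free_const_pos by simp
    ultimately show ?thesis by simp
  next
    case False
    then have Gp: "G x > 0" using G0[of x] by simp
    \<comment> \<open>The square of \<open>w\<close> dominates the initial energy and that of
      \<open>w\<close> also dominates \<open>Hc x\<close>. Positivity is demanded by
      \<open>wave_trace\<close>, hence the separate case \<open>G x = 0\<close>.\<close>
    define w where "w = sqrt (free_const * G x)"
    have w: "w > 0" "w\<^sup>2 = free_const * G x" using Gp free_const_pos by (auto simp: w_def)
    have e0: "integral {0..x} (\<lambda>s. (norm (y0 s))\<^sup>2 + (norm (q0 s))\<^sup>2) \<le> w\<^sup>2"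
    proof -
      define a where "a = norm T1"
      define k where "k = 2 * (pi * (norm H1)\<^sup>2 * G x)"
      have k0: "0 \<le> k" using G0 by (simp add: k_def)
      have "integral {0..x} (\<lambda>s. (norm (y0 s))\<^sup>2 + (norm (q0 s))\<^sup>2) \<le> (a\<^sup>2 + 2 * (1 + a)\<^sup>2) * G x + k * x"
      proof (rule has_integral_le[OF integrable_integral])
        show "(\<lambda>s. (norm (y0 s))\<^sup>2 + (norm (q0 s))\<^sup>2) integrable_on {0..x}"
          unfolding y0_def q0_def
          by (intro integrable_continuous_real continuous_on_add continuous_on_power continuous_on_norm continuous_on_sum
              continuous_on_scalar_vec cosz_continuous sinz_continuous continuous_on_const)
        show "((\<lambda>s. (a\<^sup>2 + 2 * (1 + a)\<^sup>2) * (norm (c s))\<^sup>2 + k) has_integral ((a\<^sup>2 + 2 * (1 + a)\<^sup>2) * G x + k * x)) {0..x}"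
          unfolding G_def using has_integral_const_real[of k 0 x] x
          by (intro has_integral_add has_integral_mult_right integrable_integral c_int) (simp add: mult.commute)
        fix s assume s: "s \<in> {0..x}"
        have T: "norm (T1 *v c s) \<le> a * norm (c s)" unfolding a_def by (rule norm_matrix_vector_le)
        have 1: "(norm (y0 s))\<^sup>2 \<le> a\<^sup>2 * (norm (c s))\<^sup>2"
          using power_mono[OF T, of 2] by (simp add: y0 power_mult_distrib)
        have n2: "norm (c s - T1 *v c s) \<le> (1 + a) * norm (c s)"
          using norm_triangle_ineq4[of "c s" "T1 *v c s"] T by (simp add: algebra_simps)
        have 2: "(norm (c s - T1 *v c s))\<^sup>2 \<le> (1 + a)\<^sup>2 * (norm (c s))\<^sup>2"
          using power_mono[OF n2, of 2] by (simp add: power_mult_distrib)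
        have "(norm (q0 s))\<^sup>2 \<le> 2 * (norm (c s - T1 *v c s))\<^sup>2 + 2 * (norm (Hc s))\<^sup>2"
          unfolding q0 using norm_add_sq_le[of 1 "c s - T1 *v c s" "Hc s"] by simp
        also have "\<dots> \<le> 2 * ((1 + a)\<^sup>2 * (norm (c s))\<^sup>2) + 2 * (pi * (norm H1)\<^sup>2 * G x)"
          using 2 Hcb[OF s] x by (intro add_mono mult_left_mono) auto
        finally show "(norm (y0 s))\<^sup>2 + (norm (q0 s))\<^sup>2 \<le> (a\<^sup>2 + 2 * (1 + a)\<^sup>2) * (norm (c s))\<^sup>2 + k"
          using 1 by (simp add: k_def algebra_simps)
      qed
      also have "\<dots> \<le> (a\<^sup>2 + 2 * (1 + a)\<^sup>2) * G x + k * pi"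
        using x k0 by (intro add_left_mono mult_left_mono) auto
      also have "\<dots> = (free_const - pi * (norm H1)\<^sup>2 - 1) * G x"
        by (simp add: k_def free_const_def a_def algebra_simps)
      also have "\<dots> \<le> free_const * G x"
      proof (intro mult_right_mono)
        have "0 \<le> pi * (norm H1)\<^sup>2" by simp
        then show "free_const - pi * (norm H1)\<^sup>2 - 1 \<le> free_const" by linarith
      qed (use Gp in simp)
      finally show ?thesis by (simp add: w(2))
    qed
    have tr: "norm (Y x - (y0 x + q0 x)) \<le> trace_const * w"
      unfolding Y_def y0_def q0_def
      by (rule wave_trace) (use x w(1) e0 in \<open>auto simp: y0_def q0_def phi_sol\<close>)
    have "(norm (Hc x))\<^sup>2 \<le> w\<^sup>2"
    proof -
      have "(norm (Hc x))\<^sup>2 \<le> pi * (norm H1)\<^sup>2 * G x" using Hcb[of x x] x by simp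
      also have "\<dots> \<le> free_const * G x"
        unfolding free_const_def using Gp by (intro mult_right_mono) (auto intro!: add_nonneg_nonneg)
      finally show ?thesis by (simp add: w(2))
    qed
    then have Hw: "norm (Hc x) \<le> w" by (rule power2_le_imp_le) (use w in simp)
    have "y0 x + q0 x = c x + Hc x" by (simp add: y0 q0)
    then have "c x = Y x + (- (Y x - (y0 x + q0 x)) - Hc x)" by simp
    then have "(norm (c x))\<^sup>2 \<le> 2 * (norm (Y x))\<^sup>2 + 2 * (norm (- (Y x - (y0 x + q0 x)) - Hc x))\<^sup>2"
      using norm_add_sq_le[of 1 "Y x" "- (Y x - (y0 x + q0 x)) - Hc x"] by simp
    moreover have "norm (- (Y x - (y0 x + q0 x)) - Hc x) \<le> (trace_const + 1) * w"
      using norm_triangle_ineq4[of "- (Y x - (y0 x + q0 x))" "Hc x"] tr Hw by (simp add: algebra_simps norm_minus_commute)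
    then have "(norm (- (Y x - (y0 x + q0 x)) - Hc x))\<^sup>2 \<le> ((trace_const + 1) * w)\<^sup>2" by (intro power_mono) auto
    ultimately have "(norm (c x))\<^sup>2 \<le> 2 * (norm (Y x))\<^sup>2 + 2 * ((trace_const + 1) * w)\<^sup>2" by linarith
    then show ?thesis using G0[of x] by (simp add: power_mult_distrib w(2) mult_ac)
  qed
  have dG: "ac_deriv 0 pi G (\<lambda>x. (norm (c x))\<^sup>2)"
    unfolding G_def using ac_deriv_indefinite_integral[where f = "\<lambda>x. (norm (c x))\<^sup>2" and a = 0 and b = pi and c = 0]
    by (simp add: absolutely_integrable_continuous_real continuous_on_power continuous_on_norm cc)
  have "norm (G pi) \<le> (norm (G 0) + integral {0..pi} (\<lambda>x. 2 * (norm (Y x))\<^sup>2)) * exp (integral {0..pi} (\<lambda>_. 2 * (trace_const + 1)\<^sup>2 * free_const))"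
  proof (rule ac_deriv_norm_le[OF dG, where N = "{0}"])
    show "(\<lambda>x. 2 * (norm (Y x))\<^sup>2) absolutely_integrable_on {0..pi}"
      by (intro absolutely_integrable_continuous_real continuous_intros cY)
    show "norm ((norm (c x))\<^sup>2) \<le> (2 * (trace_const + 1)\<^sup>2 * free_const) * norm (G x) + 2 * (norm (Y x))\<^sup>2" if "x \<in> {0..pi} - {0}" for x
      using main[OF that] by simp
  qed (use free_const_pos in \<open>auto intro: absolutely_integrable_continuous_real\<close>)
  moreover have "G 0 = 0" by (simp add: G_def)
  moreover have "integral {0..pi} (\<lambda>x. 2 * (norm (Y x))\<^sup>2) = 2 * L2sq 0 pi Y" by (simp add: L2sq_def)
  moreover have "G pi = L2sq 0 pi c" by (simp add: L2sq_def G_def)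
  ultimately show ?thesis
    using L2sq_nonneg[of 0 pi c] by (simp add: compare_const_def c_def Y_def mult_ac)
qed

end

section \<open>Eigenspaces and the Weyl matrix\<close>

lemma bounded_linear_column: "bounded_linear (\<lambda>A :: complex^'n^'m. column j A)"
proof -
  have "bounded_linear (\<lambda>A :: complex^'n^'m. A *v axis j 1)"
    by (rule bounded_bilinear.bounded_linear_left[OF bounded_bilinear_matrix_vector])
  moreover have "A *v axis j 1 = column j A" for A :: "complex^'n^'m"
    by (simp add: vec_eq_iff matrix_vector_mult_def column_def axis_def if_distrib cong: if_cong)
  ultimately show ?thesis by simp
qed

lemma column_matrix_mult: "column j ((A::complex^'n^'m) ** B) = A *v column j B"
  by (simp add: column_def matrix_matrix_mult_def matrix_vector_mult_def)

lemma column_add: "column j (A + B) = column j A + column j (B :: complex^'n^'m)"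
  and column_diff: "column j (A - B) = column j A - column j (B :: complex^'n^'m)"
  and column_minus: "column j (- A) = - column j (A :: complex^'n^'m)"
  and column_mat1: "column k (mat 1 :: complex^'p^'p) = axis k 1"
  by (simp_all add: column_def vec_eq_iff mat_def axis_def)

lemma mat_vector: "mat c *v (v :: complex^'n) = c *s v"
  by (simp add: vec_eq_iff matrix_vector_mult_def mat_def if_distrib if_distribR cong: if_cong)

lemma column_matrix_bdry: "column j (matrix_bdry T H Y Q) = bdry T H (column j Y) (column j Q)"
  by (simp add: matrix_bdry_def bdry_def column_diff column_matrix_mult)

lemma matrix_eq_columns: "A = B \<longleftrightarrow> (\<forall>j. column j A = column j (B :: complex^'n^'m))"
  by (auto simp: column_def vec_eq_iff)

lemma matrix_inv_works:
  fixes A :: "complex^'n^'n"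
  assumes "invertible A"
  shows "A ** matrix_inv A = mat 1" "matrix_inv A ** A = mat 1"
  using someI_ex[OF assms[unfolded invertible_def]] by (simp_all add: matrix_inv_def)

lemma complete_in_L2D:
  assumes "complete_in_L2 {a<..<b} I u" "L2_on {a<..<b} f" "e > 0"
  obtains F c where "finite F" "F \<subseteq> I" "L2sq a b (\<lambda>x. f x - (\<Sum>i\<in>F. c i *s u i x)) < e"
proof -
  have u: "\<And>i. i \<in> I \<Longrightarrow> L2_on {a<..<b} (u i)" using assms(1) by (auto simp: complete_in_L2_def)
  have "0 < sqrt e" using assms(3) by simp
  then obtain F c where F: "finite F" "F \<subseteq> I"
    "sqrt (integral\<^sup>L (lebesgue_on {a<..<b}) (\<lambda>x. (norm (f x - (\<Sum>i\<in>F. c i *s u i x)))\<^sup>2)) < sqrt e"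
    using assms(1,2) unfolding complete_in_L2_def by blast
  have "L2_on {a<..<b} (\<lambda>x. \<Sum>i\<in>F. c i *s u i x)"
    using F(2) u by (intro L2_on_sum L2_on_linear[OF _ bounded_bilinear.bounded_linear_right[OF bounded_bilinear_scalar_vec]]) auto
  then have "L2sq a b (\<lambda>x. f x - (\<Sum>i\<in>F. c i *s u i x)) < e"
    using F(3) L2sq_lebesgue[OF L2_on_diff[OF assms(2)]] by simp
  then show thesis using that F(1,2) by blast
qed

context hermitian_potential
begin

lemma sl_sol_cong:
  assumes "sl_sol z f Y Q" "\<And>x. x \<in> {0..pi} \<Longrightarrow> Y x = Y' x" "\<And>x. x \<in> {0..pi} \<Longrightarrow> Q x = Q' x"
  shows "sl_sol z f Y' Q'"
proof -
  have Y: "ac_deriv 0 pi Y (\<lambda>x. \<sigma> x *v Y x + Q x)"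
    and Q: "ac_deriv 0 pi Q (\<lambda>x. - (\<sigma> x *v Q x) - (\<sigma> x ** \<sigma> x) *v Y x - z *s Y x - f x)"
    using assms(1) by (auto simp: sl_sol_def)
  show ?thesis
    unfolding sl_sol_def
    by (intro conjI ac_deriv_cong[OF Y assms(2) negligible_empty] ac_deriv_cong[OF Q assms(3) negligible_empty])
      (simp_all add: assms(2,3))
qed

lemma sl_sol_imp_solution:
  assumes "sl_sol z (\<lambda>_. 0) Y Q"
  shows "solution \<sigma> z Y Q"
proof -
  have Y: "ac_deriv 0 pi Y (\<lambda>x. \<sigma> x *v Y x + Q x)"
    and Q: "ac_deriv 0 pi Q (\<lambda>x. - (\<sigma> x *v Q x) - (\<sigma> x ** \<sigma> x) *v Y x - z *s Y x - 0)"
    using assms by (auto simp: sl_sol_def)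
  obtain N1 where N1: "negligible N1" "\<And>x. x \<in> {0<..<pi} - N1 \<Longrightarrow> (Y has_vector_derivative (\<sigma> x *v Y x + Q x)) (at x)"
    using ac_deriv_differentiable[OF Y] by blast
  obtain N2 where N2: "negligible N2" "\<And>x. x \<in> {0<..<pi} - N2 \<Longrightarrow>
     (Q has_vector_derivative (- (\<sigma> x *v Q x) - (\<sigma> x ** \<sigma> x) *v Y x - z *s Y x - 0)) (at x)"
    using ac_deriv_differentiable[OF Q] by blast
  have "AE x in lebesgue. x \<notin> N1 \<union> N2"
    by (rule AE_not_in) (use N1 N2 in \<open>auto simp: negligible_iff_null_sets[symmetric]\<close>)
  then have "AE x in lebesgue. x \<in> {0<..<pi} \<longrightarrow> (\<exists>Y' Q'.
        (Y has_vector_derivative Y') (at x) \<and> (Q has_vector_derivative Q') (at x) \<and>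
        Q x = Y' - \<sigma> x *v Y x \<and>
        - Q' - \<sigma> x *v Q x - (\<sigma> x ** \<sigma> x) *v Y x = z *s Y x)"
    by eventually_elim (use N1(2) N2(2) in fastforce)
  then show ?thesis
    unfolding solution_def using ac_deriv_abs_cont_on[OF Y] ac_deriv_abs_cont_on[OF Q]
    by (simp add: AE_restrict_space_iff)
qed

text \<open>The derivatives hold almost everywhere and are integrable because the coefficients are
  integrable and \<open>Y\<close> and \<open>Q\<close> continuous; \<open>ac_derivI\<close> then
  gives the integrated form.\<close>

lemma solution_imp_sl_sol:
  assumes "solution \<sigma> z Y Q"
  shows "sl_sol z (\<lambda>_. 0) Y Q"
proof -
  have ac: "abs_cont_on 0 pi Y" "abs_cont_on 0 pi Q" using assms by (auto simp: solution_def)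
  define D where "D = (\<lambda>x. \<exists>Y' Q'.
        (Y has_vector_derivative Y') (at x) \<and> (Q has_vector_derivative Q') (at x) \<and>
        Q x = Y' - \<sigma> x *v Y x \<and>
        - Q' - \<sigma> x *v Q x - (\<sigma> x ** \<sigma> x) *v Y x = z *s Y x)"
  have "AE x in lebesgue. x \<in> {0<..<pi} \<longrightarrow> D x"
    using assms by (simp add: solution_def AE_restrict_space_iff D_def)
  then obtain N where N: "negligible N" "{x. \<not> (x \<in> {0<..<pi} \<longrightarrow> D x)} \<subseteq> N"
    by (auto simp: eventually_ae_filter_negligible)
  have D: "(Y has_vector_derivative (\<sigma> x *v Y x + Q x)) (at x)"
    "(Q has_vector_derivative (- (\<sigma> x *v Q x) - (\<sigma> x ** \<sigma> x) *v Y x - z *s Y x)) (at x)" if "x \<in> {0<..<pi} - N" for x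
  proof -
    have "D x" using N(2) that by blast
    then obtain Y' Q' where d: "(Y has_vector_derivative Y') (at x)" "(Q has_vector_derivative Q') (at x)"
        "Q x = Y' - \<sigma> x *v Y x" "- Q' - \<sigma> x *v Q x - (\<sigma> x ** \<sigma> x) *v Y x = z *s Y x"
      by (auto simp: D_def)
    have "Y' = \<sigma> x *v Y x + Q x" using d(3) by simp
    moreover have "Q' = - (\<sigma> x *v Q x) - (\<sigma> x ** \<sigma> x) *v Y x - z *s Y x"
      using d(4) by (metis (no_types, lifting) add.commute diff_add_cancel diff_diff_eq2 minus_diff_eq uminus_add_conv_diff)
    ultimately show "(Y has_vector_derivative (\<sigma> x *v Y x + Q x)) (at x)"
      "(Q has_vector_derivative (- (\<sigma> x *v Q x) - (\<sigma> x ** \<sigma> x) *v Y x - z *s Y x)) (at x)"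
      using d by simp_all
  qed
  have "continuous_on {0..pi} (\<lambda>x. (Y x, Q x))"
    by (intro continuous_on_Pair abs_cont_on_continuous ac)
  then have i: "(\<lambda>x. sl_field z x (Y x, Q x)) absolutely_integrable_on {0..pi}"
    using linear_field_sl_field[OF order_refl, of z] by (auto simp: linear_field_def)
  have iY: "(\<lambda>x. \<sigma> x *v Y x + Q x) absolutely_integrable_on {0..pi}"
    using absolutely_integrable_linear[OF i bounded_linear_fst] by (simp add: o_def sl_field_def)
  have iQ: "(\<lambda>x. - (\<sigma> x *v Q x) - (\<sigma> x ** \<sigma> x) *v Y x - z *s Y x) absolutely_integrable_on {0..pi}"
    using absolutely_integrable_linear[OF i bounded_linear_snd] by (simp add: o_def sl_field_def)
  show ?thesis
    unfolding sl_sol_def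
    using ac_derivI[OF ac(1) N(1) D(1) iY] ac_derivI[OF ac(2) N(1) D(2) iQ] by simp
qed

end

context sturm_liouville
begin

definition eigenfunction :: "complex \<Rightarrow> complex^'m \<Rightarrow> real \<Rightarrow> complex^'m" where
  "eigenfunction z v = (\<lambda>x. if x \<in> {0..pi} then fst (phi z v x) else 0)"

text \<open>A solution with the left condition is \<open>phi z v\<close> for its complementary
  boundary value \<open>v\<close>, and the right condition says that \<open>v\<close> lies in the
  kernel.\<close>

lemma eigenspace_eq: "eigenspace \<sigma> T1 H1 T2 H2 z = eigenfunction z ` {v. Delta z *v v = 0}"
proof (intro equalityI subsetI)
  fix Y assume "Y \<in> eigenspace \<sigma> T1 H1 T2 H2 z"
  then obtain Q where Y0: "\<And>x. x \<notin> {0..pi} \<Longrightarrow> Y x = 0" and S: "solution \<sigma> z Y Q"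
    and b: "bdry T1 H1 (Y 0) (Q 0) = 0" "bdry T2 H2 (Y pi) (Q pi) = 0"
    by (auto simp: eigenspace_def)
  define v where "v = left.bdry_perp (Y 0) (Q 0)"
  have p: "phi z v x = (Y x, Q x)" if "x \<in> {0..pi}" for x
    unfolding v_def by (rule phi_unique[OF solution_imp_sl_sol[OF S] b(1) that])
  have "Y = eigenfunction z v" using p Y0 by (auto simp: eigenfunction_def fun_eq_iff)
  moreover have "Delta z *v v = 0" using p[of pi] b(2) by (simp add: Delta_works)
  ultimately show "Y \<in> eigenfunction z ` {v. Delta z *v v = 0}" by blast
next
  fix Y assume "Y \<in> eigenfunction z ` {v. Delta z *v v = 0}"
  then obtain v where v: "Delta z *v v = 0" "Y = eigenfunction z v" by blast
  have "sl_sol z (\<lambda>_. 0) Y (\<lambda>x. snd (phi z v x))"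
    by (rule sl_sol_cong[OF phi_sol[of z v]]) (auto simp: v eigenfunction_def)
  then have "solution \<sigma> z Y (\<lambda>x. snd (phi z v x))" by (rule sl_sol_imp_solution)
  moreover have "bdry T1 H1 (Y 0) (snd (phi z v 0)) = 0" "bdry T2 H2 (Y pi) (snd (phi z v pi)) = 0"
    using phi_bdry(1)[of z v] v by (simp_all add: eigenfunction_def Delta_works)
  ultimately show "Y \<in> eigenspace \<sigma> T1 H1 T2 H2 z"
    unfolding eigenspace_def using v(2) by (auto simp: eigenfunction_def intro!: exI[of _ "\<lambda>x. snd (phi z v x)"])
qed

text \<open>The map from \<open>v\<close> to the eigenfunction is linear and, by
  \<open>phi_L2_pos\<close>, injective.\<close>

lemma multiplicity_eq: "multiplicity_of \<sigma> T1 H1 T2 H2 z = vec.dim {v. Delta z *v v = 0}"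
proof -
  interpret P: finite_dimensional_vector_space_pair_1 "(*s) :: complex \<Rightarrow> complex^'m \<Rightarrow> complex^'m" cart_basis
    "\<lambda>(c::complex) (f :: real \<Rightarrow> complex^'m) x. c *s f x" ..
  have lin: "Vector_Spaces.linear (*s) (\<lambda>(c::complex) (f :: real \<Rightarrow> complex^'m) x. c *s f x) (eigenfunction z)"
    by unfold_locales (auto simp: eigenfunction_def fun_eq_iff phi_add phi_scale)
  have "inj_on (eigenfunction z) (vec.span {v. Delta z *v v = 0})"
  proof (rule inj_onI)
    fix v w assume "eigenfunction z v = eigenfunction z w"
    then have "fst (phi z (v - w) x) = 0" if "x \<in> {0..pi}" for x
      using that by (auto simp: eigenfunction_def phi_diff fun_eq_iff split: if_splits)
    then have "integral {0..pi} (\<lambda>x. (norm (fst (phi z (v - w) x)))\<^sup>2) = integral {0..pi} (\<lambda>x. 0)"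
      by (intro integral_cong) simp
    then show "v = w" using phi_L2_pos[of "v - w" z] by auto
  qed
  from P.dim_image_eq[OF lin this] show ?thesis
    by (simp add: multiplicity_of_def eigenspace_eq)
qed

section \<open>The Weyl matrix and its residues\<close>

definition weyl_init :: "complex \<Rightarrow> complex^'m \<Rightarrow> real \<Rightarrow> (complex^'m) \<times> (complex^'m)" where
  "weyl_init z u = sl (\<lambda>_. 0) (- (u - T1 *v u)) (T1 *v u) z"

lemma weyl_init_sol: "sl_sol z (\<lambda>_. 0) (\<lambda>x. fst (weyl_init z u x)) (\<lambda>x. snd (weyl_init z u x))"
  unfolding weyl_init_def by (rule sl(2)[OF zero_int])

lemma weyl_init_0: "weyl_init z u 0 = (- (u - T1 *v u), T1 *v u)"
  unfolding weyl_init_def by (rule sl(1)[OF zero_int])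

text \<open>\<open>weyl_init z u\<close> has left boundary form \<open>u\<close> and complementary
  form 0. Adding \<open>phi z v\<close> meets the right condition iff
  \<open>Delta z *v v = weyl_rhs z u\<close>; for \<open>u\<close> a unit vector this
  \<open>v\<close> is a column of the Weyl matrix.\<close>

definition weyl_rhs :: "complex \<Rightarrow> complex^'m \<Rightarrow> complex^'m" where
  "weyl_rhs z u = - bdry T2 H2 (fst (weyl_init z u pi)) (snd (weyl_init z u pi))"

lemma weyl_rhs_holomorphic: "(\<lambda>z. weyl_rhs z u $ i) holomorphic_on UNIV"
  unfolding weyl_rhs_def weyl_init_def
proof (rule sl_holomorphic[OF zero_int, where h = "\<lambda>w. (- bdry T2 H2 (fst w) (snd w)) $ i"])
  show "bounded_linear (\<lambda>w. (- bdry T2 H2 (fst w) (snd w)) $ i)"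
    unfolding bdry_def
    by (intro bounded_linear_intros bounded_linear_minus bounded_linear_compose[OF bounded_linear_vec_nth]
        bounded_linear_compose[OF matrix_vector_mul_bounded_linear])
qed (auto simp: bdry_scale)

lemma weyl_column:
  assumes S: "sl_sol z (\<lambda>_. 0) Y Q" and b: "bdry T1 H1 (Y 0) (Q 0) = u" "bdry T2 H2 (Y pi) (Q pi) = 0"
    and d: "det (Delta z) \<noteq> 0"
  shows "left.bdry_perp (Y 0) (Q 0) = cramer_sol z (weyl_rhs z u)"
proof -
  define v where "v = left.bdry_perp (Y 0) (Q 0)"
  have S': "sl_sol z (\<lambda>_. 0) (\<lambda>x. fst (phi z v x) + fst (weyl_init z u x)) (\<lambda>x. snd (phi z v x) + snd (weyl_init z u x))"
    using sl_sol_lincomb[OF phi_sol[of z v] weyl_init_sol[of z u], of 1] by simp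
  have "Y 0 = fst (phi z v 0) + fst (weyl_init z u 0)" "Q 0 = snd (phi z v 0) + snd (weyl_init z u 0)"
    using left.bdry_param[OF b(1) v_def[symmetric]] by (simp_all add: phi_0 weyl_init_0 add_ac)
  then have "Y pi = fst (phi z v pi) + fst (weyl_init z u pi)" "Q pi = snd (phi z v pi) + snd (weyl_init z u pi)"
    using sl_sol_unique[OF S S', of pi] by auto
  then have "bdry T2 H2 (fst (phi z v pi)) (snd (phi z v pi)) + bdry T2 H2 (fst (weyl_init z u pi)) (snd (weyl_init z u pi)) = 0"
    using b(2) by (simp add: bdry_add)
  then have "Delta z *v v = weyl_rhs z u" by (simp add: Delta_works weyl_rhs_def eq_neg_iff_add_eq_0)
  then have "v = cramer_sol z (weyl_rhs z u)"
    using cramer[OF d, of v "weyl_rhs z u"] by (simp add: cramer_sol_def)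
  then show ?thesis by (simp add: v_def)
qed

lemma weyl_column_exists:
  assumes d: "det (Delta z) \<noteq> 0"
  obtains Y Q where "sl_sol z (\<lambda>_. 0) Y Q" "bdry T1 H1 (Y 0) (Q 0) = u" "bdry T2 H2 (Y pi) (Q pi) = 0"
proof
  define v where "v = cramer_sol z (weyl_rhs z u)"
  show "sl_sol z (\<lambda>_. 0) (\<lambda>x. fst (phi z v x) + fst (weyl_init z u x)) (\<lambda>x. snd (phi z v x) + snd (weyl_init z u x))"
    using sl_sol_lincomb[OF phi_sol[of z v] weyl_init_sol[of z u], of 1] by simp
  show "bdry T1 H1 (fst (phi z v 0) + fst (weyl_init z u 0)) (snd (phi z v 0) + snd (weyl_init z u 0)) = u"
    unfolding phi_0 weyl_init_0 fst_conv snd_conv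
    using left.bdry_of_param(1)[of v u] by (simp add: algebra_simps)
  show "bdry T2 H2 (fst (phi z v pi) + fst (weyl_init z u pi)) (snd (phi z v pi) + snd (weyl_init z u pi)) = 0"
    using cramer_sol[OF d, of "weyl_rhs z u"] by (simp add: bdry_add Delta_works v_def weyl_rhs_def)
qed

lemma matrix_solution_column:
  assumes "matrix_solution \<sigma> z Y Q"
  shows "sl_sol z (\<lambda>_. 0) (\<lambda>x. column j (Y x)) (\<lambda>x. column j (Q x))"
proof (rule solution_imp_sl_sol)
  have ac: "abs_cont_on 0 pi (\<lambda>x. column j (F x))" if F: "abs_cont_on 0 pi F" for F :: "real \<Rightarrow> complex^'m^'m"
  proof -
    obtain K where K: "0 \<le> K" "\<And>A :: complex^'m^'m. norm (column j A) \<le> norm A * K"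
      using bounded_linear.nonneg_bounded[OF bounded_linear_column[of j]] by blast
    show ?thesis
    proof (rule abs_cont_on_lipschitz2[OF F F K(1)])
      fix x y
      have "norm (column j (F x) - column j (F y)) \<le> norm (F x - F y) * K"
        using K(2)[of "F x - F y"] by (simp add: column_diff)
      then show "norm (column j (F x) - column j (F y)) \<le> K * (norm (F x - F y) + norm (F x - F y))"
      proof -
        assume H: "norm (column j (F x) - column j (F y)) \<le> norm (F x - F y) * K"
        have "0 \<le> norm (F x - F y) * K" using K(1) by simp
        moreover have "K * (norm (F x - F y) + norm (F x - F y)) = norm (F x - F y) * K + norm (F x - F y) * K"
          by (simp add: algebra_simps)
        ultimately show ?thesis using H by linarith
      qed
    qed
  qed
  have "AE x in lebesgue_on {0<..<pi}. \<exists>Y' Q'.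
        (Y has_vector_derivative Y') (at x) \<and> (Q has_vector_derivative Q') (at x) \<and>
        Q x = Y' - \<sigma> x ** Y x \<and> - Q' - \<sigma> x ** Q x - \<sigma> x ** \<sigma> x ** Y x = mat z ** Y x"
    using assms by (simp add: matrix_solution_def)
  then have "AE x in lebesgue_on {0<..<pi}. \<exists>Y' Q'.
        ((\<lambda>x. column j (Y x)) has_vector_derivative Y') (at x) \<and> ((\<lambda>x. column j (Q x)) has_vector_derivative Q') (at x) \<and>
        column j (Q x) = Y' - \<sigma> x *v column j (Y x) \<and>
        - Q' - \<sigma> x *v column j (Q x) - (\<sigma> x ** \<sigma> x) *v column j (Y x) = z *s column j (Y x)"
  proof eventually_elim
    case (elim x)
    then obtain Y' Q' where d: "(Y has_vector_derivative Y') (at x)" "(Q has_vector_derivative Q') (at x)"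
        "Q x = Y' - \<sigma> x ** Y x" "- Q' - \<sigma> x ** Q x - \<sigma> x ** \<sigma> x ** Y x = mat z ** Y x" by blast
    have "column j (Q x) = column j Y' - \<sigma> x *v column j (Y x)"
      using arg_cong[OF d(3), of "column j"] by (simp add: column_diff column_matrix_mult)
    moreover have "- column j Q' - \<sigma> x *v column j (Q x) - (\<sigma> x ** \<sigma> x) *v column j (Y x) = z *s column j (Y x)"
      using arg_cong[OF d(4), of "column j"] by (simp add: column_diff column_minus column_matrix_mult mat_vector)
    ultimately show ?case
      using bounded_linear.has_vector_derivative[OF bounded_linear_column d(1), of j]
        bounded_linear.has_vector_derivative[OF bounded_linear_column d(2), of j] by blast
  qed
  then show "solution \<sigma> z (\<lambda>x. column j (Y x)) (\<lambda>x. column j (Q x))"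
    using assms ac by (auto simp: solution_def matrix_solution_def)
qed

lemma matrix_solution_of_columns:
  assumes S: "\<And>j. sl_sol z (\<lambda>_. 0) (y j) (q j)"
  shows "matrix_solution \<sigma> z (\<lambda>x. \<chi> i j. y j x $ i) (\<lambda>x. \<chi> i j. q j x $ i)"
proof -
  define E :: "'m \<Rightarrow> complex^'m \<Rightarrow> complex^'m^'m" where "E = (\<lambda>j v. \<chi> i k. if k = j then v $ i else 0)"
  have blE: "bounded_linear (E j)" for j
    unfolding linear_conv_bounded_linear[symmetric] by (rule linearI) (auto simp: E_def vec_eq_iff)
  have sumE: "(\<Sum>j\<in>UNIV. E j (f j)) = (\<chi> i j. f j $ i)" for f :: "'m \<Rightarrow> complex^'m"
    by (simp add: vec_eq_iff E_def)
  define Y where "Y = (\<lambda>x. \<chi> i j. y j x $ i)"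
  define Q where "Q = (\<lambda>x. \<chi> i j. q j x $ i)"
  have y: "ac_deriv 0 pi (y j) (\<lambda>x. \<sigma> x *v y j x + q j x)"
    and q: "ac_deriv 0 pi (q j) (\<lambda>x. - (\<sigma> x *v q j x) - (\<sigma> x ** \<sigma> x) *v y j x - z *s y j x - 0)" for j
    using S[of j] by (auto simp: sl_sol_def)
  have col: "column j (Y x) = y j x" "column j (Q x) = q j x" for j x
    by (simp_all add: Y_def Q_def column_def vec_eq_iff)
  have Yd: "ac_deriv 0 pi Y (\<lambda>x. \<sigma> x ** Y x + Q x)"
  proof (rule ac_deriv_cong[OF _ _ negligible_empty])
    show "ac_deriv 0 pi (\<lambda>x. \<Sum>j\<in>UNIV. E j (y j x)) (\<lambda>x. \<Sum>j\<in>UNIV. E j (\<sigma> x *v y j x + q j x))"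
      by (intro ac_deriv_sum ac_deriv_linear[OF _ blE] y)
    show "(\<Sum>j\<in>UNIV. E j (\<sigma> x *v y j x + q j x)) = \<sigma> x ** Y x + Q x" for x
      unfolding sumE by (simp add: matrix_eq_columns column_add column_matrix_mult col) (simp add: column_def vec_eq_iff)
  qed (simp add: sumE Y_def)
  have Qd: "ac_deriv 0 pi Q (\<lambda>x. - (\<sigma> x ** Q x) - \<sigma> x ** \<sigma> x ** Y x - mat z ** Y x)"
  proof (rule ac_deriv_cong[OF _ _ negligible_empty])
    show "ac_deriv 0 pi (\<lambda>x. \<Sum>j\<in>UNIV. E j (q j x)) (\<lambda>x. \<Sum>j\<in>UNIV. E j (- (\<sigma> x *v q j x) - (\<sigma> x ** \<sigma> x) *v y j x - z *s y j x - 0))"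
      by (intro ac_deriv_sum ac_deriv_linear[OF _ blE] q)
    show "(\<Sum>j\<in>UNIV. E j (- (\<sigma> x *v q j x) - (\<sigma> x ** \<sigma> x) *v y j x - z *s y j x - 0)) = - (\<sigma> x ** Q x) - \<sigma> x ** \<sigma> x ** Y x - mat z ** Y x" for x
      unfolding sumE by (simp add: matrix_eq_columns column_diff column_minus column_matrix_mult col mat_vector) (simp add: column_def vec_eq_iff)
  qed (simp add: sumE Q_def)
  obtain N1 where N1: "negligible N1" "\<And>x. x \<in> {0<..<pi} - N1 \<Longrightarrow> (Y has_vector_derivative (\<sigma> x ** Y x + Q x)) (at x)"
    using ac_deriv_differentiable[OF Yd] by blast
  obtain N2 where N2: "negligible N2" "\<And>x. x \<in> {0<..<pi} - N2 \<Longrightarrow>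
     (Q has_vector_derivative (- (\<sigma> x ** Q x) - \<sigma> x ** \<sigma> x ** Y x - mat z ** Y x)) (at x)"
    using ac_deriv_differentiable[OF Qd] by blast
  have "AE x in lebesgue. x \<notin> N1 \<union> N2"
    by (rule AE_not_in) (use N1 N2 in \<open>auto simp: negligible_iff_null_sets[symmetric]\<close>)
  then have "AE x in lebesgue. x \<in> {0<..<pi} \<longrightarrow> (\<exists>Y' Q'.
        (Y has_vector_derivative Y') (at x) \<and> (Q has_vector_derivative Q') (at x) \<and>
        Q x = Y' - \<sigma> x ** Y x \<and>
        - Q' - \<sigma> x ** Q x - \<sigma> x ** \<sigma> x ** Y x = mat z ** Y x)"
    by eventually_elim (use N1(2) N2(2) in fastforce)
  then have "matrix_solution \<sigma> z Y Q"
    unfolding matrix_solution_def using ac_deriv_abs_cont_on[OF Yd] ac_deriv_abs_cont_on[OF Qd]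
    by (simp add: AE_restrict_space_iff)
  then show ?thesis by (simp add: Y_def Q_def)
qed

text \<open>Off the zeros of the determinant the Weyl solution exists and its complementary boundary
  value is unique, both shown column by column, so the definite description in
  \<open>weyl_matrix\<close> denotes.\<close>

lemma weyl_matrix_eq:
  assumes d: "det (Delta z) \<noteq> 0"
  shows "weyl_matrix \<sigma> T1 H1 T2 H2 z = (\<chi> i j. cramer_sol z (weyl_rhs z (axis j 1)) $ i)"
  unfolding weyl_matrix_def
proof (rule the_equality)
  have perp: "column j (matrix_bdry_perp T1 Y Q) = left.bdry_perp (column j Y) (column j Q)" for j Y Q
    by (simp add: matrix_bdry_perp_def left.bdry_perp_def column_add column_matrix_mult matrix_vector_mult_diff_rdistrib)
  have uniq: "matrix_bdry_perp T1 (\<Phi> 0) (Q 0) = (\<chi> i j. cramer_sol z (weyl_rhs z (axis j 1)) $ i)"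
    if W: "weyl_solution \<sigma> T1 H1 T2 H2 z \<Phi> Q" for \<Phi> Q
    unfolding matrix_eq_columns
  proof
    fix j
    have "sl_sol z (\<lambda>_. 0) (\<lambda>x. column j (\<Phi> x)) (\<lambda>x. column j (Q x))"
      using W by (intro matrix_solution_column) (simp add: weyl_solution_def)
    moreover have "bdry T1 H1 (column j (\<Phi> 0)) (column j (Q 0)) = axis j 1"
      using W column_matrix_bdry[of j T1 H1 "\<Phi> 0" "Q 0"] by (simp add: weyl_solution_def column_mat1)
    moreover have "bdry T2 H2 (column j (\<Phi> pi)) (column j (Q pi)) = 0"
      using W column_matrix_bdry[of j T2 H2 "\<Phi> pi" "Q pi"] by (simp add: weyl_solution_def) (simp add: column_def vec_eq_iff)
    ultimately have "left.bdry_perp (column j (\<Phi> 0)) (column j (Q 0)) = cramer_sol z (weyl_rhs z (axis j 1))"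
      by (rule weyl_column[OF _ _ _ d])
    then show "column j (matrix_bdry_perp T1 (\<Phi> 0) (Q 0)) = column j (\<chi> i j. cramer_sol z (weyl_rhs z (axis j 1)) $ i)"
      unfolding perp by (simp add: column_def)
  qed
  show "\<exists>\<Phi> Q. weyl_solution \<sigma> T1 H1 T2 H2 z \<Phi> Q \<and> (\<chi> i j. cramer_sol z (weyl_rhs z (axis j 1)) $ i) = matrix_bdry_perp T1 (\<Phi> 0) (Q 0)"
  proof -
    have "\<exists>Y Q. sl_sol z (\<lambda>_. 0) Y Q \<and> bdry T1 H1 (Y 0) (Q 0) = axis j 1 \<and> bdry T2 H2 (Y pi) (Q pi) = 0" for j
      using weyl_column_exists[OF d, of "axis j 1"] by blast
    then obtain y q where yq: "\<And>j. sl_sol z (\<lambda>_. 0) (y j) (q j)" "\<And>j. bdry T1 H1 (y j 0) (q j 0) = axis j 1"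
      "\<And>j. bdry T2 H2 (y j pi) (q j pi) = 0" by metis
    define Y where "Y = (\<lambda>x. \<chi> i j. y j x $ i)"
    define Q where "Q = (\<lambda>x. \<chi> i j. q j x $ i)"
    have col: "column j (Y x) = y j x" "column j (Q x) = q j x" for j x
      by (simp_all add: Y_def Q_def column_def vec_eq_iff)
    have "weyl_solution \<sigma> T1 H1 T2 H2 z Y Q"
      unfolding weyl_solution_def matrix_eq_columns column_matrix_bdry col
      using matrix_solution_of_columns[of z y q, OF yq(1)] yq(2,3)
      by (simp add: Y_def[symmetric] Q_def[symmetric] column_mat1) (simp add: column_def vec_eq_iff)
    then show ?thesis using uniq by metis
  qed
  show "M = (\<chi> i j. cramer_sol z (weyl_rhs z (axis j 1)) $ i)"
    if "\<exists>\<Phi> Q. weyl_solution \<sigma> T1 H1 T2 H2 z \<Phi> Q \<and> M = matrix_bdry_perp T1 (\<Phi> 0) (Q 0)" for M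
    using that uniq by blast
qed

text \<open>Each column of the residue is the limit vector \<open>\<omega>\<close> of
  \<open>cramer_sol_simple_pole\<close>, which lies in the kernel.\<close>

lemma Delta_weight_matrix: "Delta (of_real l) *v (weight_matrix \<sigma> T1 H1 T2 H2 l *v v) = 0"
proof -
  let ?M = "weyl_matrix \<sigma> T1 H1 T2 H2" and ?A = "weight_matrix \<sigma> T1 H1 T2 H2 l"
  have col: "Delta (of_real l) *v column j ?A = 0" for j
  proof -
    obtain \<omega> where \<omega>: "\<And>k. ((\<lambda>z. (z - of_real l) * cramer_sol z (weyl_rhs z (axis j 1)) $ k) \<longlongrightarrow> \<omega> $ k) (at (of_real l))"
      "Delta (of_real l) *v \<omega> = 0"
      using cramer_sol_simple_pole[of "\<lambda>z. weyl_rhs z (axis j 1)" l] weyl_rhs_holomorphic by blast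
    have ev: "\<forall>\<^sub>F z in at (of_real l). det (Delta z) \<noteq> 0" by (rule eventually_det_Delta)
    then obtain r where r: "r > 0" "\<And>z. z \<noteq> of_real l \<Longrightarrow> dist z (of_real l) < r \<Longrightarrow> det (Delta z) \<noteq> 0"
      unfolding eventually_at by auto
    have "residue (\<lambda>z. ?M z $ i $ j) (of_real l) = \<omega> $ i" for i
    proof (rule residue_simple'[of "ball (of_real l) r"])
      have "(\<lambda>z. cramer_sol z (weyl_rhs z (axis j 1)) $ i) holomorphic_on ball (of_real l) r - {of_real l}"
        by (rule holomorphic_on_subset[OF cramer_sol_holomorphic]) (use r(2) weyl_rhs_holomorphic in \<open>auto simp: dist_commute\<close>)
      then show "(\<lambda>z. ?M z $ i $ j) holomorphic_on ball (of_real l) r - {of_real l}"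
        by (rule holomorphic_transform) (use r(2) in \<open>auto simp: weyl_matrix_eq dist_commute\<close>)
      show "((\<lambda>z. ?M z $ i $ j * (z - of_real l)) \<longlongrightarrow> \<omega> $ i) (at (of_real l))"
      proof (rule Lim_transform_eventually[OF \<omega>(1)])
        show "\<forall>\<^sub>F z in at (of_real l). (z - of_real l) * cramer_sol z (weyl_rhs z (axis j 1)) $ i = ?M z $ i $ j * (z - of_real l)"
          using ev by eventually_elim (simp add: weyl_matrix_eq mult.commute)
      qed
    qed (use r in auto)
    then have "column j ?A = \<omega>" by (simp add: weight_matrix_def column_def vec_eq_iff)
    then show ?thesis using \<omega>(2) by simp
  qed
  have "?A *v v = (\<Sum>j\<in>UNIV. v $ j *s column j ?A)" by (rule matrix_mult_sum)
  also have "Delta (of_real l) *v \<dots> = (\<Sum>j\<in>UNIV. v $ j *s (Delta (of_real l) *v column j ?A))"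
    by (simp add: linear_sum[OF bounded_linear.linear[OF matrix_vector_mul_bounded_linear]] matrix_vector_scale)
  also have "\<dots> = 0" by (simp add: col)
  finally show ?thesis .
qed

end

section \<open>Trigonometric eigenfunctions\<close>

text \<open>Any two square roots of \<open>z\<close> agree up to sign, and both functions are even
  in the root.\<close>

lemma cosz_eq: "r\<^sup>2 = z \<Longrightarrow> cosz z s = cos (r * of_real s)"
  and sinz_eq: "r\<^sup>2 = z \<Longrightarrow> r \<noteq> 0 \<Longrightarrow> sinz z s = sin (r * of_real s) / r"
proof -
  assume "r\<^sup>2 = z"
  then have "(csqrt z)\<^sup>2 = r\<^sup>2" by simp
  then have r: "csqrt z = r \<or> csqrt z = - r" by (simp only: power2_eq_iff)
  then show "cosz z s = cos (r * of_real s)" by (auto simp: cosz_def)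
  assume "r \<noteq> 0"
  then have "z \<noteq> 0" using \<open>r\<^sup>2 = z\<close> by auto
  then show "sinz z s = sin (r * of_real s) / r" using r by (auto simp: sinz_def)
qed

lemma rho_power2: "(rho l)\<^sup>2 = complex_of_real l"
  unfolding rho_eq by (simp add: power_mult_distrib flip: of_real_power)

context sturm_liouville
begin

lemma T_of_vector: "T_of T1 r *v v = (if r = 0 then v else T1 *v v + r *s (v - T1 *v v))"
  by (simp add: T_of_def matrix_vector_mult_add_rdistrib matrix_vector_mul_assoc[symmetric] mat_vector matrix_vector_mult_diff_rdistrib)

lemma T_of_injective: "T_of T1 r *v v = 0 \<Longrightarrow> v = 0"
proof (cases "r = 0")
  case False
  assume "T_of T1 r *v v = 0"
  then have e: "T1 *v v + r *s (v - T1 *v v) = 0" using False by (simp add: T_of_vector)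
  then have "T1 *v (T1 *v v + r *s (v - T1 *v v)) = 0" by simp
  then have "T1 *v v = 0"
    by (simp add: matrix_vector_right_distrib matrix_vector_scale matrix_vector_mult_diff_distrib left.T_T)
  then show ?thesis using e False by simp
qed (simp add: T_of_vector)

lemma T_of_invertible: "invertible (T_of T1 r)"
  unfolding invertible_left_inverse matrix_left_invertible_ker using T_of_injective by blast

text \<open>\<open>T_of\<close> multiplies the component outside the range of \<open>T1\<close> by
  \<open>r\<close>, which cancels the denominator in \<open>sinz\<close>. For \<open>r = 0\<close>
  it is the identity and \<open>sinz 0 s = s\<close>.\<close>

lemma Y_of_eq_free:
  assumes "r\<^sup>2 = z"
  shows "Y_of T1 r e s = free z (T_of T1 r *v e) s"
proof (cases "r = 0")
  case True
  then have "z = 0" using assms by simp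
  then show ?thesis using True
    by (simp add: Y_of_def free_def T_of_vector cosz_def sinz_def matrix_vector_mult_add_rdistrib
        matrix_vector_mul_assoc[symmetric] mat_vector matrix_vector_mult_diff_rdistrib)
next
  case False
  have 1: "T1 *v (T_of T1 r *v e) = T1 *v e"
    using False by (simp add: T_of_vector matrix_vector_right_distrib matrix_vector_scale matrix_vector_mult_diff_distrib left.T_T)
  have 2: "T_of T1 r *v e - T1 *v e = r *s (e - T1 *v e)" using False by (simp add: T_of_vector)
  show ?thesis
    unfolding free_def 1 2 using False
    by (simp add: Y_of_def cosz_eq[OF assms] sinz_eq[OF assms] vec.scale_scale matrix_vector_mult_add_rdistrib
        matrix_vector_mul_assoc[symmetric] mat_vector matrix_vector_mult_diff_rdistrib)
qed

lemma free_continuous: "continuous_on A (free z v)"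
  unfolding free_def[abs_def]
  by (intro continuous_on_add continuous_on_scalar_vec cosz_continuous sinz_continuous continuous_on_const)

lemma free_scale: "free z (c *s v) s = c *s free z v s"
  by (simp add: free_def matrix_vector_scale vec_eq_iff algebra_simps)

text \<open>With both \<open>\<sigma>\<close> and \<open>H1\<close> zero, the trigonometric
  expression solves the system and has the right initial data, so uniqueness applies.\<close>

lemma phi_eq_free:
  assumes "\<sigma> = (\<lambda>_. 0)" "H1 = 0" and x: "x \<in> {0..pi}"
  shows "fst (phi z v x) = free z v x"
proof -
  define Q where "Q = (\<lambda>s. (- z * sinz z s) *s (T1 *v v) + cosz z s *s (v - T1 *v v))"
  have d: "((\<lambda>s. c s *s u) has_vector_derivative (c' *s u)) (at s within A)"
    if "(c has_vector_derivative c') (at s within A)" for c :: "real \<Rightarrow> complex" and c' and u :: "complex^'m" and s A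
    by (rule bounded_linear.has_vector_derivative[OF bounded_bilinear.bounded_linear_left[OF bounded_bilinear_scalar_vec] that])
  have 1: "ac_deriv 0 pi (free z v) Q"
  proof (rule ac_deriv_C1)
    show "(free z v has_vector_derivative Q s) (at s within {0..pi})" for s
      unfolding free_def[abs_def] Q_def by (intro has_vector_derivative_add d cosz_deriv sinz_deriv)
    show "continuous_on {0..pi} Q"
      unfolding Q_def by (intro continuous_on_add continuous_on_mult continuous_on_scalar_vec cosz_continuous sinz_continuous continuous_on_const)
  qed
  have 2: "ac_deriv 0 pi Q (\<lambda>s. - z *s free z v s)"
  proof (rule ac_deriv_C1)
    have "(Q has_vector_derivative (- z * cosz z s) *s (T1 *v v) + (- z * sinz z s) *s (v - T1 *v v)) (at s within {0..pi})" for s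
      unfolding Q_def by (intro has_vector_derivative_add d cosz_deriv has_vector_derivative_mult_right sinz_deriv)
    moreover have "(- z * cosz z s) *s (T1 *v v) + (- z * sinz z s) *s (v - T1 *v v) = - z *s free z v s" for s
      by (simp add: free_def vec_eq_iff algebra_simps)
    ultimately show "(Q has_vector_derivative - z *s free z v s) (at s within {0..pi})" for s by metis
    show "continuous_on {0..pi} (\<lambda>s. - z *s free z v s)"
      by (intro continuous_on_scalar_vec continuous_on_const free_continuous)
  qed
  have S: "sl_sol z (\<lambda>_. 0) (free z v) Q"
    unfolding sl_sol_def using 1 2 by (simp add: assms)
  have i: "free z v 0 = T1 *v v" "Q 0 = v - T1 *v v" by (simp_all add: free_def Q_def)
  have b: "bdry T1 H1 (free z v 0) (Q 0) = 0" "left.bdry_perp (free z v 0) (Q 0) = v"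
    using left.bdry_of_param[of v 0] by (simp_all add: i assms(2))
  show ?thesis using phi_unique[OF S b(1) x] by (simp add: b(2))
qed

lemma fst_phi_L2: "L2_on {0<..<pi} (\<lambda>x. fst (phi z v x))"
  by (rule continuous_imp_L2_on[OF phi_continuous])

text \<open>The family is indexed by all pairs of a parameter and a kernel vector, so it can be used
  for the auxiliary problem, whose eigenvalues carry no numbering.\<close>

lemma eigenfunctions_complete:
  "complete_in_L2 {0<..<pi} {(z, v). Delta z *v v = 0} (\<lambda>(z, v) x. fst (phi z v x))"
proof (rule complete_in_L2_if_total)
  fix g :: "real \<Rightarrow> complex^'m"
  assume g: "L2_on {0<..<pi} g" and o: "\<And>i. i \<in> {(z, v). Delta z *v v = 0} \<Longrightarrow>
     integral {0..pi} (\<lambda>x. hinner ((case i of (z, v) \<Rightarrow> \<lambda>x. fst (phi z v x)) x) (g x)) = 0"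
  show "\<exists>N. negligible N \<and> (\<forall>x\<in>{0..pi} - N. g x = 0)"
    by (rule eigenfunctions_total[OF g]) (use o in force)
qed (auto simp: fst_phi_L2)

text \<open>Multiplication by \<open>T_of\<close> cancels the left inverse factor of
  \<open>B_of\<close>, and what remains lies in the range of the weight matrix.\<close>

lemma B_of_range:
  assumes "e \<in> range (\<lambda>v. B_of \<sigma> T1 H1 T2 H2 l *v v)"
  shows "Delta (of_real l) *v (T_of T1 (rho l) *v e) = 0"
proof -
  define T where "T = T_of T1 (rho l)"
  define \<alpha> where "\<alpha> = weight_matrix \<sigma> T1 H1 T2 H2 l"
  obtain u where e: "e = B_of \<sigma> T1 H1 T2 H2 l *v u" using assms by blast
  have sc: "(c *\<^sub>R A) *v w = of_real c *s (A *v w)" for c and A :: "complex^'m^'m" and w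
    by (simp add: vec_eq_iff matrix_vector_mult_def sum_distrib_left scaleR_conv_of_real[where 'a = complex] mult.assoc)
  have "T *v (matrix_inv T *v w) = w" for w
    using matrix_inv_works(1)[OF T_of_invertible, of "rho l"] by (simp add: matrix_vector_mul_assoc T_def)
  then have "T *v e = \<alpha> *v (of_real (pi / 2) *s (matrix_inv T *v u))"
    by (simp add: e B_of_def sc matrix_vector_scale matrix_vector_mul_assoc[symmetric] T_def[symmetric] \<alpha>_def[symmetric])
  then show ?thesis using Delta_weight_matrix by (simp add: T_def \<alpha>_def)
qed

text \<open>The vectors lie in the kernel, are independent, and their number is the multiplicity,
  which is the dimension of the kernel. If no eigenvalue equals \<open>l\<close> the group is empty
  and the kernel is zero.\<close>

lemma kernel_Delta_subset_span:
  assumes num: "eigenvalue_numbering \<sigma> T1 H1 T2 H2 ev"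
    and on: "\<And>j. j \<in> index_set T1 T2 \<Longrightarrow>
           orthonormal_basis {i \<in> index_set T1 T2. ev i = ev j} \<E>
             (range (\<lambda>v. B_of \<sigma> T1 H1 T2 H2 (ev j) *v v))"
  shows "{v. Delta (of_real l) *v v = 0} \<subseteq>
    vec.span ((\<lambda>i. T_of T1 (rho l) *v \<E> i) ` {i \<in> index_set T1 T2. ev i = l})"
proof (rule vec.card_ge_dim_independent)
  define G where "G = {i \<in> index_set T1 T2. ev i = l}"
  define T where "T = T_of T1 (rho l)"
  have G: "finite G" "card G = vec.dim {v. Delta (of_real l) *v v = 0}"
    proof -
      have "finite {j \<in> index_set T1 T2. complex_of_real (ev j) = of_real l} \<and>
          card {j \<in> index_set T1 T2. complex_of_real (ev j) = of_real l} = multiplicity_of \<sigma> T1 H1 T2 H2 (of_real l)"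
        using num unfolding eigenvalue_numbering_def by blast
      then show "finite G" "card G = vec.dim {v. Delta (of_real l) *v v = 0}"
        by (simp_all add: multiplicity_eq G_def)
    qed
  have o: "orthonormal_basis G \<E> (range (\<lambda>v. B_of \<sigma> T1 H1 T2 H2 l *v v))" if "i \<in> G" for i
    using on[of i] that by (auto simp: G_def)
  have h: "hinner (\<E> i) (\<E> k) = (if i = k then 1 else 0)" if "i \<in> G" "k \<in> G" for i k
    using o[OF that(1)] that by (auto simp: orthonormal_basis_def)
  have sub: "T *v \<E> i \<in> {v. Delta (of_real l) *v v = 0}" if "i \<in> G" for i
  proof -
    have "\<E> i \<in> vec.span (\<E> ` G)" using that by (intro vec.span_base) auto
    then have "\<E> i \<in> range (\<lambda>v. B_of \<sigma> T1 H1 T2 H2 l *v v)" using o[OF that] by (simp add: orthonormal_basis_def)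
    then show ?thesis using B_of_range by (simp add: T_def)
  qed
  have inj: "inj_on (\<lambda>i. T *v \<E> i) G"
  proof (rule inj_onI)
    fix i k assume ik: "i \<in> G" "k \<in> G" "T *v \<E> i = T *v \<E> k"
    then have "T *v (\<E> i - \<E> k) = 0" by (simp add: matrix_vector_mult_diff_distrib)
    then have "\<E> i = \<E> k" using T_of_injective unfolding T_def by force
    then show "i = k" using h[OF ik(1,2)] h[OF ik(1,1)] by (auto split: if_splits)
  qed
  show "(\<lambda>i. T_of T1 (rho l) *v \<E> i) ` {i \<in> index_set T1 T2. ev i = l} \<subseteq> {v. Delta (of_real l) *v v = 0}"
    using sub by (auto simp: T_def G_def)
  show "vec.dim {v. Delta (of_real l) *v v = 0} \<le> card ((\<lambda>i. T_of T1 (rho l) *v \<E> i) ` {i \<in> index_set T1 T2. ev i = l})"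
    using G card_image[OF inj] by (simp add: T_def G_def)
  \<comment> \<open>As \<open>T\<close> is injective, a relation among the
    \<open>T *v \<E> i\<close> is one among the \<open>\<E> i\<close>, and pairing with
    \<open>\<E> k\<close> isolates one coefficient.\<close>
  have "vec.independent ((\<lambda>i. T *v \<E> i) ` G)"
  proof (rule vec.independent_if_scalars_zero)
    show "finite ((\<lambda>i. T *v \<E> i) ` G)" using G by simp
    fix f x assume s: "(\<Sum>x\<in>(\<lambda>i. T *v \<E> i) ` G. f x *s x) = 0" and x: "x \<in> (\<lambda>i. T *v \<E> i) ` G"
    obtain k where k: "k \<in> G" "x = T *v \<E> k" using x by blast
    have "(\<Sum>i\<in>G. f (T *v \<E> i) *s (T *v \<E> i)) = 0" using s by (simp add: sum.reindex[OF inj])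
    then have "T *v (\<Sum>i\<in>G. f (T *v \<E> i) *s \<E> i) = 0"
      by (simp add: linear_sum[OF bounded_linear.linear[OF matrix_vector_mul_bounded_linear]] matrix_vector_scale)
    then have "(\<Sum>i\<in>G. f (T *v \<E> i) *s \<E> i) = 0" unfolding T_def by (rule T_of_injective)
    then have "hinner (\<Sum>i\<in>G. f (T *v \<E> i) *s \<E> i) (\<E> k) = 0" by (simp add: hinner_simps)
    also have "hinner (\<Sum>i\<in>G. f (T *v \<E> i) *s \<E> i) (\<E> k) = (\<Sum>i\<in>G. if i = k then f (T *v \<E> i) else 0)"
      by (simp add: bounded_bilinear.sum_left[OF bounded_bilinear_hinner] hinner_simps h[OF _ k(1)] if_distrib cong: sum.cong if_cong)
    also have "\<dots> = f x" using G k by simp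
    finally show "f x = 0" .
  qed
  then show "vec.independent ((\<lambda>i. T_of T1 (rho l) *v \<E> i) ` {i \<in> index_set T1 T2. ev i = l})"
    by (simp add: T_def G_def)
qed

text \<open>The pairing with \<open>g\<close> is linear in the parameter vector, so its vanishing on
  the numbered vectors spreads to the whole kernel, and \<open>eigenfunctions_total\<close>
  applies.\<close>

lemma numbered_eigenfunctions_complete:
  assumes num: "eigenvalue_numbering \<sigma> T1 H1 T2 H2 ev"
    and on: "\<And>j. j \<in> index_set T1 T2 \<Longrightarrow>
           orthonormal_basis {i \<in> index_set T1 T2. ev i = ev j} \<E>
             (range (\<lambda>v. B_of \<sigma> T1 H1 T2 H2 (ev j) *v v))"
  shows "complete_in_L2 {0<..<pi} (index_set T1 T2) (\<lambda>j x. fst (phi (of_real (ev j)) (T_of T1 (rho (ev j)) *v \<E> j) x))"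
proof (rule complete_in_L2_if_total)
  fix g :: "real \<Rightarrow> complex^'m"
  assume g: "L2_on {0<..<pi} g" and o: "\<And>j. j \<in> index_set T1 T2 \<Longrightarrow>
     integral {0..pi} (\<lambda>x. hinner (fst (phi (of_real (ev j)) (T_of T1 (rho (ev j)) *v \<E> j) x)) (g x)) = 0"
  have gi: "g absolutely_integrable_on {0..pi}" by (rule L2_on_imp_absolutely_integrable[OF g])
  show "\<exists>N. negligible N \<and> (\<forall>x\<in>{0..pi} - N. g x = 0)"
  proof (rule eigenfunctions_total[OF g])
    fix l :: real and v assume v: "Delta (of_real l) *v v = 0"
    define \<Lambda> where "\<Lambda> = (\<lambda>v. integral {0..pi} (\<lambda>x. hinner (fst (phi (of_real l) v x)) (g x)))"
    have i: "(\<lambda>x. hinner (fst (phi (of_real l) v x)) (g x)) integrable_on {0..pi}" for v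
      using hinner_int[OF phi_continuous gi] by (rule set_lebesgue_integral_eq_integral(1))
    have add: "\<Lambda> (v + w) = \<Lambda> v + \<Lambda> w" for v w
    proof -
      have "\<Lambda> (v + w) = integral {0..pi} (\<lambda>x. hinner (fst (phi (of_real l) v x)) (g x) + hinner (fst (phi (of_real l) w x)) (g x))"
        unfolding \<Lambda>_def by (rule integral_cong) (simp add: phi_add hinner_simps)
      then show ?thesis unfolding \<Lambda>_def by (simp add: integral_add[OF i i])
    qed
    have scale: "\<Lambda> (c *s v) = c * \<Lambda> v" for c v
    proof -
      have "\<Lambda> (c *s v) = integral {0..pi} (\<lambda>x. c * hinner (fst (phi (of_real l) v x)) (g x))"
        unfolding \<Lambda>_def by (rule integral_cong) (simp add: phi_scale hinner_simps)
      then show ?thesis unfolding \<Lambda>_def by simp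
    qed
    have "vec.subspace {v. \<Lambda> v = 0}"
      using scale[of 0 0] by (auto simp: vec.subspace_def add scale)
    moreover have "(\<lambda>i. T_of T1 (rho l) *v \<E> i) ` {i \<in> index_set T1 T2. ev i = l} \<subseteq> {v. \<Lambda> v = 0}"
      using o by (auto simp: \<Lambda>_def)
    ultimately have "vec.span ((\<lambda>i. T_of T1 (rho l) *v \<E> i) ` {i \<in> index_set T1 T2. ev i = l}) \<subseteq> {v. \<Lambda> v = 0}"
      by (rule vec.span_minimal[rotated])
    then have "\<Lambda> v = 0" using kernel_Delta_subset_span[OF num on, of l] v by blast
    then show "integral {0..pi} (\<lambda>x. hinner (fst (phi (of_real l) v x)) (g x)) = 0" by (simp add: \<Lambda>_def)
  qed
qed (auto simp: fst_phi_L2)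

lemma free_family_complete:
  assumes num: "eigenvalue_numbering \<sigma> T1 H1 T2 H2 ev"
    and on: "\<And>j. j \<in> index_set T1 T2 \<Longrightarrow>
           orthonormal_basis {i \<in> index_set T1 T2. ev i = ev j} \<E>
             (range (\<lambda>v. B_of \<sigma> T1 H1 T2 H2 (ev j) *v v))"
  shows "complete_in_L2 {0<..<pi} (index_set T1 T2) (\<lambda>j. Y_of T1 (rho (ev j)) (\<E> j))"
proof -
  have "hconj (0::complex^'m^'m) = 0" "T1 ** 0 ** T1 = 0"
    by (simp_all add: hconj_def transpose_def map_matrix_def vec_eq_iff matrix_matrix_mult_def)
  \<comment> \<open>The auxiliary problem shares \<open>T1\<close> on the left, so its solutions are
    exactly the functions \<open>free\<close>. On the right any admissible condition would serve; it
    repeats \<open>T1\<close> and 0.\<close>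
  then interpret F: sturm_liouville "\<lambda>_. 0" T1 0 T1 0
    by unfold_locales (simp_all add: continuous_imp_L2_on left.T_herm left.T_idem)
  define V where "V = (\<lambda>j. T_of T1 (rho (ev j)) *v \<E> j)"
  define z where "z = (\<lambda>j. complex_of_real (ev j))"
  have Yeq: "Y_of T1 (rho (ev j)) (\<E> j) = free (z j) (V j)" for j
    unfolding V_def z_def by (rule ext) (rule Y_of_eq_free[OF rho_power2])
  have freeL2: "L2_on {0<..<pi} (free w v)" for w v by (rule continuous_imp_L2_on[OF free_continuous])
  have scL2: "L2_on {0<..<pi} (\<lambda>x. c *s f x)" if "L2_on {0<..<pi} f" for c and f :: "real \<Rightarrow> complex^'m"
    by (rule L2_on_linear[OF that bounded_bilinear.bounded_linear_right[OF bounded_bilinear_scalar_vec]])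
  have K: "compare_const \<ge> 0" by (simp add: compare_const_def)
  show ?thesis
    unfolding complete_in_L2_def Yeq
  proof (intro conjI ballI allI impI freeL2)
    fix f :: "real \<Rightarrow> complex^'m" and e :: real assume f: "L2_on {0<..<pi} f" and e: "e > 0"
    \<comment> \<open>Two errors of squared size \<open>e\<^sup>2 / 4\<close>, each doubled by
      \<open>L2sq_add_le\<close> with \<open>s = 1\<close>, add up to
      \<open>e\<^sup>2\<close>.\<close>
    have e1: "e\<^sup>2 / 4 > 0" using e by simp
    obtain F1 c1 where F1: "finite F1" "F1 \<subseteq> {(z, v). F.Delta z *v v = 0}"
      "L2sq 0 pi (\<lambda>x. f x - (\<Sum>i\<in>F1. c1 i *s (case i of (z, v) \<Rightarrow> \<lambda>x. fst (F.phi z v x)) x)) < e\<^sup>2 / 4"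
      by (rule complete_in_L2D[OF F.eigenfunctions_complete f e1])
    define u where "u = (\<lambda>x. \<Sum>i\<in>F1. free (fst i) (c1 i *s snd i) x)"
    define H where "H = (\<lambda>x. \<Sum>i\<in>F1. fst (phi (fst i) (c1 i *s snd i) x))"
    have u: "L2sq 0 pi (\<lambda>x. f x - u x) < e\<^sup>2 / 4"
    proof -
      have "u x = (\<Sum>i\<in>F1. c1 i *s (case i of (z, v) \<Rightarrow> \<lambda>x. fst (F.phi z v x)) x)" if "x \<in> {0..pi}" for x
        unfolding u_def using F.phi_eq_free[OF refl refl that] by (intro sum.cong) (auto simp: free_scale)
      then have "L2sq 0 pi (\<lambda>x. f x - u x) = L2sq 0 pi (\<lambda>x. f x - (\<Sum>i\<in>F1. c1 i *s (case i of (z, v) \<Rightarrow> \<lambda>x. fst (F.phi z v x)) x))"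
        unfolding L2sq_def by (intro integral_cong) simp
      then show ?thesis using F1(3) by simp
    qed
    have HL2: "L2_on {0<..<pi} H" unfolding H_def by (intro L2_on_sum fst_phi_L2)
    have uL2: "L2_on {0<..<pi} u" unfolding u_def by (intro L2_on_sum freeL2)
    \<comment> \<open>The tolerance on the side of the given equation, reduced in advance by the
      factor that the way back costs.\<close>
    define d where "d = e\<^sup>2 / (4 * (compare_const + 1))"
    have d: "d > 0" using e K by (simp add: d_def)
    obtain F2 c2 where F2: "finite F2" "F2 \<subseteq> index_set T1 T2"
      "L2sq 0 pi (\<lambda>x. H x - (\<Sum>j\<in>F2. c2 j *s fst (phi (z j) (V j) x))) < d"
      using complete_in_L2D[OF numbered_eigenfunctions_complete[OF num on] HL2 d] unfolding z_def V_def by blast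
    define w where "w = (\<lambda>x. \<Sum>j\<in>F2. c2 j *s free (z j) (V j) x)"
    have wL2: "L2_on {0<..<pi} w" unfolding w_def by (intro L2_on_sum scL2 freeL2)
    \<comment> \<open>The disjoint sum merges both finite families, the second with opposite sign,
      so that one application of \<open>free_L2_le_phi\<close> bounds \<open>u - w\<close>.\<close>
    define J where "J = F1 <+> F2"
    define zz :: "(complex \<times> (complex^'m)) + (nat \<times> nat) \<Rightarrow> complex" where "zz = case_sum fst z"
    define vv where "vv = case_sum (\<lambda>i. c1 i *s snd i) (\<lambda>j. (- c2 j) *s V j)"
    have J: "(\<Sum>k\<in>J. g k) = (\<Sum>i\<in>F1. g (Inl i)) + (\<Sum>j\<in>F2. g (Inr j))" for g :: "_ \<Rightarrow> complex^'m"
      unfolding J_def using F1(1) F2(1) by (simp add: sum.Plus)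
    have a: "(\<lambda>x. \<Sum>k\<in>J. free (zz k) (vv k) x) = (\<lambda>x. u x - w x)"
    proof
      fix x
      have "free (z j) ((- c2 j) *s V j) x = - (c2 j *s free (z j) (V j) x)" for j
        by (simp only: free_scale) simp
      then show "(\<Sum>k\<in>J. free (zz k) (vv k) x) = u x - w x"
        by (simp add: J zz_def vv_def u_def w_def sum_negf)
    qed
    have b: "L2sq 0 pi (\<lambda>x. \<Sum>k\<in>J. fst (phi (zz k) (vv k) x)) < d"
    proof -
      have "(\<Sum>k\<in>J. fst (phi (zz k) (vv k) x)) = H x - (\<Sum>j\<in>F2. c2 j *s fst (phi (z j) (V j) x))" if "x \<in> {0..pi}" for x
      proof -
        have "fst (phi (z j) ((- c2 j) *s V j) x) = - (c2 j *s fst (phi (z j) (V j) x))" for j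
          by (simp only: phi_scale[OF that] fst_conv) simp
        then show ?thesis by (simp add: J zz_def vv_def H_def sum_negf)
      qed
      then have "L2sq 0 pi (\<lambda>x. \<Sum>k\<in>J. fst (phi (zz k) (vv k) x)) = L2sq 0 pi (\<lambda>x. H x - (\<Sum>j\<in>F2. c2 j *s fst (phi (z j) (V j) x)))"
        unfolding L2sq_def by (intro integral_cong) simp
      then show ?thesis using F2(3) by simp
    qed
    have "L2sq 0 pi (\<lambda>x. u x - w x) \<le> compare_const * d"
      using free_L2_le_phi[of zz vv J] mult_left_mono[OF less_imp_le[OF b] K] unfolding a by linarith
    also have "compare_const * d \<le> e\<^sup>2 / 4"
      using K by (simp add: d_def field_simps)
    finally have uw: "L2sq 0 pi (\<lambda>x. u x - w x) \<le> e\<^sup>2 / 4" .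
    have "L2sq 0 pi (\<lambda>x. (f x - u x) + (u x - w x)) \<le> (1 + 1) * L2sq 0 pi (\<lambda>x. f x - u x) + (1 + 1 / 1) * L2sq 0 pi (\<lambda>x. u x - w x)"
      by (intro L2sq_add_le L2_on_diff f uL2 wL2) simp
    then have "L2sq 0 pi (\<lambda>x. f x - w x) < e\<^sup>2" using u uw by simp
    then have "sqrt (L2sq 0 pi (\<lambda>x. f x - w x)) < e" using e by (intro real_less_lsqrt L2sq_nonneg) auto
    then have "sqrt (integral\<^sup>L (lebesgue_on {0<..<pi}) (\<lambda>x. (norm (f x - w x))\<^sup>2)) < e"
      using L2sq_lebesgue[OF L2_on_diff[OF f wL2]] by simp
    then show "\<exists>F c. finite F \<and> F \<subseteq> index_set T1 T2 \<and>
        sqrt (integral\<^sup>L (lebesgue_on {0<..<pi}) (\<lambda>x. (norm (f x - (\<Sum>i\<in>F. c i *s free (z i) (V i) x)))\<^sup>2)) < e"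
      using F2(1,2) unfolding w_def by blast
  qed
qed

end

theorem theorem5p1:
  fixes \<sigma> :: "real \<Rightarrow> complex^'m^'m"
    and T1 T2 H1 H2 :: "complex^'m^'m"
    and ev :: "nat \<times> nat \<Rightarrow> real"
    and \<E> :: "nat \<times> nat \<Rightarrow> complex^'m"
  assumes "L2_on {0<..<pi} \<sigma>"
    and "AE x in lebesgue_on {0<..<pi}. \<sigma> x = hconj (\<sigma> x)"
    and "T1 = hconj T1" "hconj T1 = T1 ** T1"
    and "T2 = hconj T2" "hconj T2 = T2 ** T2"
    and "H1 = hconj H1" "hconj H1 = T1 ** H1 ** T1"
    and "H2 = hconj H2" "hconj H2 = T2 ** H2 ** T2"
    and "eigenvalue_numbering \<sigma> T1 H1 T2 H2 ev"
    and "\<And>j. j \<in> index_set T1 T2 \<Longrightarrow>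
           orthonormal_basis {i \<in> index_set T1 T2. ev i = ev j} \<E>
             (range (\<lambda>v. B_of \<sigma> T1 H1 T2 H2 (ev j) *v v))"
  shows "complete_in_L2 {0<..<pi} (index_set T1 T2) (\<lambda>j. Y_of T1 (rho (ev j)) (\<E> j))"
proof -
  have "sturm_liouville \<sigma> T1 H1 T2 H2"
    using assms(1-10) by unfold_locales metis+
  then show ?thesis using assms(11,12) by (rule sturm_liouville.free_family_complete)
qed

end
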